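(* Let $k$ be a field. The Hochschild-Mitchell homology and cohomology are invariant under contraction and expansion. That is: let $\mathcal{C}$ be a $k$-category and $\mathcal{M}$ a $\mathcal{C}$-bimodule, let $\mathcal{C}'$ be either the contraction of $\mathcal{C}$ along a finite full subcategory $\mathcal{F}$, or the expansion of $\mathcal{C}$ along a complete system $F$ of orthogonal idempotents of ${}_x\mathcal{C}_x$ for some object $x$, and let $\mathcal{M}'$ be the $\mathcal{C}'$-bimodule determined by $\mathcal{M}$. Then for all $n\ge0$ $$H_n(\mathcal{C},\mathcal{M})\cong H_n(\mathcal{C}',\mathcal{M}')\quad\text{and}\quad H^n(\mathcal{C},\mathcal{M})\cong H^n(\mathcal{C}',\mathcal{M}').$$
   Context: $k$-categories and bimodules. A $k$-category is a small category whose morphism sets are $k$-vector spaces and whose composition is $k$-bilinear. $\mathcal{C}_0$ is the set of objects and ${}_y\mathcal{C}_x$ is the space of morphisms from $x$ to $y$. A $\mathcal{C}$-bimodule $\mathcal{M}$ is a family of vector spaces $\{{}_y\mathcal{M}_x\}_{x,y\in\mathcal{C}_0}$ with $k$-bilinear left and right actions ${}_z\mathcal{C}_y\otimes{}_y\mathcal{M}_x\to{}_z\mathcal{M}_x$ and ${}_y\mathcal{M}_x\otimes{}_x\mathcal{C}_u\to{}_y\mathcal{M}_u$ that are associative, unital and commute with each other. Hochschild-Mitchell homology. $H_*(\mathcal{C},\mathcal{M})$ is the homology of the chain complex with $C_0(\mathcal{C},\mathcal{M})=\bigoplus_x{}_x\mathcal{M}_x$ and, for $n\ge1$, $C_n(\mathcal{C},\mathcal{M})=\bigoplus_{(x_{n+1},\dots,x_1)}{}_{x_1}\mathcal{M}_{x_{n+1}}\otimes_k{}_{x_{n+1}}\mathcal{C}_{x_n}\otimes_k\cdots\otimes_k{}_{x_2}\mathcal{C}_{x_1}$,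 with boundary $d(m,c_n,\dots,c_1)=(mc_n,c_{n-1},\dots,c_1)+\sum_{i=1}^{n-1}(-1)^i(m,c_n,\dots,c_{n-i+1}c_{n-i},\dots,c_1)+(-1)^n(c_1m,c_n,\dots,c_2)$. Hochschild-Mitchell cohomology. $H^*(\mathcal{C},\mathcal{M})$ is the cohomology of the cochain complex with $C^0(\mathcal{C},\mathcal{M})=\prod_x{}_x\mathcal{M}_x$ and, for $n\ge1$, $C^n(\mathcal{C},\mathcal{M})=\prod_{(x_{n+1},\dots,x_1)}\operatorname{Hom}_k({}_{x_{n+1}}\mathcal{C}_{x_n}\otimes\cdots\otimes{}_{x_2}\mathcal{C}_{x_1},\ {}_{x_{n+1}}\mathcal{M}_{x_1})$, with coboundary $df(c_{n+1}\otimes\cdots\otimes c_1)=(-1)^{n+1}c_{n+1}f(c_n\otimes\cdots\otimes c_1)+\sum_{i=1}^n(-1)^if(c_{n+1}\otimes\cdots\otimes c_{i+1}c_i\otimes\cdots\otimes c_1)+f(c_{n+1}\otimes\cdots\otimes c_2)c_1$ (in degree $0$: $(d(m_x)_x)(c)=-c\,m_x+m_y\,c$ for $c\in{}_y\mathcal{C}_x$). Contraction. Let $\mathcal{F}$ be a full subcategory of $\mathcal{C}$ with finitely many objects. The contraction $\mathcal{C}_{\mathcal{F}}$ is obtained by replacing the objects of $\mathcal{F}$ by a single object $*$ with endomorphism algebra $\Lambda_{\mathcal{F}}=\bigoplus_{x,y\in\mathcal{F}_0}{}_y\mathcal{C}_x$ (matrix product), and with the evident morphisms: for $z\notin\mathcal{F}_0$,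 ${}_*(\mathcal{C}_{\mathcal{F}})_z=\bigoplus_{x\in\mathcal{F}_0}{}_x\mathcal{C}_z$ and ${}_z(\mathcal{C}_{\mathcal{F}})_*=\bigoplus_{x\in\mathcal{F}_0}{}_z\mathcal{C}_x$; morphisms between objects outside $\mathcal{F}$ are unchanged and composition is matrix composition. The bimodule determined by $\mathcal{M}$ is defined by the same direct sums with $\mathcal{M}$ in place of $\mathcal{C}$. Expansion. Let $F$ be a complete system of orthogonal idempotents (not necessarily primitive) of ${}_x\mathcal{C}_x$, i.e. a finite subset of ${}_x\mathcal{C}_x$ with $e^2=e$, $ef=0$ for $e\ne f$, and $\sum_{e\in F}e={}_x1_x$. The expansion of $\mathcal{C}$ along $F$ is obtained by replacing the object $x$ by the set of objects $F$, with morphisms from $e$ to $f$ equal to $f\,{}_x\mathcal{C}_x\,e$ for $e,f\in F$, from $z\neq x$ to $e$ equal to $e\,{}_x\mathcal{C}_z$, from $e$ to $z\ne x$ equal to ${}_z\mathcal{C}_x\,e$, other morphisms unchanged, and composition induced by $\mathcal{C}$. The bimodule determined by $\mathcal{M}$ is defined by the same formulas with $\mathcal{M}$ in place of $\mathcal{C}$ (e.g. ${}_f\mathcal{M}'_e=f\,{}_x\mathcal{M}_x\,e$). *)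

theory Defs
  imports "HOL-Algebra.Algebra"
begin

text \<open>
  Vector spaces over the field \<open>K\<close> are structures \<open>V\<close> with \<open>field K\<close> and \<^term>\<open>module K V\<close>.
  The components \<^const>\<open>monoid.mult\<close> and \<^const>\<open>monoid.one\<close> that the record type of modules inherits from rings
  carry no meaning; \<open>mk_mod\<close> leaves them unspecified.
\<close>

section \<open>Linear algebra\<close>

definition mk_mod :: "'v set \<Rightarrow> ('v \<Rightarrow> 'v \<Rightarrow> 'v) \<Rightarrow> 'v \<Rightarrow> ('k \<Rightarrow> 'v \<Rightarrow> 'v) \<Rightarrow> ('k, 'v) module" where
  "mk_mod A p z s =
     \<lparr>carrier = A, monoid.mult = undefined, monoid.one = undefined, ring.zero = z, ring.add = p, smult = s\<rparr>"

definition self_mod :: "('k, 'r) ring_scheme \<Rightarrow> ('k, 'k) module" where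
  "self_mod K = mk_mod (carrier K) (ring.add K) \<zero>\<^bsub>K\<^esub> (monoid.mult K)"

definition mod_hom :: "('k, 'r) ring_scheme \<Rightarrow> ('k, 'v) module \<Rightarrow> ('k, 'w) module \<Rightarrow> ('v \<Rightarrow> 'w) set" where
  "mod_hom K V W =
     {h. h \<in> carrier V \<rightarrow> carrier W
       \<and> (\<forall>u\<in>carrier V. \<forall>v\<in>carrier V. h (u \<oplus>\<^bsub>V\<^esub> v) = h u \<oplus>\<^bsub>W\<^esub> h v)
       \<and> (\<forall>a\<in>carrier K. \<forall>v\<in>carrier V. h (a \<odot>\<^bsub>V\<^esub> v) = a \<odot>\<^bsub>W\<^esub> h v)}"

definition mod_isomorphic :: "('k, 'r) ring_scheme \<Rightarrow> ('k, 'v) module \<Rightarrow> ('k, 'w) module \<Rightarrow> bool" where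
  "mod_isomorphic K V W \<longleftrightarrow> (\<exists>h \<in> mod_hom K V W. bij_betw h (carrier V) (carrier W))"

definition bilin ::
  "('k, 'r) ring_scheme \<Rightarrow> ('k, 'u) module \<Rightarrow> ('k, 'v) module \<Rightarrow> ('k, 'w) module \<Rightarrow> ('u \<Rightarrow> 'v \<Rightarrow> 'w) \<Rightarrow> bool" where
  "bilin K U V W f \<longleftrightarrow>
     (\<forall>u\<in>carrier U. f u \<in> mod_hom K V W) \<and> (\<forall>v\<in>carrier V. (\<lambda>u. f u v) \<in> mod_hom K U W)"

definition hom_mod :: "('k, 'r) ring_scheme \<Rightarrow> ('k, 'v) module \<Rightarrow> ('k, 'w) module \<Rightarrow> ('k, 'v \<Rightarrow> 'w) module" where
  "hom_mod K V W = mk_mod (mod_hom K V W \<inter> extensional (carrier V))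
     (\<lambda>f g. \<lambda>v\<in>carrier V. f v \<oplus>\<^bsub>W\<^esub> g v) (\<lambda>v\<in>carrier V. \<zero>\<^bsub>W\<^esub>) (\<lambda>a f. \<lambda>v\<in>carrier V. a \<odot>\<^bsub>W\<^esub> f v)"

definition mod_kernel :: "('k, 'v) module \<Rightarrow> ('k, 'w) module \<Rightarrow> ('v \<Rightarrow> 'w) \<Rightarrow> ('k, 'v) module" where
  "mod_kernel V W h = V\<lparr>carrier := {v \<in> carrier V. h v = \<zero>\<^bsub>W\<^esub>}\<rparr>"

text \<open>The span of a subset, as the smallest submodule containing it.\<close>

definition mod_span :: "('k, 'r) ring_scheme \<Rightarrow> ('k, 'v) module \<Rightarrow> 'v set \<Rightarrow> 'v set" where
  "mod_span K V S = \<Inter>{H. submodule H K V \<and> S \<subseteq> H}"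

definition quot_mod :: "('k, 'v) module \<Rightarrow> 'v set \<Rightarrow> ('k, 'v set) module" where
  "quot_mod V H = mk_mod (a_rcosets\<^bsub>V\<^esub> H) (set_add V) H (\<lambda>a A. \<Union>v\<in>A. H +>\<^bsub>V\<^esub> (a \<odot>\<^bsub>V\<^esub> v))"

definition dprod_mod :: "'i set \<Rightarrow> ('i \<Rightarrow> ('k, 'v) module) \<Rightarrow> ('k, 'i \<Rightarrow> 'v) module" where
  "dprod_mod I V = mk_mod (\<Pi>\<^sub>E i\<in>I. carrier (V i))
     (\<lambda>f g. \<lambda>i\<in>I. f i \<oplus>\<^bsub>V i\<^esub> g i) (\<lambda>i\<in>I. \<zero>\<^bsub>V i\<^esub>) (\<lambda>a f. \<lambda>i\<in>I. a \<odot>\<^bsub>V i\<^esub> f i)"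

definition dsum_supp :: "'i set \<Rightarrow> ('i \<Rightarrow> ('k, 'v) module) \<Rightarrow> ('i \<Rightarrow> 'v) \<Rightarrow> 'i set" where
  "dsum_supp I V f = {i \<in> I. f i \<noteq> \<zero>\<^bsub>V i\<^esub>}"

definition dsum_mod :: "'i set \<Rightarrow> ('i \<Rightarrow> ('k, 'v) module) \<Rightarrow> ('k, 'i \<Rightarrow> 'v) module" where
  "dsum_mod I V = (dprod_mod I V)\<lparr>carrier := {f \<in> \<Pi>\<^sub>E i\<in>I. carrier (V i). finite (dsum_supp I V f)}\<rparr>"

definition dsum_inj :: "'i set \<Rightarrow> ('i \<Rightarrow> ('k, 'v) module) \<Rightarrow> 'i \<Rightarrow> 'v \<Rightarrow> 'i \<Rightarrow> 'v" where
  "dsum_inj I V j v = (\<lambda>i\<in>I. if i = j then v else \<zero>\<^bsub>V i\<^esub>)"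

text \<open>The linear map on a direct sum into \<open>N\<close> whose restriction to the \<open>i\<close>-th summand is \<open>h i\<close>.\<close>

definition dsum_lift ::
  "'i set \<Rightarrow> ('i \<Rightarrow> ('k, 'v) module) \<Rightarrow> ('k, 'w) module \<Rightarrow> ('i \<Rightarrow> 'v \<Rightarrow> 'w) \<Rightarrow> ('i \<Rightarrow> 'v) \<Rightarrow> 'w" where
  "dsum_lift I V N h f = (\<Oplus>\<^bsub>N\<^esub> i \<in> dsum_supp I V f. h i (f i))"

section \<open>Tensor products\<close>

text \<open>
  Tensor products are presented by generators and relations: the free module on the set \<open>G\<close> of
  tuples, modulo the span of the relations expressing additivity and homogeneity in each slot.
\<close>

definition free_mod :: "('k, 'r) ring_scheme \<Rightarrow> 'g set \<Rightarrow> ('k, 'g \<Rightarrow> 'k) module" where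
  "free_mod K G = dsum_mod G (\<lambda>_. self_mod K)"

definition free_gen :: "('k, 'r) ring_scheme \<Rightarrow> 'g set \<Rightarrow> 'g \<Rightarrow> 'g \<Rightarrow> 'k" where
  "free_gen K G t = dsum_inj G (\<lambda>_. self_mod K) t \<one>\<^bsub>K\<^esub>"

definition pres_mod :: "('k, 'r) ring_scheme \<Rightarrow> 'g set \<Rightarrow> ('g \<Rightarrow> 'k) set \<Rightarrow> ('k, ('g \<Rightarrow> 'k) set) module" where
  "pres_mod K G R = quot_mod (free_mod K G) (mod_span K (free_mod K G) R)"

definition pres_gen :: "('k, 'r) ring_scheme \<Rightarrow> 'g set \<Rightarrow> ('g \<Rightarrow> 'k) set \<Rightarrow> 'g \<Rightarrow> ('g \<Rightarrow> 'k) set" where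
  "pres_gen K G R t = mod_span K (free_mod K G) R +>\<^bsub>free_mod K G\<^esub> free_gen K G t"

text \<open>
  The linear map into \<open>N\<close> sending the class of each generator \<open>t\<close> to \<open>g t\<close>. The choice of a
  representative is irrelevant as soon as \<open>g\<close> respects the relations.
\<close>

definition pres_lift ::
  "('k, 'r) ring_scheme \<Rightarrow> 'g set \<Rightarrow> ('k, 'w) module \<Rightarrow> ('g \<Rightarrow> 'w) \<Rightarrow> ('g \<Rightarrow> 'k) set \<Rightarrow> 'w" where
  "pres_lift K G N g A =
     dsum_lift G (\<lambda>_. self_mod K) N (\<lambda>t a. a \<odot>\<^bsub>N\<^esub> g t) (SOME r. r \<in> A)"

text \<open>
  Here \<open>s v\<close> is the tuple with \<open>v \<in> V\<close> in one particular slot and all other entries fixed.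
\<close>

definition slot_rels ::
  "('k, 'r) ring_scheme \<Rightarrow> 'g set \<Rightarrow> ('k, 'v) module \<Rightarrow> ('v \<Rightarrow> 'g) \<Rightarrow> ('g \<Rightarrow> 'k) set" where
  "slot_rels K G V s =
     {free_gen K G (s (u \<oplus>\<^bsub>V\<^esub> v)) \<ominus>\<^bsub>free_mod K G\<^esub> (free_gen K G (s u) \<oplus>\<^bsub>free_mod K G\<^esub> free_gen K G (s v))
        | u v. u \<in> carrier V \<and> v \<in> carrier V}
   \<union> {free_gen K G (s (a \<odot>\<^bsub>V\<^esub> v)) \<ominus>\<^bsub>free_mod K G\<^esub> a \<odot>\<^bsub>free_mod K G\<^esub> free_gen K G (s v)
        | a v. a \<in> carrier K \<and> v \<in> carrier V}"

text \<open>
  \<open>ltensor K [W\<^sub>1, \<dots>, W\<^sub>n]\<close> is \<open>W\<^sub>1 \<otimes> \<dots> \<otimes> W\<^sub>n\<close>; for \<open>n = 0\<close> it is the free module on the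
  empty tuple, that is, \<open>K\<close> itself.
\<close>

definition ltuples :: "('k, 'v) module list \<Rightarrow> 'v list set" where
  "ltuples Ws = {ws. list_all2 (\<lambda>w W. w \<in> carrier W) ws Ws}"

definition ltensor_rels :: "('k, 'r) ring_scheme \<Rightarrow> ('k, 'v) module list \<Rightarrow> ('v list \<Rightarrow> 'k) set" where
  "ltensor_rels K Ws =
     (\<Union>ws\<in>ltuples Ws. \<Union>i<length Ws. slot_rels K (ltuples Ws) (Ws ! i) (\<lambda>w. ws[i := w]))"

definition ltensor :: "('k, 'r) ring_scheme \<Rightarrow> ('k, 'v) module list \<Rightarrow> ('k, ('v list \<Rightarrow> 'k) set) module" where
  "ltensor K Ws = pres_mod K (ltuples Ws) (ltensor_rels K Ws)"

definition lpure :: "('k, 'r) ring_scheme \<Rightarrow> ('k, 'v) module list \<Rightarrow> 'v list \<Rightarrow> ('v list \<Rightarrow> 'k) set" where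
  "lpure K Ws = pres_gen K (ltuples Ws) (ltensor_rels K Ws)"

text \<open>
  \<open>htensor K V [W\<^sub>1, \<dots>, W\<^sub>n]\<close> is \<open>V \<otimes> W\<^sub>1 \<otimes> \<dots> \<otimes> W\<^sub>n\<close>, where the elements of \<open>V\<close> may have a
  different HOL type than those of the \<open>W\<^sub>i\<close>; for \<open>n = 0\<close> it is a copy of \<open>V\<close>.
\<close>

definition htuples :: "('k, 'u) module \<Rightarrow> ('k, 'v) module list \<Rightarrow> ('u \<times> 'v list) set" where
  "htuples V Ws = carrier V \<times> ltuples Ws"

definition htensor_rels ::
  "('k, 'r) ring_scheme \<Rightarrow> ('k, 'u) module \<Rightarrow> ('k, 'v) module list \<Rightarrow> ('u \<times> 'v list \<Rightarrow> 'k) set" where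
  "htensor_rels K V Ws =
     (\<Union>ws\<in>ltuples Ws. slot_rels K (htuples V Ws) V (\<lambda>v. (v, ws)))
   \<union> (\<Union>v\<in>carrier V. \<Union>ws\<in>ltuples Ws. \<Union>i<length Ws.
        slot_rels K (htuples V Ws) (Ws ! i) (\<lambda>w. (v, ws[i := w])))"

definition htensor ::
  "('k, 'r) ring_scheme \<Rightarrow> ('k, 'u) module \<Rightarrow> ('k, 'v) module list \<Rightarrow> ('k, ('u \<times> 'v list \<Rightarrow> 'k) set) module" where
  "htensor K V Ws = pres_mod K (htuples V Ws) (htensor_rels K V Ws)"

definition hpure ::
  "('k, 'r) ring_scheme \<Rightarrow> ('k, 'u) module \<Rightarrow> ('k, 'v) module list \<Rightarrow> 'u \<times> 'v list \<Rightarrow> ('u \<times> 'v list \<Rightarrow> 'k) set" where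
  "hpure K V Ws = pres_gen K (htuples V Ws) (htensor_rels K V Ws)"

section \<open>Linear categories and bimodules\<close>

text \<open>
  Target objects are written to the left: \<open>khom C y x\<close> is the space of morphisms from \<open>x\<close> to \<open>y\<close>,
  and \<open>kcomp C z y x g f\<close> is the composite of \<open>f\<close> from \<open>x\<close> to \<open>y\<close> with \<open>g\<close> from \<open>y\<close> to \<open>z\<close>.
  Likewise \<open>blact M z y x\<close> and \<open>bract M y x u\<close> are the actions
  \<open>khom C z y \<times> bhom M y x \<rightarrow> bhom M z x\<close> and \<open>bhom M y x \<times> khom C x u \<rightarrow> bhom M y u\<close>.
  Each space of morphisms carries its own vector space structure.
\<close>

record ('o, 'c, 'k) kcat =
  kobj :: "'o set"
  khom :: "'o \<Rightarrow> 'o \<Rightarrow> ('k, 'c) module"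
  kcomp :: "'o \<Rightarrow> 'o \<Rightarrow> 'o \<Rightarrow> 'c \<Rightarrow> 'c \<Rightarrow> 'c"
  kid :: "'o \<Rightarrow> 'c"

record ('o, 'c, 'm, 'k) kbimod =
  bhom :: "'o \<Rightarrow> 'o \<Rightarrow> ('k, 'm) module"
  blact :: "'o \<Rightarrow> 'o \<Rightarrow> 'o \<Rightarrow> 'c \<Rightarrow> 'm \<Rightarrow> 'm"
  bract :: "'o \<Rightarrow> 'o \<Rightarrow> 'o \<Rightarrow> 'm \<Rightarrow> 'c \<Rightarrow> 'm"

locale k_category = field K for K :: "('k, 'r) ring_scheme" (structure) +
  fixes C :: "('o, 'c, 'k) kcat"
  assumes khom_module: "\<lbrakk>x \<in> kobj C; y \<in> kobj C\<rbrakk> \<Longrightarrow> module K (khom C y x)"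
    and kcomp_bilin: "\<lbrakk>x \<in> kobj C; y \<in> kobj C; z \<in> kobj C\<rbrakk>
      \<Longrightarrow> bilin K (khom C z y) (khom C y x) (khom C z x) (kcomp C z y x)"
    and kcomp_assoc: "\<lbrakk>u \<in> kobj C; x \<in> kobj C; y \<in> kobj C; z \<in> kobj C;
        h \<in> carrier (khom C z y); g \<in> carrier (khom C y x); f \<in> carrier (khom C x u)\<rbrakk>
      \<Longrightarrow> kcomp C z y u h (kcomp C y x u g f) = kcomp C z x u (kcomp C z y x h g) f"
    and kid_closed: "x \<in> kobj C \<Longrightarrow> kid C x \<in> carrier (khom C x x)"
    and kid_left: "\<lbrakk>x \<in> kobj C; y \<in> kobj C; f \<in> carrier (khom C y x)\<rbrakk>
      \<Longrightarrow> kcomp C y y x (kid C y) f = f"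
    and kid_right: "\<lbrakk>x \<in> kobj C; y \<in> kobj C; f \<in> carrier (khom C y x)\<rbrakk>
      \<Longrightarrow> kcomp C y x x f (kid C x) = f"

locale k_bimodule = k_category K C for K :: "('k, 'r) ring_scheme" (structure) and C :: "('o, 'c, 'k) kcat" +
  fixes M :: "('o, 'c, 'm, 'k) kbimod"
  assumes bhom_module: "\<lbrakk>x \<in> kobj C; y \<in> kobj C\<rbrakk> \<Longrightarrow> module K (bhom M y x)"
    and blact_bilin: "\<lbrakk>x \<in> kobj C; y \<in> kobj C; z \<in> kobj C\<rbrakk>
      \<Longrightarrow> bilin K (khom C z y) (bhom M y x) (bhom M z x) (blact M z y x)"
    and bract_bilin: "\<lbrakk>u \<in> kobj C; x \<in> kobj C; y \<in> kobj C\<rbrakk>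
      \<Longrightarrow> bilin K (bhom M y x) (khom C x u) (bhom M y u) (bract M y x u)"
    and blact_assoc: "\<lbrakk>u \<in> kobj C; x \<in> kobj C; y \<in> kobj C; z \<in> kobj C;
        h \<in> carrier (khom C z y); g \<in> carrier (khom C y x); m \<in> carrier (bhom M x u)\<rbrakk>
      \<Longrightarrow> blact M z y u h (blact M y x u g m) = blact M z x u (kcomp C z y x h g) m"
    and bract_assoc: "\<lbrakk>u \<in> kobj C; x \<in> kobj C; y \<in> kobj C; z \<in> kobj C;
        m \<in> carrier (bhom M z y); g \<in> carrier (khom C y x); f \<in> carrier (khom C x u)\<rbrakk>
      \<Longrightarrow> bract M z x u (bract M z y x m g) f = bract M z y u m (kcomp C y x u g f)"
    and blact_bract: "\<lbrakk>u \<in> kobj C; x \<in> kobj C; y \<in> kobj C; z \<in> kobj C;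
        h \<in> carrier (khom C z y); m \<in> carrier (bhom M y x); f \<in> carrier (khom C x u)\<rbrakk>
      \<Longrightarrow> blact M z y u h (bract M y x u m f) = bract M z x u (blact M z y x h m) f"
    and blact_kid: "\<lbrakk>x \<in> kobj C; y \<in> kobj C; m \<in> carrier (bhom M y x)\<rbrakk>
      \<Longrightarrow> blact M y y x (kid C y) m = m"
    and bract_kid: "\<lbrakk>x \<in> kobj C; y \<in> kobj C; m \<in> carrier (bhom M y x)\<rbrakk>
      \<Longrightarrow> bract M y x x m (kid C x) = m"

section \<open>Hochschild-Mitchell homology and cohomology\<close>

text \<open>
  The tuple of objects \<open>(x\<^sub>n\<^sub>+\<^sub>1, \<dots>, x\<^sub>1)\<close> is the list \<open>xs\<close> of length \<open>n + 1\<close> in that order, and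
  \<open>(c\<^sub>n, \<dots>, c\<^sub>1)\<close> is the list \<open>cs\<close>, so \<open>cs ! j\<close> goes from \<open>xs ! (j + 1)\<close> to \<open>xs ! j\<close>; moreover
  \<open>hd xs\<close> is \<open>x\<^sub>n\<^sub>+\<^sub>1\<close> and \<open>last xs\<close> is \<open>x\<^sub>1\<close>. Degree \<open>0\<close> is covered by the conventions on
  tensor products without factors: \<open>V\<close> with an empty list of further factors is \<open>V\<close>, and
  the linear maps from the empty tensor product \<open>K\<close> to \<open>V\<close> are \<open>V\<close>.
\<close>

definition obj_tuples :: "('o, 'c, 'k) kcat \<Rightarrow> nat \<Rightarrow> 'o list set" where
  "obj_tuples C n = {xs. length xs = Suc n \<and> set xs \<subseteq> kobj C}"

definition hom_list :: "('o, 'c, 'k) kcat \<Rightarrow> 'o list \<Rightarrow> ('k, 'c) module list" where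
  "hom_list C xs = map2 (khom C) xs (tl xs)"

definition drop_obj :: "nat \<Rightarrow> 'o list \<Rightarrow> 'o list" where
  "drop_obj p xs = take p xs @ drop (Suc p) xs"

text \<open>Composition at the inner object \<open>xs ! p\<close>, for \<open>0 < p\<close>.\<close>

definition merge_at :: "('o, 'c, 'k) kcat \<Rightarrow> 'o list \<Rightarrow> nat \<Rightarrow> 'c list \<Rightarrow> 'c list" where
  "merge_at C xs p cs = take (p - 1) cs
     @ kcomp C (xs ! (p - 1)) (xs ! p) (xs ! (p + 1)) (cs ! (p - 1)) (cs ! p) # drop (p + 1) cs"

definition ksign :: "('k, 'r) ring_scheme \<Rightarrow> nat \<Rightarrow> 'k" where
  "ksign K i = (\<ominus>\<^bsub>K\<^esub> \<one>\<^bsub>K\<^esub>) [^]\<^bsub>K\<^esub> i"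

subsection \<open>Homology\<close>

definition hm_summand ::
  "('k, 'r) ring_scheme \<Rightarrow> ('o, 'c, 'k) kcat \<Rightarrow> ('o, 'c, 'm, 'k) kbimod \<Rightarrow> 'o list
     \<Rightarrow> ('k, ('m \<times> 'c list \<Rightarrow> 'k) set) module" where
  "hm_summand K C M xs = htensor K (bhom M (last xs) (hd xs)) (hom_list C xs)"

definition hm_chain ::
  "('k, 'r) ring_scheme \<Rightarrow> ('o, 'c, 'k) kcat \<Rightarrow> ('o, 'c, 'm, 'k) kbimod \<Rightarrow> nat
     \<Rightarrow> ('k, 'o list \<Rightarrow> ('m \<times> 'c list \<Rightarrow> 'k) set) module" where
  "hm_chain K C M n = dsum_mod (obj_tuples C n) (hm_summand K C M)"

definition hm_pure ::
  "('k, 'r) ring_scheme \<Rightarrow> ('o, 'c, 'k) kcat \<Rightarrow> ('o, 'c, 'm, 'k) kbimod \<Rightarrow> nat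
     \<Rightarrow> 'o list \<Rightarrow> 'm \<times> 'c list \<Rightarrow> 'o list \<Rightarrow> ('m \<times> 'c list \<Rightarrow> 'k) set" where
  "hm_pure K C M n xs t = dsum_inj (obj_tuples C n) (hm_summand K C M) xs
     (hpure K (bhom M (last xs) (hd xs)) (hom_list C xs) t)"

text \<open>The \<open>i\<close>-th face, \<open>0 \<le> i \<le> n\<close>, of a tuple over \<open>drop_obj i xs\<close>.\<close>

definition hm_face ::
  "('o, 'c, 'k) kcat \<Rightarrow> ('o, 'c, 'm, 'k) kbimod \<Rightarrow> nat \<Rightarrow> 'o list \<Rightarrow> nat \<Rightarrow> 'm \<times> 'c list \<Rightarrow> 'm \<times> 'c list" where
  "hm_face C M n xs i = (\<lambda>(m, cs).
     if i = 0 then (bract M (last xs) (xs ! 0) (xs ! 1) m (hd cs), tl cs)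
     else if i = n then (blact M (xs ! (n - 1)) (xs ! n) (hd xs) (last cs) m, butlast cs)
     else (m, merge_at C xs i cs))"

text \<open>The boundary map from degree \<open>n\<close> to degree \<open>n - 1\<close>, for \<open>n \<ge> 1\<close>.\<close>

definition hm_boundary ::
  "('k, 'r) ring_scheme \<Rightarrow> ('o, 'c, 'k) kcat \<Rightarrow> ('o, 'c, 'm, 'k) kbimod \<Rightarrow> nat
     \<Rightarrow> ('o list \<Rightarrow> ('m \<times> 'c list \<Rightarrow> 'k) set) \<Rightarrow> ('o list \<Rightarrow> ('m \<times> 'c list \<Rightarrow> 'k) set)" where
  "hm_boundary K C M n =
     dsum_lift (obj_tuples C n) (hm_summand K C M) (hm_chain K C M (n - 1))
       (\<lambda>xs. pres_lift K (htuples (bhom M (last xs) (hd xs)) (hom_list C xs)) (hm_chain K C M (n - 1))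
         (\<lambda>t. \<Oplus>\<^bsub>hm_chain K C M (n - 1)\<^esub> i \<in> {0..n}.
            ksign K i \<odot>\<^bsub>hm_chain K C M (n - 1)\<^esub>
              hm_pure K C M (n - 1) (drop_obj i xs) (hm_face C M n xs i t)))"

definition hm_cycles ::
  "('k, 'r) ring_scheme \<Rightarrow> ('o, 'c, 'k) kcat \<Rightarrow> ('o, 'c, 'm, 'k) kbimod \<Rightarrow> nat
     \<Rightarrow> ('k, 'o list \<Rightarrow> ('m \<times> 'c list \<Rightarrow> 'k) set) module" where
  "hm_cycles K C M n = (if n = 0 then hm_chain K C M 0
     else mod_kernel (hm_chain K C M n) (hm_chain K C M (n - 1)) (hm_boundary K C M n))"

definition hm_homology ::
  "('k, 'r) ring_scheme \<Rightarrow> ('o, 'c, 'k) kcat \<Rightarrow> ('o, 'c, 'm, 'k) kbimod \<Rightarrow> nat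
     \<Rightarrow> ('k, ('o list \<Rightarrow> ('m \<times> 'c list \<Rightarrow> 'k) set) set) module" where
  "hm_homology K C M n = quot_mod (hm_cycles K C M n)
     (hm_boundary K C M (Suc n) ` carrier (hm_chain K C M (Suc n)))"

subsection \<open>Cohomology\<close>

definition hm_cofactor ::
  "('k, 'r) ring_scheme \<Rightarrow> ('o, 'c, 'k) kcat \<Rightarrow> ('o, 'c, 'm, 'k) kbimod \<Rightarrow> 'o list
     \<Rightarrow> ('k, ('c list \<Rightarrow> 'k) set \<Rightarrow> 'm) module" where
  "hm_cofactor K C M xs = hom_mod K (ltensor K (hom_list C xs)) (bhom M (hd xs) (last xs))"

definition hm_cochain ::
  "('k, 'r) ring_scheme \<Rightarrow> ('o, 'c, 'k) kcat \<Rightarrow> ('o, 'c, 'm, 'k) kbimod \<Rightarrow> nat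
     \<Rightarrow> ('k, 'o list \<Rightarrow> ('c list \<Rightarrow> 'k) set \<Rightarrow> 'm) module" where
  "hm_cochain K C M n = dprod_mod (obj_tuples C n) (hm_cofactor K C M)"

definition hm_eval ::
  "('k, 'r) ring_scheme \<Rightarrow> ('o, 'c, 'k) kcat \<Rightarrow> ('o list \<Rightarrow> ('c list \<Rightarrow> 'k) set \<Rightarrow> 'm)
     \<Rightarrow> 'o list \<Rightarrow> 'c list \<Rightarrow> 'm" where
  "hm_eval K C f xs cs = f xs (lpure K (hom_list C xs) cs)"

text \<open>
  The coboundary map from degree \<open>n\<close> to degree \<open>n + 1\<close>. Here \<open>xs\<close> is \<open>(x\<^sub>n\<^sub>+\<^sub>2, \<dots>, x\<^sub>1)\<close> and
  \<open>cs\<close> is \<open>(c\<^sub>n\<^sub>+\<^sub>1, \<dots>, c\<^sub>1)\<close>, so \<open>c\<^sub>i\<^sub>+\<^sub>1\<close> and \<open>c\<^sub>i\<close> meet at \<open>x\<^sub>i\<^sub>+\<^sub>1\<close>, which is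
  \<open>xs ! (n + 1 - i)\<close>.
\<close>

definition hm_coboundary ::
  "('k, 'r) ring_scheme \<Rightarrow> ('o, 'c, 'k) kcat \<Rightarrow> ('o, 'c, 'm, 'k) kbimod \<Rightarrow> nat
     \<Rightarrow> ('o list \<Rightarrow> ('c list \<Rightarrow> 'k) set \<Rightarrow> 'm) \<Rightarrow> ('o list \<Rightarrow> ('c list \<Rightarrow> 'k) set \<Rightarrow> 'm)" where
  "hm_coboundary K C M n f = (\<lambda>xs\<in>obj_tuples C (Suc n).
     let N = bhom M (hd xs) (last xs) in
     restrict (pres_lift K (ltuples (hom_list C xs)) N
       (\<lambda>cs.
          ksign K (n + 1) \<odot>\<^bsub>N\<^esub>
            blact M (xs ! 0) (xs ! 1) (last xs) (hd cs) (hm_eval K C f (tl xs) (tl cs))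
          \<oplus>\<^bsub>N\<^esub> (\<Oplus>\<^bsub>N\<^esub> i \<in> {1..n}. ksign K i \<odot>\<^bsub>N\<^esub>
                 hm_eval K C f (drop_obj (n + 1 - i) xs) (merge_at C xs (n + 1 - i) cs))
          \<oplus>\<^bsub>N\<^esub> bract M (hd xs) (xs ! n) (xs ! (n + 1)) (hm_eval K C f (butlast xs) (butlast cs)) (last cs)))
       (carrier (ltensor K (hom_list C xs))))"

definition hm_coboundaries ::
  "('k, 'r) ring_scheme \<Rightarrow> ('o, 'c, 'k) kcat \<Rightarrow> ('o, 'c, 'm, 'k) kbimod \<Rightarrow> nat
     \<Rightarrow> ('o list \<Rightarrow> ('c list \<Rightarrow> 'k) set \<Rightarrow> 'm) set" where
  "hm_coboundaries K C M n = (if n = 0 then {\<zero>\<^bsub>hm_cochain K C M 0\<^esub>}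
     else hm_coboundary K C M (n - 1) ` carrier (hm_cochain K C M (n - 1)))"

definition hm_cohomology ::
  "('k, 'r) ring_scheme \<Rightarrow> ('o, 'c, 'k) kcat \<Rightarrow> ('o, 'c, 'm, 'k) kbimod \<Rightarrow> nat
     \<Rightarrow> ('k, ('o list \<Rightarrow> ('c list \<Rightarrow> 'k) set \<Rightarrow> 'm) set) module" where
  "hm_cohomology K C M n =
     quot_mod (mod_kernel (hm_cochain K C M n) (hm_cochain K C M (Suc n)) (hm_coboundary K C M n))
       (hm_coboundaries K C M n)"

section \<open>Contraction\<close>

text \<open>
  The full subcategory is given by its set of objects \<open>F\<close>. In the contraction, \<^const>\<open>None\<close> is the
  object replacing those of \<open>F\<close> and \<open>Some z\<close> is the object \<open>z\<close> outside \<open>F\<close>. With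
  \<open>block F None = F\<close> and \<open>block F (Some z) = {z}\<close>, a morphism from \<open>a\<close> to \<open>b\<close> is an element of the
  direct sum of the spaces \<open>khom C y x\<close> over \<open>y\<close> in the block of \<open>b\<close> and \<open>x\<close> in the block of \<open>a\<close>,
  i.e. a matrix whose \<open>(y, x)\<close> entry goes from \<open>x\<close> to \<open>y\<close>. In particular a morphism between two
  unaffected objects \<open>z\<close>, \<open>w\<close> is stored as the one-entry matrix containing it.
\<close>

fun block :: "'o set \<Rightarrow> 'o option \<Rightarrow> 'o set" where
  "block F None = F"
| "block F (Some z) = {z}"

definition mat_space ::
  "'o set \<Rightarrow> ('o \<Rightarrow> 'o \<Rightarrow> ('k, 'v) module) \<Rightarrow> 'o option \<Rightarrow> 'o option \<Rightarrow> ('k, 'o \<times> 'o \<Rightarrow> 'v) module" where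
  "mat_space F H b a = dsum_mod (block F b \<times> block F a) (\<lambda>(y, x). H y x)"

text \<open>
  The matrix product for the middle object \<open>b\<close>, where \<open>op z y x\<close> multiplies a \<open>(z, y)\<close> entry
  with a \<open>(y, x)\<close> entry and \<open>H z x\<close> is the space containing the result.
\<close>

definition mat_prod ::
  "'o set \<Rightarrow> ('o \<Rightarrow> 'o \<Rightarrow> ('k, 'w) module) \<Rightarrow> ('o \<Rightarrow> 'o \<Rightarrow> 'o \<Rightarrow> 'u \<Rightarrow> 'v \<Rightarrow> 'w)
     \<Rightarrow> 'o option \<Rightarrow> 'o option \<Rightarrow> 'o option \<Rightarrow> ('o \<times> 'o \<Rightarrow> 'u) \<Rightarrow> ('o \<times> 'o \<Rightarrow> 'v) \<Rightarrow> 'o \<times> 'o \<Rightarrow> 'w" where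
  "mat_prod F H op c b a g f = (\<lambda>(z, x) \<in> block F c \<times> block F a.
     \<Oplus>\<^bsub>H z x\<^esub> y \<in> block F b. op z y x (g (z, y)) (f (y, x)))"

definition contraction ::
  "('o, 'c, 'k) kcat \<Rightarrow> 'o set \<Rightarrow> ('o option, 'o \<times> 'o \<Rightarrow> 'c, 'k) kcat" where
  "contraction C F =
     \<lparr>kobj = insert None (Some ` (kobj C - F)),
      khom = mat_space F (khom C),
      kcomp = mat_prod F (khom C) (kcomp C),
      kid = (\<lambda>a. \<lambda>(y, x) \<in> block F a \<times> block F a. if y = x then kid C x else \<zero>\<^bsub>khom C y x\<^esub>)\<rparr>"

definition contraction_bimod ::
  "('o, 'c, 'm, 'k) kbimod \<Rightarrow> 'o set \<Rightarrow> ('o option, 'o \<times> 'o \<Rightarrow> 'c, 'o \<times> 'o \<Rightarrow> 'm, 'k) kbimod" where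
  "contraction_bimod M F =
     \<lparr>bhom = mat_space F (bhom M),
      blact = mat_prod F (bhom M) (blact M),
      bract = mat_prod F (bhom M) (bract M)\<rparr>"

section \<open>Expansion\<close>

definition complete_orth_idempotents :: "('o, 'c, 'k) kcat \<Rightarrow> 'o \<Rightarrow> 'c set \<Rightarrow> bool" where
  "complete_orth_idempotents C x E \<longleftrightarrow>
     finite E \<and> E \<subseteq> carrier (khom C x x)
   \<and> (\<forall>e\<in>E. kcomp C x x x e e = e)
   \<and> (\<forall>e\<in>E. \<forall>f\<in>E. e \<noteq> f \<longrightarrow> kcomp C x x x e f = \<zero>\<^bsub>khom C x x\<^esub>)
   \<and> (\<Oplus>\<^bsub>khom C x x\<^esub> e \<in> E. e) = kid C x"

text \<open>
  In the expansion, \<open>Inl z\<close> is the object \<open>z \<noteq> x\<close> and \<open>Inr e\<close> is the object \<open>e \<in> E\<close>. Putting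
  \<open>base_obj x (Inl z) = z\<close>, \<open>base_obj x (Inr e) = x\<close> and \<open>base_idem C (Inl z) = kid C z\<close>,
  \<open>base_idem C (Inr e) = e\<close>, all the spaces of morphisms are the subspaces \<open>f C e\<close> cut out by the
  idempotents of the two objects; multiplying by the identity of an unaffected object does nothing.
\<close>

fun base_obj :: "'o \<Rightarrow> 'o + 'c \<Rightarrow> 'o" where
  "base_obj x (Inl z) = z"
| "base_obj x (Inr e) = x"

fun base_idem :: "('o, 'c, 'k) kcat \<Rightarrow> 'o + 'c \<Rightarrow> 'c" where
  "base_idem C (Inl z) = kid C z"
| "base_idem C (Inr e) = e"

definition expansion :: "('o, 'c, 'k) kcat \<Rightarrow> 'o \<Rightarrow> 'c set \<Rightarrow> ('o + 'c, 'c, 'k) kcat" where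
  "expansion C x E =
     \<lparr>kobj = Inl ` (kobj C - {x}) \<union> Inr ` E,
      khom = (\<lambda>b a. let y = base_obj x b; z = base_obj x a in
        (khom C y z)\<lparr>carrier :=
          (\<lambda>c. kcomp C y y z (base_idem C b) (kcomp C y z z c (base_idem C a))) ` carrier (khom C y z)\<rparr>),
      kcomp = (\<lambda>c b a. kcomp C (base_obj x c) (base_obj x b) (base_obj x a)),
      kid = base_idem C\<rparr>"

definition expansion_bimod ::
  "('o, 'c, 'k) kcat \<Rightarrow> ('o, 'c, 'm, 'k) kbimod \<Rightarrow> 'o \<Rightarrow> ('o + 'c, 'c, 'm, 'k) kbimod" where
  "expansion_bimod C M x =
     \<lparr>bhom = (\<lambda>b a. let y = base_obj x b; z = base_obj x a in
        (bhom M y z)\<lparr>carrier :=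
          (\<lambda>m. blact M y y z (base_idem C b) (bract M y z z m (base_idem C a))) ` carrier (bhom M y z)\<rparr>),
      blact = (\<lambda>c b a. blact M (base_obj x c) (base_obj x b) (base_obj x a)),
      bract = (\<lambda>c b a. bract M (base_obj x c) (base_obj x b) (base_obj x a))\<rparr>"

end

theory Submission
  imports Defs
begin

text \<open>
  Contraction and expansion are the same relation between two categories, read in opposite
  directions. In both cases a category \<open>A\<close> arises from a category \<open>B\<close> by amalgamating finite families
  of objects: the identity of an object of \<open>A\<close> is the sum of orthogonal idempotents, one for each of
  the objects of \<open>B\<close> above it, and the morphisms of \<open>B\<close> are the corners of the morphism spaces of \<open>A\<close>
  cut out by these idempotents. The same holds for the bimodules. This is the locale \<open>amalgamation\<close>.
  For a contraction \<open>B\<close> is the given category, and for an expansion \<open>A\<close> is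
  (\<open>contraction_amalgamation\<close>, \<open>expansion_amalgamation\<close>).

  The inclusion of the corners induces an injective chain map \<open>phi\<close> from \<open>B\<close> to \<open>A\<close>. There is a
  projection \<open>rmap\<close> of the chains of \<open>A\<close> onto the image of \<open>phi\<close>: it inserts the decomposition of the
  identity into idempotents on both sides of every object of a tuple, and only tuples whose
  consecutive entries meet in the same idempotent remain. Inserting an additional identity morphism
  at one object, after cutting in this way at the objects up to that one, gives a homotopy
  between \<open>rmap\<close> and the identity (\<open>bar_homotopy\<close>, \<open>chain_homotopy\<close>). Hence \<open>phi\<close> is an isomorphism on
  homology (\<open>homology_iso\<close>). Dually, restriction to the corners is a surjective cochain map \<open>psi\<close> from
  \<open>A\<close> to \<open>B\<close>. Its kernel is annihilated by the analogous projection \<open>rco\<close>, which is homotopic to the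
  identity (\<open>cochain_homotopy\<close>, \<open>cohomology_iso\<close>).

  Both homotopies come from one computation. A tuple with coefficient \<open>v m u\<close> is represented by a bar
  tuple, which has \<open>u\<close> and \<open>v\<close> as additional outer entries and \<open>m\<close> as a parameter. On bar tuples all
  faces are compositions at inner objects, and the homotopy formula is an identity between
  multilinear functions of composable tuples with values in an arbitrary module. It is applied to
  values in the chain space for homology and to values in the bimodule for cohomology.
\<close>

abbreviation mor :: "('o, 'c, 'k) kcat \<Rightarrow> 'o \<Rightarrow> 'o \<Rightarrow> 'c set" where
  "mor C y x \<equiv> carrier (khom C y x)"

abbreviation bim :: "('o, 'c, 'm, 'k) kbimod \<Rightarrow> 'o \<Rightarrow> 'o \<Rightarrow> 'm set" where
  "bim M y x \<equiv> carrier (bhom M y x)"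

section \<open>Linear maps, spans and quotients\<close>

lemma mk_mod_sel [simp]:
 "carrier (mk_mod A p z s) = A" "add (mk_mod A p z s) = p"
 "ring.zero (mk_mod A p z s) = z" "smult (mk_mod A p z s) = s"
 by (simp_all add: mk_mod_def)

lemma mod_homI:
 assumes "\<And>v. v \<in> carrier V \<Longrightarrow> h v \<in> carrier W"
  and "\<And>u v. u \<in> carrier V \<Longrightarrow> v \<in> carrier V \<Longrightarrow> h (u \<oplus>\<^bsub>V\<^esub> v) = h u \<oplus>\<^bsub>W\<^esub> h v"
  and "\<And>a v. a \<in> carrier K \<Longrightarrow> v \<in> carrier V \<Longrightarrow> h (a \<odot>\<^bsub>V\<^esub> v) = a \<odot>\<^bsub>W\<^esub> h v"
 shows "h \<in> mod_hom K V W"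
 using assms by (auto simp: mod_hom_def)

lemma
 assumes "h \<in> mod_hom K V W"
 shows lin_closed: "v \<in> carrier V \<Longrightarrow> h v \<in> carrier W"
  and lin_add: "u \<in> carrier V \<Longrightarrow> v \<in> carrier V \<Longrightarrow> h (u \<oplus>\<^bsub>V\<^esub> v) = h u \<oplus>\<^bsub>W\<^esub> h v"
  and lin_smult: "a \<in> carrier K \<Longrightarrow> v \<in> carrier V \<Longrightarrow> h (a \<odot>\<^bsub>V\<^esub> v) = a \<odot>\<^bsub>W\<^esub> h v"
 using assms by (auto simp: mod_hom_def)

lemma lin_zero:
 assumes "module K V" "module K W" "h \<in> mod_hom K V W"
 shows "h \<zero>\<^bsub>V\<^esub> = \<zero>\<^bsub>W\<^esub>"
proof -
 interpret V: module K V by fact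
 interpret W: module K W by fact
 have "h (\<zero>\<^bsub>K\<^esub> \<odot>\<^bsub>V\<^esub> \<zero>\<^bsub>V\<^esub>) = \<zero>\<^bsub>K\<^esub> \<odot>\<^bsub>W\<^esub> h \<zero>\<^bsub>V\<^esub>"
  by (rule lin_smult[OF assms(3)]) auto
 then show ?thesis using lin_closed[OF assms(3), of "\<zero>\<^bsub>V\<^esub>"] by simp
qed

lemma lin_neg:
 assumes "module K V" "module K W" "h \<in> mod_hom K V W" "v \<in> carrier V"
 shows "h (\<ominus>\<^bsub>V\<^esub> v) = \<ominus>\<^bsub>W\<^esub> h v"
proof -
 interpret V: module K V by fact
 interpret W: module K W by fact
 have "h ((\<ominus>\<^bsub>K\<^esub> \<one>\<^bsub>K\<^esub>) \<odot>\<^bsub>V\<^esub> v) = (\<ominus>\<^bsub>K\<^esub> \<one>\<^bsub>K\<^esub>) \<odot>\<^bsub>W\<^esub> h v"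
  by (rule lin_smult[OF assms(3)]) (use assms in auto)
 then show ?thesis using lin_closed[OF assms(3,4)] assms(4)
  by (simp add: V.smult_l_minus W.smult_l_minus)
qed

lemma lin_minus:
 assumes "module K V" "module K W" "h \<in> mod_hom K V W" "u \<in> carrier V" "v \<in> carrier V"
 shows "h (u \<ominus>\<^bsub>V\<^esub> v) = h u \<ominus>\<^bsub>W\<^esub> h v"
proof -
 interpret V: module K V by fact
 interpret W: module K W by fact
 show ?thesis
  using assms by (simp add: V.minus_eq W.minus_eq lin_add[OF assms(3)] lin_neg)
qed

lemma lin_finsum:
 assumes "module K V" "module K W" "h \<in> mod_hom K V W" "f \<in> I \<rightarrow> carrier V"
 shows "h (\<Oplus>\<^bsub>V\<^esub> i \<in> I. f i) = (\<Oplus>\<^bsub>W\<^esub> i \<in> I. h (f i))"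
proof -
 interpret V: module K V by fact
 interpret W: module K W by fact
 show ?thesis
 proof (cases "finite I")
  case True
  then show ?thesis using assms(4)
  proof (induction I)
   case empty
   then show ?case by (simp add: lin_zero[OF assms(1-3)])
  next
   case (insert i I)
   have "f \<in> I \<rightarrow> carrier V" "f i \<in> carrier V" using insert.prems by auto
   moreover have "(\<lambda>i. h (f i)) \<in> I \<rightarrow> carrier W" "h (f i) \<in> carrier W"
    using insert.prems lin_closed[OF assms(3)] by auto
   ultimately show ?case using insert by (simp add: lin_add[OF assms(3)])
  qed
 next
  case False
  then show ?thesis by (simp add: lin_zero[OF assms(1-3)])
 qed
qed

lemma lin_id: "(\<lambda>v. v) \<in> mod_hom K V V"
 by (auto simp: mod_hom_def)

lemma lin_comp:
 "g \<in> mod_hom K V W \<Longrightarrow> h \<in> mod_hom K U V \<Longrightarrow> (\<lambda>u. g (h u)) \<in> mod_hom K U W"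
 by (auto simp: mod_hom_def Pi_iff)

lemma lin_cong:
 assumes "module K V" "\<And>v. v \<in> carrier V \<Longrightarrow> g v = h v" "h \<in> mod_hom K V W"
 shows "g \<in> mod_hom K V W"
proof -
 interpret V: module K V by fact
 show ?thesis
  by (rule mod_homI) (use assms(2,3) in \<open>auto simp: mod_hom_def\<close>)
qed

lemma lin_const_zero:
 assumes "module K W" shows "(\<lambda>v. \<zero>\<^bsub>W\<^esub>) \<in> mod_hom K V W"
proof -
 interpret W: module K W by fact
 show ?thesis by (rule mod_homI) auto
qed

lemma lin_add_pointwise:
 assumes "module K W" "g \<in> mod_hom K V W" "h \<in> mod_hom K V W"
 shows "(\<lambda>v. g v \<oplus>\<^bsub>W\<^esub> h v) \<in> mod_hom K V W"
proof -
 interpret W: module K W by fact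
 show ?thesis
  using assms(2,3) by (auto intro!: mod_homI simp: mod_hom_def Pi_iff W.smult_r_distr W.a_ac)
qed

lemma lin_smult_pointwise:
 assumes "module K W" "a \<in> carrier K" "h \<in> mod_hom K V W"
 shows "(\<lambda>v. a \<odot>\<^bsub>W\<^esub> h v) \<in> mod_hom K V W"
proof -
 interpret W: module K W by fact
 show ?thesis
 proof (rule mod_homI)
  fix b v assume "b \<in> carrier K" "v \<in> carrier V"
  then show "a \<odot>\<^bsub>W\<^esub> h (b \<odot>\<^bsub>V\<^esub> v) = b \<odot>\<^bsub>W\<^esub> (a \<odot>\<^bsub>W\<^esub> h v)"
   using assms by (simp add: mod_hom_def Pi_iff flip: W.smult_assoc1) (simp add: W.m_comm)
 qed (use assms in \<open>auto simp: mod_hom_def Pi_iff W.smult_r_distr\<close>)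
qed

lemma lin_finsum_pointwise:
 assumes "module K V" "module K W" "\<And>i. i \<in> I \<Longrightarrow> g i \<in> mod_hom K V W"
 shows "(\<lambda>v. \<Oplus>\<^bsub>W\<^esub> i \<in> I. g i v) \<in> mod_hom K V W"
proof -
 interpret W: module K W by fact
 show ?thesis
 proof (cases "finite I")
  case True
  then show ?thesis using assms(3)
  proof (induction I)
   case empty
   then show ?case by (simp add: lin_const_zero[OF assms(2)])
  next
   case (insert i I)
   have cl: "g j v \<in> carrier W" if "j \<in> insert i I" "v \<in> carrier V" for j v
    using that insert.prems by (blast intro: lin_closed)
   have "(\<lambda>v. g i v \<oplus>\<^bsub>W\<^esub> (\<Oplus>\<^bsub>W\<^esub> i \<in> I. g i v)) \<in> mod_hom K V W"
    using insert by (intro lin_add_pointwise[OF assms(2)]) auto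
   moreover have "(\<Oplus>\<^bsub>W\<^esub> i \<in> insert i I. g i v) = g i v \<oplus>\<^bsub>W\<^esub> (\<Oplus>\<^bsub>W\<^esub> i \<in> I. g i v)"
    if "v \<in> carrier V" for v
    using that insert.hyps cl by (intro W.finsum_insert) auto
   ultimately show ?case
    by (rule lin_cong[OF assms(1), rotated]) auto
  qed
 next
  case False
  then show ?thesis by (simp add: lin_const_zero[OF assms(2)])
 qed
qed

lemma (in module) submoduleI_linear:
 assumes "H \<subseteq> carrier M" "\<zero>\<^bsub>M\<^esub> \<in> H"
  and "\<And>a b. a \<in> H \<Longrightarrow> b \<in> H \<Longrightarrow> a \<oplus>\<^bsub>M\<^esub> b \<in> H"
  and smult: "\<And>a x. a \<in> carrier R \<Longrightarrow> x \<in> H \<Longrightarrow> a \<odot>\<^bsub>M\<^esub> x \<in> H"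
 shows "submodule H R M"
proof (rule submoduleI)
 fix a assume "a \<in> H"
 then have "(\<ominus> \<one>) \<odot>\<^bsub>M\<^esub> a \<in> H" by (intro smult) auto
 with \<open>a \<in> H\<close> assms(1) show "\<ominus>\<^bsub>M\<^esub> a \<in> H"
  by (auto simp: smult_l_minus)
qed (use assms in auto)

lemma
 assumes "module K V" "submodule H K V"
 shows submodule_subset: "H \<subseteq> carrier V"
  and submodule_zero: "\<zero>\<^bsub>V\<^esub> \<in> H"
  and submodule_add: "u \<in> H \<Longrightarrow> v \<in> H \<Longrightarrow> u \<oplus>\<^bsub>V\<^esub> v \<in> H"
  and submodule_neg: "v \<in> H \<Longrightarrow> \<ominus>\<^bsub>V\<^esub> v \<in> H"
  and submodule_smult: "a \<in> carrier K \<Longrightarrow> v \<in> H \<Longrightarrow> a \<odot>\<^bsub>V\<^esub> v \<in> H"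
proof -
 interpret V: module K V by fact
 note E = V.submoduleE[OF assms(2)]
 show "H \<subseteq> carrier V" "u \<in> H \<Longrightarrow> v \<in> H \<Longrightarrow> u \<oplus>\<^bsub>V\<^esub> v \<in> H" "v \<in> H \<Longrightarrow> \<ominus>\<^bsub>V\<^esub> v \<in> H"
  "a \<in> carrier K \<Longrightarrow> v \<in> H \<Longrightarrow> a \<odot>\<^bsub>V\<^esub> v \<in> H"
  using E by auto
 show "\<zero>\<^bsub>V\<^esub> \<in> H"
  using subgroup.one_closed[OF submodule.axioms(1)[OF assms(2)]] by simp
qed

lemma submodule_finsum:
 assumes "module K V" "submodule H K V" "\<And>i. i \<in> I \<Longrightarrow> f i \<in> H"
 shows "(\<Oplus>\<^bsub>V\<^esub> i \<in> I. f i) \<in> H"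
proof -
 interpret V: module K V by fact
 note H = submodule_subset[OF assms(1,2)] submodule_zero[OF assms(1,2)] submodule_add[OF assms(1,2)]
 show ?thesis
 proof (cases "finite I")
  case True
  then show ?thesis using assms(3)
  proof (induction I)
   case (insert i I)
   then have "(\<Oplus>\<^bsub>V\<^esub> i \<in> insert i I. f i) = f i \<oplus>\<^bsub>V\<^esub> (\<Oplus>\<^bsub>V\<^esub> i \<in> I. f i)"
    using H(1) by (intro V.finsum_insert) auto
   with insert show ?case by (auto intro: H(3))
  qed (use H in simp)
 qed (use H in simp)
qed

lemma submodule_equalizer:
 assumes "module K V" "module K W" "g \<in> mod_hom K V W" "h \<in> mod_hom K V W"
 shows "submodule {v \<in> carrier V. g v = h v} K V"
proof -
 interpret V: module K V by fact
 show ?thesis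
  by (rule V.submoduleI_linear)
   (auto simp: lin_zero[OF assms(1,2)] lin_add[OF assms(3)] lin_add[OF assms(4)]
    lin_smult[OF assms(3)] lin_smult[OF assms(4)] assms(3,4))
qed

lemma submodule_preimage:
 assumes "module K V" "module K W" "h \<in> mod_hom K V W" "submodule H K W"
 shows "submodule {v \<in> carrier V. h v \<in> H} K V"
proof -
 interpret V: module K V by fact
 show ?thesis
  by (rule V.submoduleI_linear)
   (auto simp: lin_zero[OF assms(1-3)] lin_add[OF assms(3)] lin_smult[OF assms(3)]
    intro: submodule_zero submodule_add submodule_smult assms)
qed

lemma submodule_image:
 assumes "module K V" "module K W" "h \<in> mod_hom K V W"
 shows "submodule (h ` carrier V) K W"
proof -
 interpret V: module K V by fact
 interpret W: module K W by fact
 show ?thesis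
 proof (rule W.submoduleI_linear)
  show "h ` carrier V \<subseteq> carrier W" using lin_closed[OF assms(3)] by auto
  show "\<zero>\<^bsub>W\<^esub> \<in> h ` carrier V"
   by (rule image_eqI[of _ _ "\<zero>\<^bsub>V\<^esub>"]) (simp_all add: lin_zero[OF assms])
  show "a \<oplus>\<^bsub>W\<^esub> b \<in> h ` carrier V" if ab: "a \<in> h ` carrier V" "b \<in> h ` carrier V" for a b
  proof -
   obtain u v where "u \<in> carrier V" "v \<in> carrier V" "a = h u" "b = h v" using ab by blast
   then show ?thesis by (intro image_eqI[of _ _ "u \<oplus>\<^bsub>V\<^esub> v"]) (auto simp: lin_add[OF assms(3)])
  qed
  show "a \<odot>\<^bsub>W\<^esub> x \<in> h ` carrier V" if a: "a \<in> carrier K" "x \<in> h ` carrier V" for a x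
  proof -
   obtain v where "v \<in> carrier V" "x = h v" using a by blast
   then show ?thesis using a by (intro image_eqI[of _ _ "a \<odot>\<^bsub>V\<^esub> v"]) (auto simp: lin_smult[OF assms(3)])
  qed
 qed
qed

lemma mod_span_submodule:
 assumes "module K V" "S \<subseteq> carrier V"
 shows "submodule (mod_span K V S) K V"
proof -
 interpret V: module K V by fact
 have "carrier V \<in> {H. submodule H K V \<and> S \<subseteq> H}"
  using V.carrier_is_submodule assms(2) by blast
 then show ?thesis
  unfolding mod_span_def
  by (intro V.submoduleI_linear)
   (auto intro: submodule_zero submodule_add submodule_smult assms(1))
qed

lemma mod_span_superset: "S \<subseteq> mod_span K V S"
 by (auto simp: mod_span_def)

lemma mod_span_minimal: "submodule H K V \<Longrightarrow> S \<subseteq> H \<Longrightarrow> mod_span K V S \<subseteq> H"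
 by (auto simp: mod_span_def)

lemma lin_eq_on_span:
 assumes "module K V" "module K W" "g \<in> mod_hom K V W" "h \<in> mod_hom K V W"
  and "S \<subseteq> carrier V" "\<And>x. x \<in> S \<Longrightarrow> g x = h x" "v \<in> mod_span K V S"
 shows "g v = h v"
 using mod_span_minimal[OF submodule_equalizer[OF assms(1-4)], of S] assms(5-7) by auto

lemma lin_span_into:
 assumes "module K V" "module K W" "h \<in> mod_hom K V W" "submodule H K W"
  and "S \<subseteq> carrier V" "\<And>x. x \<in> S \<Longrightarrow> h x \<in> H" "v \<in> mod_span K V S"
 shows "h v \<in> H"
 using mod_span_minimal[OF submodule_preimage[OF assms(1-4)], of S] assms(5-7) by auto

lemma mod_span_full:
 assumes "module K V" "S \<subseteq> carrier V" "carrier V \<subseteq> mod_span K V S"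
 shows "mod_span K V S = carrier V"
 using submodule_subset[OF assms(1) mod_span_submodule[OF assms(1,2)]] assms(3) by blast

lemma mod_span_surj_image:
 assumes "module K V" "module K W" "q \<in> mod_hom K V W" "q ` carrier V = carrier W"
  and "S \<subseteq> carrier V" "mod_span K V S = carrier V"
 shows "mod_span K W (q ` S) = carrier W"
proof (rule mod_span_full[OF assms(2)])
 show sub: "q ` S \<subseteq> carrier W" using image_mono[OF assms(5), of q] assms(4) by simp
 have "q v \<in> mod_span K W (q ` S)" if v: "v \<in> carrier V" for v
 proof (rule lin_span_into[OF assms(1-3) mod_span_submodule[OF assms(2) sub] assms(5)])
  show "v \<in> mod_span K V S" using v assms(6) by simp
  show "q x \<in> mod_span K W (q ` S)" if "x \<in> S" for x
   by (rule subsetD[OF mod_span_superset imageI[OF that]])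
 qed
 then have "q ` carrier V \<subseteq> mod_span K W (q ` S)" by (rule image_subsetI)
 then show "carrier W \<subseteq> mod_span K W (q ` S)" using assms(4) by simp
qed

text \<open>A quotient inherits the module axioms through its projection, which saves checking them
 on cosets.\<close>

lemma module_surj_image:
 assumes "module K V" "q ` carrier V = carrier W"
  and add: "\<And>u v. u \<in> carrier V \<Longrightarrow> v \<in> carrier V \<Longrightarrow> q (u \<oplus>\<^bsub>V\<^esub> v) = q u \<oplus>\<^bsub>W\<^esub> q v"
  and smult: "\<And>a v. a \<in> carrier K \<Longrightarrow> v \<in> carrier V \<Longrightarrow> q (a \<odot>\<^bsub>V\<^esub> v) = a \<odot>\<^bsub>W\<^esub> q v"
  and zero: "q \<zero>\<^bsub>V\<^esub> = \<zero>\<^bsub>W\<^esub>"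
 shows "module K W"
proof -
 interpret V: module K V by fact
 have ex: "\<exists>v\<in>carrier V. w = q v" if "w \<in> carrier W" for w
  using that assms(2) by blast
 have q: "q v \<in> carrier W" if "v \<in> carrier V" for v
  using that assms(2) by blast
 show ?thesis
 proof (rule moduleI)
  show "cring K" by (rule V.is_cring)
  show "abelian_group W"
  proof (rule abelian_groupI)
   show "x \<oplus>\<^bsub>W\<^esub> y \<in> carrier W" if "x \<in> carrier W" "y \<in> carrier W" for x y
    using that ex q by (metis V.add.m_closed add)
   show "\<zero>\<^bsub>W\<^esub> \<in> carrier W" using q zero by (metis V.zero_closed)
   show "x \<oplus>\<^bsub>W\<^esub> y \<oplus>\<^bsub>W\<^esub> z = x \<oplus>\<^bsub>W\<^esub> (y \<oplus>\<^bsub>W\<^esub> z)"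
    if "x \<in> carrier W" "y \<in> carrier W" "z \<in> carrier W" for x y z
   proof -
    obtain x' y' z' where "x' \<in> carrier V" "y' \<in> carrier V" "z' \<in> carrier V" "x = q x'" "y = q y'" "z = q z'"
     using ex \<open>x \<in> carrier W\<close> \<open>y \<in> carrier W\<close> \<open>z \<in> carrier W\<close> by metis
    then show ?thesis by (simp add: V.a_assoc flip: add)
   qed
   show "x \<oplus>\<^bsub>W\<^esub> y = y \<oplus>\<^bsub>W\<^esub> x" if "x \<in> carrier W" "y \<in> carrier W" for x y
    using that ex by (metis V.a_comm add)
   show "\<zero>\<^bsub>W\<^esub> \<oplus>\<^bsub>W\<^esub> x = x" if "x \<in> carrier W" for x
    using that ex by (metis V.l_zero V.zero_closed add zero)
   show "\<exists>y\<in>carrier W. y \<oplus>\<^bsub>W\<^esub> x = \<zero>\<^bsub>W\<^esub>" if "x \<in> carrier W" for x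
    using that ex q by (metis V.a_inv_closed V.l_neg add zero)
  qed
  show "\<one>\<^bsub>K\<^esub> \<odot>\<^bsub>W\<^esub> x = x" if "x \<in> carrier W" for x
   using ex[OF that] by (auto simp flip: smult)
  fix a x assume a: "a \<in> carrier K" and "x \<in> carrier W"
  then obtain x' where x: "x' \<in> carrier V" "x = q x'" using ex by blast
  show "a \<odot>\<^bsub>W\<^esub> x \<in> carrier W" using a x q by (metis V.smult_closed smult)
  show "(a \<oplus>\<^bsub>K\<^esub> b) \<odot>\<^bsub>W\<^esub> x = a \<odot>\<^bsub>W\<^esub> x \<oplus>\<^bsub>W\<^esub> b \<odot>\<^bsub>W\<^esub> x" if b: "b \<in> carrier K" for b
   using a x b by (simp add: V.smult_l_distr flip: smult add)
  show "a \<otimes>\<^bsub>K\<^esub> b \<odot>\<^bsub>W\<^esub> x = a \<odot>\<^bsub>W\<^esub> (b \<odot>\<^bsub>W\<^esub> x)" if "b \<in> carrier K" for b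
   using a x that by (simp add: V.smult_assoc1 flip: smult)
  fix y assume "y \<in> carrier W"
  then obtain y' where y: "y' \<in> carrier V" "y = q y'" using ex by blast
  show "a \<odot>\<^bsub>W\<^esub> (x \<oplus>\<^bsub>W\<^esub> y) = a \<odot>\<^bsub>W\<^esub> x \<oplus>\<^bsub>W\<^esub> a \<odot>\<^bsub>W\<^esub> y"
   using a x y by (simp add: V.smult_r_distr flip: smult add)
 qed
qed

lemma quot_mod_sel [simp]:
 "carrier (quot_mod V H) = a_rcosets\<^bsub>V\<^esub> H" "add (quot_mod V H) = set_add V"
 "ring.zero (quot_mod V H) = H" "smult (quot_mod V H) = (\<lambda>a A. \<Union>v\<in>A. H +>\<^bsub>V\<^esub> (a \<odot>\<^bsub>V\<^esub> v))"
 by (simp_all add: quot_mod_def)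

lemma coset_iff: "x \<in> H +>\<^bsub>V\<^esub> v \<longleftrightarrow> (\<exists>h\<in>H. x = h \<oplus>\<^bsub>V\<^esub> v)"
 by (auto simp: a_r_coset_def r_coset_def)

lemma cosets_eq_image: "a_rcosets\<^bsub>V\<^esub> H = (\<lambda>v. H +>\<^bsub>V\<^esub> v) ` carrier V"
 by (auto simp: A_RCOSETS_def RCOSETS_def a_r_coset_def)

lemma coset_eq_iff:
 assumes "module K V" "submodule H K V" "u \<in> carrier V" "v \<in> carrier V"
 shows "H +>\<^bsub>V\<^esub> u = H +>\<^bsub>V\<^esub> v \<longleftrightarrow> u \<ominus>\<^bsub>V\<^esub> v \<in> H"
proof -
 interpret V: module K V by fact
 have sg: "subgroup H (add_monoid V)" using assms(2) by (simp add: submodule_def)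
 have sub: "H \<subseteq> carrier V" by (rule submodule_subset[OF assms(1,2)])
 show ?thesis
 proof
  assume "H +>\<^bsub>V\<^esub> u = H +>\<^bsub>V\<^esub> v"
  moreover have "u = \<zero>\<^bsub>V\<^esub> \<oplus>\<^bsub>V\<^esub> u" using assms(3) by simp
  then have "u \<in> H +>\<^bsub>V\<^esub> u"
   unfolding coset_iff using submodule_zero[OF assms(1,2)] by blast
  ultimately have "u \<in> H +>\<^bsub>V\<^esub> v" by simp
  then obtain h where "h \<in> H" "u = h \<oplus>\<^bsub>V\<^esub> v" unfolding coset_iff by blast
  then show "u \<ominus>\<^bsub>V\<^esub> v \<in> H"
   using sub assms(4) by (auto simp: V.minus_eq V.a_assoc V.r_neg subset_iff)
 next
  assume "u \<ominus>\<^bsub>V\<^esub> v \<in> H"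
  moreover have "u = (u \<ominus>\<^bsub>V\<^esub> v) \<oplus>\<^bsub>V\<^esub> v"
   using assms(3,4) by (simp add: V.minus_eq V.a_assoc V.l_neg)
  ultimately have "u \<in> H +>\<^bsub>V\<^esub> v" unfolding coset_iff by blast
  then show "H +>\<^bsub>V\<^esub> u = H +>\<^bsub>V\<^esub> v"
   using V.a_repr_independence[OF _ assms(4) sg] by simp
 qed
qed

text \<open>A linear map that carries one submodule into another acts on cosets by the formula which,
 for the multiplication by a scalar, is the definition of the scalar action on the quotient.\<close>

lemma coset_map_eq:
 assumes "module K V" "module K V'" "submodule H K V" "submodule H' K V'" "f \<in> mod_hom K V V'"
  and "f ` H \<subseteq> H'" "v \<in> carrier V"
 shows "(\<Union>x\<in>H +>\<^bsub>V\<^esub> v. H' +>\<^bsub>V'\<^esub> f x) = H' +>\<^bsub>V'\<^esub> f v"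
proof -
 interpret V: module K V by fact
 interpret V': module K V' by fact
 have sub: "H \<subseteq> carrier V" by (rule submodule_subset[OF assms(1,3)])
 have eq: "H' +>\<^bsub>V'\<^esub> f (h \<oplus>\<^bsub>V\<^esub> v) = H' +>\<^bsub>V'\<^esub> f v" if "h \<in> H" for h
 proof (subst coset_eq_iff[OF assms(2,4)])
  have hv: "h \<in> carrier V" "f h \<in> carrier V'" "f v \<in> carrier V'"
   using that sub assms(5,7) by (auto intro: lin_closed)
  then show "f (h \<oplus>\<^bsub>V\<^esub> v) \<in> carrier V'" "f v \<in> carrier V'"
   using assms(5,7) by (auto intro: lin_closed)
  have "f (h \<oplus>\<^bsub>V\<^esub> v) \<ominus>\<^bsub>V'\<^esub> f v = f h"
   using hv assms(7) by (simp add: lin_add[OF assms(5)] V'.minus_eq V'.a_assoc V'.r_neg)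
  then show "f (h \<oplus>\<^bsub>V\<^esub> v) \<ominus>\<^bsub>V'\<^esub> f v \<in> H'" using that assms(6) by auto
 qed
 show ?thesis
 proof (rule SUP_eq_const)
  have "\<zero>\<^bsub>V\<^esub> \<oplus>\<^bsub>V\<^esub> v \<in> H +>\<^bsub>V\<^esub> v"
   unfolding coset_iff using submodule_zero[OF assms(1,3)] by blast
  then show "H +>\<^bsub>V\<^esub> v \<noteq> {}" by blast
  show "H' +>\<^bsub>V'\<^esub> f x = H' +>\<^bsub>V'\<^esub> f v" if "x \<in> H +>\<^bsub>V\<^esub> v" for x
  proof -
   obtain h where "h \<in> H" "x = h \<oplus>\<^bsub>V\<^esub> v" using \<open>x \<in> H +>\<^bsub>V\<^esub> v\<close> unfolding coset_iff by blast
   then show ?thesis using eq by simp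
  qed
 qed
qed

lemma coset_add:
 assumes "module K V" "submodule H K V" "u \<in> carrier V" "v \<in> carrier V"
 shows "(H +>\<^bsub>V\<^esub> u) <+>\<^bsub>V\<^esub> (H +>\<^bsub>V\<^esub> v) = H +>\<^bsub>V\<^esub> (u \<oplus>\<^bsub>V\<^esub> v)"
proof -
 interpret V: module K V by fact
 interpret abelian_subgroup H V
  by (rule abelian_subgroupI3)
   (use assms(2) in \<open>auto simp: submodule_def additive_subgroup_def V.abelian_group_axioms\<close>)
 show ?thesis by (rule a_rcos_sum[OF assms(3,4)])
qed

lemma coset_smult:
 fixes V :: "('k, 'v) module"
 assumes "module K V" "submodule H K V" "a \<in> carrier K" "v \<in> carrier V"
 shows "(\<Union>x\<in>H +>\<^bsub>V\<^esub> v. H +>\<^bsub>V\<^esub> (a \<odot>\<^bsub>V\<^esub> x)) = H +>\<^bsub>V\<^esub> (a \<odot>\<^bsub>V\<^esub> v)"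
proof (rule coset_map_eq[OF assms(1,1,2,2) _ _ assms(4)])
 show "(\<lambda>v. a \<odot>\<^bsub>V\<^esub> v) \<in> mod_hom K V V"
  by (rule lin_smult_pointwise[where h = "\<lambda>v. v"]) (rule assms lin_id)+
 show "(\<lambda>v. a \<odot>\<^bsub>V\<^esub> v) ` H \<subseteq> H"
  using submodule_smult[OF assms(1,2,3)] by blast
qed

lemma quot_mod_proj:
 assumes "module K V" "submodule H K V"
 shows "(\<lambda>v. H +>\<^bsub>V\<^esub> v) \<in> mod_hom K V (quot_mod V H)"
 by (rule mod_homI) (auto simp: cosets_eq_image coset_add[OF assms] coset_smult[OF assms])

lemma quot_mod_module:
 assumes "module K V" "submodule H K V"
 shows "module K (quot_mod V H)"
proof (rule module_surj_image[OF assms(1), where q = "\<lambda>v. H +>\<^bsub>V\<^esub> v"])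
 interpret V: module K V by fact
 show "H +>\<^bsub>V\<^esub> \<zero>\<^bsub>V\<^esub> = \<zero>\<^bsub>quot_mod V H\<^esub>"
  using V.a_coset_add_zero[OF submodule_subset[OF assms]] by simp
qed (auto simp: cosets_eq_image coset_add[OF assms] coset_smult[OF assms])

lemma mod_isomorphic_sym:
 assumes "mod_isomorphic K V W"
  and add: "\<And>u v. u \<in> carrier V \<Longrightarrow> v \<in> carrier V \<Longrightarrow> u \<oplus>\<^bsub>V\<^esub> v \<in> carrier V"
  and smult: "\<And>a v. a \<in> carrier K \<Longrightarrow> v \<in> carrier V \<Longrightarrow> a \<odot>\<^bsub>V\<^esub> v \<in> carrier V"
 shows "mod_isomorphic K W V"
proof -
 obtain h where h: "h \<in> mod_hom K V W" and bij: "bij_betw h (carrier V) (carrier W)"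
  using assms(1) by (auto simp: mod_isomorphic_def)
 let ?g = "inv_into (carrier V) h"
 have bij': "bij_betw ?g (carrier W) (carrier V)" by (rule bij_betw_inv_into[OF bij])
 have g: "?g w \<in> carrier V" "h (?g w) = w" if "w \<in> carrier W" for w
  using bij_betw_apply[OF bij' that] bij_betw_inv_into_right[OF bij that] by auto
 have gI: "?g w = v" if "v \<in> carrier V" "h v = w" for v w
  using bij_betw_inv_into_left[OF bij that(1)] that(2) by simp
 have "?g \<in> mod_hom K W V"
 proof (rule mod_homI)
  show "?g w \<in> carrier V" if "w \<in> carrier W" for w by (rule g[OF that])
  show "?g (u \<oplus>\<^bsub>W\<^esub> v) = ?g u \<oplus>\<^bsub>V\<^esub> ?g v" if "u \<in> carrier W" "v \<in> carrier W" for u v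
   by (rule gI) (use g[OF that(1)] g[OF that(2)] in \<open>simp_all add: add lin_add[OF h]\<close>)
  show "?g (a \<odot>\<^bsub>W\<^esub> v) = a \<odot>\<^bsub>V\<^esub> ?g v" if "a \<in> carrier K" "v \<in> carrier W" for a v
   by (rule gI) (use that(1) g[OF that(2)] in \<open>simp_all add: smult lin_smult[OF h]\<close>)
 qed
 with bij' show ?thesis by (auto simp: mod_isomorphic_def)
qed

lemma quot_submodule_sel:
 shows "carrier (quot_mod (V\<lparr>carrier := Z\<rparr>) H) = (\<lambda>v. H +>\<^bsub>V\<^esub> v) ` Z"
  and "S \<oplus>\<^bsub>quot_mod (V\<lparr>carrier := Z\<rparr>) H\<^esub> T = S <+>\<^bsub>V\<^esub> T"
  and "a \<odot>\<^bsub>quot_mod (V\<lparr>carrier := Z\<rparr>) H\<^esub> S = (\<Union>v\<in>S. H +>\<^bsub>V\<^esub> (a \<odot>\<^bsub>V\<^esub> v))"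
 by (auto simp: cosets_eq_image set_add_def set_mult_def a_r_coset_def r_coset_def)

text \<open>
 The criterion by which a linear map \<open>f\<close> of chain spaces induces an isomorphism of homology.
 The cosets of the submodule \<open>H\<close> of boundaries are
 taken in the whole chain space \<open>V\<close>.
\<close>

lemma quot_mod_isoI:
 assumes "module K V" "module K V'" "submodule H K V" "submodule H' K V'"
  and "submodule Z K V" "submodule Z' K V'" "f \<in> mod_hom K V V'"
  and HH: "f ` H \<subseteq> H'" and ZZ: "f ` Z \<subseteq> Z'"
  and inj: "\<And>z. z \<in> Z \<Longrightarrow> f z \<in> H' \<Longrightarrow> z \<in> H"
  and surj: "\<And>z'. z' \<in> Z' \<Longrightarrow> \<exists>z\<in>Z. z' \<ominus>\<^bsub>V'\<^esub> f z \<in> H'"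
 shows "mod_isomorphic K (quot_mod (V\<lparr>carrier := Z\<rparr>) H) (quot_mod (V'\<lparr>carrier := Z'\<rparr>) H')"
  and "mod_isomorphic K (quot_mod (V'\<lparr>carrier := Z'\<rparr>) H') (quot_mod (V\<lparr>carrier := Z\<rparr>) H)"
proof -
 interpret V: module K V by fact
 interpret V': module K V' by fact
 define Q where "Q = quot_mod (V\<lparr>carrier := Z\<rparr>) H"
 define Q' where "Q' = quot_mod (V'\<lparr>carrier := Z'\<rparr>) H'"
 define F where "F = (\<lambda>S. \<Union>x\<in>S. H' +>\<^bsub>V'\<^esub> f x)"
 have Zs: "z \<in> carrier V" "f z \<in> Z'" if "z \<in> Z" for z
  using that submodule_subset[OF assms(1,5)] ZZ by auto
 have Zs': "z \<in> carrier V'" if "z \<in> Z'" for z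
  using that submodule_subset[OF assms(2,6)] by auto
 have F: "F (H +>\<^bsub>V\<^esub> z) = H' +>\<^bsub>V'\<^esub> f z" if "z \<in> Z" for z
  unfolding F_def by (rule coset_map_eq[OF assms(1-4,7) HH Zs(1)[OF that]])
 have C: "carrier Q = (\<lambda>v. H +>\<^bsub>V\<^esub> v) ` Z" and C': "carrier Q' = (\<lambda>v. H' +>\<^bsub>V'\<^esub> v) ` Z'"
  by (simp_all only: Q_def Q'_def quot_submodule_sel)
 have op: "(H +>\<^bsub>V\<^esub> x) \<oplus>\<^bsub>Q\<^esub> (H +>\<^bsub>V\<^esub> y) = H +>\<^bsub>V\<^esub> (x \<oplus>\<^bsub>V\<^esub> y)"
  "a \<in> carrier K \<Longrightarrow> a \<odot>\<^bsub>Q\<^esub> (H +>\<^bsub>V\<^esub> x) = H +>\<^bsub>V\<^esub> (a \<odot>\<^bsub>V\<^esub> x)"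
  if "x \<in> Z" "y \<in> Z" for a x y
  unfolding Q_def quot_submodule_sel
  by (rule coset_add[OF assms(1,3) Zs(1)[OF that(1)] Zs(1)[OF that(2)]])
   (rule coset_smult[OF assms(1,3) _ Zs(1)[OF that(1)]])
 have op': "(H' +>\<^bsub>V'\<^esub> x) \<oplus>\<^bsub>Q'\<^esub> (H' +>\<^bsub>V'\<^esub> y) = H' +>\<^bsub>V'\<^esub> (x \<oplus>\<^bsub>V'\<^esub> y)"
  "a \<in> carrier K \<Longrightarrow> a \<odot>\<^bsub>Q'\<^esub> (H' +>\<^bsub>V'\<^esub> x) = H' +>\<^bsub>V'\<^esub> (a \<odot>\<^bsub>V'\<^esub> x)"
  if "x \<in> Z'" "y \<in> Z'" for a x y
  unfolding Q'_def quot_submodule_sel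
  by (rule coset_add[OF assms(2,4) Zs'[OF that(1)] Zs'[OF that(2)]])
   (rule coset_smult[OF assms(2,4) _ Zs'[OF that(1)]])
 note Zadd = submodule_add[OF assms(1,5)] and Zsmult = submodule_smult[OF assms(1,5)]
 have add: "S \<oplus>\<^bsub>Q\<^esub> T \<in> carrier Q" "F (S \<oplus>\<^bsub>Q\<^esub> T) = F S \<oplus>\<^bsub>Q'\<^esub> F T"
  if ST: "S \<in> carrier Q" "T \<in> carrier Q" for S T
 proof -
  obtain x y where xy: "x \<in> Z" "S = H +>\<^bsub>V\<^esub> x" "y \<in> Z" "T = H +>\<^bsub>V\<^esub> y"
   using ST unfolding C by blast
  then show "S \<oplus>\<^bsub>Q\<^esub> T \<in> carrier Q" unfolding C by (auto simp: op Zadd)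
  show "F (S \<oplus>\<^bsub>Q\<^esub> T) = F S \<oplus>\<^bsub>Q'\<^esub> F T"
   using xy by (simp add: op op' F Zadd Zs lin_add[OF assms(7)])
 qed
 have smult: "a \<odot>\<^bsub>Q\<^esub> S \<in> carrier Q" "F (a \<odot>\<^bsub>Q\<^esub> S) = a \<odot>\<^bsub>Q'\<^esub> F S"
  if ST: "S \<in> carrier Q" "a \<in> carrier K" for S a
 proof -
  obtain x where xy: "x \<in> Z" "S = H +>\<^bsub>V\<^esub> x"
   using ST unfolding C by blast
  then show "a \<odot>\<^bsub>Q\<^esub> S \<in> carrier Q" unfolding C using ST(2) by (auto simp: op(2)[of x x] Zsmult)
  show "F (a \<odot>\<^bsub>Q\<^esub> S) = a \<odot>\<^bsub>Q'\<^esub> F S"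
   using xy ST(2) by (simp add: op(2)[of x x] op'(2)[of "f x" "f x"] F Zsmult Zs lin_smult[OF assms(7)])
 qed
 have cl: "F S \<in> carrier Q'" if "S \<in> carrier Q" for S
  using that unfolding C C' by (auto simp: F Zs)
 have "F \<in> mod_hom K Q Q'"
  by (rule mod_homI) (use add smult cl in auto)
 moreover have "inj_on F (carrier Q)"
 proof (rule inj_onI)
  fix S T assume ST: "S \<in> carrier Q" "T \<in> carrier Q" and eq: "F S = F T"
  from ST obtain x y where x: "x \<in> Z" "S = H +>\<^bsub>V\<^esub> x" "y \<in> Z" "T = H +>\<^bsub>V\<^esub> y"
   unfolding C by blast
  have "f x \<ominus>\<^bsub>V'\<^esub> f y \<in> H'"
   using eq x coset_eq_iff[OF assms(2,4), of "f x" "f y"] by (simp add: F Zs Zs')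
  then have "f (x \<ominus>\<^bsub>V\<^esub> y) \<in> H'" using x by (simp add: lin_minus[OF assms(1,2,7)] Zs)
  moreover have "x \<ominus>\<^bsub>V\<^esub> y \<in> Z"
   using x unfolding V.minus_eq by (intro Zadd submodule_neg[OF assms(1,5)])
  ultimately have "x \<ominus>\<^bsub>V\<^esub> y \<in> H" by (intro inj)
  then show "S = T" using coset_eq_iff[OF assms(1,3), of x y] x Zs by simp
 qed
 moreover have "carrier Q' \<subseteq> F ` carrier Q"
 proof
  fix S' assume "S' \<in> carrier Q'"
  then obtain z' where z': "z' \<in> Z'" "S' = H' +>\<^bsub>V'\<^esub> z'" unfolding C' by blast
  obtain z where z: "z \<in> Z" "z' \<ominus>\<^bsub>V'\<^esub> f z \<in> H'" using surj[OF z'(1)] by blast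
  have "S' = F (H +>\<^bsub>V\<^esub> z)"
   using z z' coset_eq_iff[OF assms(2,4), of z' "f z"] by (simp add: F Zs Zs')
  then show "S' \<in> F ` carrier Q" using z unfolding C by blast
 qed
 ultimately have "mod_isomorphic K Q Q'"
  using cl by (auto simp: mod_isomorphic_def bij_betw_def intro!: bexI[of _ F])
 then show "mod_isomorphic K (quot_mod (V\<lparr>carrier := Z\<rparr>) H) (quot_mod (V'\<lparr>carrier := Z'\<rparr>) H')"
  and "mod_isomorphic K (quot_mod (V'\<lparr>carrier := Z'\<rparr>) H') (quot_mod (V\<lparr>carrier := Z\<rparr>) H)"
  using mod_isomorphic_sym[of K Q Q'] add(1) smult(1) unfolding Q_def Q'_def by blast+
qed

section \<open>Products, sums and presentations\<close>

lemma dprod_mod_sel [simp]: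
 "carrier (dprod_mod I V) = (\<Pi>\<^sub>E i\<in>I. carrier (V i))"
 "f \<oplus>\<^bsub>dprod_mod I V\<^esub> g = (\<lambda>i\<in>I. f i \<oplus>\<^bsub>V i\<^esub> g i)"
 "\<zero>\<^bsub>dprod_mod I V\<^esub> = (\<lambda>i\<in>I. \<zero>\<^bsub>V i\<^esub>)"
 "a \<odot>\<^bsub>dprod_mod I V\<^esub> f = (\<lambda>i\<in>I. a \<odot>\<^bsub>V i\<^esub> f i)"
 by (simp_all add: dprod_mod_def)

lemma dprod_mod_module:
 assumes "cring K" "\<And>i. i \<in> I \<Longrightarrow> module K (V i)"
 shows "module K (dprod_mod I V)"
proof -
 have ag: "abelian_group (V i)" and sm: "module K (V i)" if "i \<in> I" for i
  using assms(2)[OF that] by (simp_all add: module_def)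
 note am = ag[unfolded abelian_group_def, THEN conjunct1]
 show ?thesis
 proof (rule moduleI)
  show "cring K" by fact
  show "abelian_group (dprod_mod I V)"
  proof (rule abelian_groupI)
   fix f assume f: "f \<in> carrier (dprod_mod I V)"
   show "\<exists>g\<in>carrier (dprod_mod I V). g \<oplus>\<^bsub>dprod_mod I V\<^esub> f = \<zero>\<^bsub>dprod_mod I V\<^esub>"
   proof (rule bexI)
    show "(\<lambda>i\<in>I. \<ominus>\<^bsub>V i\<^esub> f i) \<oplus>\<^bsub>dprod_mod I V\<^esub> f = \<zero>\<^bsub>dprod_mod I V\<^esub>"
     using f ag by (auto simp: fun_eq_iff PiE_iff abelian_group.l_neg)
   qed (use f ag in \<open>auto simp: PiE_iff abelian_group.a_inv_closed\<close>)
  next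
   fix f g h assume "f \<in> carrier (dprod_mod I V)" "g \<in> carrier (dprod_mod I V)" "h \<in> carrier (dprod_mod I V)"
   then show "f \<oplus>\<^bsub>dprod_mod I V\<^esub> g \<oplus>\<^bsub>dprod_mod I V\<^esub> h = f \<oplus>\<^bsub>dprod_mod I V\<^esub> (g \<oplus>\<^bsub>dprod_mod I V\<^esub> h)"
    using am by (auto simp: fun_eq_iff PiE_iff abelian_monoid.a_assoc)
  next
   fix f g assume "f \<in> carrier (dprod_mod I V)" "g \<in> carrier (dprod_mod I V)"
   then show "f \<oplus>\<^bsub>dprod_mod I V\<^esub> g = g \<oplus>\<^bsub>dprod_mod I V\<^esub> f"
    using am by (auto simp: fun_eq_iff PiE_iff abelian_monoid.a_comm)
  next
   fix f assume "f \<in> carrier (dprod_mod I V)"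
   then show "\<zero>\<^bsub>dprod_mod I V\<^esub> \<oplus>\<^bsub>dprod_mod I V\<^esub> f = f"
    using am by (auto simp: fun_eq_iff PiE_iff abelian_monoid.l_zero extensional_def)
  qed (use am in \<open>auto intro: abelian_monoid.a_closed abelian_monoid.zero_closed simp: PiE_iff\<close>)
 next
  fix f assume "f \<in> carrier (dprod_mod I V)"
  then show "\<one>\<^bsub>K\<^esub> \<odot>\<^bsub>dprod_mod I V\<^esub> f = f"
   using sm by (auto simp: fun_eq_iff PiE_iff module.smult_one extensional_def)
 next
  fix a b f assume "a \<in> carrier K" "b \<in> carrier K" "f \<in> carrier (dprod_mod I V)"
  then show "(a \<oplus>\<^bsub>K\<^esub> b) \<odot>\<^bsub>dprod_mod I V\<^esub> f = a \<odot>\<^bsub>dprod_mod I V\<^esub> f \<oplus>\<^bsub>dprod_mod I V\<^esub> b \<odot>\<^bsub>dprod_mod I V\<^esub> f"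
   and "a \<otimes>\<^bsub>K\<^esub> b \<odot>\<^bsub>dprod_mod I V\<^esub> f = a \<odot>\<^bsub>dprod_mod I V\<^esub> (b \<odot>\<^bsub>dprod_mod I V\<^esub> f)"
   using sm by (auto simp: fun_eq_iff PiE_iff module.smult_l_distr module.smult_assoc1)
 next
  fix a f g assume "a \<in> carrier K" "f \<in> carrier (dprod_mod I V)" "g \<in> carrier (dprod_mod I V)"
  then show "a \<odot>\<^bsub>dprod_mod I V\<^esub> (f \<oplus>\<^bsub>dprod_mod I V\<^esub> g) = a \<odot>\<^bsub>dprod_mod I V\<^esub> f \<oplus>\<^bsub>dprod_mod I V\<^esub> a \<odot>\<^bsub>dprod_mod I V\<^esub> g"
   using sm by (auto simp: fun_eq_iff PiE_iff module.smult_r_distr[of K])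
 qed (use sm in \<open>auto intro: module.smult_closed simp: PiE_iff\<close>)
qed

lemma self_mod_module:
 assumes "cring K" shows "module K (self_mod K)"
proof -
 interpret cring K by fact
 show ?thesis unfolding self_mod_def
  by (rule moduleI) (auto intro!: abelian_groupI assms simp: a_ac l_distr r_distr m_assoc
    intro: l_neg)
qed

lemma self_mod_sel [simp]:
 "carrier (self_mod K) = carrier K" "a \<oplus>\<^bsub>self_mod K\<^esub> b = a \<oplus>\<^bsub>K\<^esub> b"
 "\<zero>\<^bsub>self_mod K\<^esub> = \<zero>\<^bsub>K\<^esub>" "a \<odot>\<^bsub>self_mod K\<^esub> b = a \<otimes>\<^bsub>K\<^esub> b"
 by (simp_all add: self_mod_def)

lemma hom_mod_module:
 assumes "module K V" "module K W"
 shows "module K (hom_mod K V W)"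
proof -
 interpret V: module K V by fact
 interpret W: module K W by fact
 let ?P = "dprod_mod (carrier V) (\<lambda>_. W)" and ?H = "mod_hom K V W \<inter> extensional (carrier V)"
 interpret P: module K ?P by (rule dprod_mod_module) (use V.is_cring assms in auto)
 have *: "restrict h (carrier V) \<in> ?H" if "h \<in> mod_hom K V W" for h
  using lin_cong[OF assms(1) _ that, of "restrict h (carrier V)"] by auto
 have "submodule ?H K ?P"
 proof (rule P.submoduleI_linear)
  show "?H \<subseteq> carrier ?P" by (auto simp: lin_closed PiE_iff extensional_def)
  show "\<zero>\<^bsub>?P\<^esub> \<in> ?H" using *[OF lin_const_zero[OF assms(2)]] by simp
  show "f \<oplus>\<^bsub>?P\<^esub> g \<in> ?H" if "f \<in> ?H" "g \<in> ?H" for f g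
   using *[OF lin_add_pointwise[OF assms(2), of f V g]] that by simp
  show "a \<odot>\<^bsub>?P\<^esub> f \<in> ?H" if "a \<in> carrier K" "f \<in> ?H" for f a
   using *[OF lin_smult_pointwise[OF assms(2), of a f V]] that by simp
 qed
 then have "module K (?P\<lparr>carrier := ?H\<rparr>)" by (rule submodule.submodule_is_module) (rule P.module_axioms)
 moreover have "?P\<lparr>carrier := ?H\<rparr> = hom_mod K V W"
  by (simp add: dprod_mod_def hom_mod_def mk_mod_def)
 ultimately show ?thesis by simp
qed

lemma hom_mod_sel [simp]:
 "carrier (hom_mod K V W) = mod_hom K V W \<inter> extensional (carrier V)"
 "f \<oplus>\<^bsub>hom_mod K V W\<^esub> g = (\<lambda>v\<in>carrier V. f v \<oplus>\<^bsub>W\<^esub> g v)"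
 "\<zero>\<^bsub>hom_mod K V W\<^esub> = (\<lambda>v\<in>carrier V. \<zero>\<^bsub>W\<^esub>)"
 "a \<odot>\<^bsub>hom_mod K V W\<^esub> f = (\<lambda>v\<in>carrier V. a \<odot>\<^bsub>W\<^esub> f v)"
 by (simp_all add: hom_mod_def)

lemma dsum_mod_sel [simp]:
 "carrier (dsum_mod I V) = {f \<in> \<Pi>\<^sub>E i\<in>I. carrier (V i). finite (dsum_supp I V f)}"
 "f \<oplus>\<^bsub>dsum_mod I V\<^esub> g = (\<lambda>i\<in>I. f i \<oplus>\<^bsub>V i\<^esub> g i)"
 "\<zero>\<^bsub>dsum_mod I V\<^esub> = (\<lambda>i\<in>I. \<zero>\<^bsub>V i\<^esub>)"
 "a \<odot>\<^bsub>dsum_mod I V\<^esub> f = (\<lambda>i\<in>I. a \<odot>\<^bsub>V i\<^esub> f i)"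
 by (simp_all add: dsum_mod_def dprod_mod_def mk_mod_def)

locale module_family =
 fixes K :: "('k, 'r) ring_scheme" and I :: "'i set" and V :: "'i \<Rightarrow> ('k, 'v) module"
 assumes cring: "cring K" and summand_module: "\<And>i. i \<in> I \<Longrightarrow> module K (V i)"
begin

lemma summand_zero [simp]: "i \<in> I \<Longrightarrow> \<zero>\<^bsub>V i\<^esub> \<in> carrier (V i)"
 using summand_module[of i] by (simp add: module_def abelian_group_def abelian_monoid.zero_closed)

lemma summand_zero_add [simp]: "i \<in> I \<Longrightarrow> \<zero>\<^bsub>V i\<^esub> \<oplus>\<^bsub>V i\<^esub> \<zero>\<^bsub>V i\<^esub> = \<zero>\<^bsub>V i\<^esub>"
 using summand_module[of i] by (simp add: module_def abelian_group_def abelian_monoid.l_zero)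

lemma summand_smult_zero [simp]: "i \<in> I \<Longrightarrow> a \<in> carrier K \<Longrightarrow> a \<odot>\<^bsub>V i\<^esub> \<zero>\<^bsub>V i\<^esub> = \<zero>\<^bsub>V i\<^esub>"
 using summand_module[of i] by (simp add: module.smult_r_null)

lemma dsum_supp_add:
 "dsum_supp I V (\<lambda>i\<in>I. f i \<oplus>\<^bsub>V i\<^esub> g i) \<subseteq> dsum_supp I V f \<union> dsum_supp I V g"
 by (auto simp: dsum_supp_def)

lemma dsum_supp_smult:
 "a \<in> carrier K \<Longrightarrow> dsum_supp I V (\<lambda>i\<in>I. a \<odot>\<^bsub>V i\<^esub> f i) \<subseteq> dsum_supp I V f"
 by (auto simp: dsum_supp_def)

lemma dsum_mod_module: "module K (dsum_mod I V)"
proof -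
 interpret P: module K "dprod_mod I V" by (rule dprod_mod_module[OF cring summand_module])
 let ?H = "{f \<in> \<Pi>\<^sub>E i\<in>I. carrier (V i). finite (dsum_supp I V f)}"
 have "submodule ?H K (dprod_mod I V)"
 proof (rule P.submoduleI_linear)
  show "\<zero>\<^bsub>dprod_mod I V\<^esub> \<in> ?H" by (auto simp: dsum_supp_def)
  show "f \<oplus>\<^bsub>dprod_mod I V\<^esub> g \<in> ?H" if "f \<in> ?H" "g \<in> ?H" for f g
   using that P.a_closed[of f g] finite_subset[OF dsum_supp_add[of f g]] by auto
  show "a \<odot>\<^bsub>dprod_mod I V\<^esub> f \<in> ?H" if "a \<in> carrier K" "f \<in> ?H" for a f
   using that P.smult_closed[of a f] finite_subset[OF dsum_supp_smult[of a f]] by auto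
 qed auto
 then have "module K ((dprod_mod I V)\<lparr>carrier := ?H\<rparr>)"
  by (rule submodule.submodule_is_module) (rule P.module_axioms)
 then show ?thesis by (simp add: dsum_mod_def)
qed

lemma dsum_eval_hom: "i \<in> I \<Longrightarrow> (\<lambda>f. f i) \<in> mod_hom K (dsum_mod I V) (V i)"
 by (rule mod_homI) auto

lemma dsum_inj_hom: "j \<in> I \<Longrightarrow> dsum_inj I V j \<in> mod_hom K (V j) (dsum_mod I V)"
proof (rule mod_homI)
 assume j: "j \<in> I"
 fix v assume v: "v \<in> carrier (V j)"
 have "dsum_supp I V (dsum_inj I V j v) \<subseteq> {j}" by (auto simp: dsum_supp_def dsum_inj_def)
 then show "dsum_inj I V j v \<in> carrier (dsum_mod I V)"
  using v j by (auto simp: dsum_inj_def finite_subset)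
qed (auto simp: dsum_inj_def fun_eq_iff)

lemma dsum_expansion:
 assumes "f \<in> carrier (dsum_mod I V)"
 shows "f = (\<Oplus>\<^bsub>dsum_mod I V\<^esub> j \<in> dsum_supp I V f. dsum_inj I V j (f j))"
proof -
 interpret D: module K "dsum_mod I V" by (rule dsum_mod_module)
 let ?S = "dsum_supp I V f"
 have S: "finite ?S" "\<And>j. j \<in> ?S \<Longrightarrow> j \<in> I" using assms by (auto simp: dsum_supp_def)
 have inj: "(\<lambda>j. dsum_inj I V j (f j)) \<in> ?S \<rightarrow> carrier (dsum_mod I V)"
  using lin_closed[OF dsum_inj_hom] S assms by (auto simp del: dsum_mod_sel) (auto simp: PiE_iff)
 let ?g = "\<Oplus>\<^bsub>dsum_mod I V\<^esub> j \<in> ?S. dsum_inj I V j (f j)"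
 have "?g i = f i" if i: "i \<in> I" for i
 proof -
  interpret Vi: module K "V i" by (rule summand_module[OF i])
  have "?g i = (\<Oplus>\<^bsub>V i\<^esub> j \<in> ?S. dsum_inj I V j (f j) i)"
   by (rule lin_finsum[OF D.module_axioms Vi.module_axioms dsum_eval_hom[OF i] inj])
  also have "\<dots> = (\<Oplus>\<^bsub>V i\<^esub> j \<in> ?S. if i = j then f j else \<zero>\<^bsub>V i\<^esub>)"
   using i assms by (intro Vi.finsum_cong') (auto simp: dsum_inj_def)
  also have "\<dots> = f i"
  proof (cases "i \<in> ?S")
   case True
   have "(\<Oplus>\<^bsub>V i\<^esub> j \<in> ?S. if i = j then f j else \<zero>\<^bsub>V i\<^esub>) = (\<Oplus>\<^bsub>V i\<^esub> j \<in> ?S. if i = j then f i else \<zero>\<^bsub>V i\<^esub>)"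
    by (rule arg_cong[of _ _ "\<lambda>g. finsum (V i) g ?S"]) auto
   then show ?thesis using Vi.finsum_singleton[OF True S(1), of "\<lambda>_. f i"] assms i by (simp add: PiE_iff)
  next
   case False
   then have "(\<Oplus>\<^bsub>V i\<^esub> j \<in> ?S. if i = j then f j else \<zero>\<^bsub>V i\<^esub>) = (\<Oplus>\<^bsub>V i\<^esub> j \<in> ?S. \<zero>\<^bsub>V i\<^esub>)"
    by (intro Vi.finsum_cong') auto
   then show ?thesis using False i by (auto simp: dsum_supp_def)
  qed
  finally show ?thesis .
 qed
 moreover have "?g \<in> carrier (dsum_mod I V)" by (rule D.finsum_closed[OF inj])
 ultimately show ?thesis using assms by (auto intro!: PiE_ext[of f I "\<lambda>i. carrier (V i)" ?g])
qed

lemma dsum_mod_span: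
 "mod_span K (dsum_mod I V) (\<Union>j\<in>I. dsum_inj I V j ` carrier (V j)) = carrier (dsum_mod I V)"
 (is "mod_span K ?D ?S = _")
proof
 interpret D: module K ?D by (rule dsum_mod_module)
 have S: "?S \<subseteq> carrier ?D" using lin_closed[OF dsum_inj_hom] by blast
 have sub: "submodule (mod_span K ?D ?S) K ?D" by (rule mod_span_submodule[OF D.module_axioms S])
 then show "mod_span K ?D ?S \<subseteq> carrier ?D" by (rule submodule_subset[OF D.module_axioms])
 show "carrier ?D \<subseteq> mod_span K ?D ?S"
 proof
  fix f assume f: "f \<in> carrier ?D"
  have "(\<Oplus>\<^bsub>?D\<^esub> j \<in> dsum_supp I V f. dsum_inj I V j (f j)) \<in> mod_span K ?D ?S"
   using f by (intro submodule_finsum[OF D.module_axioms sub] subsetD[OF mod_span_superset])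
    (auto simp: dsum_supp_def PiE_iff)
  then show "f \<in> mod_span K ?D ?S" using dsum_expansion[OF f] by simp
 qed
qed

context
 fixes N :: "('k, 'w) module" and h :: "'i \<Rightarrow> 'v \<Rightarrow> 'w"
 assumes N: "module K N" and h: "\<And>i. i \<in> I \<Longrightarrow> h i \<in> mod_hom K (V i) N"
begin

lemma dsum_lift_eq:
 assumes "f \<in> carrier (dsum_mod I V)" "finite S" "dsum_supp I V f \<subseteq> S" "S \<subseteq> I"
 shows "dsum_lift I V N h f = (\<Oplus>\<^bsub>N\<^esub> i \<in> S. h i (f i))"
proof -
 interpret N: module K N by (rule N)
 show ?thesis unfolding dsum_lift_def
 proof (rule N.add.finprod_mono_neutral_cong_left[OF assms(2,3)])
  show "h i (f i) = \<zero>\<^bsub>N\<^esub>" if "i \<in> S - dsum_supp I V f" for i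
   using that assms(4) lin_zero[OF summand_module N h, of i] by (auto simp: dsum_supp_def)
  show "(\<lambda>i. h i (f i)) \<in> S \<rightarrow> carrier N"
   using assms(1,4) lin_closed[OF h] by (auto simp: PiE_iff subset_iff)
 qed auto
qed

lemma dsum_lift_hom: "dsum_lift I V N h \<in> mod_hom K (dsum_mod I V) N"
proof (rule mod_homI)
 interpret N: module K N by (rule N)
 interpret D: module K "dsum_mod I V" by (rule dsum_mod_module)
 have SI: "dsum_supp I V f \<subseteq> I" for f by (auto simp: dsum_supp_def)
 have cl: "h i (f i) \<in> carrier N" if "f \<in> carrier (dsum_mod I V)" "i \<in> I" for f i
  using that lin_closed[OF h] by (auto simp: PiE_iff)
 show "dsum_lift I V N h f \<in> carrier N" if "f \<in> carrier (dsum_mod I V)" for f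
  unfolding dsum_lift_def using cl[OF that] SI by (intro N.finsum_closed) auto
 show "dsum_lift I V N h (f \<oplus>\<^bsub>dsum_mod I V\<^esub> g) = dsum_lift I V N h f \<oplus>\<^bsub>N\<^esub> dsum_lift I V N h g"
  if fg: "f \<in> carrier (dsum_mod I V)" "g \<in> carrier (dsum_mod I V)" for f g
 proof -
  define S where "S = dsum_supp I V f \<union> dsum_supp I V g"
  have S: "finite S" "S \<subseteq> I" using fg SI by (auto simp: S_def)
  have "dsum_lift I V N h (f \<oplus>\<^bsub>dsum_mod I V\<^esub> g) = (\<Oplus>\<^bsub>N\<^esub> i \<in> S. h i ((f \<oplus>\<^bsub>dsum_mod I V\<^esub> g) i))"
   using D.a_closed[OF fg] dsum_supp_add[of f g]
   by (intro dsum_lift_eq S) (auto simp: S_def)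
  also have "\<dots> = (\<Oplus>\<^bsub>N\<^esub> i \<in> S. h i (f i) \<oplus>\<^bsub>N\<^esub> h i (g i))"
   using S fg cl[OF fg(1)] cl[OF fg(2)] lin_add[OF h]
   by (intro N.finsum_cong') (auto simp: PiE_iff subset_iff)
  also have "\<dots> = (\<Oplus>\<^bsub>N\<^esub> i \<in> S. h i (f i)) \<oplus>\<^bsub>N\<^esub> (\<Oplus>\<^bsub>N\<^esub> i \<in> S. h i (g i))"
   using S cl[OF fg(1)] cl[OF fg(2)] by (intro N.finsum_addf) auto
  also have "\<dots> = dsum_lift I V N h f \<oplus>\<^bsub>N\<^esub> dsum_lift I V N h g"
   using dsum_lift_eq[OF fg(1) S(1) _ S(2)] dsum_lift_eq[OF fg(2) S(1) _ S(2)] by (simp add: S_def)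
  finally show ?thesis .
 qed
 show "dsum_lift I V N h (a \<odot>\<^bsub>dsum_mod I V\<^esub> f) = a \<odot>\<^bsub>N\<^esub> dsum_lift I V N h f"
  if a: "a \<in> carrier K" "f \<in> carrier (dsum_mod I V)" for a f
 proof -
  have S: "finite (dsum_supp I V f)" using a by auto
  have "dsum_lift I V N h (a \<odot>\<^bsub>dsum_mod I V\<^esub> f) = (\<Oplus>\<^bsub>N\<^esub> i \<in> dsum_supp I V f. h i ((a \<odot>\<^bsub>dsum_mod I V\<^esub> f) i))"
   using D.smult_closed[OF a] dsum_supp_smult[OF a(1), of f] SI
   by (intro dsum_lift_eq S) auto
  also have "\<dots> = (\<Oplus>\<^bsub>N\<^esub> i \<in> dsum_supp I V f. a \<odot>\<^bsub>N\<^esub> h i (f i))"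
   using SI a cl[OF a(2)] lin_smult[OF h]
   by (intro N.finsum_cong') (auto simp: PiE_iff subset_iff)
  also have "\<dots> = a \<odot>\<^bsub>N\<^esub> dsum_lift I V N h f"
   unfolding dsum_lift_def using SI cl[OF a(2)] by (subst N.finsum_smult_ldistr[OF S a(1)]) auto
  finally show ?thesis .
 qed
qed

lemma dsum_lift_inj:
 assumes "j \<in> I" "v \<in> carrier (V j)"
 shows "dsum_lift I V N h (dsum_inj I V j v) = h j v"
proof -
 interpret N: module K N by (rule N)
 have "dsum_lift I V N h (dsum_inj I V j v) = (\<Oplus>\<^bsub>N\<^esub> i \<in> {j}. h i (dsum_inj I V j v i))"
  using assms lin_closed[OF dsum_inj_hom[OF assms(1)] assms(2)]
  by (intro dsum_lift_eq) (auto simp: dsum_supp_def dsum_inj_def)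
 also have "\<dots> = h j v"
  using assms lin_closed[OF h[OF assms(1)] assms(2)] by (simp add: dsum_inj_def)
 finally show ?thesis .
qed

end

end

text \<open>The universal property of a module given by generators and relations.\<close>

locale presentation =
 fixes K :: "('k, 'r) ring_scheme" and G :: "'g set" and R :: "('g \<Rightarrow> 'k) set"
 assumes cring_K: "cring K" and rels: "R \<subseteq> carrier (free_mod K G)"
begin

sublocale free: module_family K G "\<lambda>_. self_mod K"
 by (rule module_family.intro) (auto intro: self_mod_module cring_K)

lemma free_module: "module K (free_mod K G)"
 unfolding free_mod_def by (rule free.dsum_mod_module)

lemma rels_submodule: "submodule (mod_span K (free_mod K G) R) K (free_mod K G)"
 by (rule mod_span_submodule[OF free_module rels])

lemma pres_module: "module K (pres_mod K G R)"
 unfolding pres_mod_def by (rule quot_mod_module[OF free_module rels_submodule])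

lemma free_gen_closed: "t \<in> G \<Longrightarrow> free_gen K G t \<in> carrier (free_mod K G)"
 unfolding free_gen_def free_mod_def
 using lin_closed[OF free.dsum_inj_hom, of t "\<one>\<^bsub>K\<^esub>"] cring.cring_simprules(6)[OF cring_K] by simp

lemma pres_gen_closed: "t \<in> G \<Longrightarrow> pres_gen K G R t \<in> carrier (pres_mod K G R)"
 unfolding pres_gen_def pres_mod_def
 using lin_closed[OF quot_mod_proj[OF free_module rels_submodule] free_gen_closed] by simp

lemma free_span: "mod_span K (free_mod K G) (free_gen K G ` G) = carrier (free_mod K G)"
proof (rule mod_span_full[OF free_module])
 interpret cring K by (rule cring_K)
 show sub: "free_gen K G ` G \<subseteq> carrier (free_mod K G)" by (auto intro: free_gen_closed)
 note H = mod_span_submodule[OF free_module sub]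
 let ?S = "\<Union>t\<in>G. dsum_inj G (\<lambda>_. self_mod K) t ` carrier (self_mod K)"
 have "?S \<subseteq> mod_span K (free_mod K G) (free_gen K G ` G)"
 proof (intro UN_least image_subsetI)
  fix t a assume t: "t \<in> G" "a \<in> carrier (self_mod K)"
  have "dsum_inj G (\<lambda>_. self_mod K) t a = a \<odot>\<^bsub>free_mod K G\<^esub> free_gen K G t"
   using t lin_smult[OF free.dsum_inj_hom[of t], of a "\<one>\<^bsub>K\<^esub>"]
   by (simp add: free_mod_def free_gen_def)
  moreover have "free_gen K G t \<in> mod_span K (free_mod K G) (free_gen K G ` G)"
   by (rule subsetD[OF mod_span_superset imageI[OF t(1)]])
  ultimately show "dsum_inj G (\<lambda>_. self_mod K) t a \<in> mod_span K (free_mod K G) (free_gen K G ` G)"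
   using t(2) submodule_smult[OF free_module H] by simp
 qed
 from mod_span_minimal[OF H this] show "carrier (free_mod K G) \<subseteq> mod_span K (free_mod K G) (free_gen K G ` G)"
  using free.dsum_mod_span by (simp add: free_mod_def)
qed

lemma pres_proj: "(\<lambda>f. mod_span K (free_mod K G) R +>\<^bsub>free_mod K G\<^esub> f) \<in> mod_hom K (free_mod K G) (pres_mod K G R)"
 unfolding pres_mod_def by (rule quot_mod_proj[OF free_module rels_submodule])

lemma pres_span: "mod_span K (pres_mod K G R) (pres_gen K G R ` G) = carrier (pres_mod K G R)"
proof -
 let ?q = "\<lambda>f. mod_span K (free_mod K G) R +>\<^bsub>free_mod K G\<^esub> f"
 have "mod_span K (pres_mod K G R) (?q ` free_gen K G ` G) = carrier (pres_mod K G R)"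
 proof (rule mod_span_surj_image[OF free_module pres_module pres_proj _ _ free_span])
  show "?q ` carrier (free_mod K G) = carrier (pres_mod K G R)" by (simp add: pres_mod_def cosets_eq_image)
  show "free_gen K G ` G \<subseteq> carrier (free_mod K G)" by (rule image_subsetI[OF free_gen_closed])
 qed
 then show ?thesis by (simp add: image_image pres_gen_def)
qed

lemma pres_hom_ext:
 assumes "module K N" "g \<in> mod_hom K (pres_mod K G R) N" "h \<in> mod_hom K (pres_mod K G R) N"
  and "\<And>t. t \<in> G \<Longrightarrow> g (pres_gen K G R t) = h (pres_gen K G R t)" and "v \<in> carrier (pres_mod K G R)"
 shows "g v = h v"
proof (rule lin_eq_on_span[OF pres_module assms(1-3)])
 show "pres_gen K G R ` G \<subseteq> carrier (pres_mod K G R)" by (rule image_subsetI[OF pres_gen_closed])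
 show "v \<in> mod_span K (pres_mod K G R) (pres_gen K G R ` G)" unfolding pres_span by (rule assms(5))
 show "g x = h x" if "x \<in> pres_gen K G R ` G" for x using that by (auto simp: assms(4))
qed

context
 fixes N :: "('k, 'w) module" and g :: "'g \<Rightarrow> 'w"
 assumes N: "module K N" and g: "\<And>t. t \<in> G \<Longrightarrow> g t \<in> carrier N"
begin

abbreviation free_lift :: "('g \<Rightarrow> 'k) \<Rightarrow> 'w" where
 "free_lift \<equiv> dsum_lift G (\<lambda>_. self_mod K) N (\<lambda>t a. a \<odot>\<^bsub>N\<^esub> g t)"

lemma free_lift_summand: "t \<in> G \<Longrightarrow> (\<lambda>a. a \<odot>\<^bsub>N\<^esub> g t) \<in> mod_hom K (self_mod K) N"
proof -
 interpret N: module K N by (rule N)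
 show "t \<in> G \<Longrightarrow> (\<lambda>a. a \<odot>\<^bsub>N\<^esub> g t) \<in> mod_hom K (self_mod K) N"
  by (rule mod_homI) (auto simp: g N.smult_l_distr N.smult_assoc1)
qed

lemma free_lift_hom: "free_lift \<in> mod_hom K (free_mod K G) N"
 unfolding free_mod_def by (rule free.dsum_lift_hom[OF N free_lift_summand])

lemma free_lift_gen: "t \<in> G \<Longrightarrow> free_lift (free_gen K G t) = g t"
proof -
 interpret N: module K N by (rule N)
 show "t \<in> G \<Longrightarrow> free_lift (free_gen K G t) = g t"
  unfolding free_gen_def by (subst free.dsum_lift_inj[OF N free_lift_summand]) (auto simp: g)
qed

context
 assumes rels_kernel: "\<And>r. r \<in> R \<Longrightarrow> free_lift r = \<zero>\<^bsub>N\<^esub>"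
begin

lemma pres_lift_coset:
 assumes "f \<in> carrier (free_mod K G)"
 shows "pres_lift K G N g (mod_span K (free_mod K G) R +>\<^bsub>free_mod K G\<^esub> f) = free_lift f"
proof -
 interpret F: module K "free_mod K G" by (rule free_module)
 interpret N: module K N by (rule N)
 let ?H = "mod_span K (free_mod K G) R" and ?A = "mod_span K (free_mod K G) R +>\<^bsub>free_mod K G\<^esub> f"
 have "\<zero>\<^bsub>free_mod K G\<^esub> \<oplus>\<^bsub>free_mod K G\<^esub> f \<in> ?A"
  unfolding coset_iff using submodule_zero[OF free_module rels_submodule] by blast
 then have "(SOME r. r \<in> ?A) \<in> ?A" by (rule someI[of "\<lambda>r. r \<in> ?A"])
 then obtain s where s: "s \<in> ?H" "(SOME r. r \<in> ?A) = s \<oplus>\<^bsub>free_mod K G\<^esub> f" unfolding coset_iff by blast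
 have "free_lift s = \<zero>\<^bsub>N\<^esub>"
  by (rule lin_eq_on_span[OF free_module N free_lift_hom lin_const_zero[OF N] rels rels_kernel s(1)])
 moreover have "s \<in> carrier (free_mod K G)"
  using s(1) submodule_subset[OF free_module rels_submodule] by blast
 ultimately show ?thesis
  unfolding pres_lift_def s(2)
  using assms lin_closed[OF free_lift_hom assms] by (simp add: lin_add[OF free_lift_hom])
qed

lemma pres_lift_hom: "pres_lift K G N g \<in> mod_hom K (pres_mod K G R) N"
proof (rule mod_homI)
 let ?q = "\<lambda>f. mod_span K (free_mod K G) R +>\<^bsub>free_mod K G\<^esub> f"
 note q = pres_proj
 interpret F: module K "free_mod K G" by (rule free_module)
 have ex: "\<exists>f\<in>carrier (free_mod K G). v = ?q f" if "v \<in> carrier (pres_mod K G R)" for v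
  using that by (auto simp: pres_mod_def cosets_eq_image)
 fix v assume v: "v \<in> carrier (pres_mod K G R)"
 then obtain f where f: "f \<in> carrier (free_mod K G)" "v = ?q f" using ex by blast
 show "pres_lift K G N g v \<in> carrier N"
  using f pres_lift_coset[OF f(1)] lin_closed[OF free_lift_hom f(1)] by simp
 fix a assume a: "a \<in> carrier K"
 show "pres_lift K G N g (a \<odot>\<^bsub>pres_mod K G R\<^esub> v) = a \<odot>\<^bsub>N\<^esub> pres_lift K G N g v"
  using f a by (simp add: pres_lift_coset lin_smult[OF free_lift_hom] flip: lin_smult[OF q])
next
 let ?q = "\<lambda>f. mod_span K (free_mod K G) R +>\<^bsub>free_mod K G\<^esub> f"
 note q = pres_proj
 interpret F: module K "free_mod K G" by (rule free_module)
 have ex: "\<exists>f\<in>carrier (free_mod K G). v = ?q f" if "v \<in> carrier (pres_mod K G R)" for v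
  using that by (auto simp: pres_mod_def cosets_eq_image)
 fix u v assume "u \<in> carrier (pres_mod K G R)" "v \<in> carrier (pres_mod K G R)"
 then obtain f f' where f: "f \<in> carrier (free_mod K G)" "u = ?q f" "f' \<in> carrier (free_mod K G)" "v = ?q f'"
  using ex by metis
 show "pres_lift K G N g (u \<oplus>\<^bsub>pres_mod K G R\<^esub> v) = pres_lift K G N g u \<oplus>\<^bsub>N\<^esub> pres_lift K G N g v"
  using f by (simp add: pres_lift_coset lin_add[OF free_lift_hom] flip: lin_add[OF q])
qed

lemma pres_lift_gen: "t \<in> G \<Longrightarrow> pres_lift K G N g (pres_gen K G R t) = g t"
 unfolding pres_gen_def by (simp add: pres_lift_coset free_gen_closed free_lift_gen)

end

text \<open>The relations attached to a slot hold in \<open>N\<close> exactly when \<open>g\<close> is linear in that slot.\<close>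

lemma free_lift_slot_rels:
 assumes V: "module K V" and s: "\<And>v. v \<in> carrier V \<Longrightarrow> s v \<in> G" and lin: "(\<lambda>v. g (s v)) \<in> mod_hom K V N"
  and r: "r \<in> slot_rels K G V s"
 shows "free_lift r = \<zero>\<^bsub>N\<^esub>"
proof -
 interpret F: module K "free_mod K G" by (rule free_module)
 interpret N: module K N by (rule N)
 interpret V: module K V by (rule V)
 note simps = lin_minus[OF free_module N free_lift_hom] lin_add[OF free_lift_hom]
  lin_smult[OF free_lift_hom] free_gen_closed free_lift_gen s
  lin_add[OF lin] lin_smult[OF lin] lin_closed[OF lin]
 consider u v where "u \<in> carrier V" "v \<in> carrier V"
   "r = free_gen K G (s (u \<oplus>\<^bsub>V\<^esub> v)) \<ominus>\<^bsub>free_mod K G\<^esub> (free_gen K G (s u) \<oplus>\<^bsub>free_mod K G\<^esub> free_gen K G (s v))"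
  | a v where "a \<in> carrier K" "v \<in> carrier V"
   "r = free_gen K G (s (a \<odot>\<^bsub>V\<^esub> v)) \<ominus>\<^bsub>free_mod K G\<^esub> a \<odot>\<^bsub>free_mod K G\<^esub> free_gen K G (s v)"
  using r by (auto simp: slot_rels_def)
 then show ?thesis
  by cases (simp_all add: simps, simp_all add: N.minus_eq N.r_neg lin_closed[OF lin])
qed

end

lemma pres_gen_slot_linear:
 assumes V: "module K V" and s: "\<And>v. v \<in> carrier V \<Longrightarrow> s v \<in> G" and sub: "slot_rels K G V s \<subseteq> R"
 shows "(\<lambda>v. pres_gen K G R (s v)) \<in> mod_hom K V (pres_mod K G R)"
proof (rule mod_homI)
 interpret F: module K "free_mod K G" by (rule free_module)
 interpret V: module K V by (rule V)
 let ?H = "mod_span K (free_mod K G) R"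
 have q: "(\<lambda>f. ?H +>\<^bsub>free_mod K G\<^esub> f) \<in> mod_hom K (free_mod K G) (pres_mod K G R)"
  unfolding pres_mod_def by (rule quot_mod_proj[OF free_module rels_submodule])
 have RH: "R \<subseteq> ?H" by (rule mod_span_superset)
 show "pres_gen K G R (s v) \<in> carrier (pres_mod K G R)" if "v \<in> carrier V" for v
  by (rule pres_gen_closed[OF s[OF that]])
 show "pres_gen K G R (s (u \<oplus>\<^bsub>V\<^esub> v)) = pres_gen K G R (s u) \<oplus>\<^bsub>pres_mod K G R\<^esub> pres_gen K G R (s v)"
  if uv: "u \<in> carrier V" "v \<in> carrier V" for u v
 proof -
  have "free_gen K G (s (u \<oplus>\<^bsub>V\<^esub> v)) \<ominus>\<^bsub>free_mod K G\<^esub> (free_gen K G (s u) \<oplus>\<^bsub>free_mod K G\<^esub> free_gen K G (s v)) \<in> slot_rels K G V s"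
   unfolding slot_rels_def using uv by blast
  then have "?H +>\<^bsub>free_mod K G\<^esub> free_gen K G (s (u \<oplus>\<^bsub>V\<^esub> v))
    = ?H +>\<^bsub>free_mod K G\<^esub> (free_gen K G (s u) \<oplus>\<^bsub>free_mod K G\<^esub> free_gen K G (s v))"
   using uv s sub RH by (subst coset_eq_iff[OF free_module rels_submodule]) (auto simp: free_gen_closed)
  then show ?thesis unfolding pres_gen_def using uv s by (simp add: lin_add[OF q] free_gen_closed)
 qed
 show "pres_gen K G R (s (a \<odot>\<^bsub>V\<^esub> v)) = a \<odot>\<^bsub>pres_mod K G R\<^esub> pres_gen K G R (s v)"
  if uv: "a \<in> carrier K" "v \<in> carrier V" for a v
 proof -
  have "free_gen K G (s (a \<odot>\<^bsub>V\<^esub> v)) \<ominus>\<^bsub>free_mod K G\<^esub> a \<odot>\<^bsub>free_mod K G\<^esub> free_gen K G (s v) \<in> slot_rels K G V s"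
   unfolding slot_rels_def using uv by blast
  then have "?H +>\<^bsub>free_mod K G\<^esub> free_gen K G (s (a \<odot>\<^bsub>V\<^esub> v))
    = ?H +>\<^bsub>free_mod K G\<^esub> (a \<odot>\<^bsub>free_mod K G\<^esub> free_gen K G (s v))"
   using uv s sub RH by (subst coset_eq_iff[OF free_module rels_submodule]) (auto simp: free_gen_closed)
  then show ?thesis unfolding pres_gen_def using uv s by (simp add: lin_smult[OF q] free_gen_closed)
 qed
qed

end

section \<open>Multilinear maps on tuples\<close>

definition multilinear ::
 "('k, 'r) ring_scheme \<Rightarrow> ('k, 'v) module list \<Rightarrow> ('k, 'w) module \<Rightarrow> ('v list \<Rightarrow> 'w) \<Rightarrow> bool" where
 "multilinear K Ws N g \<longleftrightarrow> (\<forall>ws\<in>ltuples Ws. g ws \<in> carrier N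
   \<and> (\<forall>i<length Ws. (\<lambda>w. g (ws[i := w])) \<in> mod_hom K (Ws ! i) N))"

definition hmultilinear ::
 "('k, 'r) ring_scheme \<Rightarrow> ('k, 'u) module \<Rightarrow> ('k, 'v) module list \<Rightarrow> ('k, 'w) module \<Rightarrow> ('u \<times> 'v list \<Rightarrow> 'w) \<Rightarrow> bool" where
 "hmultilinear K V Ws N g \<longleftrightarrow> (\<forall>ws\<in>ltuples Ws. (\<lambda>v. g (v, ws)) \<in> mod_hom K V N)
   \<and> (\<forall>v\<in>carrier V. multilinear K Ws N (\<lambda>ws. g (v, ws)))"

lemma ltuples_iff:
 "ws \<in> ltuples Ws \<longleftrightarrow> length ws = length Ws \<and> (\<forall>i<length Ws. ws ! i \<in> carrier (Ws ! i))"
 by (auto simp: ltuples_def list_all2_conv_all_nth)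

lemma ltuples_update:
 "ws \<in> ltuples Ws \<Longrightarrow> w \<in> carrier (Ws ! i) \<Longrightarrow> ws[i := w] \<in> ltuples Ws"
 by (cases "i < length Ws") (auto simp: ltuples_iff nth_list_update)

lemma multilinear_comp:
 assumes "multilinear K Ws N g" and T: "T \<in> mod_hom K N P"
 shows "multilinear K Ws P (\<lambda>ws. T (g ws))"
 unfolding multilinear_def
proof (intro ballI conjI allI impI)
 fix ws assume ws: "ws \<in> ltuples Ws"
 show "T (g ws) \<in> carrier P"
  by (rule lin_closed[OF T]) (use assms(1) ws in \<open>simp add: multilinear_def\<close>)
 show "(\<lambda>w. T (g (ws[i := w]))) \<in> mod_hom K (Ws ! i) P" if "i < length Ws" for i
  by (rule lin_comp[OF T]) (use assms(1) ws that in \<open>simp add: multilinear_def\<close>)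
qed

lemma hmultilinear_comp:
 assumes "hmultilinear K V Ws N g" and T: "T \<in> mod_hom K N P"
 shows "hmultilinear K V Ws P (\<lambda>t. T (g t))"
 unfolding hmultilinear_def
proof (intro ballI conjI)
 show "(\<lambda>v. T (g (v, ws))) \<in> mod_hom K V P" if "ws \<in> ltuples Ws" for ws
  by (rule lin_comp[OF T]) (use assms(1) that in \<open>simp add: hmultilinear_def\<close>)
 show "multilinear K Ws P (\<lambda>ws. T (g (v, ws)))" if "v \<in> carrier V" for v
  by (rule multilinear_comp[OF _ T]) (use assms(1) that in \<open>simp add: hmultilinear_def\<close>)
qed

lemma slot_rels_in_free:
 fixes V :: "('k, 'v) module"
 assumes "cring K" "module K V" and s: "\<And>v. v \<in> carrier V \<Longrightarrow> s v \<in> G"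
 shows "slot_rels K G V s \<subseteq> carrier (free_mod K G)"
proof -
 interpret P: presentation K G "{}" by (rule presentation.intro) (use assms in auto)
 interpret F: module K "free_mod K G" by (rule P.free_module)
 interpret V: module K V by fact
 show ?thesis
  unfolding slot_rels_def
  by (auto intro!: F.minus_closed F.a_closed F.smult_closed P.free_gen_closed s)
qed

locale tensor_factors =
 fixes K :: "('k, 'r) ring_scheme" and Ws :: "('k, 'v) module list"
 assumes cring_K: "cring K" and factor_module: "\<And>i. i < length Ws \<Longrightarrow> module K (Ws ! i)"
begin

sublocale L: presentation K "ltuples Ws" "ltensor_rels K Ws"
proof (rule presentation.intro)
 show "cring K" by (rule cring_K)
 show "ltensor_rels K Ws \<subseteq> carrier (free_mod K (ltuples Ws))"
  unfolding ltensor_rels_def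
  by (intro UN_least slot_rels_in_free[OF cring_K])
   (auto intro: factor_module ltuples_update)
qed

lemma ltensor_module: "module K (ltensor K Ws)"
 unfolding ltensor_def by (rule L.pres_module)

lemma multilinear_zero:
 assumes "module K P" "multilinear K Ws P g" "ws \<in> ltuples Ws" "i < length Ws" "ws ! i = \<zero>\<^bsub>Ws ! i\<^esub>"
 shows "g ws = \<zero>\<^bsub>P\<^esub>"
proof -
 have "g (ws[i := \<zero>\<^bsub>Ws ! i\<^esub>]) = \<zero>\<^bsub>P\<^esub>"
  by (rule lin_zero[OF factor_module[OF assms(4)] assms(1), where h = "\<lambda>w. g (ws[i := w])"])
   (use assms in \<open>simp add: multilinear_def\<close>)
 then show ?thesis using assms(5) by (metis list_update_id)
qed

lemma lpure_multilinear: "multilinear K Ws (ltensor K Ws) (lpure K Ws)"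
 unfolding multilinear_def
proof (intro ballI conjI allI impI)
 fix ws assume ws: "ws \<in> ltuples Ws"
 show "lpure K Ws ws \<in> carrier (ltensor K Ws)"
  unfolding lpure_def ltensor_def by (rule L.pres_gen_closed[OF ws])
 fix i assume i: "i < length Ws"
 show "(\<lambda>w. lpure K Ws (ws[i := w])) \<in> mod_hom K (Ws ! i) (ltensor K Ws)"
  unfolding lpure_def ltensor_def
  by (rule L.pres_gen_slot_linear[OF factor_module[OF i]])
   (use ws i in \<open>auto intro: ltuples_update simp: ltensor_rels_def\<close>)
qed

lemma ltensor_hom_ext:
 assumes "module K N" "g \<in> mod_hom K (ltensor K Ws) N" "h \<in> mod_hom K (ltensor K Ws) N"
  and "\<And>ws. ws \<in> ltuples Ws \<Longrightarrow> g (lpure K Ws ws) = h (lpure K Ws ws)" and "v \<in> carrier (ltensor K Ws)"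
 shows "g v = h v"
 using assms unfolding ltensor_def lpure_def by (rule L.pres_hom_ext)

lemma
 assumes N: "module K N" and g: "multilinear K Ws N g"
 shows ltensor_lift_hom: "pres_lift K (ltuples Ws) N g \<in> mod_hom K (ltensor K Ws) N"
  and ltensor_lift_pure: "ws \<in> ltuples Ws \<Longrightarrow> pres_lift K (ltuples Ws) N g (lpure K Ws ws) = g ws"
proof -
 have cl: "g ws \<in> carrier N" if "ws \<in> ltuples Ws" for ws using g that by (auto simp: multilinear_def)
 have ker: "L.free_lift N g r = \<zero>\<^bsub>N\<^esub>" if r: "r \<in> ltensor_rels K Ws" for r
 proof -
  obtain ws i where wsi: "ws \<in> ltuples Ws" "i < length Ws"
   "r \<in> slot_rels K (ltuples Ws) (Ws ! i) (\<lambda>w. ws[i := w])"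
   using r unfolding ltensor_rels_def by blast
  show ?thesis
   by (rule L.free_lift_slot_rels[OF N cl factor_module[OF wsi(2)] _ _ wsi(3)])
    (use wsi g in \<open>auto intro: ltuples_update simp: multilinear_def\<close>)
 qed
 show "pres_lift K (ltuples Ws) N g \<in> mod_hom K (ltensor K Ws) N"
  unfolding ltensor_def by (rule L.pres_lift_hom[OF N cl ker])
 show "ws \<in> ltuples Ws \<Longrightarrow> pres_lift K (ltuples Ws) N g (lpure K Ws ws) = g ws"
  unfolding lpure_def by (rule L.pres_lift_gen[OF N cl ker])
qed

end

locale htensor_factors = tensor_factors K Ws
 for K :: "('k, 'r) ring_scheme" and Ws :: "('k, 'v) module list" +
 fixes V :: "('k, 'u) module"
 assumes head_module: "module K V"
begin

sublocale H: presentation K "htuples V Ws" "htensor_rels K V Ws"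
proof (rule presentation.intro)
 show "cring K" by (rule cring_K)
 interpret V: module K V by (rule head_module)
 show "htensor_rels K V Ws \<subseteq> carrier (free_mod K (htuples V Ws))"
  unfolding htensor_rels_def
 proof (intro Un_least UN_least)
  fix ws assume "ws \<in> ltuples Ws"
  then show "slot_rels K (htuples V Ws) V (\<lambda>v. (v, ws)) \<subseteq> carrier (free_mod K (htuples V Ws))"
   by (intro slot_rels_in_free[OF cring_K]) (auto simp: htuples_def head_module)
 next
  fix v ws i assume "v \<in> carrier V" "ws \<in> ltuples Ws" "i \<in> {..<length Ws}"
  then show "slot_rels K (htuples V Ws) (Ws ! i) (\<lambda>w. (v, ws[i := w])) \<subseteq> carrier (free_mod K (htuples V Ws))"
   by (intro slot_rels_in_free[OF cring_K])
    (auto simp: htuples_def intro: factor_module ltuples_update)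
 qed
qed

lemma htensor_module: "module K (htensor K V Ws)"
 unfolding htensor_def by (rule H.pres_module)

lemma hpure_multilinear: "hmultilinear K V Ws (htensor K V Ws) (hpure K V Ws)"
 unfolding hmultilinear_def multilinear_def
proof (intro ballI conjI allI impI)
 fix ws assume ws: "ws \<in> ltuples Ws"
 show "(\<lambda>v. hpure K V Ws (v, ws)) \<in> mod_hom K V (htensor K V Ws)"
  unfolding hpure_def htensor_def
  by (rule H.pres_gen_slot_linear[OF head_module])
   (use ws in \<open>auto simp: htuples_def htensor_rels_def\<close>)
next
 fix v ws assume v: "v \<in> carrier V" and ws: "ws \<in> ltuples Ws"
 show "hpure K V Ws (v, ws) \<in> carrier (htensor K V Ws)"
  unfolding hpure_def htensor_def by (rule H.pres_gen_closed) (use v ws in \<open>auto simp: htuples_def\<close>)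
 fix i assume i: "i < length Ws"
 show "(\<lambda>w. hpure K V Ws (v, ws[i := w])) \<in> mod_hom K (Ws ! i) (htensor K V Ws)"
  unfolding hpure_def htensor_def
  by (rule H.pres_gen_slot_linear[OF factor_module[OF i]])
   (use v ws i in \<open>auto intro: ltuples_update simp: htensor_rels_def htuples_def\<close>)
qed

lemma
 assumes N: "module K N" and g: "hmultilinear K V Ws N g"
 shows htensor_lift_hom: "pres_lift K (htuples V Ws) N g \<in> mod_hom K (htensor K V Ws) N"
  and htensor_lift_pure: "t \<in> htuples V Ws \<Longrightarrow> pres_lift K (htuples V Ws) N g (hpure K V Ws t) = g t"
proof -
 have cl: "g t \<in> carrier N" if "t \<in> htuples V Ws" for t
  using g that by (auto simp: hmultilinear_def multilinear_def htuples_def)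
 have ker: "H.free_lift N g r = \<zero>\<^bsub>N\<^esub>" if r: "r \<in> htensor_rels K V Ws" for r
 proof -
  consider ws where "ws \<in> ltuples Ws" "r \<in> slot_rels K (htuples V Ws) V (\<lambda>v. (v, ws))"
   | v ws i where "v \<in> carrier V" "ws \<in> ltuples Ws" "i < length Ws"
    "r \<in> slot_rels K (htuples V Ws) (Ws ! i) (\<lambda>w. (v, ws[i := w]))"
   using r unfolding htensor_rels_def by blast
  then show ?thesis
  proof cases
   case 1
   show ?thesis
    by (rule H.free_lift_slot_rels[OF N cl head_module _ _ 1(2)])
     (use 1 g in \<open>auto simp: htuples_def hmultilinear_def\<close>)
  next
   case 2
   show ?thesis
    by (rule H.free_lift_slot_rels[OF N cl factor_module[OF 2(3)] _ _ 2(4)])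
     (use 2 g in \<open>auto simp: htuples_def hmultilinear_def multilinear_def intro: ltuples_update\<close>)
  qed
 qed
 show "pres_lift K (htuples V Ws) N g \<in> mod_hom K (htensor K V Ws) N"
  unfolding htensor_def by (rule H.pres_lift_hom[OF N cl ker])
 show "t \<in> htuples V Ws \<Longrightarrow> pres_lift K (htuples V Ws) N g (hpure K V Ws t) = g t"
  unfolding hpure_def by (rule H.pres_lift_gen[OF N cl ker])
qed

end

section \<open>Chains and cochains as multilinear families\<close>

lemma length_hom_list [simp]: "length (hom_list C xs) = length xs - 1"
 by (simp add: hom_list_def)

lemma nth_hom_list [simp]:
 "i < length xs - 1 \<Longrightarrow> hom_list C xs ! i = khom C (xs ! i) (xs ! Suc i)"
 by (simp add: hom_list_def nth_tl)

lemma obj_tuples_nth: "xs \<in> obj_tuples C n \<Longrightarrow> i < Suc n \<Longrightarrow> xs ! i \<in> kobj C"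
 by (auto simp: obj_tuples_def)

lemma
 assumes "xs \<in> obj_tuples C n"
 shows obj_tuples_length: "length xs = Suc n"
  and obj_tuples_hd: "hd xs \<in> kobj C" and obj_tuples_last: "last xs \<in> kobj C"
  and obj_tuples_hd_nth: "hd xs = xs ! 0" and obj_tuples_last_nth: "last xs = xs ! n"
proof -
 show l: "length xs = Suc n" using assms by (simp add: obj_tuples_def)
 show "hd xs = xs ! 0" using l by (intro hd_conv_nth) auto
 moreover show "last xs = xs ! n" using l by (subst last_conv_nth) auto
 ultimately show "hd xs \<in> kobj C" "last xs \<in> kobj C" using obj_tuples_nth[OF assms] by auto
qed

context k_bimodule
begin

lemma hom_list_factors: "xs \<in> obj_tuples C n \<Longrightarrow> tensor_factors K (hom_list C xs)"
 by (rule tensor_factors.intro) (auto simp: is_cring obj_tuples_length intro!: khom_module intro: obj_tuples_nth)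

lemma summand_factors:
 "xs \<in> obj_tuples C n \<Longrightarrow> htensor_factors K (hom_list C xs) (bhom M (last xs) (hd xs))"
 using hom_list_factors obj_tuples_hd obj_tuples_last
 by (intro htensor_factors.intro htensor_factors_axioms.intro bhom_module) auto

lemma chain_family: "module_family K (obj_tuples C n) (hm_summand K C M)"
 by (rule module_family.intro)
  (auto simp: is_cring hm_summand_def intro: htensor_factors.htensor_module summand_factors)

lemma chain_module: "module K (hm_chain K C M n)"
 unfolding hm_chain_def by (rule module_family.dsum_mod_module[OF chain_family])

lemma cofactor_module: "xs \<in> obj_tuples C n \<Longrightarrow> module K (hm_cofactor K C M xs)"
 unfolding hm_cofactor_def
 by (intro hom_mod_module tensor_factors.ltensor_module hom_list_factors bhom_module)
  (auto intro: obj_tuples_hd obj_tuples_last)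

lemma cochain_module: "module K (hm_cochain K C M n)"
 unfolding hm_cochain_def by (rule dprod_mod_module[OF is_cring cofactor_module])

end

text \<open>A linear map on chains is the same thing as a family of functions, one for each tuple of
 objects, that are linear in the coefficient and in each of the morphisms.\<close>

definition chain_multilinear ::
 "('k, 'r) ring_scheme \<Rightarrow> ('o, 'c, 'k) kcat \<Rightarrow> ('o, 'c, 'm, 'k) kbimod \<Rightarrow> nat \<Rightarrow> ('k, 'w) module
   \<Rightarrow> ('o list \<Rightarrow> 'm \<times> 'c list \<Rightarrow> 'w) \<Rightarrow> bool" where
 "chain_multilinear K C M n N G \<longleftrightarrow> (\<forall>xs\<in>obj_tuples C n.
   hmultilinear K (bhom M (last xs) (hd xs)) (hom_list C xs) N (G xs))"

definition chain_lift ::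
 "('k, 'r) ring_scheme \<Rightarrow> ('o, 'c, 'k) kcat \<Rightarrow> ('o, 'c, 'm, 'k) kbimod \<Rightarrow> nat \<Rightarrow> ('k, 'w) module
   \<Rightarrow> ('o list \<Rightarrow> 'm \<times> 'c list \<Rightarrow> 'w) \<Rightarrow> ('o list \<Rightarrow> ('m \<times> 'c list \<Rightarrow> 'k) set) \<Rightarrow> 'w" where
 "chain_lift K C M n N G = dsum_lift (obj_tuples C n) (hm_summand K C M) N
   (\<lambda>xs. pres_lift K (htuples (bhom M (last xs) (hd xs)) (hom_list C xs)) N (G xs))"

definition chain_tuples ::
 "('o, 'c, 'k) kcat \<Rightarrow> ('o, 'c, 'm, 'k) kbimod \<Rightarrow> 'o list \<Rightarrow> ('m \<times> 'c list) set" where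
 "chain_tuples C M xs = htuples (bhom M (last xs) (hd xs)) (hom_list C xs)"

context k_bimodule
begin

context
 fixes n and N :: "('k, 'w) module" and G
 assumes N: "module K N" and G: "chain_multilinear K C M n N G"
begin

lemma chain_lift_summand:
 assumes "xs \<in> obj_tuples C n"
 shows "pres_lift K (htuples (bhom M (last xs) (hd xs)) (hom_list C xs)) N (G xs) \<in> mod_hom K (hm_summand K C M xs) N"
 unfolding hm_summand_def
 by (rule htensor_factors.htensor_lift_hom[OF summand_factors[OF assms] N])
  (use G assms in \<open>auto simp: chain_multilinear_def\<close>)

lemma chain_lift_hom: "chain_lift K C M n N G \<in> mod_hom K (hm_chain K C M n) N"
 unfolding chain_lift_def hm_chain_def
 by (rule module_family.dsum_lift_hom[OF chain_family N chain_lift_summand])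

lemma chain_lift_pure:
 assumes "xs \<in> obj_tuples C n" "t \<in> chain_tuples C M xs"
 shows "chain_lift K C M n N G (hm_pure K C M n xs t) = G xs t"
proof -
 interpret htensor_factors K "hom_list C xs" "bhom M (last xs) (hd xs)" by (rule summand_factors[OF assms(1)])
 have t: "hpure K (bhom M (last xs) (hd xs)) (hom_list C xs) t \<in> carrier (hm_summand K C M xs)"
  using assms(2) H.pres_gen_closed by (simp add: chain_tuples_def hpure_def hm_summand_def htensor_def)
 have "chain_lift K C M n N G (hm_pure K C M n xs t)
   = pres_lift K (htuples (bhom M (last xs) (hd xs)) (hom_list C xs)) N (G xs)
     (hpure K (bhom M (last xs) (hd xs)) (hom_list C xs) t)"
  unfolding chain_lift_def hm_pure_def
  by (rule module_family.dsum_lift_inj[OF chain_family N chain_lift_summand assms(1) t])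
 also have "\<dots> = G xs t"
  by (rule htensor_lift_pure[OF N]) (use G assms in \<open>auto simp: chain_multilinear_def chain_tuples_def\<close>)
 finally show ?thesis .
qed

end

lemma pure_closed:
 assumes "xs \<in> obj_tuples C n" "t \<in> chain_tuples C M xs"
 shows "hm_pure K C M n xs t \<in> carrier (hm_chain K C M n)"
proof -
 interpret htensor_factors K "hom_list C xs" "bhom M (last xs) (hd xs)" by (rule summand_factors[OF assms(1)])
 show ?thesis
  unfolding hm_pure_def hm_chain_def
  by (rule lin_closed[OF module_family.dsum_inj_hom[OF chain_family assms(1)]])
   (use assms(2) H.pres_gen_closed in \<open>simp add: chain_tuples_def hpure_def hm_summand_def htensor_def\<close>)
qed

lemma pure_multilinear: "chain_multilinear K C M n (hm_chain K C M n) (hm_pure K C M n)"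
 unfolding chain_multilinear_def
proof
 fix xs assume xs: "xs \<in> obj_tuples C n"
 interpret htensor_factors K "hom_list C xs" "bhom M (last xs) (hd xs)" by (rule summand_factors[OF xs])
 note inj = module_family.dsum_inj_hom[OF chain_family xs, unfolded hm_summand_def]
 show "hmultilinear K (bhom M (last xs) (hd xs)) (hom_list C xs) (hm_chain K C M n) (hm_pure K C M n xs)"
  unfolding hm_pure_def hm_chain_def hm_summand_def
  by (rule hmultilinear_comp[OF hpure_multilinear inj])
qed

lemma chain_span:
 "mod_span K (hm_chain K C M n) {hm_pure K C M n xs t |xs t. xs \<in> obj_tuples C n \<and> t \<in> chain_tuples C M xs}
   = carrier (hm_chain K C M n)" (is "mod_span K ?D ?S = _")
proof
 have S: "?S \<subseteq> carrier ?D" by (auto intro: pure_closed)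
 have sub: "submodule (mod_span K ?D ?S) K ?D" by (rule mod_span_submodule[OF chain_module S])
 then show "mod_span K ?D ?S \<subseteq> carrier ?D" by (rule submodule_subset[OF chain_module])
 let ?T = "\<Union>xs\<in>obj_tuples C n. dsum_inj (obj_tuples C n) (hm_summand K C M) xs ` carrier (hm_summand K C M xs)"
 have "?T \<subseteq> mod_span K ?D ?S"
 proof (intro UN_least image_subsetI)
  fix xs v assume xs: "xs \<in> obj_tuples C n" and v: "v \<in> carrier (hm_summand K C M xs)"
  interpret htensor_factors K "hom_list C xs" "bhom M (last xs) (hd xs)" by (rule summand_factors[OF xs])
  note inj = module_family.dsum_inj_hom[OF chain_family[of n] xs, folded hm_chain_def]
  show "dsum_inj (obj_tuples C n) (hm_summand K C M) xs v \<in> mod_span K ?D ?S"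
  proof (rule lin_span_into[OF _ chain_module inj sub])
   show "module K (hm_summand K C M xs)" unfolding hm_summand_def by (rule htensor_module)
   show "v \<in> mod_span K (hm_summand K C M xs)
     (hpure K (bhom M (last xs) (hd xs)) (hom_list C xs) ` htuples (bhom M (last xs) (hd xs)) (hom_list C xs))"
    using v unfolding hm_summand_def htensor_def hpure_def H.pres_span .
   show "hpure K (bhom M (last xs) (hd xs)) (hom_list C xs) ` htuples (bhom M (last xs) (hd xs)) (hom_list C xs)
     \<subseteq> carrier (hm_summand K C M xs)"
    using H.pres_gen_closed unfolding hm_summand_def htensor_def hpure_def by blast
   fix w assume "w \<in> hpure K (bhom M (last xs) (hd xs)) (hom_list C xs) ` htuples (bhom M (last xs) (hd xs)) (hom_list C xs)"
   then have "dsum_inj (obj_tuples C n) (hm_summand K C M) xs w \<in> ?S"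
    using xs by (auto simp: chain_tuples_def hm_pure_def)
   then show "dsum_inj (obj_tuples C n) (hm_summand K C M) xs w \<in> mod_span K ?D ?S"
    by (rule subsetD[OF mod_span_superset])
  qed
 qed
 from mod_span_minimal[OF sub this] show "carrier ?D \<subseteq> mod_span K ?D ?S"
  unfolding hm_chain_def module_family.dsum_mod_span[OF chain_family] .
qed

lemma chain_hom_ext:
 assumes "module K N" "g \<in> mod_hom K (hm_chain K C M n) N" "h \<in> mod_hom K (hm_chain K C M n) N"
  and "\<And>xs t. xs \<in> obj_tuples C n \<Longrightarrow> t \<in> chain_tuples C M xs \<Longrightarrow> g (hm_pure K C M n xs t) = h (hm_pure K C M n xs t)"
  and "w \<in> carrier (hm_chain K C M n)"
 shows "g w = h w"
proof (rule lin_eq_on_span[OF chain_module assms(1-3)])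
 let ?S = "{hm_pure K C M n xs t |xs t. xs \<in> obj_tuples C n \<and> t \<in> chain_tuples C M xs}"
 show "?S \<subseteq> carrier (hm_chain K C M n)" by (auto intro: pure_closed)
 show "w \<in> mod_span K (hm_chain K C M n) ?S" unfolding chain_span by (rule assms(5))
 show "g x = h x" if "x \<in> ?S" for x using that by (auto intro: assms(4))
qed

lemma chain_hom_into:
 assumes "module K N" "g \<in> mod_hom K (hm_chain K C M n) N" "submodule H K N"
  and "\<And>xs t. xs \<in> obj_tuples C n \<Longrightarrow> t \<in> chain_tuples C M xs \<Longrightarrow> g (hm_pure K C M n xs t) \<in> H"
  and "w \<in> carrier (hm_chain K C M n)"
 shows "g w \<in> H"
proof (rule lin_span_into[OF chain_module assms(1-3)])
 let ?S = "{hm_pure K C M n xs t |xs t. xs \<in> obj_tuples C n \<and> t \<in> chain_tuples C M xs}"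
 show "?S \<subseteq> carrier (hm_chain K C M n)" by (auto intro: pure_closed)
 show "w \<in> mod_span K (hm_chain K C M n) ?S" unfolding chain_span by (rule assms(5))
 show "g x \<in> H" if "x \<in> ?S" for x using that by (auto intro: assms(4))
qed

end

text \<open>Likewise a cochain is a family of multilinear functions of the morphisms.\<close>

definition cochain_multilinear ::
 "('k, 'r) ring_scheme \<Rightarrow> ('o, 'c, 'k) kcat \<Rightarrow> ('o, 'c, 'm, 'k) kbimod \<Rightarrow> nat
   \<Rightarrow> ('o list \<Rightarrow> 'c list \<Rightarrow> 'm) \<Rightarrow> bool" where
 "cochain_multilinear K C M n g \<longleftrightarrow> (\<forall>xs\<in>obj_tuples C n.
   multilinear K (hom_list C xs) (bhom M (hd xs) (last xs)) (g xs))"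

definition cochain_of ::
 "('k, 'r) ring_scheme \<Rightarrow> ('o, 'c, 'k) kcat \<Rightarrow> ('o, 'c, 'm, 'k) kbimod \<Rightarrow> nat
   \<Rightarrow> ('o list \<Rightarrow> 'c list \<Rightarrow> 'm) \<Rightarrow> 'o list \<Rightarrow> ('c list \<Rightarrow> 'k) set \<Rightarrow> 'm" where
 "cochain_of K C M n g = (\<lambda>xs\<in>obj_tuples C n. restrict
   (pres_lift K (ltuples (hom_list C xs)) (bhom M (hd xs) (last xs)) (g xs)) (carrier (ltensor K (hom_list C xs))))"

context k_bimodule
begin

lemma cochain_iff:
 "f \<in> carrier (hm_cochain K C M n) \<longleftrightarrow> f \<in> extensional (obj_tuples C n)
   \<and> (\<forall>xs\<in>obj_tuples C n. f xs \<in> mod_hom K (ltensor K (hom_list C xs)) (bhom M (hd xs) (last xs))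
     \<and> f xs \<in> extensional (carrier (ltensor K (hom_list C xs))))"
 by (auto simp: hm_cochain_def hm_cofactor_def PiE_iff)

lemma coefficient_module: "xs \<in> obj_tuples C n \<Longrightarrow> module K (bhom M (hd xs) (last xs))"
 by (intro bhom_module obj_tuples_hd obj_tuples_last)

lemma eval_multilinear:
 assumes f: "f \<in> carrier (hm_cochain K C M n)"
 shows "cochain_multilinear K C M n (hm_eval K C f)"
 unfolding cochain_multilinear_def
proof
 fix xs assume xs: "xs \<in> obj_tuples C n"
 interpret tensor_factors K "hom_list C xs" by (rule hom_list_factors[OF xs])
 have h: "f xs \<in> mod_hom K (ltensor K (hom_list C xs)) (bhom M (hd xs) (last xs))"
  using f xs by (simp add: cochain_iff)
 show "multilinear K (hom_list C xs) (bhom M (hd xs) (last xs)) (hm_eval K C f xs)"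
  unfolding hm_eval_def by (rule multilinear_comp[OF lpure_multilinear h])
qed

lemma
 assumes g: "cochain_multilinear K C M n g"
 shows cochain_of_closed: "cochain_of K C M n g \<in> carrier (hm_cochain K C M n)"
  and eval_cochain_of: "xs \<in> obj_tuples C n \<Longrightarrow> cs \<in> ltuples (hom_list C xs) \<Longrightarrow>
   hm_eval K C (cochain_of K C M n g) xs cs = g xs cs"
proof -
 have lift: "pres_lift K (ltuples (hom_list C xs)) (bhom M (hd xs) (last xs)) (g xs)
   \<in> mod_hom K (ltensor K (hom_list C xs)) (bhom M (hd xs) (last xs))"
  and pure: "cs \<in> ltuples (hom_list C xs) \<Longrightarrow> pres_lift K (ltuples (hom_list C xs)) (bhom M (hd xs) (last xs)) (g xs)
   (lpure K (hom_list C xs) cs) = g xs cs" "cs \<in> ltuples (hom_list C xs) \<Longrightarrow> lpure K (hom_list C xs) cs \<in> carrier (ltensor K (hom_list C xs))"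
  and mod: "module K (ltensor K (hom_list C xs))"
  if xs: "xs \<in> obj_tuples C n" for xs cs
 proof -
  interpret tensor_factors K "hom_list C xs" by (rule hom_list_factors[OF xs])
  have gx: "multilinear K (hom_list C xs) (bhom M (hd xs) (last xs)) (g xs)"
   using g xs by (simp add: cochain_multilinear_def)
  show "pres_lift K (ltuples (hom_list C xs)) (bhom M (hd xs) (last xs)) (g xs)
   \<in> mod_hom K (ltensor K (hom_list C xs)) (bhom M (hd xs) (last xs))"
   by (rule ltensor_lift_hom[OF coefficient_module[OF xs] gx])
  show "cs \<in> ltuples (hom_list C xs) \<Longrightarrow> pres_lift K (ltuples (hom_list C xs)) (bhom M (hd xs) (last xs)) (g xs)
   (lpure K (hom_list C xs) cs) = g xs cs"
   by (rule ltensor_lift_pure[OF coefficient_module[OF xs] gx])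
  show "cs \<in> ltuples (hom_list C xs) \<Longrightarrow> lpure K (hom_list C xs) cs \<in> carrier (ltensor K (hom_list C xs))"
   using lpure_multilinear by (simp add: multilinear_def)
  show "module K (ltensor K (hom_list C xs))" by (rule ltensor_module)
 qed
 show "cochain_of K C M n g \<in> carrier (hm_cochain K C M n)"
  unfolding cochain_iff cochain_of_def
  by (auto intro!: lin_cong[OF mod _ lift])
 show "xs \<in> obj_tuples C n \<Longrightarrow> cs \<in> ltuples (hom_list C xs) \<Longrightarrow>
   hm_eval K C (cochain_of K C M n g) xs cs = g xs cs"
  by (simp add: hm_eval_def cochain_of_def pure)
qed

lemma cochain_ext:
 assumes f: "f \<in> carrier (hm_cochain K C M n)" and g: "g \<in> carrier (hm_cochain K C M n)"
  and eq: "\<And>xs cs. xs \<in> obj_tuples C n \<Longrightarrow> cs \<in> ltuples (hom_list C xs) \<Longrightarrow> hm_eval K C f xs cs = hm_eval K C g xs cs"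
 shows "f = g"
proof (rule extensionalityI[of _ "obj_tuples C n"])
 show "f \<in> extensional (obj_tuples C n)" "g \<in> extensional (obj_tuples C n)"
  using f g by (auto simp: cochain_iff)
 fix xs assume xs: "xs \<in> obj_tuples C n"
 interpret tensor_factors K "hom_list C xs" by (rule hom_list_factors[OF xs])
 show "f xs = g xs"
 proof (rule extensionalityI[of _ "carrier (ltensor K (hom_list C xs))"])
  show "f xs \<in> extensional (carrier (ltensor K (hom_list C xs)))"
   "g xs \<in> extensional (carrier (ltensor K (hom_list C xs)))"
   using f g xs by (auto simp: cochain_iff)
  show "f xs v = g xs v" if "v \<in> carrier (ltensor K (hom_list C xs))" for v
   by (rule ltensor_hom_ext[OF coefficient_module[OF xs] _ _ _ that])
    (use f g xs eq in \<open>auto simp: cochain_iff hm_eval_def\<close>)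
 qed
qed

end

section \<open>Tuples of composable morphisms\<close>

context k_category
begin

lemma comp_hom_left:
 "\<lbrakk>x \<in> kobj C; y \<in> kobj C; z \<in> kobj C; f \<in> mor C y x\<rbrakk>
\<Longrightarrow> (\<lambda>g. kcomp C z y x g f) \<in> mod_hom K (khom C z y) (khom C z x)"
 using kcomp_bilin[of x y z] by (simp add: bilin_def)

lemma comp_hom_right:
 "\<lbrakk>x \<in> kobj C; y \<in> kobj C; z \<in> kobj C; g \<in> mor C z y\<rbrakk>
\<Longrightarrow> (\<lambda>f. kcomp C z y x g f) \<in> mod_hom K (khom C y x) (khom C z x)"
 using kcomp_bilin[of x y z] by (simp add: bilin_def)

lemma comp_closed:
 "\<lbrakk>x \<in> kobj C; y \<in> kobj C; z \<in> kobj C; g \<in> mor C z y; f \<in> mor C y x\<rbrakk>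
\<Longrightarrow> kcomp C z y x g f \<in> mor C z x"
 by (rule lin_closed[OF comp_hom_right])

end

definition path :: "('o, 'c, 'k) kcat \<Rightarrow> 'o list \<Rightarrow> 'c list \<Rightarrow> bool" where
 "path A os es \<longleftrightarrow> set os \<subseteq> kobj A \<and> length os = Suc (length es)
   \<and> (\<forall>i<length es. es ! i \<in> mor A (os ! i) (os ! Suc i))"

lemma path_length: "path A os es \<Longrightarrow> length os = Suc (length es)"
 by (simp add: path_def)

lemma path_obj: "path A os es \<Longrightarrow> i \<le> length es \<Longrightarrow> os ! i \<in> kobj A"
 by (auto simp: path_def)

lemma path_hom: "path A os es \<Longrightarrow> i < length es \<Longrightarrow> es ! i \<in> mor A (os ! i) (os ! Suc i)"
 by (simp add: path_def)

lemma pathI: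
 assumes "length os = Suc (length es)" "\<And>i. i \<le> length es \<Longrightarrow> os ! i \<in> kobj A"
  and "\<And>i. i < length es \<Longrightarrow> es ! i \<in> mor A (os ! i) (os ! Suc i)"
 shows "path A os es"
 using assms by (auto simp: path_def in_set_conv_nth less_Suc_eq_le)

lemma path_update:
 "path A os es \<Longrightarrow> c \<in> mor A (os ! i) (os ! Suc i) \<Longrightarrow> path A os (es[i := c])"
 by (cases "i < length es") (auto simp: path_def nth_list_update)

lemma length_drop_obj [simp]: "p < length os \<Longrightarrow> length (drop_obj p os) = length os - 1"
 by (simp add: drop_obj_def)

lemma nth_drop_obj:
 "p < length os \<Longrightarrow> i < length os - 1 \<Longrightarrow> drop_obj p os ! i = (if i < p then os ! i else os ! Suc i)"
 by (simp add: drop_obj_def nth_append)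

lemma length_merge_at [simp]: "Suc q < length es \<Longrightarrow> length (merge_at A os (Suc q) es) = length es - 1"
 by (simp add: merge_at_def)

lemma nth_merge_at:
 "Suc q < length es \<Longrightarrow> i < length es - 1 \<Longrightarrow> merge_at A os (Suc q) es ! i =
   (if i < q then es ! i
   else if i = q then kcomp A (os ! q) (os ! Suc q) (os ! Suc (Suc q)) (es ! q) (es ! Suc q)
   else es ! Suc i)"
 by (auto simp: merge_at_def nth_append nth_Cons')

text \<open>Multiplication by an endomorphism \<open>e\<close> of the inner object \<open>os ! Suc q\<close> on both sides
 of that object.\<close>

definition cut_at :: "('o, 'c, 'k) kcat \<Rightarrow> 'o list \<Rightarrow> nat \<Rightarrow> 'c \<Rightarrow> 'c list \<Rightarrow> 'c list" where
 "cut_at A os q e es = es[q := kcomp A (os ! q) (os ! Suc q) (os ! Suc q) (es ! q) e,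
   Suc q := kcomp A (os ! Suc q) (os ! Suc q) (os ! Suc (Suc q)) e (es ! Suc q)]"

definition dup_obj :: "nat \<Rightarrow> 'o list \<Rightarrow> 'o list" where
 "dup_obj q os = take (Suc (Suc q)) os @ drop (Suc q) os"

definition insert_id :: "('o, 'c, 'k) kcat \<Rightarrow> 'o list \<Rightarrow> nat \<Rightarrow> 'c list \<Rightarrow> 'c list" where
 "insert_id A os q es = take (Suc q) es @ kid A (os ! Suc q) # drop (Suc q) es"

lemma length_cut_at [simp]: "length (cut_at A os q e es) = length es"
 by (simp add: cut_at_def)

lemma nth_cut_at:
 "Suc q < length es \<Longrightarrow> cut_at A os q e es ! i =
   (if i = q then kcomp A (os ! q) (os ! Suc q) (os ! Suc q) (es ! q) e
   else if i = Suc q then kcomp A (os ! Suc q) (os ! Suc q) (os ! Suc (Suc q)) e (es ! Suc q)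
   else es ! i)"
 by (auto simp: cut_at_def nth_list_update)

lemma length_dup_obj [simp]: "Suc q < length os \<Longrightarrow> length (dup_obj q os) = Suc (length os)"
 by (simp add: dup_obj_def)

lemma nth_dup_obj:
 assumes "Suc q < length os" "i \<le> length os"
 shows "dup_obj q os ! i = (if i \<le> Suc q then os ! i else os ! (i - 1))"
proof -
 have "Suc (i - 2) = i - Suc 0" if "\<not> i \<le> Suc q" using that by arith
 moreover have "length os - Suc 0 = Suc q" if "length os \<le> Suc (Suc q)" using that assms(1) by arith
 ultimately show ?thesis using assms by (auto simp: dup_obj_def nth_append min_def)
qed

lemma length_insert_id [simp]: "Suc q < length es \<Longrightarrow> length (insert_id A os q es) = Suc (length es)"
 by (simp add: insert_id_def)

lemma nth_insert_id:
 assumes "Suc q < length es"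
 shows "insert_id A os q es ! i =
   (if i \<le> q then es ! i else if i = Suc q then kid A (os ! Suc q) else es ! (i - 1))"
proof -
 have "Suc (i - 2) = i - Suc 0" if "\<not> i \<le> q" "i \<noteq> Suc q" using that by arith
 then show ?thesis using assms by (auto simp: insert_id_def nth_append min_def nth_Cons')
qed

context k_category
begin

lemma path_merge:
 assumes "path C os es" "Suc q < length es"
 shows "path C (drop_obj (Suc q) os) (merge_at C os (Suc q) es)"
proof (rule pathI)
 note P = path_obj[OF assms(1)] path_hom[OF assms(1)] path_length[OF assms(1)]
 show "length (drop_obj (Suc q) os) = Suc (length (merge_at C os (Suc q) es))" using assms(2) P by simp
 show "drop_obj (Suc q) os ! i \<in> kobj C" if "i \<le> length (merge_at C os (Suc q) es)" for i
  using that assms(2) P by (auto simp: nth_drop_obj)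
 show "merge_at C os (Suc q) es ! i \<in> mor C (drop_obj (Suc q) os ! i) (drop_obj (Suc q) os ! Suc i)"
  if "i < length (merge_at C os (Suc q) es)" for i
 proof -
  consider "i < q" | "i = q" | "q < i" by linarith
  then show ?thesis
   using that assms(2) P by cases (auto simp: nth_drop_obj nth_merge_at comp_closed)
 qed
qed

lemma path_cut:
 assumes "path C os es" "Suc q < length es" "e \<in> mor C (os ! Suc q) (os ! Suc q)"
 shows "path C os (cut_at C os q e es)"
 unfolding cut_at_def using assms
 by (intro path_update) (auto intro!: comp_closed path_obj path_hom)

lemma path_dup:
 assumes "path C os es" "Suc q < length es"
 shows "path C (dup_obj q os) (insert_id C os q es)"
proof (rule pathI)
 note P = path_obj[OF assms(1)] path_hom[OF assms(1)] path_length[OF assms(1)]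
 show "length (dup_obj q os) = Suc (length (insert_id C os q es))" using assms(2) P by simp
 show "dup_obj q os ! i \<in> kobj C" if "i \<le> length (insert_id C os q es)" for i
  using that assms(2) P by (auto simp: nth_dup_obj)
 show "insert_id C os q es ! i \<in> mor C (dup_obj q os ! i) (dup_obj q os ! Suc i)"
  if i: "i < length (insert_id C os q es)" for i
 proof -
  consider "i \<le> q" | "i = Suc q" | j where "i = Suc j" "q < j"
   using Suc_le_D[of q i] by (metis Suc_lessI not_le less_Suc_eq_le Suc_less_eq)
  then show ?thesis
   using i assms(2) P by cases (auto simp: nth_dup_obj nth_insert_id kid_closed Suc_diff_le)
 qed
qed

lemma drop_obj_commute_dup:
 assumes "Suc j < length os" "q < j"
 shows "drop_obj (Suc q) (dup_obj j os) = dup_obj (j - 1) (drop_obj (Suc q) os)"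
 using assms by (intro nth_equalityI) (auto simp: nth_drop_obj nth_dup_obj Suc_diff_le)

lemma drop_dup_obj:
 assumes "Suc j < length os" "q = j \<or> q = Suc j"
 shows "drop_obj (Suc q) (dup_obj j os) = os"
 using assms by (intro nth_equalityI) (auto simp: nth_drop_obj nth_dup_obj)

lemma drop_obj_commute_dup':
 assumes "Suc j < q" "q < length os"
 shows "drop_obj (Suc q) (dup_obj j os) = dup_obj j (drop_obj q os)"
 using assms by (intro nth_equalityI) (auto simp: nth_drop_obj nth_dup_obj)

lemma merge_commute_insert:
 assumes "path C os es" "Suc j < length es" "q < j"
 shows "merge_at C (dup_obj j os) (Suc q) (insert_id C os j es)
  = insert_id C (drop_obj (Suc q) os) (j - 1) (merge_at C os (Suc q) es)"
 using assms(2,3) path_length[OF assms(1)]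
 by (intro nth_equalityI) (auto simp: nth_drop_obj nth_dup_obj nth_merge_at nth_insert_id)

lemma merge_insert:
 assumes "path C os es" "Suc j < length es" "q = j \<or> q = Suc j"
 shows "merge_at C (dup_obj j os) (Suc q) (insert_id C os j es) = es"
 using assms(2,3) path_length[OF assms(1)] path_obj[OF assms(1)] path_hom[OF assms(1)]
 by (intro nth_equalityI) (auto simp: nth_dup_obj nth_merge_at nth_insert_id kid_left kid_right)

lemma merge_commute_insert':
 assumes "path C os es" "Suc j < q" "q < length es"
 shows "merge_at C (dup_obj j os) (Suc q) (insert_id C os j es)
  = insert_id C (drop_obj q os) j (merge_at C os q es)"
proof -
 obtain p where q: "q = Suc p" using assms(2) by (cases q) auto
 show ?thesis
  using assms(2,3) path_length[OF assms(1)] unfolding q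
  by (intro nth_equalityI) (auto simp: nth_drop_obj nth_dup_obj nth_merge_at nth_insert_id)
qed

lemma merge_cut_less:
 assumes "path C os es" "Suc q < length es" "k < q" "e \<in> mor C (os ! Suc k) (os ! Suc k)"
 shows "merge_at C os (Suc q) (cut_at C os k e es)
  = cut_at C (drop_obj (Suc q) os) k e (merge_at C os (Suc q) es)"
proof (rule nth_equalityI)
 note P = path_obj[OF assms(1)] path_hom[OF assms(1)] path_length[OF assms(1)]
 show "length (merge_at C os (Suc q) (cut_at C os k e es)) = length (cut_at C (drop_obj (Suc q) os) k e (merge_at C os (Suc q) es))"
  using assms by simp
 fix i assume i: "i < length (merge_at C os (Suc q) (cut_at C os k e es))"
 show "merge_at C os (Suc q) (cut_at C os k e es) ! i = cut_at C (drop_obj (Suc q) os) k e (merge_at C os (Suc q) es) ! i"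
 proof (cases "q = Suc k")
  case True
  have "kcomp C (os ! Suc k) (os ! Suc k) (os ! Suc (Suc (Suc k))) e
    (kcomp C (os ! Suc k) (os ! Suc (Suc k)) (os ! Suc (Suc (Suc k))) (es ! Suc k) (es ! Suc (Suc k)))
   = kcomp C (os ! Suc k) (os ! Suc (Suc k)) (os ! Suc (Suc (Suc k)))
    (kcomp C (os ! Suc k) (os ! Suc k) (os ! Suc (Suc k)) e (es ! Suc k)) (es ! Suc (Suc k))"
   using assms True by (intro kcomp_assoc P) auto
  then show ?thesis
   using i assms(2,3) P True by (auto simp: nth_drop_obj nth_merge_at nth_cut_at)
 next
  case False
  then show ?thesis
   using i assms(2,3) P by (auto simp: nth_drop_obj nth_merge_at nth_cut_at)
 qed
qed

lemma merge_cut_greater: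
 assumes "path C os es" "Suc k < length es" "q < k" "e \<in> mor C (os ! Suc k) (os ! Suc k)"
 shows "merge_at C os (Suc q) (cut_at C os k e es)
  = cut_at C (drop_obj (Suc q) os) (k - 1) e (merge_at C os (Suc q) es)"
proof (rule nth_equalityI)
 note P = path_obj[OF assms(1)] path_hom[OF assms(1)] path_length[OF assms(1)]
 obtain k' where k: "k = Suc k'" using assms(3) by (cases k) auto
 show "length (merge_at C os (Suc q) (cut_at C os k e es)) = length (cut_at C (drop_obj (Suc q) os) (k - 1) e (merge_at C os (Suc q) es))"
  using assms by simp
 fix i assume i: "i < length (merge_at C os (Suc q) (cut_at C os k e es))"
 show "merge_at C os (Suc q) (cut_at C os k e es) ! i = cut_at C (drop_obj (Suc q) os) (k - 1) e (merge_at C os (Suc q) es) ! i"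
 proof (cases "q = k'")
  case True
  have "kcomp C (os ! q) (os ! Suc q) (os ! Suc (Suc q)) (es ! q)
    (kcomp C (os ! Suc q) (os ! Suc (Suc q)) (os ! Suc (Suc q)) (es ! Suc q) e)
   = kcomp C (os ! q) (os ! Suc (Suc q)) (os ! Suc (Suc q))
    (kcomp C (os ! q) (os ! Suc q) (os ! Suc (Suc q)) (es ! q) (es ! Suc q)) e"
   using assms True k by (intro kcomp_assoc P) auto
  then show ?thesis
   using i assms(2,3) P True k by (auto simp: nth_drop_obj nth_merge_at nth_cut_at)
 next
  case False
  then show ?thesis
   using i assms(2,3) P k by (auto simp: nth_drop_obj nth_merge_at nth_cut_at)
 qed
qed

lemma merge_cut_same:
 assumes "path C os es" "Suc q < length es" "e \<in> mor C (os ! Suc q) (os ! Suc q)"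
  and "kcomp C (os ! Suc q) (os ! Suc q) (os ! Suc q) e e = e"
 shows "merge_at C os (Suc q) (cut_at C os q e es)
  = merge_at C os (Suc q) (es[Suc q := kcomp C (os ! Suc q) (os ! Suc q) (os ! Suc (Suc q)) e (es ! Suc q)])"
proof -
 note P = path_obj[OF assms(1)] path_hom[OF assms(1)] path_length[OF assms(1)]
 let ?x = "os ! q" and ?y = "os ! Suc q" and ?z = "os ! Suc (Suc q)"
 have "kcomp C ?x ?y ?z (kcomp C ?x ?y ?y (es ! q) e) (kcomp C ?y ?y ?z e (es ! Suc q))
  = kcomp C ?x ?y ?z (es ! q) (kcomp C ?y ?y ?z e (kcomp C ?y ?y ?z e (es ! Suc q)))"
  using assms by (intro kcomp_assoc[symmetric] P comp_closed) auto
 also have "kcomp C ?y ?y ?z e (kcomp C ?y ?y ?z e (es ! Suc q)) = kcomp C ?y ?y ?z (kcomp C ?y ?y ?y e e) (es ! Suc q)"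
  using assms by (intro kcomp_assoc P) auto
 finally show ?thesis
  using assms(2,4) P by (intro nth_equalityI) (auto simp: nth_merge_at nth_cut_at)
qed

lemma merge_update:
 assumes "Suc q < length es" "i < length es"
 shows "merge_at C os (Suc q) (es[i := c]) =
  (if i < q then (merge_at C os (Suc q) es)[i := c]
   else if i = q then (merge_at C os (Suc q) es)[q := kcomp C (os ! q) (os ! Suc q) (os ! Suc (Suc q)) c (es ! Suc q)]
   else if i = Suc q then (merge_at C os (Suc q) es)[q := kcomp C (os ! q) (os ! Suc q) (os ! Suc (Suc q)) (es ! q) c]
   else (merge_at C os (Suc q) es)[i - 1 := c])"
 using assms by (intro nth_equalityI) (auto simp: nth_merge_at nth_list_update)

lemma cut_update:
 assumes "Suc q < length es" "i < length es"
 shows "cut_at C os q e (es[i := c]) =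
  (if i = q then (cut_at C os q e es)[q := kcomp C (os ! q) (os ! Suc q) (os ! Suc q) c e]
   else if i = Suc q then (cut_at C os q e es)[Suc q := kcomp C (os ! Suc q) (os ! Suc q) (os ! Suc (Suc q)) e c]
   else (cut_at C os q e es)[i := c])"
 using assms by (intro nth_equalityI) (auto simp: nth_cut_at nth_list_update)

lemma insert_update:
 assumes "Suc q < length es" "i < length es"
 shows "insert_id C os q (es[i := c]) = (insert_id C os q es)[(if i \<le> q then i else Suc i) := c]"
 using assms by (intro nth_equalityI) (auto simp: nth_insert_id nth_list_update)

end

text \<open>Multiplication of the two outer entries from outside, which moves the two end objects.\<close>

definition outer_obj :: "'o \<Rightarrow> 'o \<Rightarrow> 'o list \<Rightarrow> 'o list" where
 "outer_obj y z os = os[0 := y, length os - 1 := z]"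

definition outer_mor :: "('o, 'c, 'k) kcat \<Rightarrow> 'o \<Rightarrow> 'o \<Rightarrow> 'c \<Rightarrow> 'c \<Rightarrow> 'o list \<Rightarrow> 'c list \<Rightarrow> 'c list" where
 "outer_mor A y z u v os es =
   es[0 := kcomp A y (os ! 0) (os ! 1) u (es ! 0),
    length es - 1 := kcomp A (os ! (length es - 1)) (os ! length es) z (es ! (length es - 1)) v]"

lemma length_outer [simp]:
 "length (outer_obj y z os) = length os" "length (outer_mor A y z u v os es) = length es"
 by (simp_all add: outer_obj_def outer_mor_def)

lemma nth_outer_obj:
 "2 \<le> length os \<Longrightarrow> i < length os \<Longrightarrow> outer_obj y z os ! i = (if i = 0 then y else if Suc i = length os then z else os ! i)"
 by (auto simp: outer_obj_def nth_list_update)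

lemma nth_outer_mor:
 "2 \<le> length es \<Longrightarrow> i < length es \<Longrightarrow> outer_mor A y z u v os es ! i =
  (if i = 0 then kcomp A y (os ! 0) (os ! 1) u (es ! 0)
   else if Suc i = length es then kcomp A (os ! i) (os ! Suc i) z (es ! i) v
   else es ! i)"
 by (auto simp: outer_mor_def nth_list_update)

context k_category
begin

lemma path_outer:
 assumes "path C os es" "2 \<le> length es" "y \<in> kobj C" "z \<in> kobj C"
  and "u \<in> mor C y (os ! 0)" "v \<in> mor C (os ! length es) z"
 shows "path C (outer_obj y z os) (outer_mor C y z u v os es)"
proof (rule pathI)
 note P = path_obj[OF assms(1)] path_hom[OF assms(1)] path_length[OF assms(1)]
 show "length (outer_obj y z os) = Suc (length (outer_mor C y z u v os es))" using P by simp
 show "outer_obj y z os ! i \<in> kobj C" if "i \<le> length (outer_mor C y z u v os es)" for i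
  using that P assms by (auto simp: nth_outer_obj)
 show "outer_mor C y z u v os es ! i \<in> mor C (outer_obj y z os ! i) (outer_obj y z os ! Suc i)"
  if "i < length (outer_mor C y z u v os es)" for i
  using that assms P(1)[of 0] P(1)[of 1] P(1)[of i] P(1)[of "Suc i"] P(2)[of 0] P(2)[of i] P(3)
  by (auto simp: nth_outer_obj nth_outer_mor intro!: comp_closed)
qed

lemma outer_dup:
 assumes "path C os es" "Suc q < length es"
 shows "outer_obj y z (dup_obj q os) = dup_obj q (outer_obj y z os)"
  and "outer_mor C y z u v (dup_obj q os) (insert_id C os q es) = insert_id C (outer_obj y z os) q (outer_mor C y z u v os es)"
proof -
 have l: "length os = Suc (length es)" by (rule path_length[OF assms(1)])
 show "outer_obj y z (dup_obj q os) = dup_obj q (outer_obj y z os)"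
  using assms(2) l by (intro nth_equalityI) (auto simp: nth_outer_obj nth_dup_obj)
 show "outer_mor C y z u v (dup_obj q os) (insert_id C os q es) = insert_id C (outer_obj y z os) q (outer_mor C y z u v os es)"
  using assms(2) l by (intro nth_equalityI) (auto simp: nth_outer_obj nth_dup_obj nth_outer_mor nth_insert_id)
qed

lemma outer_cut:
 assumes "path C os es" "Suc q < length es" "y \<in> kobj C" "z \<in> kobj C"
  and "u \<in> mor C y (os ! 0)" "v \<in> mor C (os ! length es) z"
  and "e \<in> mor C (os ! Suc q) (os ! Suc q)"
 shows "outer_mor C y z u v os (cut_at C os q e es) = cut_at C (outer_obj y z os) q e (outer_mor C y z u v os es)"
proof (rule nth_equalityI)
 note P = path_obj[OF assms(1)] path_hom[OF assms(1)] path_length[OF assms(1)]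
 show "length (outer_mor C y z u v os (cut_at C os q e es)) = length (cut_at C (outer_obj y z os) q e (outer_mor C y z u v os es))"
  by simp
 fix i assume i: "i < length (outer_mor C y z u v os (cut_at C os q e es))"
 have 1: "kcomp C y (os ! 0) (os ! 1) u (kcomp C (os ! 0) (os ! 1) (os ! 1) (es ! 0) e)
   = kcomp C y (os ! 1) (os ! 1) (kcomp C y (os ! 0) (os ! 1) u (es ! 0)) e" if "q = 0"
 proof -
  have "0 < length es" using assms(2) by linarith
  then show ?thesis using that assms P(2)[of 0] by (intro kcomp_assoc P(1)) auto
 qed
 have 2: "kcomp C (os ! Suc q) (os ! Suc (Suc q)) z (kcomp C (os ! Suc q) (os ! Suc q) (os ! Suc (Suc q)) e (es ! Suc q)) v
   = kcomp C (os ! Suc q) (os ! Suc q) z e (kcomp C (os ! Suc q) (os ! Suc (Suc q)) z (es ! Suc q) v)" if "Suc (Suc q) = length es"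
  using that assms P(2)[of "Suc q"] by (intro kcomp_assoc[symmetric] P(1)) auto
 show "outer_mor C y z u v os (cut_at C os q e es) ! i = cut_at C (outer_obj y z os) q e (outer_mor C y z u v os es) ! i"
  using i assms(2) P(3) 1 2 by (auto simp: nth_outer_obj nth_outer_mor nth_cut_at)
qed

end

section \<open>The contracting homotopy\<close>

lemma (in abelian_monoid) finsum_swap:
 assumes "finite I" "finite J" "\<And>i j. i \<in> I \<Longrightarrow> j \<in> J \<Longrightarrow> f i j \<in> carrier G"
 shows "(\<Oplus>i\<in>I. \<Oplus>j\<in>J. f i j) = (\<Oplus>j\<in>J. \<Oplus>i\<in>I. f i j)"
 using assms(1,3)
proof (induction I)
 case empty
 then show ?case by simp
next
 case (insert i I)
 have "(\<Oplus>j\<in>J. \<Oplus>i\<in>insert i I. f i j) = (\<Oplus>j\<in>J. f i j \<oplus> (\<Oplus>i\<in>I. f i j))"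
  using insert by (intro finsum_cong') (auto intro!: finsum_closed)
 also have "\<dots> = (\<Oplus>j\<in>J. f i j) \<oplus> (\<Oplus>j\<in>J. \<Oplus>i\<in>I. f i j)"
  using insert by (intro finsum_addf) (auto intro!: finsum_closed)
 also have "\<dots> = (\<Oplus>j\<in>J. f i j) \<oplus> (\<Oplus>i\<in>I. \<Oplus>j\<in>J. f i j)"
  using insert by auto
 also have "\<dots> = (\<Oplus>i\<in>insert i I. \<Oplus>j\<in>J. f i j)"
  using insert by (intro finsum_insert[symmetric]) (auto intro!: finsum_closed)
 finally show ?case ..
qed

lemma (in abelian_monoid) finsum_lessThan_Suc:
 assumes "\<And>i. i \<le> n \<Longrightarrow> f i \<in> carrier G"
 shows "(\<Oplus>i\<in>{..<Suc n}. f i) = (\<Oplus>i\<in>{..<n}. f i) \<oplus> f n"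
 using assms by (subst lessThan_Suc, subst finsum_insert) (auto intro!: a_comm finsum_closed)

lemma (in abelian_group) finsum_neg:
 assumes "finite I" "\<And>i. i \<in> I \<Longrightarrow> f i \<in> carrier G"
 shows "(\<Oplus>i\<in>I. \<ominus> f i) = \<ominus> (\<Oplus>i\<in>I. f i)"
 using assms
proof (induction I)
 case empty
 show ?case by (simp, rule minus_equality[symmetric]) auto
qed (simp add: minus_add Pi_iff)

text \<open>
 The cancellation behind the homotopy. The entries \<open>z j q\<close> of a rectangular array are, up to sign,
 the entries of the smaller array \<open>w\<close> away from the two middle diagonals, and telescope along them.
\<close>

lemma (in abelian_group) homotopy_cancellation:
 assumes "\<And>i. i \<le> m \<Longrightarrow> r i \<in> carrier G"
  and "\<And>q j. q < m \<Longrightarrow> Suc j < m \<Longrightarrow> w q j \<in> carrier G"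
  and "\<And>j q. j < m \<Longrightarrow> q < j \<Longrightarrow> z j q = \<ominus> w q (j - 1)"
  and "\<And>j. j < m \<Longrightarrow> z j j = r j"
  and "\<And>j. j < m \<Longrightarrow> z j (Suc j) = \<ominus> r (Suc j)"
  and "\<And>j q. \<lbrakk>j < m; Suc j < q; q \<le> m\<rbrakk> \<Longrightarrow> z j q = \<ominus> w (q - 1) j"
 shows "(\<Oplus>j\<in>{..<m}. \<Oplus>q\<in>{..<Suc m}. z j q) \<oplus> (\<Oplus>q\<in>{..<m}. \<Oplus>j\<in>{..<m - 1}. w q j) = r 0 \<ominus> r m"
 using assms
proof (induction m)
 case 0
 then show ?case by (simp add: r_neg minus_eq)
next
 case (Suc m)
 note r = Suc.prems(1) and w = Suc.prems(2) and z = Suc.prems(3-6)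
 have zc: "z j q \<in> carrier G" if "j \<le> m" "q \<le> Suc m" for j q
 proof -
  consider "q < j" | "q = j" | "q = Suc j" | "Suc j < q" by linarith
  then show ?thesis
  proof cases
   case 1
   have "w q (j - 1) \<in> carrier G" by (rule w) (use 1 that in auto)
   then show ?thesis using z(1)[of j q] 1 that by simp
  next
   case 2 then show ?thesis using z(2)[of j] r[of j] that by simp
  next
   case 3 then show ?thesis using z(3)[of j] r[of "Suc j"] that by simp
  next
   case 4
   have "w (q - 1) j \<in> carrier G" by (rule w) (use 4 that in auto)
   then show ?thesis using z(4)[of j q] 4 that by simp
  qed
 qed
 have IH: "(\<Oplus>j\<in>{..<m}. \<Oplus>q\<in>{..<Suc m}. z j q) \<oplus> (\<Oplus>q\<in>{..<m}. \<Oplus>j\<in>{..<m - 1}. w q j) = r 0 \<ominus> r m"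
  by (rule Suc.IH) (use r w z in auto)
 define Z where "Z = (\<Oplus>j\<in>{..<m}. \<Oplus>q\<in>{..<Suc m}. z j q)"
 define W where "W = (\<Oplus>q\<in>{..<m}. \<Oplus>j\<in>{..<m - 1}. w q j)"
 define row where "row = (\<Oplus>j\<in>{..<m}. w m j)"
 define col where "col = (\<Oplus>q\<in>{..<m}. w q (m - 1))"
 have cl: "Z \<in> carrier G" "W \<in> carrier G" "row \<in> carrier G" "col \<in> carrier G"
  unfolding Z_def W_def row_def col_def using zc w by (auto intro!: finsum_closed)
 have "(\<Oplus>j\<in>{..<Suc m}. \<Oplus>q\<in>{..<Suc (Suc m)}. z j q)
   = (\<Oplus>j\<in>{..<m}. \<Oplus>q\<in>{..<Suc (Suc m)}. z j q) \<oplus> (\<Oplus>q\<in>{..<Suc (Suc m)}. z m q)"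
  by (rule finsum_lessThan_Suc) (use zc in \<open>auto intro!: finsum_closed\<close>)
 also have "(\<Oplus>j\<in>{..<m}. \<Oplus>q\<in>{..<Suc (Suc m)}. z j q) = (\<Oplus>j\<in>{..<m}. (\<Oplus>q\<in>{..<Suc m}. z j q) \<oplus> z j (Suc m))"
  by (rule finsum_cong') (use zc in \<open>auto intro!: finsum_closed finsum_lessThan_Suc\<close>)
 also have "\<dots> = Z \<oplus> (\<Oplus>j\<in>{..<m}. z j (Suc m))"
  unfolding Z_def by (rule finsum_addf) (use zc in \<open>auto intro!: finsum_closed\<close>)
 also have "(\<Oplus>j\<in>{..<m}. z j (Suc m)) = (\<Oplus>j\<in>{..<m}. \<ominus> w m j)"
  by (rule finsum_cong') (use z(4) w in auto)
 also have "\<dots> = \<ominus> row"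
  unfolding row_def by (rule finsum_neg) (use w in auto)
 also have "(\<Oplus>q\<in>{..<Suc (Suc m)}. z m q) = (\<Oplus>q\<in>{..<m}. z m q) \<oplus> z m m \<oplus> z m (Suc m)"
  using zc by (simp add: finsum_lessThan_Suc del: lessThan_Suc)
 also have "(\<Oplus>q\<in>{..<m}. z m q) = (\<Oplus>q\<in>{..<m}. \<ominus> w q (m - 1))"
  by (rule finsum_cong') (use z(1) w in auto)
 also have "\<dots> = \<ominus> col"
  unfolding col_def by (rule finsum_neg) (use w in auto)
 finally have lhs: "(\<Oplus>j\<in>{..<Suc m}. \<Oplus>q\<in>{..<Suc (Suc m)}. z j q)
   = Z \<oplus> \<ominus> row \<oplus> (\<ominus> col \<oplus> r m \<oplus> \<ominus> r (Suc m))"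
  using z(2)[of m] z(3)[of m] by simp
 have "(\<Oplus>q\<in>{..<Suc m}. \<Oplus>j\<in>{..<m}. w q j) = (\<Oplus>q\<in>{..<m}. \<Oplus>j\<in>{..<m}. w q j) \<oplus> row"
  unfolding row_def by (rule finsum_lessThan_Suc) (use w in \<open>auto intro!: finsum_closed\<close>)
 also have "(\<Oplus>q\<in>{..<m}. \<Oplus>j\<in>{..<m}. w q j) = W \<oplus> col"
 proof (cases m)
  case 0
  then show ?thesis by (simp add: W_def col_def)
 next
  case (Suc m')
  have "(\<Oplus>q\<in>{..<m}. \<Oplus>j\<in>{..<m}. w q j) = (\<Oplus>q\<in>{..<m}. (\<Oplus>j\<in>{..<m'}. w q j) \<oplus> w q m')"
   unfolding Suc by (rule finsum_cong') (use w Suc in \<open>auto intro!: finsum_closed finsum_lessThan_Suc\<close>)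
  also have "\<dots> = W \<oplus> col"
   unfolding W_def col_def Suc diff_Suc_1 by (rule finsum_addf) (use w Suc in \<open>auto intro!: finsum_closed\<close>)
  finally show ?thesis .
 qed
 finally have rhs: "(\<Oplus>q\<in>{..<Suc m}. \<Oplus>j\<in>{..<Suc m - 1}. w q j) = W \<oplus> col \<oplus> row" by simp
 have rc: "r 0 \<in> carrier G" "r m \<in> carrier G" "r (Suc m) \<in> carrier G" using r by auto
 have "Z \<oplus> \<ominus> row \<oplus> (\<ominus> col \<oplus> r m \<oplus> \<ominus> r (Suc m)) \<oplus> (W \<oplus> col \<oplus> row)
   = (Z \<oplus> W) \<oplus> (r m \<oplus> \<ominus> r (Suc m)) \<oplus> ((col \<oplus> \<ominus> col) \<oplus> (row \<oplus> \<ominus> row))"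
  using cl rc by (simp add: a_ac)
 also have "\<dots> = (r 0 \<ominus> r m) \<oplus> (r m \<oplus> \<ominus> r (Suc m))"
  using IH cl rc unfolding Z_def[symmetric] W_def[symmetric] by (simp add: r_neg)
 also have "\<dots> = r 0 \<ominus> r (Suc m)"
  using rc by (simp add: minus_eq a_assoc r_neg1 l_neg r_neg2)
 finally show ?case unfolding lhs rhs .
qed

locale idempotent_category = k_category K A
 for K :: "('k, 'r) ring_scheme" (structure) and A :: "('a, 'c, 'k) kcat" +
 fixes Idx :: "'a \<Rightarrow> 'i set" and e :: "'i \<Rightarrow> 'c"
 assumes idx_finite: "a \<in> kobj A \<Longrightarrow> finite (Idx a)"
  and idem_closed: "a \<in> kobj A \<Longrightarrow> x \<in> Idx a \<Longrightarrow> e x \<in> mor A a a"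
  and idem: "a \<in> kobj A \<Longrightarrow> x \<in> Idx a \<Longrightarrow> kcomp A a a a (e x) (e x) = e x"
  and idem_sum: "a \<in> kobj A \<Longrightarrow> (\<Oplus>\<^bsub>khom A a a\<^esub> x \<in> Idx a. e x) = kid A a"

text \<open>A bar tuple with ends \<open>y\<close> and \<open>z\<close> has \<open>N - 1\<close> inner objects. All operations below act at an
 inner object, so all faces are treated alike.\<close>

definition bar_tuples :: "('o, 'c, 'k) kcat \<Rightarrow> 'o \<Rightarrow> 'o \<Rightarrow> nat \<Rightarrow> ('o list \<times> 'c list) set" where
 "bar_tuples A y z N = {(os, es). path A os es \<and> length es = N \<and> os ! 0 = y \<and> os ! N = z}"

definition bar_linear ::
 "('k, 'r) ring_scheme \<Rightarrow> ('o, 'c, 'k) kcat \<Rightarrow> ('k, 'p) module \<Rightarrow> 'o \<Rightarrow> 'o \<Rightarrow> nat \<Rightarrow> ('o list \<Rightarrow> 'c list \<Rightarrow> 'p) \<Rightarrow> bool" where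
 "bar_linear K A P y z N F \<longleftrightarrow> (\<forall>(os, es)\<in>bar_tuples A y z N. F os es \<in> carrier P
   \<and> (\<forall>i<N. (\<lambda>c. F os (es[i := c])) \<in> mod_hom K (khom A (os ! i) (os ! Suc i)) P))"

definition bface :: "('o, 'c, 'k) kcat \<Rightarrow> nat \<Rightarrow> ('o list \<Rightarrow> 'c list \<Rightarrow> 'p) \<Rightarrow> 'o list \<Rightarrow> 'c list \<Rightarrow> 'p" where
 "bface A q F os es = F (drop_obj (Suc q) os) (merge_at A os (Suc q) es)"

definition bdup :: "('o, 'c, 'k) kcat \<Rightarrow> nat \<Rightarrow> ('o list \<Rightarrow> 'c list \<Rightarrow> 'p) \<Rightarrow> 'o list \<Rightarrow> 'c list \<Rightarrow> 'p" where
 "bdup A q F os es = F (dup_obj q os) (insert_id A os q es)"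

lemma bar_tuplesD:
 assumes "(os, es) \<in> bar_tuples A y z N"
 shows "path A os es" "length es = N" "length os = Suc N" "os ! 0 = y" "os ! N = z"
 using assms path_length by (auto simp: bar_tuples_def)

context idempotent_category
begin

text \<open>The identity of the inner object \<open>os ! Suc q\<close> is a sum of idempotents; cutting there replaces
 it by the sum of \<open>e x \<otimes> e x\<close>.\<close>

definition bcut :: "('k, 'p) module \<Rightarrow> nat \<Rightarrow> ('a list \<Rightarrow> 'c list \<Rightarrow> 'p) \<Rightarrow> 'a list \<Rightarrow> 'c list \<Rightarrow> 'p" where
 "bcut P q F os es = (\<Oplus>\<^bsub>P\<^esub> x \<in> Idx (os ! Suc q). F os (cut_at A os q (e x) es))"

fun bcuts :: "('k, 'p) module \<Rightarrow> nat \<Rightarrow> ('a list \<Rightarrow> 'c list \<Rightarrow> 'p) \<Rightarrow> 'a list \<Rightarrow> 'c list \<Rightarrow> 'p" where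
 "bcuts P 0 F = F"
| "bcuts P (Suc j) F = bcut P j (bcuts P j F)"

definition bdiff :: "('k, 'p) module \<Rightarrow> nat \<Rightarrow> ('a list \<Rightarrow> 'c list \<Rightarrow> 'p) \<Rightarrow> 'a list \<Rightarrow> 'c list \<Rightarrow> 'p" where
 "bdiff P m F os es = (\<Oplus>\<^bsub>P\<^esub> q \<in> {..<m}. ksign K q \<odot>\<^bsub>P\<^esub> bface A q F os es)"

text \<open>The \<open>j\<close>-th term inserts an identity at the \<open>j\<close>-th inner object, after which all inner objects up to
 the first copy of the duplicated one are cut.\<close>

definition bhtpy :: "('k, 'p) module \<Rightarrow> nat \<Rightarrow> ('a list \<Rightarrow> 'c list \<Rightarrow> 'p) \<Rightarrow> 'a list \<Rightarrow> 'c list \<Rightarrow> 'p" where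
 "bhtpy P m F os es = (\<Oplus>\<^bsub>P\<^esub> j \<in> {..<m}. ksign K j \<odot>\<^bsub>P\<^esub> bdup A j (bcuts P (Suc j) F) os es)"

lemma ksign_closed [simp]: "ksign K i \<in> carrier K"
 by (simp add: ksign_def)

lemma ksign_Suc: "ksign K (Suc i) = \<ominus> ksign K i"
 by (simp add: ksign_def l_minus r_minus)

lemma tuple_face:
 assumes "(os, es) \<in> bar_tuples A y z (Suc N)" "q < N"
 shows "(drop_obj (Suc q) os, merge_at A os (Suc q) es) \<in> bar_tuples A y z N"
 using assms path_merge[of os es q] bar_tuplesD[OF assms(1)]
 by (auto simp: bar_tuples_def nth_drop_obj)

lemma tuple_cut:
 assumes "(os, es) \<in> bar_tuples A y z N" "Suc q < N" "c \<in> mor A (os ! Suc q) (os ! Suc q)"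
 shows "(os, cut_at A os q c es) \<in> bar_tuples A y z N"
 using assms path_cut[of os es q c] bar_tuplesD[OF assms(1)] by (auto simp: bar_tuples_def)

lemma tuple_dup:
 assumes "(os, es) \<in> bar_tuples A y z N" "Suc q < N"
 shows "(dup_obj q os, insert_id A os q es) \<in> bar_tuples A y z (Suc N)"
 using assms path_dup[of os es q] bar_tuplesD[OF assms(1)]
 by (auto simp: bar_tuples_def nth_dup_obj)

lemma tuple_obj: "(os, es) \<in> bar_tuples A y z N \<Longrightarrow> i \<le> N \<Longrightarrow> os ! i \<in> kobj A"
 using path_obj[of A os es i] by (simp add: bar_tuples_def)

lemma tuple_hom: "(os, es) \<in> bar_tuples A y z N \<Longrightarrow> i < N \<Longrightarrow> es ! i \<in> mor A (os ! i) (os ! Suc i)"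
 using path_hom[of A os es i] by (simp add: bar_tuples_def)

lemma tuple_cut_idem:
 assumes "(os, es) \<in> bar_tuples A y z N" "Suc q < N" "x \<in> Idx (os ! Suc q)"
 shows "(os, cut_at A os q (e x) es) \<in> bar_tuples A y z N"
 using assms tuple_obj[OF assms(1), of "Suc q"] by (intro tuple_cut idem_closed) auto

lemma bar_closed: "bar_linear K A P y z N F \<Longrightarrow> (os, es) \<in> bar_tuples A y z N \<Longrightarrow> F os es \<in> carrier P"
 by (auto simp: bar_linear_def)

lemma bar_slot:
 "\<lbrakk>bar_linear K A P y z N F; (os, es) \<in> bar_tuples A y z N; i < N\<rbrakk>
\<Longrightarrow> (\<lambda>c. F os (es[i := c])) \<in> mod_hom K (khom A (os ! i) (os ! Suc i)) P"
 by (auto simp: bar_linear_def)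

lemma bar_linearI:
 assumes "\<And>os es. (os, es) \<in> bar_tuples A y z N \<Longrightarrow> F os es \<in> carrier P"
  and "\<And>os es i. (os, es) \<in> bar_tuples A y z N \<Longrightarrow> i < N
   \<Longrightarrow> (\<lambda>c. F os (es[i := c])) \<in> mod_hom K (khom A (os ! i) (os ! Suc i)) P"
 shows "bar_linear K A P y z N F"
 using assms by (auto simp: bar_linear_def)

lemma bface_linear:
 assumes F: "bar_linear K A P y z N F" and q: "q < N"
 shows "bar_linear K A P y z (Suc N) (bface A q F)"
proof (rule bar_linearI)
 fix os es assume t: "(os, es) \<in> bar_tuples A y z (Suc N)"
 note D = bar_tuplesD[OF t] and t' = tuple_face[OF t q]
 show "bface A q F os es \<in> carrier P" unfolding bface_def by (rule bar_closed[OF F t'])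
 fix i assume i: "i < Suc N"
 have ob: "os ! j \<in> kobj A" if "j \<le> Suc N" for j using tuple_obj[OF t that] .
 have ho: "es ! j \<in> mor A (os ! j) (os ! Suc j)" if "j < Suc N" for j using tuple_hom[OF t that] .
 have upd: "merge_at A os (Suc q) (es[i := c]) =
  (if i < q then (merge_at A os (Suc q) es)[i := c]
   else if i = q then (merge_at A os (Suc q) es)[q := kcomp A (os ! q) (os ! Suc q) (os ! Suc (Suc q)) c (es ! Suc q)]
   else if i = Suc q then (merge_at A os (Suc q) es)[q := kcomp A (os ! q) (os ! Suc q) (os ! Suc (Suc q)) (es ! q) c]
   else (merge_at A os (Suc q) es)[i - 1 := c])" for c
  by (rule merge_update) (use i q D in auto)
 consider "i < q" | "i = q" | "i = Suc q" | "Suc q < i" by linarith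
 then show "(\<lambda>c. bface A q F os (es[i := c])) \<in> mod_hom K (khom A (os ! i) (os ! Suc i)) P"
 proof cases
  case 1
  then show ?thesis unfolding bface_def upd
   using bar_slot[OF F t', of i] q D by (simp add: nth_drop_obj)
 next
  case 2
  have "(\<lambda>c. F (drop_obj (Suc q) os) ((merge_at A os (Suc q) es)[q := c])) \<in> mod_hom K (khom A (os ! q) (os ! Suc (Suc q))) P"
   using bar_slot[OF F t' q] q D by (simp add: nth_drop_obj)
  from lin_comp[OF this comp_hom_left[OF ob ob ob ho]]
  show ?thesis unfolding bface_def upd using 2 q by simp
 next
  case 3
  have "(\<lambda>c. F (drop_obj (Suc q) os) ((merge_at A os (Suc q) es)[q := c])) \<in> mod_hom K (khom A (os ! q) (os ! Suc (Suc q))) P"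
   using bar_slot[OF F t' q] q D by (simp add: nth_drop_obj)
  from lin_comp[OF this comp_hom_right[OF ob ob ob ho]]
  show ?thesis unfolding bface_def upd using 3 q by simp
 next
  case 4
  then obtain i' where i': "i = Suc i'" by (cases i) auto
  show ?thesis unfolding bface_def upd
   using bar_slot[OF F t', of i'] 4 i i' D by (simp add: nth_drop_obj)
 qed
qed

lemma bdup_linear:
 assumes F: "bar_linear K A P y z (Suc N) F" and q: "Suc q < N"
 shows "bar_linear K A P y z N (bdup A q F)"
proof (rule bar_linearI)
 fix os es assume t: "(os, es) \<in> bar_tuples A y z N"
 note D = bar_tuplesD[OF t] and t' = tuple_dup[OF t q]
 show "bdup A q F os es \<in> carrier P" unfolding bdup_def by (rule bar_closed[OF F t'])
 fix i assume i: "i < N"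
 have upd: "insert_id A os q (es[i := c]) = (insert_id A os q es)[(if i \<le> q then i else Suc i) := c]" for c
  by (rule insert_update) (use i q D in auto)
 show "(\<lambda>c. bdup A q F os (es[i := c])) \<in> mod_hom K (khom A (os ! i) (os ! Suc i)) P"
  unfolding bdup_def upd
  using bar_slot[OF F t', of "if i \<le> q then i else Suc i"] q i D by (auto simp: nth_dup_obj)
qed

lemma bcut_linear:
 assumes P: "module K P" and F: "bar_linear K A P y z N F" and q: "Suc q < N"
 shows "bar_linear K A P y z N (bcut P q F)"
proof (rule bar_linearI)
 interpret P: module K P by (rule P)
 fix os es assume t: "(os, es) \<in> bar_tuples A y z N"
 note D = bar_tuplesD[OF t] and t' = tuple_cut_idem[OF t q]
 show "bcut P q F os es \<in> carrier P" unfolding bcut_def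
  using bar_closed[OF F t'] by (intro P.finsum_closed) auto
 fix i assume i: "i < N"
 have ob: "os ! j \<in> kobj A" if "j \<le> N" for j using tuple_obj[OF t that] .
 have upd: "cut_at A os q x (es[i := c]) =
  (if i = q then (cut_at A os q x es)[q := kcomp A (os ! q) (os ! Suc q) (os ! Suc q) c x]
   else if i = Suc q then (cut_at A os q x es)[Suc q := kcomp A (os ! Suc q) (os ! Suc q) (os ! Suc (Suc q)) x c]
   else (cut_at A os q x es)[i := c])" for x c
  by (rule cut_update) (use i q D in auto)
 show "(\<lambda>c. bcut P q F os (es[i := c])) \<in> mod_hom K (khom A (os ! i) (os ! Suc i)) P"
  unfolding bcut_def
 proof (rule lin_finsum_pointwise[OF _ P])
  show "module K (khom A (os ! i) (os ! Suc i))" using i by (intro khom_module ob) auto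
  fix x assume x: "x \<in> Idx (os ! Suc q)"
  have ex: "e x \<in> mor A (os ! Suc q) (os ! Suc q)" using x q by (intro idem_closed ob) auto
  note sl = bar_slot[OF F t'[OF x]]
  consider "i = q" | "i = Suc q" | "i \<noteq> q" "i \<noteq> Suc q" by blast
  then show "(\<lambda>c. F os (cut_at A os q (e x) (es[i := c]))) \<in> mod_hom K (khom A (os ! i) (os ! Suc i)) P"
  proof cases
   case 1
   have "(\<lambda>c. kcomp A (os ! q) (os ! Suc q) (os ! Suc q) c (e x)) \<in> mod_hom K (khom A (os ! q) (os ! Suc q)) (khom A (os ! q) (os ! Suc q))"
    using q by (intro comp_hom_left ob ex) auto
   from lin_comp[OF sl this] show ?thesis
    unfolding upd using 1 q by simp
  next
   case 2
   have "(\<lambda>c. kcomp A (os ! Suc q) (os ! Suc q) (os ! Suc (Suc q)) (e x) c) \<in> mod_hom K (khom A (os ! Suc q) (os ! Suc (Suc q))) (khom A (os ! Suc q) (os ! Suc (Suc q)))"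
    using i 2 by (intro comp_hom_right ob ex) auto
   from lin_comp[OF sl this] show ?thesis
    unfolding upd using 2 q by simp
  next
   case 3
   then show ?thesis unfolding upd using sl[OF i] by simp
  qed
 qed
qed

lemma bcuts_linear:
 assumes "module K P" "bar_linear K A P y z N F" "j < N"
 shows "bar_linear K A P y z N (bcuts P j F)"
 using assms(3)
 by (induction j) (use assms(1,2) in \<open>auto intro: bcut_linear\<close>)

lemma bcut_cong:
 assumes P: "module K P" and F: "bar_linear K A P y z N F" and q: "Suc q < N"
  and eq: "\<And>os es. (os, es) \<in> bar_tuples A y z N \<Longrightarrow> F' os es = F os es" and t: "(os, es) \<in> bar_tuples A y z N"
 shows "bcut P q F' os es = bcut P q F os es"
proof -
 interpret P: module K P by (rule P)
 note t' = tuple_cut_idem[OF t q]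
 show ?thesis unfolding bcut_def
  by (rule P.finsum_cong') (use eq t' bar_closed[OF F] in auto)
qed

lemma bcuts_cong:
 assumes "module K P" "bar_linear K A P y z N F" "j < N"
  and "\<And>os es. (os, es) \<in> bar_tuples A y z N \<Longrightarrow> F' os es = F os es" and "(os, es) \<in> bar_tuples A y z N"
 shows "bcuts P j F' os es = bcuts P j F os es"
 using assms(3,5)
proof (induction j arbitrary: os es)
 case 0
 then show ?case using assms(4) by simp
next
 case (Suc j)
 then show ?case
  using bcut_cong[OF assms(1) bcuts_linear[OF assms(1,2)], of j j "bcuts P j F'"] by simp
qed

text \<open>Merging commutes with cutting at the other inner objects and absorbs a cut at the merged object:
 inserting the idempotents of a decomposition of the identity there has no effect on the composite.\<close>

lemma bcut_bface:
 assumes P: "module K P" and F: "bar_linear K A P y z N F" and k: "k < N" and q: "q < N"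
  and t: "(os, es) \<in> bar_tuples A y z (Suc N)"
 shows "bcut P k (bface A q F) os es =
  (if k < q then bface A q (bcut P k F) os es
   else if k = q then bface A q F os es
   else bface A q (bcut P (k - 1) F) os es)"
proof -
 interpret P: module K P by (rule P)
 note D = bar_tuplesD[OF t]
 have ob: "os ! j \<in> kobj A" if "j \<le> Suc N" for j using tuple_obj[OF t that] .
 have ho: "es ! j \<in> mor A (os ! j) (os ! Suc j)" if "j < Suc N" for j using tuple_hom[OF t that] .
 have ex: "e x \<in> mor A (os ! Suc k) (os ! Suc k)" if "x \<in> Idx (os ! Suc k)" for x
  using that k by (intro idem_closed ob) auto
 note t' = tuple_cut_idem[OF t, of k]
 have cl: "F (drop_obj (Suc q) os) (merge_at A os (Suc q) (cut_at A os k (e x) es)) \<in> carrier P"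
  if "x \<in> Idx (os ! Suc k)" for x
  using bar_closed[OF F tuple_face[OF t' q]] that k by simp
 consider "k < q" | "k = q" | "q < k" by linarith
 then show ?thesis
 proof cases
  case 1
  have "drop_obj (Suc q) os ! Suc k = os ! Suc k" using 1 q D by (simp add: nth_drop_obj)
  then have "bcut P k (bface A q F) os es = bface A q (bcut P k F) os es"
   unfolding bcut_def bface_def
   using cl merge_cut_less[OF D(1) _ 1 ex] q D
   by (intro P.finsum_cong') auto
  then show ?thesis using 1 by simp
 next
  case 3
  have "drop_obj (Suc q) os ! Suc (k - 1) = os ! Suc k" using 3 q k D by (simp add: nth_drop_obj)
  then have "bcut P k (bface A q F) os es = bface A q (bcut P (k - 1) F) os es"
   unfolding bcut_def bface_def
   using cl merge_cut_greater[OF D(1) _ 3 ex] k D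
   by (intro P.finsum_cong') auto
  then show ?thesis using 3 by simp
 next
  case 2
  let ?y = "os ! Suc q" and ?z = "os ! Suc (Suc q)"
  let ?h = "\<lambda>c. bface A q F os (es[Suc q := kcomp A ?y ?y ?z c (es ! Suc q)])"
  have slot: "(\<lambda>c. bface A q F os (es[Suc q := c])) \<in> mod_hom K (khom A ?y ?z) P"
   using bar_slot[OF bface_linear[OF F q] t, of "Suc q"] q by simp
  have h: "?h \<in> mod_hom K (khom A ?y ?y) P"
   using lin_comp[OF slot comp_hom_left[OF ob ob ob ho]] q by simp
  have "bcut P k (bface A q F) os es = (\<Oplus>\<^bsub>P\<^esub> x \<in> Idx ?y. ?h (e x))"
   unfolding bcut_def 2
  proof (rule P.finsum_cong')
   show "(\<lambda>x. ?h (e x)) \<in> Idx ?y \<rightarrow> carrier P" using lin_closed[OF h] ex 2 by auto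
   show "bface A q F os (cut_at A os q (e x) es) = ?h (e x)" if x: "x \<in> Idx ?y" for x
    unfolding bface_def
    using merge_cut_same[OF D(1), of q "e x"] q D ex[of x] x 2 idem[OF ob, of "Suc q" x] by simp
  qed simp
  also have "\<dots> = ?h (\<Oplus>\<^bsub>khom A ?y ?y\<^esub> x \<in> Idx ?y. e x)"
   by (rule lin_finsum[OF khom_module[OF ob ob] P h, symmetric]) (use q ex 2 in auto)
  also have "\<dots> = bface A q F os es"
   using q ho[of "Suc q"] D by (simp add: idem_sum ob kid_left)
  finally show ?thesis using 2 by simp
 qed
qed

lemma bcuts_bface:
 assumes P: "module K P" and F: "bar_linear K A P y z N F" and q: "q < N" and j: "j \<le> N"
  and t: "(os, es) \<in> bar_tuples A y z (Suc N)"
 shows "bcuts P j (bface A q F) os es = bface A q (bcuts P (if q < j then j - 1 else j) F) os es"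
 using j t
proof (induction j arbitrary: os es)
 case 0
 then show ?case by simp
next
 case (Suc j)
 let ?G = "bcuts P (if q < j then j - 1 else j) F"
 have G: "bar_linear K A P y z N ?G"
  using Suc.prems q by (intro bcuts_linear[OF P F]) auto
 have "bcuts P (Suc j) (bface A q F) os es = bcut P j (bface A q ?G) os es"
  unfolding bcuts.simps
  by (rule bcut_cong[OF P bface_linear[OF G q]]) (use Suc in auto)
 also have "\<dots> = (if j < q then bface A q (bcut P j ?G) os es
   else if j = q then bface A q ?G os es
   else bface A q (bcut P (j - 1) ?G) os es)"
  by (rule bcut_bface[OF P G]) (use Suc q in auto)
 also have "\<dots> = bface A q (bcuts P (if q < Suc j then Suc j - 1 else Suc j) F) os es"
  by (cases j) auto
 finally show ?case .
qed

lemma bdup_bface: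
 assumes F: "bar_linear K A P y z N F" and q: "q < N" and j: "Suc j < N"
  and t: "(os, es) \<in> bar_tuples A y z N"
 shows "bdup A j (bface A q F) os es =
  (if q < j then bface A q (bdup A (j - 1) F) os es
   else if q \<le> Suc j then F os es
   else bface A (q - 1) (bdup A j F) os es)"
proof -
 note D = bar_tuplesD[OF t]
 consider "q < j" | "q = j \<or> q = Suc j" | "Suc j < q" by linarith
 then show ?thesis
 proof cases
  case 1
  then show ?thesis
   using drop_obj_commute_dup[of j os q] merge_commute_insert[OF D(1), of j q] j D by (simp add: bdup_def bface_def)
 next
  case 2
  then show ?thesis
   using drop_dup_obj[of j os q] merge_insert[OF D(1), of j q] j D by (auto simp: bdup_def bface_def)
 next
  case 3
  then show ?thesis
   using drop_obj_commute_dup'[of j q os] merge_commute_insert'[OF D(1), of j q] q D by (simp add: bdup_def bface_def)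
 qed
qed

lemma bcuts_finsum:
 assumes P: "module K P" and S: "finite S" and a: "\<And>q. q \<in> S \<Longrightarrow> a q \<in> carrier K"
  and F: "\<And>q. q \<in> S \<Longrightarrow> bar_linear K A P y z N (F q)" and j: "j < N" and t: "(os, es) \<in> bar_tuples A y z N"
 shows "bcuts P j (\<lambda>os es. \<Oplus>\<^bsub>P\<^esub> q \<in> S. a q \<odot>\<^bsub>P\<^esub> F q os es) os es = (\<Oplus>\<^bsub>P\<^esub> q \<in> S. a q \<odot>\<^bsub>P\<^esub> bcuts P j (F q) os es)"
 using j t
proof (induction j arbitrary: os es)
 case 0
 then show ?case by simp
next
 case (Suc j)
 interpret P: module K P by (rule P)
 note t = Suc.prems(2)
 have fin: "finite (Idx (os ! Suc j))"
  using Suc.prems tuple_obj[OF t, of "Suc j"] by (intro idx_finite) auto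
 note t' = tuple_cut_idem[OF t Suc.prems(1)]
 have cl: "bcuts P j (F q) os (cut_at A os j (e x) es) \<in> carrier P" if "q \<in> S" "x \<in> Idx (os ! Suc j)" for q x
  using Suc.prems by (intro bar_closed[OF bcuts_linear[OF P F] t'] that) auto
 have "bcuts P (Suc j) (\<lambda>os es. \<Oplus>\<^bsub>P\<^esub> q \<in> S. a q \<odot>\<^bsub>P\<^esub> F q os es) os es
   = (\<Oplus>\<^bsub>P\<^esub> x \<in> Idx (os ! Suc j). \<Oplus>\<^bsub>P\<^esub> q \<in> S. a q \<odot>\<^bsub>P\<^esub> bcuts P j (F q) os (cut_at A os j (e x) es))"
  unfolding bcuts.simps bcut_def
  by (rule P.finsum_cong') (use Suc t' cl a in \<open>auto intro!: P.finsum_closed\<close>)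
 also have "\<dots> = (\<Oplus>\<^bsub>P\<^esub> q \<in> S. \<Oplus>\<^bsub>P\<^esub> x \<in> Idx (os ! Suc j). a q \<odot>\<^bsub>P\<^esub> bcuts P j (F q) os (cut_at A os j (e x) es))"
  by (rule P.finsum_swap[OF fin S]) (use cl a in auto)
 also have "\<dots> = (\<Oplus>\<^bsub>P\<^esub> q \<in> S. a q \<odot>\<^bsub>P\<^esub> bcuts P (Suc j) (F q) os es)"
  unfolding bcuts.simps bcut_def
  by (rule P.finsum_cong') (use cl a fin in \<open>auto intro!: P.finsum_closed P.finsum_smult_ldistr[symmetric]\<close>)
 finally show ?case .
qed

text \<open>Two faces of the \<open>j\<close>-th term of the homotopy compose with the inserted identity. They leave \<open>F\<close>
 after \<open>j\<close> and after \<open>j + 1\<close> cuts, and these contributions telescope. All other faces cancel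
 against the homotopy applied to the faces of the tuple.\<close>

theorem bar_homotopy:
 assumes P: "module K P" and F: "bar_linear K A P y z (Suc m) F" and t: "(os, es) \<in> bar_tuples A y z (Suc m)"
 shows "bhtpy P m (bdiff P (Suc m) F) os es \<oplus>\<^bsub>P\<^esub> bdiff P m (bhtpy P (m - 1) F) os es
  = F os es \<ominus>\<^bsub>P\<^esub> bcuts P m F os es"
proof -
 interpret P: module K P by (rule P)
 note D = bar_tuplesD[OF t]
 define r where "r j = bcuts P j F os es" for j
 define w where "w q j = ksign K q \<odot>\<^bsub>P\<^esub> (ksign K j \<odot>\<^bsub>P\<^esub> bface A q (bdup A j (bcuts P (Suc j) F)) os es)" for q j
 define z' where "z' j q = ksign K j \<odot>\<^bsub>P\<^esub> (ksign K q \<odot>\<^bsub>P\<^esub> bdup A j (bcuts P (Suc j) (bface A q F)) os es)" for j q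
 have r: "r j \<in> carrier P" if "j \<le> m" for j
  unfolding r_def using that by (intro bar_closed[OF bcuts_linear[OF P F] t]) auto
 have y: "bface A q (bdup A j (bcuts P (Suc j) F)) os es \<in> carrier P" if "q < m" "Suc j < m" for q j
  using that by (intro bar_closed[OF bface_linear[OF bdup_linear[OF bcuts_linear[OF P F]]] t]) auto
 have td: "(dup_obj j os, insert_id A os j es) \<in> bar_tuples A y z (Suc (Suc m))" if "j < m" for j
  using that by (intro tuple_dup[OF t]) auto
 have x: "bdup A j (bcuts P (Suc j) (bface A q F)) os es =
   (if q < j then bface A q (bdup A (j - 1) (bcuts P j F)) os es
    else if q = j then r j else if q = Suc j then r (Suc j)
    else bface A (q - 1) (bdup A j (bcuts P (Suc j) F)) os es)"
  if j: "j < m" and q: "q \<le> m" for j q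
 proof -
  let ?G = "bcuts P (if q < Suc j then Suc j - 1 else Suc j) F"
  have "bdup A j (bcuts P (Suc j) (bface A q F)) os es = bdup A j (bface A q ?G) os es"
   unfolding bdup_def using j q by (intro bcuts_bface[OF P F _ _ td]) auto
  also have "\<dots> = (if q < j then bface A q (bdup A (j - 1) ?G) os es
    else if q \<le> Suc j then ?G os es else bface A (q - 1) (bdup A j ?G) os es)"
   using j q by (intro bdup_bface[OF bcuts_linear[OF P F] _ _ t]) auto
  finally show ?thesis using j by (auto simp: r_def simp del: bcuts.simps)
 qed
 have "bhtpy P m (bdiff P (Suc m) F) os es = (\<Oplus>\<^bsub>P\<^esub> j \<in> {..<m}. \<Oplus>\<^bsub>P\<^esub> q \<in> {..<Suc m}. z' j q)"
  unfolding bhtpy_def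
 proof (rule P.finsum_cong')
  have zc: "bdup A j (bcuts P (Suc j) (bface A q F)) os es \<in> carrier P" if "j < m" "q < Suc m" for j q
   unfolding bdup_def
   using that by (intro bar_closed[OF bcuts_linear[OF P bface_linear[OF F]] td]) auto
  then show "(\<lambda>j. \<Oplus>\<^bsub>P\<^esub> q \<in> {..<Suc m}. z' j q) \<in> {..<m} \<rightarrow> carrier P"
   unfolding z'_def by (auto intro!: P.finsum_closed simp del: bcuts.simps lessThan_Suc)
  fix j assume j: "j \<in> {..<m}"
  have "bdup A j (bcuts P (Suc j) (bdiff P (Suc m) F)) os es
    = (\<Oplus>\<^bsub>P\<^esub> q \<in> {..<Suc m}. ksign K q \<odot>\<^bsub>P\<^esub> bdup A j (bcuts P (Suc j) (bface A q F)) os es)"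
   unfolding bdup_def bdiff_def[abs_def]
   using j by (intro bcuts_finsum[OF P _ _ bface_linear[OF F] _ td]) auto
  then show "ksign K j \<odot>\<^bsub>P\<^esub> bdup A j (bcuts P (Suc j) (bdiff P (Suc m) F)) os es = (\<Oplus>\<^bsub>P\<^esub> q \<in> {..<Suc m}. z' j q)"
   unfolding z'_def using zc j
   by (simp add: P.finsum_smult_ldistr Pi_iff del: bcuts.simps lessThan_Suc)
 qed simp
 moreover have "bdiff P m (bhtpy P (m - 1) F) os es = (\<Oplus>\<^bsub>P\<^esub> q \<in> {..<m}. \<Oplus>\<^bsub>P\<^esub> j \<in> {..<m - 1}. w q j)"
  unfolding bdiff_def
 proof (rule P.finsum_cong')
  show "(\<lambda>q. \<Oplus>\<^bsub>P\<^esub> j \<in> {..<m - 1}. w q j) \<in> {..<m} \<rightarrow> carrier P"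
   unfolding w_def using y by (auto intro!: P.finsum_closed simp del: bcuts.simps)
  fix q assume q: "q \<in> {..<m}"
  have "bface A q (bhtpy P (m - 1) F) os es
   = (\<Oplus>\<^bsub>P\<^esub> j \<in> {..<m - 1}. ksign K j \<odot>\<^bsub>P\<^esub> bface A q (bdup A j (bcuts P (Suc j) F)) os es)"
   by (simp add: bface_def bhtpy_def)
  then show "ksign K q \<odot>\<^bsub>P\<^esub> bface A q (bhtpy P (m - 1) F) os es = (\<Oplus>\<^bsub>P\<^esub> j \<in> {..<m - 1}. w q j)"
   unfolding w_def using y q
   by (simp add: P.finsum_smult_ldistr Pi_iff del: bcuts.simps)
 qed simp
 moreover have "(\<Oplus>\<^bsub>P\<^esub> j \<in> {..<m}. \<Oplus>\<^bsub>P\<^esub> q \<in> {..<Suc m}. z' j q) \<oplus>\<^bsub>P\<^esub> (\<Oplus>\<^bsub>P\<^esub> q \<in> {..<m}. \<Oplus>\<^bsub>P\<^esub> j \<in> {..<m - 1}. w q j) = r 0 \<ominus>\<^bsub>P\<^esub> r m"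
 proof (rule P.homotopy_cancellation)
  have sq: "ksign K j \<odot>\<^bsub>P\<^esub> (ksign K j \<odot>\<^bsub>P\<^esub> v) = v" if "v \<in> carrier P" for j v
  proof -
   have "ksign K j \<otimes> ksign K j = \<one>"
    by (induction j) (simp_all add: ksign_Suc l_minus r_minus, simp add: ksign_def)
   then show ?thesis using that by (simp flip: P.smult_assoc1)
  qed
  have comm: "ksign K j \<odot>\<^bsub>P\<^esub> (ksign K q \<odot>\<^bsub>P\<^esub> v) = ksign K q \<odot>\<^bsub>P\<^esub> (ksign K j \<odot>\<^bsub>P\<^esub> v)" if "v \<in> carrier P" for j q v
   using that by (simp flip: P.smult_assoc1) (simp add: m_comm)
  show "r i \<in> carrier P" if "i \<le> m" for i by (rule r[OF that])
  show "w q j \<in> carrier P" if "q < m" "Suc j < m" for q j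
   unfolding w_def using y[OF that] by (simp del: bcuts.simps)
  show "z' j q = \<ominus>\<^bsub>P\<^esub> w q (j - 1)" if "j < m" "q < j" for j q
  proof -
   obtain j' where j': "j = Suc j'" using \<open>q < j\<close> by (cases j) auto
   show ?thesis unfolding z'_def w_def
    using x[of j q] y[of q j'] comm[OF y[of q j'], of j' q] that
    by (simp add: j' ksign_Suc P.smult_l_minus P.smult_r_minus del: bcuts.simps)
  qed
  show "z' j j = r j" if "j < m" for j
   unfolding z'_def using x[of j j] sq r[of j] that by (simp del: bcuts.simps)
  show "z' j (Suc j) = \<ominus>\<^bsub>P\<^esub> r (Suc j)" if "j < m" for j
   unfolding z'_def using x[of j "Suc j"] sq[OF r[of "Suc j"]] r[of "Suc j"] that
   by (simp add: ksign_Suc P.smult_l_minus P.smult_r_minus del: bcuts.simps)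
  show "z' j q = \<ominus>\<^bsub>P\<^esub> w (q - 1) j" if "j < m" "Suc j < q" "q \<le> m" for j q
  proof -
   obtain q' where q': "q = Suc q'" using \<open>Suc j < q\<close> by (cases q) auto
   show ?thesis unfolding z'_def w_def
    using x[of j q] y[of q' j] comm[OF y[of q' j], of j q'] that
    by (simp add: q' ksign_Suc P.smult_l_minus P.smult_r_minus del: bcuts.simps)
  qed
 qed
 ultimately show ?thesis by (simp add: r_def)
qed

end

section \<open>Naturality of the cutting operators\<close>

context idempotent_category
begin

lemma bcuts_post:
 assumes P: "module K P" and P': "module K P'" and T: "T \<in> mod_hom K P P'" and F: "bar_linear K A P y z N F"
  and j: "j < N" and t: "(os, es) \<in> bar_tuples A y z N"
 shows "T (bcuts P j F os es) = bcuts P' j (\<lambda>os es. T (F os es)) os es"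
 using j t
proof (induction j arbitrary: os es)
 case 0
 then show ?case by simp
next
 case (Suc j)
 interpret P': module K P' by (rule P')
 note t' = tuple_cut_idem[OF Suc.prems(2,1)]
 have cl: "bcuts P j F os (cut_at A os j (e x) es) \<in> carrier P" if "x \<in> Idx (os ! Suc j)" for x
  using Suc.prems by (intro bar_closed[OF bcuts_linear[OF P F] t'] that) auto
 have "T (bcuts P (Suc j) F os es) = (\<Oplus>\<^bsub>P'\<^esub> x \<in> Idx (os ! Suc j). T (bcuts P j F os (cut_at A os j (e x) es)))"
  unfolding bcuts.simps bcut_def by (rule lin_finsum[OF P P' T]) (use cl in auto)
 also have "\<dots> = bcuts P' (Suc j) (\<lambda>os es. T (F os es)) os es"
  unfolding bcuts.simps bcut_def
  by (rule P'.finsum_cong')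
   (use Suc t' cl lin_closed[OF T] in \<open>auto simp flip: Suc.IH\<close>)
 finally show ?case .
qed

lemma bcuts_param:
 assumes V: "module K V" and P: "module K P"
  and F: "\<And>os es. (os, es) \<in> bar_tuples A y z N \<Longrightarrow> (\<lambda>m. F m os es) \<in> mod_hom K V P"
  and j: "j < N" and t: "(os, es) \<in> bar_tuples A y z N"
 shows "(\<lambda>m. bcuts P j (F m) os es) \<in> mod_hom K V P"
 using j t
proof (induction j arbitrary: os es)
 case 0
 then show ?case using F by simp
next
 case (Suc j)
 note t' = tuple_cut_idem[OF Suc.prems(2,1)]
 show ?case
  unfolding bcuts.simps bcut_def
  by (rule lin_finsum_pointwise[OF V P]) (use Suc t' in auto)
qed

lemma tuple_outer:
 assumes "(os, es) \<in> bar_tuples A y z N" "2 \<le> N" "y' \<in> kobj A" "z' \<in> kobj A"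
  and "u \<in> mor A y' y" "v \<in> mor A z z'"
 shows "(outer_obj y' z' os, outer_mor A y' z' u v os es) \<in> bar_tuples A y' z' N"
 using assms path_outer[of os es y' z' u v] bar_tuplesD[OF assms(1)]
 by (auto simp: bar_tuples_def nth_outer_obj)

text \<open>Cuts happen at inner objects only, so they commute with composition at the two ends. This makes
 the operators on chains and cochains below independent of the outer morphisms by which a tuple is
 completed to a bar tuple.\<close>

lemma bcuts_outer:
 assumes P: "module K P" and F: "bar_linear K A P y' z' N F"
  and uv: "y' \<in> kobj A" "z' \<in> kobj A" "u \<in> mor A y' y" "v \<in> mor A z z'"
  and j: "j < N" and N: "2 \<le> N" and t: "(os, es) \<in> bar_tuples A y z N"
 shows "bcuts P j F (outer_obj y' z' os) (outer_mor A y' z' u v os es)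
  = bcuts P j (\<lambda>os es. F (outer_obj y' z' os) (outer_mor A y' z' u v os es)) os es"
 using j t
proof (induction j arbitrary: os es)
 case 0
 then show ?case by simp
next
 case (Suc j)
 interpret P: module K P by (rule P)
 note t = Suc.prems(2) note t' = tuple_cut_idem[OF t Suc.prems(1)]
 note D = bar_tuplesD[OF t] and uv' = uv[folded D(4,5)]
 have ex: "e x \<in> mor A (os ! Suc j) (os ! Suc j)" if "x \<in> Idx (os ! Suc j)" for x
  using that Suc.prems tuple_obj[OF t, of "Suc j"] by (intro idem_closed) auto
 have ob: "outer_obj y' z' os ! Suc j = os ! Suc j"
  using Suc.prems(1) N D by (simp add: nth_outer_obj)
 have oc: "outer_mor A y' z' u v os (cut_at A os j (e x) es)
   = cut_at A (outer_obj y' z' os) j (e x) (outer_mor A y' z' u v os es)" if "x \<in> Idx (os ! Suc j)" for x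
  by (rule outer_cut[OF D(1)]) (use uv D Suc.prems ex that in auto)
 have cl: "bcuts P j F (outer_obj y' z' os) (outer_mor A y' z' u v os (cut_at A os j (e x) es)) \<in> carrier P"
  if "x \<in> Idx (os ! Suc j)" for x
  using Suc.prems by (intro bar_closed[OF bcuts_linear[OF P F]] tuple_outer[OF t'[OF that] N uv]) auto
 show ?case
  unfolding bcuts.simps bcut_def ob
  by (rule P.finsum_cong') (use Suc t' cl in \<open>auto simp: oc simp flip: Suc.IH\<close>)
qed

lemma bhtpy_linear:
 assumes P: "module K P" and F: "bar_linear K A P y z (Suc N) F" and m: "m < N"
 shows "bar_linear K A P y z N (bhtpy P m F)"
proof (rule bar_linearI)
 interpret P: module K P by (rule P)
 have lin: "bar_linear K A P y z N (bdup A j (bcuts P (Suc j) F))" if "j < m" for j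
  using that m by (intro bdup_linear bcuts_linear[OF P F]) auto
 fix os es assume t: "(os, es) \<in> bar_tuples A y z N"
 show "bhtpy P m F os es \<in> carrier P"
  unfolding bhtpy_def by (intro P.finsum_closed) (use bar_closed[OF lin t] in auto)
 fix i assume i: "i < N"
 show "(\<lambda>c. bhtpy P m F os (es[i := c])) \<in> mod_hom K (khom A (os ! i) (os ! Suc i)) P"
  unfolding bhtpy_def
  using bar_slot[OF lin t i] i
  by (intro lin_finsum_pointwise P lin_smult_pointwise khom_module tuple_obj[OF t]) auto
qed

lemma bhtpy_cong:
 assumes P: "module K P" and F: "bar_linear K A P y z (Suc N) F" and m: "m < N"
  and eq: "\<And>os es. (os, es) \<in> bar_tuples A y z (Suc N) \<Longrightarrow> F' os es = F os es" and t: "(os, es) \<in> bar_tuples A y z N"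
 shows "bhtpy P m F' os es = bhtpy P m F os es"
proof -
 interpret P: module K P by (rule P)
 have lin: "bar_linear K A P y z N (bdup A j (bcuts P (Suc j) F))" if "j < m" for j
  using that m by (intro bdup_linear bcuts_linear[OF P F]) auto
 have td: "(dup_obj j os, insert_id A os j es) \<in> bar_tuples A y z (Suc N)" if "j < m" for j
  using that m by (intro tuple_dup[OF t]) auto
 have "bdup A j (bcuts P (Suc j) F') os es = bdup A j (bcuts P (Suc j) F) os es" if "j < m" for j
  unfolding bdup_def by (rule bcuts_cong[OF P F _ eq td[OF that]]) (use that m in auto)
 then show ?thesis
  unfolding bhtpy_def by (intro P.finsum_cong') (use bar_closed[OF lin t] in auto)
qed

lemma bhtpy_post:
 assumes P: "module K P" and P': "module K P'" and T: "T \<in> mod_hom K P P'" and F: "bar_linear K A P y z (Suc N) F"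
  and m: "m < N" and t: "(os, es) \<in> bar_tuples A y z N"
 shows "T (bhtpy P m F os es) = bhtpy P' m (\<lambda>os es. T (F os es)) os es"
proof -
 interpret P: module K P by (rule P)
 interpret P': module K P' by (rule P')
 have cl: "bdup A j (bcuts P (Suc j) F) os es \<in> carrier P" if "j < m" for j
  using that m by (intro bar_closed[OF bdup_linear[OF bcuts_linear[OF P F]] t]) auto
 have td: "(dup_obj j os, insert_id A os j es) \<in> bar_tuples A y z (Suc N)" if "j < m" for j
  using that m by (intro tuple_dup[OF t]) auto
 have eq: "T (bdup A j (bcuts P (Suc j) F) os es) = bdup A j (bcuts P' (Suc j) (\<lambda>os es. T (F os es))) os es" if "j < m" for j
  unfolding bdup_def by (rule bcuts_post[OF P P' T F _ td[OF that]]) (use that m in auto)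
 have "T (bhtpy P m F os es) = (\<Oplus>\<^bsub>P'\<^esub> j \<in> {..<m}. T (ksign K j \<odot>\<^bsub>P\<^esub> bdup A j (bcuts P (Suc j) F) os es))"
  unfolding bhtpy_def by (rule lin_finsum[OF P P' T]) (use cl in \<open>auto simp del: bcuts.simps\<close>)
 also have "\<dots> = bhtpy P' m (\<lambda>os es. T (F os es)) os es"
  unfolding bhtpy_def
  by (rule P'.finsum_cong')
   (use cl lin_closed[OF T] in \<open>auto simp: lin_smult[OF T] simp del: bcuts.simps simp flip: eq\<close>)
 finally show ?thesis .
qed

lemma bhtpy_param:
 assumes V: "module K V" and P: "module K P"
  and F: "\<And>os es. (os, es) \<in> bar_tuples A y z (Suc N) \<Longrightarrow> (\<lambda>m. F m os es) \<in> mod_hom K V P"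
  and j: "j < N" and t: "(os, es) \<in> bar_tuples A y z N"
 shows "(\<lambda>m. bhtpy P j (F m) os es) \<in> mod_hom K V P"
 unfolding bhtpy_def bdup_def
 by (intro lin_finsum_pointwise[OF V P] lin_smult_pointwise[OF P] bcuts_param[OF V P F])
  (use j in \<open>auto intro!: tuple_dup[OF t]\<close>)

lemma bhtpy_outer:
 assumes P: "module K P" and F: "bar_linear K A P y' z' (Suc N) F"
  and uv: "y' \<in> kobj A" "z' \<in> kobj A" "u \<in> mor A y' y" "v \<in> mor A z z'"
  and m: "m < N" and N: "2 \<le> N" and t: "(os, es) \<in> bar_tuples A y z N"
 shows "bhtpy P m F (outer_obj y' z' os) (outer_mor A y' z' u v os es)
  = bhtpy P m (\<lambda>os es. F (outer_obj y' z' os) (outer_mor A y' z' u v os es)) os es"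
proof -
 interpret P: module K P by (rule P)
 note D = bar_tuplesD[OF t]
 have lin: "bar_linear K A P y' z' N (bdup A j (bcuts P (Suc j) F))" if "j < m" for j
  using that m by (intro bdup_linear bcuts_linear[OF P F]) auto
 have td: "(dup_obj j os, insert_id A os j es) \<in> bar_tuples A y z (Suc N)" if "j < m" for j
  using that m by (intro tuple_dup[OF t]) auto
 have "bdup A j (bcuts P (Suc j) F) (outer_obj y' z' os) (outer_mor A y' z' u v os es)
   = bdup A j (bcuts P (Suc j) (\<lambda>os es. F (outer_obj y' z' os) (outer_mor A y' z' u v os es))) os es" if j: "j < m" for j
  using bcuts_outer[OF P F uv _ _ td[OF j], of "Suc j"] j m N outer_dup[OF D(1), of j] D
  by (simp add: bdup_def del: bcuts.simps)
 then show ?thesis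
  unfolding bhtpy_def
  by (intro P.finsum_cong') (use bar_closed[OF lin tuple_outer[OF t N uv]] in auto)
qed

end

section \<open>From chains and cochains to functions of tuples\<close>

definition core :: "'x list \<Rightarrow> 'x list" where
 "core xs = butlast (tl xs)"

lemma length_core [simp]: "length (core xs) = length xs - 2"
 by (simp add: core_def)

lemma nth_core: "i < length xs - 2 \<Longrightarrow> core xs ! i = xs ! Suc i"
 by (simp add: core_def nth_butlast nth_tl)

lemma core_update:
 "i < length es \<Longrightarrow> core (es[i := c]) = (if i = 0 \<or> Suc i = length es then core es else (core es)[i - 1 := c])"
 by (intro nth_equalityI) (auto simp: nth_core nth_list_update)

lemma core_drop: "q < length os - 2 \<Longrightarrow> core (drop_obj (Suc q) os) = drop_obj q (core os)"
 by (intro nth_equalityI) (auto simp: nth_core nth_drop_obj)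

definition with_ends :: "'x \<Rightarrow> 'x list \<Rightarrow> 'x \<Rightarrow> 'x list" where
 "with_ends a xs b = a # xs @ [b]"

lemma length_with_ends [simp]: "length (with_ends a xs b) = Suc (Suc (length xs))"
 by (simp add: with_ends_def)

lemma nth_with_ends:
 "i < Suc (Suc (length xs)) \<Longrightarrow> with_ends a xs b ! i = (if i = 0 then a else if i = Suc (length xs) then b else xs ! (i - 1))"
 by (auto simp: with_ends_def nth_append nth_Cons')

lemma core_with_ends [simp]: "core (with_ends a xs b) = xs"
 by (intro nth_equalityI) (auto simp: nth_core nth_with_ends)

abbreviation id_objs :: "'o list \<Rightarrow> 'o list" where
 "id_objs as \<equiv> with_ends (hd as) as (last as)"

abbreviation id_mors :: "('o, 'c, 'k) kcat \<Rightarrow> 'o list \<Rightarrow> 'c list \<Rightarrow> 'c list" where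
 "id_mors A as cs \<equiv> with_ends (kid A (hd as)) cs (kid A (last as))"

lemma hom_list_tuples_iff:
 "cs \<in> ltuples (hom_list A as) \<longleftrightarrow> length cs = length as - 1 \<and> (\<forall>i<length as - 1. cs ! i \<in> mor A (as ! i) (as ! Suc i))"
 by (auto simp: ltuples_iff)

context k_category
begin

lemma id_tuple:
 assumes "as \<in> obj_tuples C n" "cs \<in> ltuples (hom_list C as)"
 shows "(id_objs as, id_mors C as cs) \<in> bar_tuples C (hd as) (last as) (Suc (Suc n))"
proof -
 note l = obj_tuples_length[OF assms(1)] and e = obj_tuples_hd_nth[OF assms(1)] obj_tuples_last_nth[OF assms(1)]
 have cs: "length cs = n" "\<And>i. i < n \<Longrightarrow> cs ! i \<in> mor C (as ! i) (as ! Suc i)"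
  using assms(2) l by (auto simp: hom_list_tuples_iff)
 have ob: "as ! i \<in> kobj C" if "i \<le> n" for i using obj_tuples_nth[OF assms(1), of i] that by simp
 have "path C (id_objs as) (id_mors C as cs)"
 proof (rule pathI)
  show "id_objs as ! i \<in> kobj C" if "i \<le> length (id_mors C as cs)" for i
   using that cs l ob by (auto simp: nth_with_ends e)
  show "id_mors C as cs ! i \<in> mor C (id_objs as ! i) (id_objs as ! Suc i)"
   if "i < length (id_mors C as cs)" for i
  proof -
   consider "i = 0" | "i = Suc n" | j where "i = Suc j" "j < n"
    using \<open>i < length (id_mors C as cs)\<close> cs(1) by (cases i) (auto simp: less_Suc_eq)
   then show ?thesis
    using cs l ob by cases (auto simp: nth_with_ends e kid_closed)
  qed
 qed (use cs l in simp)
 then show ?thesis using cs l by (auto simp: bar_tuples_def nth_with_ends)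
qed

lemma core_tuple:
 assumes "(os, es) \<in> bar_tuples C y z (Suc (Suc n))"
 shows "core os \<in> obj_tuples C n" "core es \<in> ltuples (hom_list C (core os))"
  and "hd (core os) = os ! 1" "last (core os) = os ! Suc n"
proof -
 note D = bar_tuplesD[OF assms]
 have "set (core os) \<subseteq> kobj C"
  using D path_obj[OF D(1)] by (auto simp: in_set_conv_nth nth_core)
 then show c: "core os \<in> obj_tuples C n" using D by (simp add: obj_tuples_def)
 show "core es \<in> ltuples (hom_list C (core os))"
  using D path_hom[OF D(1)] by (auto simp: hom_list_tuples_iff nth_core)
 show "hd (core os) = os ! 1" "last (core os) = os ! Suc n"
  using D obj_tuples_hd_nth[OF c] obj_tuples_last_nth[OF c] by (auto simp: nth_core)
qed

lemma outer_id_tuple: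
 assumes "(os, es) \<in> bar_tuples C y z (Suc (Suc n))"
 shows "outer_obj y z (id_objs (core os)) = os"
  and "outer_mor C y z (es ! 0) (es ! Suc n) (id_objs (core os)) (id_mors C (core os) (core es)) = es"
proof -
 note D = bar_tuplesD[OF assms] and c = core_tuple[OF assms]
 have ob: "os ! i \<in> kobj C" if "i \<le> Suc (Suc n)" for i using path_obj[OF D(1)] that D by simp
 have ho: "es ! i \<in> mor C (os ! i) (os ! Suc i)" if "i < Suc (Suc n)" for i using path_hom[OF D(1)] that D by simp
 show "outer_obj y z (id_objs (core os)) = os"
  using D by (intro nth_equalityI) (auto simp: nth_outer_obj nth_with_ends nth_core)
 have "kcomp C y (os ! 1) (os ! 1) (es ! 0) (kid C (os ! 1)) = es ! 0"
  using ob[of 0] ob[of 1] ho[of 0] D by (intro kid_right) auto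
 moreover have "kcomp C (os ! Suc n) (os ! Suc n) z (kid C (os ! Suc n)) (es ! Suc n) = es ! Suc n"
  using ob[of "Suc n"] ob[of "Suc (Suc n)"] ho[of "Suc n"] D by (intro kid_left) auto
 ultimately show "outer_mor C y z (es ! 0) (es ! Suc n) (id_objs (core os)) (id_mors C (core os) (core es)) = es"
  using D c(3,4) by (intro nth_equalityI) (auto simp: nth_outer_mor nth_with_ends nth_core)
qed

end

section \<open>Chains and cochains on bar tuples\<close>

context k_bimodule
begin

lemma
 assumes "x \<in> kobj C" "y \<in> kobj C" "z \<in> kobj C"
 shows lact_hom_left: "m \<in> bim M y x \<Longrightarrow> (\<lambda>g. blact M z y x g m) \<in> mod_hom K (khom C z y) (bhom M z x)"
  and lact_hom_right: "g \<in> mor C z y \<Longrightarrow> (\<lambda>m. blact M z y x g m) \<in> mod_hom K (bhom M y x) (bhom M z x)"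
  and ract_hom_left: "f \<in> mor C y x \<Longrightarrow> (\<lambda>m. bract M z y x m f) \<in> mod_hom K (bhom M z y) (bhom M z x)"
  and ract_hom_right: "m' \<in> bim M z y \<Longrightarrow> (\<lambda>f. bract M z y x m' f) \<in> mod_hom K (khom C y x) (bhom M z x)"
 using blact_bilin[OF assms] bract_bilin[OF assms] by (simp_all add: bilin_def)

lemma lact_closed:
 "\<lbrakk>x \<in> kobj C; y \<in> kobj C; z \<in> kobj C; g \<in> mor C z y; m \<in> bim M y x\<rbrakk>
\<Longrightarrow> blact M z y x g m \<in> bim M z x"
 by (rule lin_closed[OF lact_hom_right])

lemma ract_closed:
 "\<lbrakk>x \<in> kobj C; y \<in> kobj C; z \<in> kobj C; m \<in> bim M z y; f \<in> mor C y x\<rbrakk>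
\<Longrightarrow> bract M z y x m f \<in> bim M z x"
 by (rule lin_closed[OF ract_hom_left])

text \<open>
 The tuple \<open>(m; u, c\<^sub>n, \<dots>, c\<^sub>1, v)\<close> stands for the chain \<open>(v m u, c\<^sub>n, \<dots>, c\<^sub>1)\<close>, and it makes
 every face of the latter a composition at an inner object: the two faces that involve the
 coefficient become \<open>u c\<^sub>n\<close> and \<open>c\<^sub>1 v\<close>.
\<close>

definition
 "absorb n m os es = blact M (os ! Suc n) (os ! Suc (Suc n)) (os ! 1) (es ! Suc n)
   (bract M (os ! Suc (Suc n)) (os ! 0) (os ! 1) m (es ! 0))"

definition
 "chain_bar n G m os es = G (core os) (absorb n m os es, core es)"

context
 fixes n y z os es
 assumes t: "(os, es) \<in> bar_tuples C y z (Suc (Suc n))"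
begin

lemma tuple_objs: "i \<le> Suc (Suc n) \<Longrightarrow> os ! i \<in> kobj C"
 using bar_tuplesD[OF t] path_obj[of C os es i] by simp

lemma tuple_homs: "i < Suc (Suc n) \<Longrightarrow> es ! i \<in> mor C (os ! i) (os ! Suc i)"
 using bar_tuplesD[OF t] path_hom[of C os es i] by simp

lemma absorb_hom: "(\<lambda>m. absorb n m os es) \<in> mod_hom K (bhom M z y) (bhom M (last (core os)) (hd (core os)))"
proof -
 note D = bar_tuplesD[OF t]
 have 1: "(\<lambda>m. bract M (os ! Suc (Suc n)) (os ! 0) (os ! 1) m (es ! 0))
   \<in> mod_hom K (bhom M (os ! Suc (Suc n)) (os ! 0)) (bhom M (os ! Suc (Suc n)) (os ! 1))"
  using tuple_homs[of 0] by (intro ract_hom_left tuple_objs) auto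
 have 2: "(\<lambda>m. blact M (os ! Suc n) (os ! Suc (Suc n)) (os ! 1) (es ! Suc n) m)
   \<in> mod_hom K (bhom M (os ! Suc (Suc n)) (os ! 1)) (bhom M (os ! Suc n) (os ! 1))"
  using tuple_homs[of "Suc n"] by (intro lact_hom_right tuple_objs) auto
 show ?thesis using lin_comp[OF 2 1] core_tuple[OF t] D by (simp add: absorb_def)
qed

lemma absorb_closed: "m \<in> bim M z y \<Longrightarrow> absorb n m os es \<in> bim M (last (core os)) (hd (core os))"
 by (rule lin_closed[OF absorb_hom])

lemma chain_bar_param:
 assumes "chain_multilinear K C M n P G"
 shows "(\<lambda>m. chain_bar n G m os es) \<in> mod_hom K (bhom M z y) P"
proof -
 have "(\<lambda>m. G (core os) (m, core es)) \<in> mod_hom K (bhom M (last (core os)) (hd (core os))) P"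
  using assms core_tuple[OF t] by (auto simp: chain_multilinear_def hmultilinear_def)
 from lin_comp[OF this absorb_hom] show ?thesis by (simp add: chain_bar_def)
qed

lemma chain_bar_tuple: "m \<in> bim M z y \<Longrightarrow> (absorb n m os es, core es) \<in> chain_tuples C M (core os)"
 using core_tuple[OF t] absorb_closed by (simp add: chain_tuples_def htuples_def)

end

lemma chain_bar_linear:
 assumes G: "chain_multilinear K C M n P G" and m: "m \<in> bim M z y"
 shows "bar_linear K C P y z (Suc (Suc n)) (chain_bar n G m)"
proof -
 have "chain_bar n G m os es \<in> carrier P" and
  "i < Suc (Suc n) \<longrightarrow> (\<lambda>c. chain_bar n G m os (es[i := c])) \<in> mod_hom K (khom C (os ! i) (os ! Suc i)) P"
  if t: "(os, es) \<in> bar_tuples C y z (Suc (Suc n))" for os es i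
 proof -
  note D = bar_tuplesD[OF t] and core = core_tuple[OF t]
  note ob = tuple_objs[OF t] and ho = tuple_homs[OF t]
  show "chain_bar n G m os es \<in> carrier P" by (rule lin_closed[OF chain_bar_param[OF t G] m])
  have Gm: "(\<lambda>m. G (core os) (m, core es)) \<in> mod_hom K (bhom M (os ! Suc n) (os ! 1)) P"
   using G core by (auto simp: chain_multilinear_def hmultilinear_def)
  have Gc: "(\<lambda>c. G (core os) (absorb n m os es, (core es)[i := c])) \<in> mod_hom K (khom C (core os ! i) (core os ! Suc i)) P" if "i < n" for i
   using G core absorb_closed[OF t m] that obj_tuples_length[OF core(1)]
   by (auto simp: chain_multilinear_def hmultilinear_def multilinear_def)
  show "i < Suc (Suc n) \<longrightarrow> (\<lambda>c. chain_bar n G m os (es[i := c])) \<in> mod_hom K (khom C (os ! i) (os ! Suc i)) P"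
  proof
   assume i: "i < Suc (Suc n)"
   consider "i = 0" | "i = Suc n" | j where "i = Suc j" "j < n" using i by (cases i) (auto simp: less_Suc_eq)
   then show "(\<lambda>c. chain_bar n G m os (es[i := c])) \<in> mod_hom K (khom C (os ! i) (os ! Suc i)) P"
   proof cases
    case 1
    have r: "(\<lambda>c. bract M (os ! Suc (Suc n)) (os ! 0) (os ! 1) m c) \<in> mod_hom K (khom C (os ! 0) (os ! 1)) (bhom M (os ! Suc (Suc n)) (os ! 1))"
     using m D by (intro ract_hom_right ob) auto
    have l: "(\<lambda>m. blact M (os ! Suc n) (os ! Suc (Suc n)) (os ! 1) (es ! Suc n) m) \<in> mod_hom K (bhom M (os ! Suc (Suc n)) (os ! 1)) (bhom M (os ! Suc n) (os ! 1))"
     using ho[of "Suc n"] by (intro lact_hom_right ob) auto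
    show ?thesis using lin_comp[OF Gm lin_comp[OF l r]] D 1
     by (simp add: chain_bar_def absorb_def core_update)
   next
    case 2
    have mu: "bract M (os ! Suc (Suc n)) (os ! 0) (os ! 1) m (es ! 0) \<in> bim M (os ! Suc (Suc n)) (os ! 1)"
     using m D ho[of 0] by (intro ract_closed ob) auto
    have l: "(\<lambda>c. blact M (os ! Suc n) (os ! Suc (Suc n)) (os ! 1) c (bract M (os ! Suc (Suc n)) (os ! 0) (os ! 1) m (es ! 0)))
      \<in> mod_hom K (khom C (os ! Suc n) (os ! Suc (Suc n))) (bhom M (os ! Suc n) (os ! 1))"
     using mu by (intro lact_hom_left ob) auto
    show ?thesis using lin_comp[OF Gm l] D 2
     by (simp add: chain_bar_def absorb_def core_update)
   next
    case 3
    then show ?thesis using Gc[of j] D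
     by (simp add: chain_bar_def absorb_def core_update nth_core)
   qed
  qed
 qed
 then show ?thesis by (auto simp: bar_linear_def)
qed

lemma chain_bar_id:
 assumes as: "as \<in> obj_tuples C n" and t: "(m, cs) \<in> chain_tuples C M as"
 shows "chain_bar n G m (id_objs as) (id_mors C as cs) = G as (m, cs)"
proof -
 have cs: "length cs = n" using t obj_tuples_length[OF as] by (auto simp: chain_tuples_def htuples_def hom_list_tuples_iff)
 have m: "m \<in> bim M (last as) (hd as)" using t by (auto simp: chain_tuples_def htuples_def)
 note ob = obj_tuples_hd[OF as] obj_tuples_last[OF as] and l = obj_tuples_length[OF as]
 note e = obj_tuples_hd_nth[OF as] obj_tuples_last_nth[OF as]
 have "absorb n m (id_objs as) (id_mors C as cs) = m"
  using m ob cs l by (simp add: absorb_def nth_with_ends bract_kid blact_kid flip: e)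
 then show ?thesis by (simp add: chain_bar_def)
qed

lemma chain_bar_outer:
 assumes t: "(os, es) \<in> bar_tuples C y z (Suc (Suc n))" and y': "y' \<in> kobj C" "z' \<in> kobj C"
  and uv: "u \<in> mor C y' y" "v \<in> mor C z z'" and m: "m \<in> bim M z' y'"
 shows "chain_bar n G m (outer_obj y' z' os) (outer_mor C y' z' u v os es)
  = chain_bar n G (blact M z z' y v (bract M z' y' y m u)) os es"
proof -
 note D = bar_tuplesD[OF t] and ob = tuple_objs[OF t] and ho = tuple_homs[OF t]
 have yz: "y \<in> kobj C" "z \<in> kobj C" "os ! 1 \<in> kobj C" "os ! Suc n \<in> kobj C"
  using ob[of 0] ob[of "Suc (Suc n)"] ob[of 1] ob[of "Suc n"] D by auto
 have u0: "es ! 0 \<in> mor C y (os ! 1)" and vn: "es ! Suc n \<in> mor C (os ! Suc n) z"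
  using ho[of 0] ho[of "Suc n"] D by auto
 have mu: "bract M z' y' y m u \<in> bim M z' y" using m uv y' yz by (intro ract_closed)
 have muu: "bract M z' y (os ! 1) (bract M z' y' y m u) (es ! 0) \<in> bim M z' (os ! 1)"
  using m uv u0 y' yz by (intro ract_closed)
 have "blact M (os ! Suc n) z' (os ! 1) (kcomp C (os ! Suc n) z z' (es ! Suc n) v)
   (bract M z' y' (os ! 1) m (kcomp C y' y (os ! 1) u (es ! 0)))
  = blact M (os ! Suc n) z' (os ! 1) (kcomp C (os ! Suc n) z z' (es ! Suc n) v)
    (bract M z' y (os ! 1) (bract M z' y' y m u) (es ! 0))"
  using m uv u0 y' yz by (simp add: bract_assoc)
 also have "\<dots> = blact M (os ! Suc n) z (os ! 1) (es ! Suc n)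
   (blact M z z' (os ! 1) v (bract M z' y (os ! 1) (bract M z' y' y m u) (es ! 0)))"
  using muu uv vn y' yz by (simp add: blact_assoc)
 also have "blact M z z' (os ! 1) v (bract M z' y (os ! 1) (bract M z' y' y m u) (es ! 0))
   = bract M z y (os ! 1) (blact M z z' y v (bract M z' y' y m u)) (es ! 0)"
  using mu uv u0 y' yz by (intro blact_bract) auto
 finally have co: "absorb n m (outer_obj y' z' os) (outer_mor C y' z' u v os es)
   = absorb n (blact M z z' y v (bract M z' y' y m u)) os es"
  using D by (simp add: absorb_def nth_outer_obj nth_outer_mor)
 have "core (outer_obj y' z' os) = core os" "core (outer_mor C y' z' u v os es) = core es"
  using D by (auto intro!: nth_equalityI simp: nth_core nth_outer_obj nth_outer_mor)
 then show ?thesis by (simp add: chain_bar_def co)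
qed

text \<open>The first and the last composition of the bar tuple take an entry of the tuple into the
 coefficient, which is what the two outer faces do.\<close>

lemma chain_bar_face:
 assumes t: "(os, es) \<in> bar_tuples C y z (Suc (Suc (Suc n)))" and q: "q \<le> Suc n" and m: "m \<in> bim M z y"
 shows "bface C q (chain_bar n G m) os es
  = chain_bar (Suc n) (\<lambda>as t. G (drop_obj q as) (hm_face C M (Suc n) as q t)) m os es"
proof -
 note D = bar_tuplesD[OF t] and ob = tuple_objs[OF t] and ho = tuple_homs[OF t] and core = core_tuple[OF t]
 let ?N = "Suc (Suc n)" and ?L = "Suc (Suc (Suc n))"
 have cd: "core (drop_obj (Suc q) os) = drop_obj q (core os)" using q D by (intro core_drop) auto
 have o: "os ! 0 \<in> kobj C" "os ! 1 \<in> kobj C" "os ! 2 \<in> kobj C" "os ! Suc n \<in> kobj C" "os ! ?N \<in> kobj C" "os ! ?L \<in> kobj C"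
  using ob[of 0] ob[of 1] ob[of 2] ob[of "Suc n"] ob[of ?N] ob[of ?L] by auto
 have h: "es ! 0 \<in> mor C (os ! 0) (os ! 1)" "es ! 1 \<in> mor C (os ! 1) (os ! 2)"
  "es ! Suc n \<in> mor C (os ! Suc n) (os ! ?N)" "es ! ?N \<in> mor C (os ! ?N) (os ! ?L)"
  using ho[of 0] ho[of 1] ho[of "Suc n"] ho[of ?N] by (auto simp: numeral_2_eq_2)
 have m': "m \<in> bim M (os ! ?L) (os ! 0)" using m D by simp
 have hd: "hd (core es) = es ! 1" and last: "last (core es) = es ! Suc n"
  using D by (auto simp: hd_conv_nth last_conv_nth nth_core simp flip: length_0_conv)
 consider "q = 0" | "q = Suc n" | p where "q = Suc p" "p < n" using q by (cases q) (auto simp: less_Suc_eq le_less)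
 then show ?thesis
 proof cases
  case 1
  have mu: "bract M (os ! ?L) (os ! 0) (os ! 1) m (es ! 0) \<in> bim M (os ! ?L) (os ! 1)"
   using m' h o by (intro ract_closed)
  have "bract M (os ! ?L) (os ! 0) (os ! 2) m (kcomp C (os ! 0) (os ! 1) (os ! 2) (es ! 0) (es ! 1))
    = bract M (os ! ?L) (os ! 1) (os ! 2) (bract M (os ! ?L) (os ! 0) (os ! 1) m (es ! 0)) (es ! 1)"
   using m' h o by (intro bract_assoc[symmetric])
  then have "absorb n m (drop_obj 1 os) (merge_at C os 1 es) = bract M (os ! ?N) (os ! 1) (os ! 2) (absorb (Suc n) m os es) (es ! 1)"
   using D blact_bract[OF o(3,2,6,5) h(4) mu h(2)] nth_merge_at[of 0 es _ C os]
   by (simp add: absorb_def nth_drop_obj numeral_2_eq_2)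
  moreover have "core (merge_at C os 1 es) = tl (core es)"
   using D nth_merge_at[of 0 es _ C os] length_merge_at[of 0 es C os]
   by (intro nth_equalityI) (auto simp: nth_core nth_tl)
  ultimately show ?thesis
   using 1 cd core D hd by (simp add: bface_def chain_bar_def hm_face_def nth_core numeral_2_eq_2)
 next
  case 2
  have mu: "bract M (os ! ?L) (os ! 0) (os ! 1) m (es ! 0) \<in> bim M (os ! ?L) (os ! 1)"
   using m' h o by (intro ract_closed)
  have "absorb n m (drop_obj ?N os) (merge_at C os ?N es) = blact M (os ! Suc n) (os ! ?N) (os ! 1) (es ! Suc n) (absorb (Suc n) m os es)"
   using D blact_assoc[OF o(2,6,5,4) h(3,4) mu] by (simp add: absorb_def nth_drop_obj nth_merge_at)
  moreover have "core (merge_at C os ?N es) = butlast (core es)"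
   using D by (intro nth_equalityI) (auto simp: nth_core nth_butlast nth_merge_at)
  ultimately show ?thesis
   using 2 cd core D last by (simp add: bface_def chain_bar_def hm_face_def nth_core)
 next
  case 3
  have "absorb n m (drop_obj (Suc q) os) (merge_at C os (Suc q) es) = absorb (Suc n) m os es"
   using D 3 by (simp add: absorb_def nth_drop_obj nth_merge_at)
  moreover have "core (merge_at C os (Suc q) es) = merge_at C (core os) q (core es)"
   using D 3 by (intro nth_equalityI) (auto simp: nth_core nth_merge_at)
  ultimately show ?thesis
   using 3 cd by (simp add: bface_def chain_bar_def hm_face_def)
 qed
qed

text \<open>The cochain \<open>g\<close> is evaluated at \<open>(u, c\<^sub>n, \<dots>, c\<^sub>1, v)\<close> as \<open>u g(c\<^sub>n, \<dots>, c\<^sub>1) v\<close>; again all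
 terms of the coboundary become compositions at inner objects.\<close>

definition
 "wrap n m os es = blact M (os ! 0) (os ! 1) (os ! Suc (Suc n)) (es ! 0)
   (bract M (os ! 1) (os ! Suc n) (os ! Suc (Suc n)) m (es ! Suc n))"

definition
 "cochain_bar n g os es = wrap n (g (core os) (core es)) os es"

lemma wrap_hom:
 assumes t: "(os, es) \<in> bar_tuples C y z (Suc (Suc n))"
 shows "(\<lambda>m. wrap n m os es) \<in> mod_hom K (bhom M (hd (core os)) (last (core os))) (bhom M y z)"
proof -
 note D = bar_tuplesD[OF t] and ob = tuple_objs[OF t] and ho = tuple_homs[OF t]
 have 1: "(\<lambda>m. bract M (os ! 1) (os ! Suc n) (os ! Suc (Suc n)) m (es ! Suc n))
   \<in> mod_hom K (bhom M (os ! 1) (os ! Suc n)) (bhom M (os ! 1) (os ! Suc (Suc n)))"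
  using ho[of "Suc n"] by (intro ract_hom_left ob) auto
 have 2: "(\<lambda>m. blact M (os ! 0) (os ! 1) (os ! Suc (Suc n)) (es ! 0) m)
   \<in> mod_hom K (bhom M (os ! 1) (os ! Suc (Suc n))) (bhom M (os ! 0) (os ! Suc (Suc n)))"
  using ho[of 0] by (intro lact_hom_right ob) auto
 show ?thesis using lin_comp[OF 2 1] core_tuple[OF t] D by (simp add: wrap_def)
qed

lemma cochain_bar_linear:
 assumes g: "cochain_multilinear K C M n g" and yz: "y \<in> kobj C" "z \<in> kobj C"
 shows "bar_linear K C (bhom M y z) y z (Suc (Suc n)) (cochain_bar n g)"
proof -
 have "cochain_bar n g os es \<in> bim M y z" and
  "i < Suc (Suc n) \<longrightarrow> (\<lambda>c. cochain_bar n g os (es[i := c])) \<in> mod_hom K (khom C (os ! i) (os ! Suc i)) (bhom M y z)"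
  if t: "(os, es) \<in> bar_tuples C y z (Suc (Suc n))" for os es i
 proof -
  note D = bar_tuplesD[OF t] and core = core_tuple[OF t]
  note ob = tuple_objs[OF t] and ho = tuple_homs[OF t]
  have gc: "g (core os) (core es) \<in> bim M (os ! 1) (os ! Suc n)"
   using g core by (auto simp: cochain_multilinear_def multilinear_def)
  show "cochain_bar n g os es \<in> bim M y z"
   unfolding cochain_bar_def using gc core by (intro lin_closed[OF wrap_hom[OF t]]) simp
  have Gc: "(\<lambda>c. g (core os) ((core es)[i := c])) \<in> mod_hom K (khom C (core os ! i) (core os ! Suc i)) (bhom M (hd (core os)) (last (core os)))" if "i < n" for i
   using g core that obj_tuples_length[OF core(1)]
   by (auto simp: cochain_multilinear_def multilinear_def)
  have mv: "bract M (os ! 1) (os ! Suc n) (os ! Suc (Suc n)) (g (core os) (core es)) (es ! Suc n) \<in> bim M (os ! 1) (os ! Suc (Suc n))"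
   using gc ho[of "Suc n"] by (intro ract_closed ob) auto
  show "i < Suc (Suc n) \<longrightarrow> (\<lambda>c. cochain_bar n g os (es[i := c])) \<in> mod_hom K (khom C (os ! i) (os ! Suc i)) (bhom M y z)"
  proof
   assume i: "i < Suc (Suc n)"
   consider "i = 0" | "i = Suc n" | j where "i = Suc j" "j < n" using i by (cases i) (auto simp: less_Suc_eq)
   then show "(\<lambda>c. cochain_bar n g os (es[i := c])) \<in> mod_hom K (khom C (os ! i) (os ! Suc i)) (bhom M y z)"
   proof cases
    case 1
    have "(\<lambda>c. blact M (os ! 0) (os ! 1) (os ! Suc (Suc n)) c (bract M (os ! 1) (os ! Suc n) (os ! Suc (Suc n)) (g (core os) (core es)) (es ! Suc n)))
      \<in> mod_hom K (khom C (os ! 0) (os ! 1)) (bhom M (os ! 0) (os ! Suc (Suc n)))"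
     using mv by (intro lact_hom_left ob) auto
    then show ?thesis using D 1 by (simp add: cochain_bar_def wrap_def core_update)
   next
    case 2
    have r: "(\<lambda>c. bract M (os ! 1) (os ! Suc n) (os ! Suc (Suc n)) (g (core os) (core es)) c) \<in> mod_hom K (khom C (os ! Suc n) (os ! Suc (Suc n))) (bhom M (os ! 1) (os ! Suc (Suc n)))"
     using gc by (intro ract_hom_right ob) auto
    have l: "(\<lambda>m. blact M (os ! 0) (os ! 1) (os ! Suc (Suc n)) (es ! 0) m) \<in> mod_hom K (bhom M (os ! 1) (os ! Suc (Suc n))) (bhom M (os ! 0) (os ! Suc (Suc n)))"
     using ho[of 0] by (intro lact_hom_right ob) auto
    show ?thesis using lin_comp[OF l r] D 2 by (simp add: cochain_bar_def wrap_def core_update)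
   next
    case 3
    then show ?thesis using lin_comp[OF wrap_hom[OF t] Gc[of j]] D
     by (simp add: cochain_bar_def wrap_def core_update nth_core)
   qed
  qed
 qed
 then show ?thesis by (auto simp: bar_linear_def)
qed

lemma cochain_bar_id:
 assumes as: "as \<in> obj_tuples C n" and cs: "cs \<in> ltuples (hom_list C as)" and g: "g as cs \<in> bim M (hd as) (last as)"
 shows "cochain_bar n g (id_objs as) (id_mors C as cs) = g as cs"
proof -
 have l: "length cs = n" using cs obj_tuples_length[OF as] by (auto simp: hom_list_tuples_iff)
 note ob = obj_tuples_hd[OF as] obj_tuples_last[OF as] and l' = obj_tuples_length[OF as]
 note e = obj_tuples_hd_nth[OF as] obj_tuples_last_nth[OF as]
 show ?thesis
  using g ob l l' by (simp add: cochain_bar_def wrap_def nth_with_ends bract_kid blact_kid flip: e)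
qed

lemma cochain_bar_outer:
 assumes t: "(os, es) \<in> bar_tuples C y z (Suc (Suc n))" and y': "y' \<in> kobj C" "z' \<in> kobj C"
  and uv: "u \<in> mor C y' y" "v \<in> mor C z z'" and g: "cochain_multilinear K C M n g"
 shows "cochain_bar n g (outer_obj y' z' os) (outer_mor C y' z' u v os es)
  = blact M y' y z' u (bract M y z z' (cochain_bar n g os es) v)"
proof -
 note D = bar_tuplesD[OF t] and ob = tuple_objs[OF t] and ho = tuple_homs[OF t] and core = core_tuple[OF t]
 have yz: "y \<in> kobj C" "z \<in> kobj C" "os ! 1 \<in> kobj C" "os ! Suc n \<in> kobj C"
  using ob[of 0] ob[of "Suc (Suc n)"] ob[of 1] ob[of "Suc n"] D by auto
 have u0: "es ! 0 \<in> mor C y (os ! 1)" and vn: "es ! Suc n \<in> mor C (os ! Suc n) z"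
  using ho[of 0] ho[of "Suc n"] D by auto
 let ?g = "g (core os) (core es)"
 have gc: "?g \<in> bim M (os ! 1) (os ! Suc n)"
  using g core by (auto simp: cochain_multilinear_def multilinear_def)
 have gv: "bract M (os ! 1) (os ! Suc n) z ?g (es ! Suc n) \<in> bim M (os ! 1) z"
  using gc vn yz by (intro ract_closed)
 have gvv: "bract M (os ! 1) z z' (bract M (os ! 1) (os ! Suc n) z ?g (es ! Suc n)) v \<in> bim M (os ! 1) z'"
  using gc vn uv yz y' by (intro ract_closed)
 have "bract M (os ! 1) (os ! Suc n) z' ?g (kcomp C (os ! Suc n) z z' (es ! Suc n) v)
   = bract M (os ! 1) z z' (bract M (os ! 1) (os ! Suc n) z ?g (es ! Suc n)) v"
  using gc vn uv yz y' by (intro bract_assoc[symmetric])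
 moreover have "blact M y' (os ! 1) z' (kcomp C y' y (os ! 1) u (es ! 0)) (bract M (os ! 1) z z' (bract M (os ! 1) (os ! Suc n) z ?g (es ! Suc n)) v)
   = blact M y' y z' u (blact M y (os ! 1) z' (es ! 0) (bract M (os ! 1) z z' (bract M (os ! 1) (os ! Suc n) z ?g (es ! Suc n)) v))"
  using gvv u0 uv yz y' by (intro blact_assoc[symmetric])
 moreover have "blact M y (os ! 1) z' (es ! 0) (bract M (os ! 1) z z' (bract M (os ! 1) (os ! Suc n) z ?g (es ! Suc n)) v)
   = bract M y z z' (blact M y (os ! 1) z (es ! 0) (bract M (os ! 1) (os ! Suc n) z ?g (es ! Suc n))) v"
  using gv u0 uv yz y' by (intro blact_bract)
 moreover have "core (outer_obj y' z' os) = core os" "core (outer_mor C y' z' u v os es) = core es"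
  using D by (auto intro!: nth_equalityI simp: nth_core nth_outer_obj nth_outer_mor)
 ultimately show ?thesis
  using D by (simp add: cochain_bar_def wrap_def nth_outer_obj nth_outer_mor)
qed

end

section \<open>The homotopy on chains\<close>

lemma chain_multilinear_cong:
 assumes "k_bimodule K C M" "chain_multilinear K C M n P G"
  and eq: "\<And>as t. as \<in> obj_tuples C n \<Longrightarrow> t \<in> chain_tuples C M as \<Longrightarrow> G' as t = G as t"
 shows "chain_multilinear K C M n P G'"
proof -
 interpret k_bimodule K C M by fact
 show ?thesis unfolding chain_multilinear_def
 proof
  fix as assume as: "as \<in> obj_tuples C n"
  interpret htensor_factors K "hom_list C as" "bhom M (last as) (hd as)" by (rule summand_factors[OF as])
  have G: "hmultilinear K (bhom M (last as) (hd as)) (hom_list C as) P (G as)"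
   using assms(2) as by (simp add: chain_multilinear_def)
  have eq': "G' as (m, cs) = G as (m, cs)" if "m \<in> bim M (last as) (hd as)" "cs \<in> ltuples (hom_list C as)" for m cs
   using that by (intro eq[OF as]) (auto simp: chain_tuples_def htuples_def)
  show "hmultilinear K (bhom M (last as) (hd as)) (hom_list C as) P (G' as)"
   unfolding hmultilinear_def multilinear_def
  proof (intro conjI ballI allI impI)
   fix cs assume cs: "cs \<in> ltuples (hom_list C as)"
   show "(\<lambda>v. G' as (v, cs)) \<in> mod_hom K (bhom M (last as) (hd as)) P"
    by (rule lin_cong[OF head_module eq'[OF _ cs]]) (use G cs in \<open>auto simp: hmultilinear_def\<close>)
  next
   fix m cs assume m: "m \<in> bim M (last as) (hd as)" and cs: "cs \<in> ltuples (hom_list C as)"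
   show "G' as (m, cs) \<in> carrier P"
    using G m cs eq'[OF m cs] by (auto simp: hmultilinear_def multilinear_def)
   fix i assume i: "i < length (hom_list C as)"
   show "(\<lambda>w. G' as (m, cs[i := w])) \<in> mod_hom K (hom_list C as ! i) P"
    by (rule lin_cong[OF factor_module[OF i] eq'[OF m ltuples_update[OF cs]]])
     (use G m cs i in \<open>auto simp: hmultilinear_def multilinear_def\<close>)
  qed
 qed
qed

lemma (in k_category) outer_merge:
 assumes "path C os es" "Suc q < length es" "3 \<le> length es" "y \<in> kobj C" "z \<in> kobj C"
  and "u \<in> mor C y (os ! 0)" "v \<in> mor C (os ! length es) z"
 shows "outer_obj y z (drop_obj (Suc q) os) = drop_obj (Suc q) (outer_obj y z os)"
  and "outer_mor C y z u v (drop_obj (Suc q) os) (merge_at C os (Suc q) es)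
   = merge_at C (outer_obj y z os) (Suc q) (outer_mor C y z u v os es)"
proof -
 note P = path_obj[OF assms(1)] path_hom[OF assms(1)] path_length[OF assms(1)]
 show "outer_obj y z (drop_obj (Suc q) os) = drop_obj (Suc q) (outer_obj y z os)"
  using assms(2,3) P(3) by (intro nth_equalityI) (auto simp: nth_outer_obj nth_drop_obj)
 show "outer_mor C y z u v (drop_obj (Suc q) os) (merge_at C os (Suc q) es)
   = merge_at C (outer_obj y z os) (Suc q) (outer_mor C y z u v os es)"
 proof (rule nth_equalityI)
  show "length (outer_mor C y z u v (drop_obj (Suc q) os) (merge_at C os (Suc q) es))
    = length (merge_at C (outer_obj y z os) (Suc q) (outer_mor C y z u v os es))" using assms(2) by simp
  fix i assume i: "i < length (outer_mor C y z u v (drop_obj (Suc q) os) (merge_at C os (Suc q) es))"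
  have n: "0 < length es" "1 < length es" using assms(3) by auto
  have first: "kcomp C y (os ! 0) (os ! 2) u (kcomp C (os ! 0) (os ! 1) (os ! 2) (es ! 0) (es ! 1))
    = kcomp C y (os ! 1) (os ! 2) (kcomp C y (os ! 0) (os ! 1) u (es ! 0)) (es ! 1)"
   using assms P(2)[OF n(1)] P(2)[OF n(2)] by (intro kcomp_assoc P(1)) (auto simp: numeral_2_eq_2)
  have last: "kcomp C (os ! q) (os ! Suc (Suc q)) z (kcomp C (os ! q) (os ! Suc q) (os ! Suc (Suc q)) (es ! q) (es ! Suc q)) v
    = kcomp C (os ! q) (os ! Suc q) z (es ! q) (kcomp C (os ! Suc q) (os ! Suc (Suc q)) z (es ! Suc q) v)" if "length es = Suc (Suc q)"
   using that assms P(2)[of q] P(2)[of "Suc q"] by (intro kcomp_assoc[symmetric] P(1)) auto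
  obtain l where "length es = 3 + l" using le_Suc_ex[OF assms(3)] by auto
  then have l: "length es = Suc (Suc (Suc l))" by simp
  have lo: "length os = Suc (Suc (Suc (Suc l)))" using P(3) l by simp
  have i': "i < Suc (Suc l)" using i l assms(2) by simp
  have ql: "q < Suc (Suc l)" using assms(2) l by simp
  have lm: "length (merge_at C os (Suc q) es) = Suc (Suc l)" using ql l by simp
  have m0: "merge_at C os (Suc q) es ! j = (if j < q then es ! j
    else if j = q then kcomp C (os ! q) (os ! Suc q) (os ! Suc (Suc q)) (es ! q) (es ! Suc q) else es ! Suc j)"
   if "j < Suc (Suc l)" for j
   using that ql l by (intro nth_merge_at) auto
  have d: "drop_obj (Suc q) os ! j = (if j < Suc q then os ! j else os ! Suc j)" if "j < Suc (Suc (Suc l))" for j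
   using that ql lo by (intro nth_drop_obj) auto
  have lhs: "outer_mor C y z u v (drop_obj (Suc q) os) (merge_at C os (Suc q) es) ! i =
   (if i = 0 then kcomp C y (drop_obj (Suc q) os ! 0) (drop_obj (Suc q) os ! 1) u (merge_at C os (Suc q) es ! 0)
    else if i = Suc l then kcomp C (drop_obj (Suc q) os ! i) (drop_obj (Suc q) os ! Suc i) z (merge_at C os (Suc q) es ! i) v
    else merge_at C os (Suc q) es ! i)"
   using i' lm by (simp add: nth_outer_mor)
  have rhs: "merge_at C (outer_obj y z os) (Suc q) (outer_mor C y z u v os es) ! i =
   (if i < q then outer_mor C y z u v os es ! i
    else if i = q then kcomp C (outer_obj y z os ! q) (outer_obj y z os ! Suc q) (outer_obj y z os ! Suc (Suc q))
     (outer_mor C y z u v os es ! q) (outer_mor C y z u v os es ! Suc q)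
    else outer_mor C y z u v os es ! Suc i)"
   using i' ql l by (intro nth_merge_at) auto
  have om: "outer_mor C y z u v os es ! j = (if j = 0 then kcomp C y (os ! 0) (os ! 1) u (es ! 0)
    else if j = Suc (Suc l) then kcomp C (os ! j) (os ! Suc j) z (es ! j) v else es ! j)" if "j < Suc (Suc (Suc l))" for j
   using that l by (simp add: nth_outer_mor)
  have oo: "outer_obj y z os ! j = (if j = 0 then y else if j = Suc (Suc (Suc l)) then z else os ! j)" if "j < Suc (Suc (Suc (Suc l)))" for j
   using that lo by (simp add: nth_outer_obj)
  consider "q = 0" | "q = Suc l" | "0 < q" "q < Suc l" using ql by linarith
  then show "outer_mor C y z u v (drop_obj (Suc q) os) (merge_at C os (Suc q) es) ! i
    = merge_at C (outer_obj y z os) (Suc q) (outer_mor C y z u v os es) ! i"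
  proof cases
   case 1
   then show ?thesis using i' first
    unfolding lhs rhs by (auto simp: m0[unfolded 1] d[unfolded 1] om oo numeral_2_eq_2)
  next
   case 2
   have "i < Suc l \<or> i = Suc l" using i' by linarith
   then show ?thesis using last l
    unfolding lhs rhs by (elim disjE) (simp_all add: m0[unfolded 2] d[unfolded 2] om oo 2)
  next
   case 3
   then show ?thesis using i' unfolding lhs rhs by (auto simp: m0 d om oo)
  qed
 qed
qed

context k_bimodule
begin

lemma chain_multilinear_of_bar:
 assumes lin: "\<And>y z m. \<lbrakk>y \<in> kobj C; z \<in> kobj C; m \<in> bim M z y\<rbrakk> \<Longrightarrow> bar_linear K C P y z (Suc (Suc n)) (\<Phi> m)"
  and param: "\<And>y z os es. \<lbrakk>y \<in> kobj C; z \<in> kobj C; (os, es) \<in> bar_tuples C y z (Suc (Suc n))\<rbrakk>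
\<Longrightarrow> (\<lambda>m. \<Phi> m os es) \<in> mod_hom K (bhom M z y) P"
 shows "chain_multilinear K C M n P (\<lambda>as t. \<Phi> (fst t) (id_objs as) (id_mors C as (snd t)))"
 unfolding chain_multilinear_def hmultilinear_def multilinear_def
proof (intro conjI ballI allI impI; simp only: fst_conv snd_conv)
 fix as cs assume as: "as \<in> obj_tuples C n" and cs: "cs \<in> ltuples (hom_list C as)"
 note ob = obj_tuples_hd[OF as] obj_tuples_last[OF as] and t = id_tuple[OF as cs]
 note len = obj_tuples_length[OF as]
 have lcs: "length cs = n" using cs len by (simp add: hom_list_tuples_iff)
 show "(\<lambda>v. \<Phi> v (id_objs as) (id_mors C as cs)) \<in> mod_hom K (bhom M (last as) (hd as)) P"
  by (rule param[OF ob t])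
 fix m assume m: "m \<in> bim M (last as) (hd as)"
 note L = lin[OF ob m, unfolded bar_linear_def, rule_format, OF t, simplified]
 show "\<Phi> m (id_objs as) (id_mors C as cs) \<in> carrier P" using L by simp
 fix i assume i: "i < length (hom_list C as)"
 have "id_mors C as (cs[i := c]) = (id_mors C as cs)[Suc i := c]" for c
  using i len lcs by (simp add: with_ends_def list_update_append)
 then show "(\<lambda>w. \<Phi> m (id_objs as) (id_mors C as (cs[i := w]))) \<in> mod_hom K (hom_list C as ! i) P"
  using conjunct2[OF L, rule_format, of "Suc i"] i len by (auto simp: nth_with_ends)
qed

text \<open>An operator that is defined on the tuples with identities at the ends is given by the same
 formula on all bar tuples, provided that the formula allows the outer morphisms to be moved into the
 coefficient.\<close>

lemma chain_lift_bar:
 assumes P: "module K P"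
  and lin: "\<And>y z m. \<lbrakk>y \<in> kobj C; z \<in> kobj C; m \<in> bim M z y\<rbrakk> \<Longrightarrow> bar_linear K C P y z (Suc (Suc n)) (\<Phi> m)"
  and param: "\<And>y z os es. \<lbrakk>y \<in> kobj C; z \<in> kobj C; (os, es) \<in> bar_tuples C y z (Suc (Suc n))\<rbrakk>
\<Longrightarrow> (\<lambda>m. \<Phi> m os es) \<in> mod_hom K (bhom M z y) P"
  and outer: "\<And>y z y' z' u v m os es. \<lbrakk>y \<in> kobj C; z \<in> kobj C; y' \<in> kobj C; z' \<in> kobj C; (os, es) \<in> bar_tuples C y z (Suc (Suc n));
u \<in> mor C y' y; v \<in> mor C z z'; m \<in> bim M z' y'\<rbrakk>
\<Longrightarrow> \<Phi> m (outer_obj y' z' os) (outer_mor C y' z' u v os es) = \<Phi> (blact M z z' y v (bract M z' y' y m u)) os es"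
  and t: "(os, es) \<in> bar_tuples C y z (Suc (Suc n))" and m: "m \<in> bim M z y"
 shows "chain_lift K C M n P (\<lambda>as t. \<Phi> (fst t) (id_objs as) (id_mors C as (snd t))) (chain_bar n (hm_pure K C M n) m os es) = \<Phi> m os es"
proof -
 note D = bar_tuplesD[OF t] and core = core_tuple[OF t] and ob = tuple_objs[OF t] and ho = tuple_homs[OF t]
 have "chain_lift K C M n P (\<lambda>as t. \<Phi> (fst t) (id_objs as) (id_mors C as (snd t))) (chain_bar n (hm_pure K C M n) m os es)
   = \<Phi> (absorb n m os es) (id_objs (core os)) (id_mors C (core os) (core es))"
  unfolding chain_bar_def
  by (subst chain_lift_pure[OF P chain_multilinear_of_bar[OF lin param] core(1) chain_bar_tuple[OF t m]]) auto
 also have "absorb n m os es = blact M (last (core os)) z (hd (core os)) (es ! Suc n) (bract M z y (hd (core os)) m (es ! 0))"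
  using D core by (simp add: absorb_def)
 also have "\<Phi> \<dots> (id_objs (core os)) (id_mors C (core os) (core es))
   = \<Phi> m (outer_obj y z (id_objs (core os))) (outer_mor C y z (es ! 0) (es ! Suc n) (id_objs (core os)) (id_mors C (core os) (core es)))"
  by (rule outer[OF _ _ _ _ id_tuple[OF core(1,2)], symmetric])
   (use m D core ob[of 0] ob[of 1] ob[of "Suc n"] ob[of "Suc (Suc n)"] ho[of 0] ho[of "Suc n"] in auto)
 also have "\<dots> = \<Phi> m os es" by (simp only: outer_id_tuple[OF t])
 finally show ?thesis .
qed

text \<open>Every chain is a combination of chains of the form \<open>chain_bar\<close>, so identities between linear
 maps may be checked on the latter.\<close>

lemma chain_hom_ext_bar:
 assumes "module K P" "g \<in> mod_hom K (hm_chain K C M n) P" "h \<in> mod_hom K (hm_chain K C M n) P"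
  and eq: "\<And>y z m os es. \<lbrakk>y \<in> kobj C; z \<in> kobj C; m \<in> bim M z y; (os, es) \<in> bar_tuples C y z (Suc (Suc n))\<rbrakk>
\<Longrightarrow> g (chain_bar n (hm_pure K C M n) m os es) = h (chain_bar n (hm_pure K C M n) m os es)"
  and "w \<in> carrier (hm_chain K C M n)"
 shows "g w = h w"
proof (rule chain_hom_ext[OF assms(1-3) _ assms(5)])
 fix as t assume as: "as \<in> obj_tuples C n" and t: "t \<in> chain_tuples C M as"
 obtain m cs where mcs: "t = (m, cs)" by (cases t)
 have m: "m \<in> bim M (last as) (hd as)" and cs: "cs \<in> ltuples (hom_list C as)"
  using t mcs by (auto simp: chain_tuples_def htuples_def)
 have "chain_bar n (hm_pure K C M n) m (id_objs as) (id_mors C as cs) = hm_pure K C M n as (m, cs)"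
  by (rule chain_bar_id[OF as]) (use t mcs in simp)
 then show "g (hm_pure K C M n as t) = h (hm_pure K C M n as t)"
  using eq[OF obj_tuples_hd[OF as] obj_tuples_last[OF as] m id_tuple[OF as cs]] mcs by metis
qed

lemma ksign_in [simp]: "ksign K i \<in> carrier K"
 by (simp add: ksign_def)

lemma boundary_eq_lift:
 "hm_boundary K C M (Suc n) = chain_lift K C M (Suc n) (hm_chain K C M n)
   (\<lambda>as t. \<Oplus>\<^bsub>hm_chain K C M n\<^esub> i \<in> {0..Suc n}. ksign K i \<odot>\<^bsub>hm_chain K C M n\<^esub>
    hm_pure K C M n (drop_obj i as) (hm_face C M (Suc n) as i t))"
 by (simp add: hm_boundary_def chain_lift_def)

text \<open>With the identities as the only idempotents, the calculus of bar tuples applies to every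
 category.\<close>

lemma trivial_idempotents: "idempotent_category K C (\<lambda>a. {a}) (kid C)"
proof (unfold_locales; (simp only: singleton_iff)?)
 show "(\<Oplus>\<^bsub>khom C a a\<^esub> x \<in> {a}. kid C x) = kid C a" if "a \<in> kobj C" for a
 proof -
  interpret module K "khom C a a" by (rule khom_module[OF that that])
  show ?thesis using kid_closed[OF that] by simp
 qed
qed (auto simp: kid_closed kid_left)

lemma face_multilinear:
 assumes i: "i \<le> Suc n"
 shows "chain_multilinear K C M (Suc n) (hm_chain K C M n) (\<lambda>as t. hm_pure K C M n (drop_obj i as) (hm_face C M (Suc n) as i t))"
proof (rule chain_multilinear_cong[OF k_bimodule_axioms])
 interpret I: idempotent_category K C "\<lambda>a. {a}" "kid C" by (rule trivial_idempotents)
 let ?\<Phi> = "\<lambda>m. bface C i (chain_bar n (hm_pure K C M n) m)"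
 show "chain_multilinear K C M (Suc n) (hm_chain K C M n) (\<lambda>as t. ?\<Phi> (fst t) (id_objs as) (id_mors C as (snd t)))"
 proof (rule chain_multilinear_of_bar)
  show "bar_linear K C (hm_chain K C M n) y z (Suc (Suc (Suc n))) (?\<Phi> m)"
   if "y \<in> kobj C" "z \<in> kobj C" "m \<in> bim M z y" for y z m
   by (rule I.bface_linear[OF chain_bar_linear[OF pure_multilinear that(3)]]) (use i in simp)
  show "(\<lambda>m. ?\<Phi> m os es) \<in> mod_hom K (bhom M z y) (hm_chain K C M n)"
   if "(os, es) \<in> bar_tuples C y z (Suc (Suc (Suc n)))" for y z os es
   unfolding bface_def
   by (rule chain_bar_param[OF I.tuple_face[OF that] pure_multilinear]) (use i in simp)
 qed
 fix as t assume as: "as \<in> obj_tuples C (Suc n)" and t: "t \<in> chain_tuples C M as"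
 obtain m cs where mcs: "t = (m, cs)" by (cases t)
 have m: "m \<in> bim M (last as) (hd as)" and cs: "cs \<in> ltuples (hom_list C as)"
  using t mcs by (auto simp: chain_tuples_def htuples_def)
 have t': "(m, cs) \<in> chain_tuples C M as" using t mcs by simp
 show "hm_pure K C M n (drop_obj i as) (hm_face C M (Suc n) as i t) = ?\<Phi> (fst t) (id_objs as) (id_mors C as (snd t))"
  unfolding mcs fst_conv snd_conv chain_bar_face[OF id_tuple[OF as cs] i m]
  by (rule chain_bar_id[OF as t', symmetric])
qed

lemma boundary_multilinear:
 "chain_multilinear K C M (Suc n) (hm_chain K C M n)
   (\<lambda>as t. \<Oplus>\<^bsub>hm_chain K C M n\<^esub> i \<in> {0..Suc n}. ksign K i \<odot>\<^bsub>hm_chain K C M n\<^esub>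
    hm_pure K C M n (drop_obj i as) (hm_face C M (Suc n) as i t))"
proof -
 interpret D: module K "hm_chain K C M n" by (rule chain_module)
 have f: "hmultilinear K (bhom M (last as) (hd as)) (hom_list C as) (hm_chain K C M n)
   (\<lambda>t. hm_pure K C M n (drop_obj i as) (hm_face C M (Suc n) as i t))" if "as \<in> obj_tuples C (Suc n)" "i \<le> Suc n" for as i
  using face_multilinear[OF that(2)] that(1) by (simp add: chain_multilinear_def)
 show ?thesis
  unfolding chain_multilinear_def
 proof
  fix as assume as: "as \<in> obj_tuples C (Suc n)"
  interpret htensor_factors K "hom_list C as" "bhom M (last as) (hd as)" by (rule summand_factors[OF as])
  note f = f[OF as, unfolded hmultilinear_def multilinear_def]
  show "hmultilinear K (bhom M (last as) (hd as)) (hom_list C as) (hm_chain K C M n)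
   (\<lambda>t. \<Oplus>\<^bsub>hm_chain K C M n\<^esub> i \<in> {0..Suc n}. ksign K i \<odot>\<^bsub>hm_chain K C M n\<^esub>
    hm_pure K C M n (drop_obj i as) (hm_face C M (Suc n) as i t))"
   unfolding hmultilinear_def multilinear_def
  proof (intro conjI ballI allI impI)
   fix ws assume ws: "ws \<in> ltuples (hom_list C as)"
   show "(\<lambda>v. \<Oplus>\<^bsub>hm_chain K C M n\<^esub> i \<in> {0..Suc n}. ksign K i \<odot>\<^bsub>hm_chain K C M n\<^esub>
     hm_pure K C M n (drop_obj i as) (hm_face C M (Suc n) as i (v, ws))) \<in> mod_hom K (bhom M (last as) (hd as)) (hm_chain K C M n)"
    by (rule lin_finsum_pointwise[OF head_module D.module_axioms lin_smult_pointwise[OF D.module_axioms]])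
     (use f ws in auto)
   fix v assume v: "v \<in> bim M (last as) (hd as)"
   show "(\<Oplus>\<^bsub>hm_chain K C M n\<^esub> i \<in> {0..Suc n}. ksign K i \<odot>\<^bsub>hm_chain K C M n\<^esub>
     hm_pure K C M n (drop_obj i as) (hm_face C M (Suc n) as i (v, ws))) \<in> carrier (hm_chain K C M n)"
    by (rule D.finsum_closed) (use f v ws in auto)
   fix j assume j: "j < length (hom_list C as)"
   show "(\<lambda>w. \<Oplus>\<^bsub>hm_chain K C M n\<^esub> i \<in> {0..Suc n}. ksign K i \<odot>\<^bsub>hm_chain K C M n\<^esub>
     hm_pure K C M n (drop_obj i as) (hm_face C M (Suc n) as i (v, ws[j := w]))) \<in> mod_hom K (hom_list C as ! j) (hm_chain K C M n)"
    by (rule lin_finsum_pointwise[OF factor_module[OF j] D.module_axioms lin_smult_pointwise[OF D.module_axioms]])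
     (use f v ws j in \<open>auto simp del: nth_hom_list\<close>)
  qed
 qed
qed

lemma boundary_hom: "hm_boundary K C M (Suc n) \<in> mod_hom K (hm_chain K C M (Suc n)) (hm_chain K C M n)"
 unfolding boundary_eq_lift by (rule chain_lift_hom[OF chain_module boundary_multilinear])

lemma boundary_pure:
 assumes "as \<in> obj_tuples C (Suc n)" "t \<in> chain_tuples C M as"
 shows "hm_boundary K C M (Suc n) (hm_pure K C M (Suc n) as t)
  = (\<Oplus>\<^bsub>hm_chain K C M n\<^esub> i \<in> {0..Suc n}. ksign K i \<odot>\<^bsub>hm_chain K C M n\<^esub>
    hm_pure K C M n (drop_obj i as) (hm_face C M (Suc n) as i t))"
 unfolding boundary_eq_lift by (rule chain_lift_pure[OF chain_module boundary_multilinear assms])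

end

locale idempotent_bimodule = idempotent_category K A Idx e + k_bimodule K A N
 for K :: "('k, 'r) ring_scheme" (structure) and A :: "('a, 'c, 'k) kcat"
  and Idx :: "'a \<Rightarrow> 'i set" and e :: "'i \<Rightarrow> 'c" and N :: "('a, 'c, 'm, 'k) kbimod"
begin

abbreviation "chn n \<equiv> hm_chain K A N n"

abbreviation "cochn n \<equiv> hm_cochain K A N n"

abbreviation "pure_bar n \<equiv> chain_bar n (hm_pure K A N n)"

lemma pure_bar_linear:
 "m \<in> bim N z y \<Longrightarrow> bar_linear K A (chn n) y z (Suc (Suc n)) (pure_bar n m)"
 by (rule chain_bar_linear[OF pure_multilinear])

lemma boundary_bar:
 assumes t: "(os, es) \<in> bar_tuples A y z (Suc (Suc (Suc n)))" and m: "m \<in> bim N z y"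
 shows "hm_boundary K A N (Suc n) (pure_bar (Suc n) m os es) = bdiff (chn n) (Suc (Suc n)) (pure_bar n m) os es"
proof -
 interpret D: module K "chn n" by (rule chain_module)
 have fc: "bface A i (pure_bar n m) os es
   = hm_pure K A N n (drop_obj i (core os)) (hm_face A N (Suc n) (core os) i (absorb (Suc n) m os es, core es))" if "i \<le> Suc n" for i
  using chain_bar_face[OF t that m] by (simp add: chain_bar_def)
 have cl: "bface A i (pure_bar n m) os es \<in> carrier (chn n)" if "i \<le> Suc n" for i
  using that by (intro bar_closed[OF bface_linear[OF pure_bar_linear[OF m]] t]) auto
 have "hm_boundary K A N (Suc n) (pure_bar (Suc n) m os es)
   = (\<Oplus>\<^bsub>chn n\<^esub> i \<in> {0..Suc n}. ksign K i \<odot>\<^bsub>chn n\<^esub>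
    hm_pure K A N n (drop_obj i (core os)) (hm_face A N (Suc n) (core os) i (absorb (Suc n) m os es, core es)))"
  unfolding chain_bar_def by (rule boundary_pure[OF core_tuple(1)[OF t] chain_bar_tuple[OF t m]])
 also have "\<dots> = bdiff (chn n) (Suc (Suc n)) (pure_bar n m) os es"
  unfolding bdiff_def by (rule D.finsum_cong') (use cl fc in auto)
 finally show ?thesis .
qed

text \<open>The cuts and the homotopy on chains, obtained from a tuple by adding identities at its ends.\<close>

definition
 "rmap n = chain_lift K A N n (chn n)
   (\<lambda>as t. bcuts (chn n) (Suc n) (pure_bar n (fst t)) (id_objs as) (id_mors A as (snd t)))"

definition
 "hmap n = chain_lift K A N n (chn (Suc n))
   (\<lambda>as t. bhtpy (chn (Suc n)) (Suc n) (pure_bar (Suc n) (fst t)) (id_objs as) (id_mors A as (snd t)))"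

lemma
 shows rmap_hom: "rmap n \<in> mod_hom K (chn n) (chn n)"
  and rmap_bar: "(os, es) \<in> bar_tuples A y z (Suc (Suc n)) \<Longrightarrow> m \<in> bim N z y
   \<Longrightarrow> rmap n (pure_bar n m os es) = bcuts (chn n) (Suc n) (pure_bar n m) os es"
proof -
 let ?\<Phi> = "\<lambda>m. bcuts (chn n) (Suc n) (pure_bar n m)"
 have lin: "bar_linear K A (chn n) y z (Suc (Suc n)) (?\<Phi> m)" if "m \<in> bim N z y" for y z m
  by (rule bcuts_linear[OF chain_module pure_bar_linear[OF that]]) simp
 have param: "(\<lambda>m. ?\<Phi> m os es) \<in> mod_hom K (bhom N z y) (chn n)"
  if "y \<in> kobj A" "z \<in> kobj A" "(os, es) \<in> bar_tuples A y z (Suc (Suc n))" for y z os es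
  by (rule bcuts_param[OF bhom_module[OF that(1,2)] chain_module chain_bar_param[OF _ pure_multilinear] _ that(3)]) auto
 have outer: "?\<Phi> m (outer_obj y' z' os) (outer_mor A y' z' u v os es) = ?\<Phi> (blact N z z' y v (bract N z' y' y m u)) os es"
  if yz: "y \<in> kobj A" "z \<in> kobj A" and y': "y' \<in> kobj A" "z' \<in> kobj A" and t: "(os, es) \<in> bar_tuples A y z (Suc (Suc n))"
   and uv: "u \<in> mor A y' y" "v \<in> mor A z z'" and m: "m \<in> bim N z' y'" for y z y' z' u v m os es
 proof -
  have m': "blact N z z' y v (bract N z' y' y m u) \<in> bim N z y"
   using yz y' uv m by (intro lact_closed ract_closed)
  have "?\<Phi> m (outer_obj y' z' os) (outer_mor A y' z' u v os es)
    = bcuts (chn n) (Suc n) (\<lambda>os es. pure_bar n m (outer_obj y' z' os) (outer_mor A y' z' u v os es)) os es"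
   by (rule bcuts_outer[OF chain_module pure_bar_linear[OF m] y' uv _ _ t]) auto
  also have "\<dots> = ?\<Phi> (blact N z z' y v (bract N z' y' y m u)) os es"
   by (rule bcuts_cong[OF chain_module pure_bar_linear[OF m'] _ chain_bar_outer[OF _ y' uv m] t]) auto
  finally show ?thesis .
 qed
 show "rmap n \<in> mod_hom K (chn n) (chn n)"
  unfolding rmap_def by (rule chain_lift_hom[OF chain_module chain_multilinear_of_bar[OF lin param]])
 show "(os, es) \<in> bar_tuples A y z (Suc (Suc n)) \<Longrightarrow> m \<in> bim N z y \<Longrightarrow> rmap n (pure_bar n m os es) = ?\<Phi> m os es"
  unfolding rmap_def by (rule chain_lift_bar[OF chain_module lin param outer])
qed

lemma
 shows hmap_hom: "hmap n \<in> mod_hom K (chn n) (chn (Suc n))"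
  and hmap_bar: "(os, es) \<in> bar_tuples A y z (Suc (Suc n)) \<Longrightarrow> m \<in> bim N z y
   \<Longrightarrow> hmap n (pure_bar n m os es) = bhtpy (chn (Suc n)) (Suc n) (pure_bar (Suc n) m) os es"
proof -
 let ?\<Phi> = "\<lambda>m. bhtpy (chn (Suc n)) (Suc n) (pure_bar (Suc n) m)"
 have lin: "bar_linear K A (chn (Suc n)) y z (Suc (Suc n)) (?\<Phi> m)" if "m \<in> bim N z y" for y z m
  by (rule bhtpy_linear[OF chain_module pure_bar_linear[OF that]]) simp
 have param: "(\<lambda>m. ?\<Phi> m os es) \<in> mod_hom K (bhom N z y) (chn (Suc n))"
  if "y \<in> kobj A" "z \<in> kobj A" "(os, es) \<in> bar_tuples A y z (Suc (Suc n))" for y z os es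
  by (rule bhtpy_param[OF bhom_module[OF that(1,2)] chain_module chain_bar_param[OF _ pure_multilinear] _ that(3)]) auto
 have outer: "?\<Phi> m (outer_obj y' z' os) (outer_mor A y' z' u v os es) = ?\<Phi> (blact N z z' y v (bract N z' y' y m u)) os es"
  if yz: "y \<in> kobj A" "z \<in> kobj A" and y': "y' \<in> kobj A" "z' \<in> kobj A" and t: "(os, es) \<in> bar_tuples A y z (Suc (Suc n))"
   and uv: "u \<in> mor A y' y" "v \<in> mor A z z'" and m: "m \<in> bim N z' y'" for y z y' z' u v m os es
 proof -
  have m': "blact N z z' y v (bract N z' y' y m u) \<in> bim N z y"
   using yz y' uv m by (intro lact_closed ract_closed)
  have "?\<Phi> m (outer_obj y' z' os) (outer_mor A y' z' u v os es)
    = bhtpy (chn (Suc n)) (Suc n) (\<lambda>os es. pure_bar (Suc n) m (outer_obj y' z' os) (outer_mor A y' z' u v os es)) os es"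
   by (rule bhtpy_outer[OF chain_module pure_bar_linear[OF m] y' uv _ _ t]) auto
  also have "\<dots> = ?\<Phi> (blact N z z' y v (bract N z' y' y m u)) os es"
   by (rule bhtpy_cong[OF chain_module pure_bar_linear[OF m'] _ chain_bar_outer[OF _ y' uv m] t]) auto
  finally show ?thesis .
 qed
 show "hmap n \<in> mod_hom K (chn n) (chn (Suc n))"
  unfolding hmap_def by (rule chain_lift_hom[OF chain_module chain_multilinear_of_bar[OF lin param]])
 show "(os, es) \<in> bar_tuples A y z (Suc (Suc n)) \<Longrightarrow> m \<in> bim N z y \<Longrightarrow> hmap n (pure_bar n m os es) = ?\<Phi> m os es"
  unfolding hmap_def by (rule chain_lift_bar[OF chain_module lin param outer])
qed

lemma bdiff_linear:
 assumes P: "module K P" and F: "bar_linear K A P y z N' F" and m: "m \<le> N'"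
 shows "bar_linear K A P y z (Suc N') (bdiff P m F)"
proof (rule bar_linearI)
 interpret P: module K P by (rule P)
 have lin: "bar_linear K A P y z (Suc N') (bface A q F)" if "q < m" for q
  using that m by (intro bface_linear[OF F]) auto
 fix os es assume t: "(os, es) \<in> bar_tuples A y z (Suc N')"
 show "bdiff P m F os es \<in> carrier P"
  unfolding bdiff_def by (intro P.finsum_closed) (use bar_closed[OF lin t] in auto)
 fix i assume i: "i < Suc N'"
 show "(\<lambda>c. bdiff P m F os (es[i := c])) \<in> mod_hom K (khom A (os ! i) (os ! Suc i)) P"
  unfolding bdiff_def
  using bar_slot[OF lin t i] i
  by (intro lin_finsum_pointwise P lin_smult_pointwise khom_module tuple_obj[OF t]) auto
qed

lemma bdiff_post:
 assumes P: "module K P" and P': "module K P'" and T: "T \<in> mod_hom K P P'" and F: "bar_linear K A P y z N' F"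
  and m: "m \<le> N'" and t: "(os, es) \<in> bar_tuples A y z (Suc N')"
 shows "T (bdiff P m F os es) = bdiff P' m (\<lambda>os es. T (F os es)) os es"
proof -
 interpret P': module K P' by (rule P')
 interpret P: module K P by (rule P)
 have cl: "bface A q F os es \<in> carrier P" if "q < m" for q
  using that m by (intro bar_closed[OF bface_linear[OF F] t]) auto
 have "T (bdiff P m F os es) = (\<Oplus>\<^bsub>P'\<^esub> q \<in> {..<m}. T (ksign K q \<odot>\<^bsub>P\<^esub> bface A q F os es))"
  unfolding bdiff_def by (rule lin_finsum[OF P P' T]) (use cl in auto)
 also have "\<dots> = bdiff P' m (\<lambda>os es. T (F os es)) os es"
  unfolding bdiff_def
  by (rule P'.finsum_cong') (use cl lin_closed[OF T] in \<open>auto simp: lin_smult[OF T] bface_def\<close>)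
 finally show ?thesis .
qed

lemma bdiff_cong:
 assumes P: "module K P" and F: "bar_linear K A P y z N' F" and m: "m \<le> N'"
  and eq: "\<And>os es. (os, es) \<in> bar_tuples A y z N' \<Longrightarrow> F' os es = F os es" and t: "(os, es) \<in> bar_tuples A y z (Suc N')"
 shows "bdiff P m F' os es = bdiff P m F os es"
proof -
 interpret P: module K P by (rule P)
 have cl: "bface A q F os es \<in> carrier P" if "q < m" for q
  using that m by (intro bar_closed[OF bface_linear[OF F] t]) auto
 have "bface A q F' os es = bface A q F os es" if "q < m" for q
  unfolding bface_def using that m by (intro eq tuple_face[OF t]) auto
 then show ?thesis unfolding bdiff_def by (intro P.finsum_cong') (use cl in auto)
qed

lemma bcuts_bdiff:
 assumes P: "module K P" and F: "bar_linear K A P y z (Suc m) F" and t: "(os, es) \<in> bar_tuples A y z (Suc (Suc m))"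
 shows "bcuts P (Suc m) (bdiff P (Suc m) F) os es = bdiff P (Suc m) (bcuts P m F) os es"
proof -
 interpret P: module K P by (rule P)
 have "bcuts P (Suc m) (bdiff P (Suc m) F) os es
   = (\<Oplus>\<^bsub>P\<^esub> q \<in> {..<Suc m}. ksign K q \<odot>\<^bsub>P\<^esub> bcuts P (Suc m) (bface A q F) os es)"
  unfolding bdiff_def[abs_def] by (rule bcuts_finsum[OF P _ _ bface_linear[OF F] _ t]) auto
 also have "\<dots> = bdiff P (Suc m) (bcuts P m F) os es"
  unfolding bdiff_def
 proof (rule P.finsum_cong')
  show "ksign K q \<odot>\<^bsub>P\<^esub> bcuts P (Suc m) (bface A q F) os es = ksign K q \<odot>\<^bsub>P\<^esub> bface A q (bcuts P m F) os es"
   if "q \<in> {..<Suc m}" for q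
   using bcuts_bface[OF P F _ _ t, of q "Suc m"] that by (simp del: bcuts.simps)
  show "(\<lambda>q. ksign K q \<odot>\<^bsub>P\<^esub> bface A q (bcuts P m F) os es) \<in> {..<Suc m} \<rightarrow> carrier P"
   using bar_closed[OF bface_linear[OF bcuts_linear[OF P F]] t] by auto
 qed simp
 finally show ?thesis .
qed

lemma boundary_rmap:
 assumes "w \<in> carrier (chn (Suc n))"
 shows "hm_boundary K A N (Suc n) (rmap (Suc n) w) = rmap n (hm_boundary K A N (Suc n) w)"
proof (rule chain_hom_ext_bar[OF chain_module _ _ _ assms])
 show "(\<lambda>w. hm_boundary K A N (Suc n) (rmap (Suc n) w)) \<in> mod_hom K (chn (Suc n)) (chn n)"
  "(\<lambda>w. rmap n (hm_boundary K A N (Suc n) w)) \<in> mod_hom K (chn (Suc n)) (chn n)"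
  by (intro lin_comp[OF boundary_hom rmap_hom] lin_comp[OF rmap_hom boundary_hom])+
 fix y z m os es
 assume m: "m \<in> bim N z y" and t: "(os, es) \<in> bar_tuples A y z (Suc (Suc (Suc n)))"
 let ?C = "chn n"
 note L = pure_bar_linear[OF m]
 have "hm_boundary K A N (Suc n) (rmap (Suc n) (pure_bar (Suc n) m os es))
   = bcuts ?C (Suc (Suc n)) (\<lambda>os es. hm_boundary K A N (Suc n) (pure_bar (Suc n) m os es)) os es"
  unfolding rmap_bar[OF t m] by (rule bcuts_post[OF chain_module chain_module boundary_hom L _ t]) simp
 also have "\<dots> = bcuts ?C (Suc (Suc n)) (bdiff ?C (Suc (Suc n)) (pure_bar n m)) os es"
  by (rule bcuts_cong[OF chain_module bdiff_linear[OF chain_module L] _ boundary_bar[OF _ m] t]) auto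
 also have "\<dots> = bdiff ?C (Suc (Suc n)) (bcuts ?C (Suc n) (pure_bar n m)) os es"
  by (rule bcuts_bdiff[OF chain_module L t])
 also have "\<dots> = bdiff ?C (Suc (Suc n)) (\<lambda>os es. rmap n (pure_bar n m os es)) os es"
  by (rule bdiff_cong[OF chain_module bcuts_linear[OF chain_module L] _ _ t, symmetric]) (use rmap_bar[OF _ m] in auto)
 also have "\<dots> = rmap n (bdiff ?C (Suc (Suc n)) (pure_bar n m) os es)"
  by (rule bdiff_post[OF chain_module chain_module rmap_hom L _ t, symmetric]) simp
 finally show "hm_boundary K A N (Suc n) (rmap (Suc n) (pure_bar (Suc n) m os es))
   = rmap n (hm_boundary K A N (Suc n) (pure_bar (Suc n) m os es))"
  unfolding boundary_bar[OF t m] .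
qed

lemma chain_homotopy_bar:
 assumes m: "m \<in> bim N z y" and t: "(os, es) \<in> bar_tuples A y z (Suc (Suc n))"
 shows "hm_boundary K A N (Suc n) (hmap n (pure_bar n m os es))
   \<oplus>\<^bsub>chn n\<^esub> bdiff (chn n) (Suc n) (bhtpy (chn n) n (pure_bar n m)) os es
  = pure_bar n m os es \<ominus>\<^bsub>chn n\<^esub> rmap n (pure_bar n m os es)"
proof -
 let ?C = "chn n"
 note L = pure_bar_linear[OF m]
 have "hm_boundary K A N (Suc n) (hmap n (pure_bar n m os es))
   = bhtpy ?C (Suc n) (\<lambda>os es. hm_boundary K A N (Suc n) (pure_bar (Suc n) m os es)) os es"
  unfolding hmap_bar[OF t m] by (rule bhtpy_post[OF chain_module chain_module boundary_hom L _ t]) simp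
 also have "\<dots> = bhtpy ?C (Suc n) (bdiff ?C (Suc (Suc n)) (pure_bar n m)) os es"
  by (rule bhtpy_cong[OF chain_module bdiff_linear[OF chain_module L] _ boundary_bar[OF _ m] t]) auto
 finally show ?thesis
  using bar_homotopy[OF chain_module L t] rmap_bar[OF t m] by simp
qed

text \<open>The boundary is the alternating sum of the faces of the bar tuple, so this is the homotopy formula
 for the function that sends a bar tuple to its chain.\<close>

theorem chain_homotopy:
 assumes w: "w \<in> carrier (chn n)"
 shows "hm_boundary K A N (Suc n) (hmap n w)
   \<oplus>\<^bsub>chn n\<^esub> (if n = 0 then \<zero>\<^bsub>chn n\<^esub> else hmap (n - 1) (hm_boundary K A N n w))
  = w \<ominus>\<^bsub>chn n\<^esub> rmap n w"
proof -
 let ?C = "chn n"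
 interpret C: module K ?C by (rule chain_module)
 have tail_hom: "(\<lambda>w. if n = 0 then \<zero>\<^bsub>?C\<^esub> else hmap (n - 1) (hm_boundary K A N n w)) \<in> mod_hom K ?C ?C"
 proof (cases n)
  case 0
  then show ?thesis using lin_const_zero[OF C.module_axioms] by simp
 next
  case (Suc n')
  then show ?thesis using lin_comp[OF hmap_hom boundary_hom] by simp
 qed
 have minus: "(\<lambda>w. w \<ominus>\<^bsub>?C\<^esub> rmap n w) \<in> mod_hom K ?C ?C"
 proof (rule mod_homI)
  fix u v assume "u \<in> carrier ?C" "v \<in> carrier ?C"
  then show "u \<oplus>\<^bsub>?C\<^esub> v \<ominus>\<^bsub>?C\<^esub> rmap n (u \<oplus>\<^bsub>?C\<^esub> v) = u \<ominus>\<^bsub>?C\<^esub> rmap n u \<oplus>\<^bsub>?C\<^esub> (v \<ominus>\<^bsub>?C\<^esub> rmap n v)"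
   by (simp add: lin_add[OF rmap_hom] lin_closed[OF rmap_hom] C.minus_eq C.minus_add C.a_ac)
 next
  fix a v assume "a \<in> carrier K" "v \<in> carrier ?C"
  then show "a \<odot>\<^bsub>?C\<^esub> v \<ominus>\<^bsub>?C\<^esub> rmap n (a \<odot>\<^bsub>?C\<^esub> v) = a \<odot>\<^bsub>?C\<^esub> (v \<ominus>\<^bsub>?C\<^esub> rmap n v)"
   by (simp add: lin_smult[OF rmap_hom] lin_closed[OF rmap_hom] C.minus_eq C.smult_r_distr C.smult_r_minus)
 qed (simp add: lin_closed[OF rmap_hom])
 show ?thesis
 proof (rule chain_hom_ext_bar[OF C.module_axioms lin_add_pointwise[OF C.module_axioms lin_comp[OF boundary_hom hmap_hom] tail_hom] minus _ w])
  fix y z m os es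
  assume m: "m \<in> bim N z y" and t: "(os, es) \<in> bar_tuples A y z (Suc (Suc n))"
  note L = pure_bar_linear[OF m]
  have "(if n = 0 then \<zero>\<^bsub>?C\<^esub> else hmap (n - 1) (hm_boundary K A N n (pure_bar n m os es)))
    = bdiff ?C (Suc n) (bhtpy ?C n (pure_bar n m)) os es"
  proof (cases n)
   case 0
   interpret C0: module K "chn 0" by (rule chain_module)
   show ?thesis unfolding 0 by (simp add: bdiff_def bface_def bhtpy_def)
  next
   case (Suc n')
   have "hmap n' (hm_boundary K A N (Suc n') (pure_bar (Suc n') m os es))
     = hmap n' (bdiff (chn n') (Suc (Suc n')) (pure_bar n' m) os es)"
    by (subst boundary_bar[OF _ m]) (use t Suc in auto)
   also have "\<dots> = bdiff ?C (Suc (Suc n')) (\<lambda>os es. hmap n' (pure_bar n' m os es)) os es"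
    unfolding Suc by (rule bdiff_post[OF chain_module chain_module hmap_hom L]) (use t Suc in auto)
   also have "\<dots> = bdiff ?C (Suc (Suc n')) (bhtpy ?C (Suc n') (pure_bar (Suc n') m)) os es"
    unfolding Suc by (rule bdiff_cong[OF chain_module bhtpy_linear[OF chain_module L] _ hmap_bar[OF _ m]])
     (use t Suc in auto)
   finally show ?thesis using Suc by simp
  qed
  then show "hm_boundary K A N (Suc n) (hmap n (pure_bar n m os es))
    \<oplus>\<^bsub>?C\<^esub> (if n = 0 then \<zero>\<^bsub>?C\<^esub> else hmap (n - 1) (hm_boundary K A N n (pure_bar n m os es)))
   = pure_bar n m os es \<ominus>\<^bsub>?C\<^esub> rmap n (pure_bar n m os es)"
   using chain_homotopy_bar[OF m t] by simp
 qed
qed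

end

section \<open>The homotopy on cochains\<close>

context k_bimodule
begin

lemma cochain_multilinear_cong:
 assumes "cochain_multilinear K C M n g"
  and eq: "\<And>as cs. as \<in> obj_tuples C n \<Longrightarrow> cs \<in> ltuples (hom_list C as) \<Longrightarrow> g' as cs = g as cs"
 shows "cochain_multilinear K C M n g'"
 unfolding cochain_multilinear_def multilinear_def
proof (intro conjI ballI allI impI)
 fix as cs assume as: "as \<in> obj_tuples C n" and cs: "cs \<in> ltuples (hom_list C as)"
 interpret tensor_factors K "hom_list C as" by (rule hom_list_factors[OF as])
 note G = assms(1)[unfolded cochain_multilinear_def multilinear_def, rule_format, OF as cs]
 show "g' as cs \<in> bim M (hd as) (last as)" using G eq[OF as cs] by simp
 fix i assume i: "i < length (hom_list C as)"
 show "(\<lambda>w. g' as (cs[i := w])) \<in> mod_hom K (hom_list C as ! i) (bhom M (hd as) (last as))"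
  by (rule lin_cong[OF factor_module[OF i] eq[OF as ltuples_update[OF cs]]]) (use G i in auto)
qed

lemma cochain_multilinear_of_bar:
 assumes lin: "\<And>y z. y \<in> kobj C \<Longrightarrow> z \<in> kobj C \<Longrightarrow> bar_linear K C (bhom M y z) y z (Suc (Suc n)) (\<Phi> y z)"
 shows "cochain_multilinear K C M n (\<lambda>as cs. \<Phi> (hd as) (last as) (id_objs as) (id_mors C as cs))"
 unfolding cochain_multilinear_def multilinear_def
proof (intro conjI ballI allI impI)
 fix as cs assume as: "as \<in> obj_tuples C n" and cs: "cs \<in> ltuples (hom_list C as)"
 note ob = obj_tuples_hd[OF as] obj_tuples_last[OF as] and t = id_tuple[OF as cs]
 note len = obj_tuples_length[OF as]
 have lcs: "length cs = n" using cs len by (simp add: hom_list_tuples_iff)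
 note L = lin[OF ob, unfolded bar_linear_def, rule_format, OF t, simplified]
 show "\<Phi> (hd as) (last as) (id_objs as) (id_mors C as cs) \<in> bim M (hd as) (last as)" using L by simp
 fix i assume i: "i < length (hom_list C as)"
 have "id_mors C as (cs[i := c]) = (id_mors C as cs)[Suc i := c]" for c
  using i len lcs by (simp add: with_ends_def list_update_append)
 then show "(\<lambda>w. \<Phi> (hd as) (last as) (id_objs as) (id_mors C as (cs[i := w]))) \<in> mod_hom K (hom_list C as ! i) (bhom M (hd as) (last as))"
  using conjunct2[OF L, rule_format, of "Suc i"] i len by (auto simp: nth_with_ends)
qed

lemma cochain_bar_of_bar:
 assumes g: "\<And>as cs. as \<in> obj_tuples C n \<Longrightarrow> cs \<in> ltuples (hom_list C as)
   \<Longrightarrow> g as cs = \<Phi> (hd as) (last as) (id_objs as) (id_mors C as cs)"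
  and outer: "\<And>y z y' z' u v os es. \<lbrakk>y \<in> kobj C; z \<in> kobj C; y' \<in> kobj C; z' \<in> kobj C; (os, es) \<in> bar_tuples C y z (Suc (Suc n));
u \<in> mor C y' y; v \<in> mor C z z'\<rbrakk>
\<Longrightarrow> \<Phi> y' z' (outer_obj y' z' os) (outer_mor C y' z' u v os es) = blact M y' y z' u (bract M y z z' (\<Phi> y z os es) v)"
  and t: "(os, es) \<in> bar_tuples C y z (Suc (Suc n))"
 shows "cochain_bar n g os es = \<Phi> y z os es"
proof -
 note D = bar_tuplesD[OF t] and core = core_tuple[OF t] and ob = tuple_objs[OF t] and ho = tuple_homs[OF t]
 have "cochain_bar n g os es = blact M y (hd (core os)) z (es ! 0) (bract M (hd (core os)) (last (core os)) z
   (\<Phi> (hd (core os)) (last (core os)) (id_objs (core os)) (id_mors C (core os) (core es))) (es ! Suc n))"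
  using D core g by (simp add: cochain_bar_def wrap_def)
 also have "\<dots> = \<Phi> y z (outer_obj y z (id_objs (core os))) (outer_mor C y z (es ! 0) (es ! Suc n) (id_objs (core os)) (id_mors C (core os) (core es)))"
  by (rule outer[OF _ _ _ _ id_tuple[OF core(1,2)], symmetric])
   (use D core ob[of 0] ob[of 1] ob[of "Suc n"] ob[of "Suc (Suc n)"] ho[of 0] ho[of "Suc n"] in auto)
 also have "\<dots> = \<Phi> y z os es" by (simp only: outer_id_tuple[OF t])
 finally show ?thesis .
qed

lemma cochain_bar_face:
 assumes as: "as \<in> obj_tuples C (Suc n)" and cs: "cs \<in> ltuples (hom_list C as)" and g: "cochain_multilinear K C M n g"
  and q: "q \<le> Suc n"
 shows "bface C q (cochain_bar n g) (id_objs as) (id_mors C as cs) =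
  (if q = 0 then blact M (as ! 0) (as ! 1) (last as) (hd cs) (g (tl as) (tl cs))
   else if q = Suc n then bract M (hd as) (as ! n) (as ! Suc n) (g (butlast as) (butlast cs)) (last cs)
   else g (drop_obj q as) (merge_at C as q cs))"
proof -
 interpret I: idempotent_category K C "\<lambda>a. {a}" "kid C" by (rule trivial_idempotents)
 note t = id_tuple[OF as cs]
 have t': "(drop_obj (Suc q) (id_objs as), merge_at C (id_objs as) (Suc q) (id_mors C as cs)) \<in> bar_tuples C (hd as) (last as) (Suc (Suc n))"
  using q by (intro I.tuple_face[OF t]) auto
 note core = core_tuple[OF t']
 have gc: "g (core (drop_obj (Suc q) (id_objs as))) (core (merge_at C (id_objs as) (Suc q) (id_mors C as cs)))
   \<in> bim M (hd (core (drop_obj (Suc q) (id_objs as)))) (last (core (drop_obj (Suc q) (id_objs as))))"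
  using g core by (auto simp: cochain_multilinear_def multilinear_def)
 note l = obj_tuples_length[OF as] and hd = obj_tuples_hd_nth[OF as] and last = obj_tuples_last_nth[OF as]
 have lc: "length cs = Suc n" using cs l by (simp add: hom_list_tuples_iff)
 have c: "cs ! i \<in> mor C (as ! i) (as ! Suc i)" if "i < Suc n" for i
  using cs l that by (simp add: hom_list_tuples_iff)
 have ob: "as ! i \<in> kobj C" if "i < Suc (Suc n)" for i by (rule obj_tuples_nth[OF as that])
 have o: "as ! 0 \<in> kobj C" "as ! 1 \<in> kobj C" "as ! n \<in> kobj C" "as ! Suc n \<in> kobj C"
  using ob by auto
 have cd: "core (drop_obj (Suc q) (id_objs as)) = drop_obj q as"
  using q l by (subst core_drop) auto
 have hdcs: "hd cs = cs ! 0" and lastcs: "last cs = cs ! n"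
  using lc by (auto simp: hd_conv_nth last_conv_nth simp flip: length_0_conv)
 consider "q = 0" | "q = Suc n" | p where "q = Suc p" "p < n" using q by (cases q) (auto simp: less_Suc_eq le_less)
 then show ?thesis
 proof cases
  case 1
  have cm: "core (merge_at C (id_objs as) (Suc 0) (id_mors C as cs)) = tl cs"
   using lc nth_merge_at[of 0 "id_mors C as cs" _ C "id_objs as"] length_merge_at[of 0 "id_mors C as cs" C "id_objs as"]
   by (intro nth_equalityI) (auto simp: nth_core nth_with_ends nth_tl)
  have d: "drop_obj 0 as = tl as" by (simp add: drop_obj_def drop_Suc)
  have cd: "core (drop_obj (Suc 0) (id_objs as)) = tl as" using cd unfolding 1 d .
  have gc': "g (tl as) (tl cs) \<in> bim M (as ! 1) (as ! Suc n)"
   using gc core(3,4) l unfolding 1 cd cm by (simp add: nth_drop_obj nth_with_ends last)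
  then show ?thesis
   using 1 cd d cm l lc o c[of 0] nth_merge_at[of 0 "id_mors C as cs" _ C "id_objs as"]
   by (simp add: bface_def cochain_bar_def wrap_def nth_drop_obj nth_with_ends hd last hdcs bract_kid kid_left)
 next
  case 2
  have cm: "core (merge_at C (id_objs as) (Suc (Suc n)) (id_mors C as cs)) = butlast cs"
   using lc by (intro nth_equalityI) (auto simp: nth_core nth_with_ends nth_merge_at nth_butlast)
  have d: "drop_obj (Suc n) as = butlast as" using l by (simp add: drop_obj_def butlast_conv_take)
  have cd: "core (drop_obj (Suc (Suc n)) (id_objs as)) = butlast as" using cd unfolding 2 d .
  have gc': "g (butlast as) (butlast cs) \<in> bim M (as ! 0) (as ! n)"
   using gc core(3,4) l unfolding 2 cd cm by (simp add: nth_drop_obj nth_with_ends hd)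
  have "bract M (as ! 0) (as ! n) (as ! Suc n) (g (butlast as) (butlast cs)) (cs ! n) \<in> bim M (as ! 0) (as ! Suc n)"
   using gc' c[of n] o by (intro ract_closed) auto
  then show ?thesis
   using 2 cd d cm l lc o c[of n] nth_merge_at[of "Suc n" "id_mors C as cs" _ C "id_objs as"]
   by (simp add: bface_def cochain_bar_def wrap_def nth_drop_obj nth_with_ends hd last lastcs blact_kid kid_right)
 next
  case 3
  have cm: "core (merge_at C (id_objs as) (Suc q) (id_mors C as cs)) = merge_at C as q cs"
   using lc l 3 by (intro nth_equalityI) (auto simp: nth_core nth_with_ends nth_merge_at)
  have gc': "g (drop_obj q as) (merge_at C as q cs) \<in> bim M (as ! 0) (as ! Suc n)"
   using gc core l 3 unfolding cd cm by (simp add: nth_drop_obj nth_with_ends hd last)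
  then show ?thesis
   using 3 cd cm l lc o
   by (simp add: bface_def cochain_bar_def wrap_def nth_drop_obj nth_with_ends nth_merge_at hd last blact_kid bract_kid)
 qed
qed

lemma ksign_mult: "ksign K i \<otimes> ksign K j = ksign K (i + j)"
 by (simp add: ksign_def nat_pow_mult)

lemma ksign_double: "ksign K (i + i) = \<one>"
 by (induction i) (simp_all add: ksign_def l_minus r_minus)

lemma ksign_square: "module K P \<Longrightarrow> w \<in> carrier P \<Longrightarrow> ksign K i \<odot>\<^bsub>P\<^esub> (ksign K i \<odot>\<^bsub>P\<^esub> w) = w"
proof -
 assume "module K P" and w: "w \<in> carrier P"
 interpret P: module K P by fact
 show ?thesis using w by (simp flip: P.smult_assoc1 add: ksign_mult ksign_double)
qed

text \<open>The alternating sums of faces and of the terms of the coboundary differ by the global sign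
 that comes from numbering the objects from the other end.\<close>

lemma signed_sum_reverse:
 assumes "module K P" and T: "\<And>q. q \<le> Suc n \<Longrightarrow> T q \<in> carrier P"
 shows "ksign K (Suc n) \<odot>\<^bsub>P\<^esub> (\<Oplus>\<^bsub>P\<^esub> q \<in> {..<Suc (Suc n)}. ksign K q \<odot>\<^bsub>P\<^esub> T q)
  = ksign K (n + 1) \<odot>\<^bsub>P\<^esub> T 0 \<oplus>\<^bsub>P\<^esub> (\<Oplus>\<^bsub>P\<^esub> i \<in> {1..n}. ksign K i \<odot>\<^bsub>P\<^esub> T (n + 1 - i)) \<oplus>\<^bsub>P\<^esub> T (Suc n)"
proof -
 interpret P: module K P by fact
 have s: "ksign K (Suc n) \<otimes> ksign K (Suc n - i) = ksign K i" if "i \<le> Suc n" for i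
 proof -
  have "Suc n + (Suc n - i) = ((Suc n - i) + (Suc n - i)) + i" using that by linarith
  then have "ksign K (Suc n) \<otimes> ksign K (Suc n - i) = ksign K (((Suc n - i) + (Suc n - i)) + i)"
   by (simp only: ksign_mult)
  also have "\<dots> = ksign K i"
   unfolding ksign_mult[symmetric, of "(Suc n - i) + (Suc n - i)"] ksign_double by simp
  finally show ?thesis .
 qed
 have rew: "ksign K (Suc n) \<odot>\<^bsub>P\<^esub> (ksign K (Suc n - i) \<odot>\<^bsub>P\<^esub> T (Suc n - i)) = ksign K i \<odot>\<^bsub>P\<^esub> T (Suc n - i)" if "i \<le> Suc n" for i
  using T[of "Suc n - i"] s[OF that] by (simp flip: P.smult_assoc1)
 have "ksign K (Suc n) \<odot>\<^bsub>P\<^esub> (\<Oplus>\<^bsub>P\<^esub> q \<in> {..<Suc (Suc n)}. ksign K q \<odot>\<^bsub>P\<^esub> T q)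
   = (\<Oplus>\<^bsub>P\<^esub> q \<in> (\<lambda>i. Suc n - i) ` {..Suc n}. ksign K (Suc n) \<odot>\<^bsub>P\<^esub> (ksign K q \<odot>\<^bsub>P\<^esub> T q))"
 proof -
  have "q \<in> (\<lambda>i. Suc n - i) ` {..Suc n}" if "q < Suc (Suc n)" for q
   using that by (intro image_eqI[of _ _ "Suc n - q"]) auto
  then have "(\<lambda>i. Suc n - i) ` {..Suc n} = {..<Suc (Suc n)}" by (intro equalityI subsetI) auto
  then show ?thesis using T by (simp only:) (rule P.finsum_smult_ldistr, auto)
 qed
 also have "\<dots> = (\<Oplus>\<^bsub>P\<^esub> i \<in> {..Suc n}. ksign K (Suc n) \<odot>\<^bsub>P\<^esub> (ksign K (Suc n - i) \<odot>\<^bsub>P\<^esub> T (Suc n - i)))"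
  by (rule P.finsum_reindex) (use T in \<open>auto simp: inj_on_def\<close>)
 also have "\<dots> = (\<Oplus>\<^bsub>P\<^esub> i \<in> {..Suc n}. ksign K i \<odot>\<^bsub>P\<^esub> T (Suc n - i))"
  by (rule P.finsum_cong') (use T rew in auto)
 also have "{..Suc n} = insert 0 (insert (Suc n) {1..n})" by auto
 also have "(\<Oplus>\<^bsub>P\<^esub> i \<in> insert 0 (insert (Suc n) {1..n}). ksign K i \<odot>\<^bsub>P\<^esub> T (Suc n - i))
   = T (Suc n) \<oplus>\<^bsub>P\<^esub> (ksign K (Suc n) \<odot>\<^bsub>P\<^esub> T 0 \<oplus>\<^bsub>P\<^esub> (\<Oplus>\<^bsub>P\<^esub> i \<in> {1..n}. ksign K i \<odot>\<^bsub>P\<^esub> T (Suc n - i)))"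
  using T by (subst P.finsum_insert; simp add: ksign_def Pi_iff)+
 also have "\<dots> = ksign K (n + 1) \<odot>\<^bsub>P\<^esub> T 0 \<oplus>\<^bsub>P\<^esub> (\<Oplus>\<^bsub>P\<^esub> i \<in> {1..n}. ksign K i \<odot>\<^bsub>P\<^esub> T (n + 1 - i)) \<oplus>\<^bsub>P\<^esub> T (Suc n)"
  using T by (simp add: P.a_comm P.finsum_closed Pi_iff)
 finally show ?thesis .
qed

end

context idempotent_bimodule
begin

abbreviation "eval_bar n f \<equiv> cochain_bar n (hm_eval K A f)"

lemma eval_bar_linear:
 "\<lbrakk>f \<in> carrier (cochn n); y \<in> kobj A; z \<in> kobj A\<rbrakk>
\<Longrightarrow> bar_linear K A (bhom N y z) y z (Suc (Suc n)) (eval_bar n f)"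
 by (rule cochain_bar_linear[OF eval_multilinear])

lemma eval_hom:
 assumes "as \<in> obj_tuples A n" "cs \<in> ltuples (hom_list A as)"
 shows "(\<lambda>f. hm_eval K A f as cs) \<in> mod_hom K (cochn n) (bhom N (hd as) (last as))"
proof (rule mod_homI)
 interpret tensor_factors K "hom_list A as" by (rule hom_list_factors[OF assms(1)])
 have pure: "lpure K (hom_list A as) cs \<in> carrier (ltensor K (hom_list A as))"
  using lpure_multilinear assms(2) by (simp add: multilinear_def)
 show "hm_eval K A f as cs \<in> bim N (hd as) (last as)" if "f \<in> carrier (cochn n)" for f
  using that assms(1) lin_closed[OF _ pure] by (auto simp: hm_eval_def cochain_iff)
 show "hm_eval K A (f \<oplus>\<^bsub>cochn n\<^esub> g) as cs = hm_eval K A f as cs \<oplus>\<^bsub>bhom N (hd as) (last as)\<^esub> hm_eval K A g as cs" for f g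
  using assms(1) pure by (simp add: hm_eval_def hm_cochain_def hm_cofactor_def)
 show "hm_eval K A (a \<odot>\<^bsub>cochn n\<^esub> f) as cs = a \<odot>\<^bsub>bhom N (hd as) (last as)\<^esub> hm_eval K A f as cs" for a f
  using assms(1) pure by (simp add: hm_eval_def hm_cochain_def hm_cofactor_def)
qed

lemma eval_bar_param:
 assumes t: "(os, es) \<in> bar_tuples A y z (Suc (Suc n))"
 shows "(\<lambda>f. eval_bar n f os es) \<in> mod_hom K (cochn n) (bhom N y z)"
 unfolding cochain_bar_def
 by (rule lin_comp[OF wrap_hom[OF t] eval_hom[OF core_tuple(1,2)[OF t]]])

lemma cochain_op_hom:
 assumes cl: "\<And>f. f \<in> carrier (cochn n) \<Longrightarrow> T f \<in> carrier (cochn n')"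
  and ev: "\<And>f as cs. \<lbrakk>f \<in> carrier (cochn n); as \<in> obj_tuples A n'; cs \<in> ltuples (hom_list A as)\<rbrakk>
\<Longrightarrow> hm_eval K A (T f) as cs = \<Psi> f as cs"
  and lin: "\<And>as cs. as \<in> obj_tuples A n' \<Longrightarrow> cs \<in> ltuples (hom_list A as)
   \<Longrightarrow> (\<lambda>f. \<Psi> f as cs) \<in> mod_hom K (cochn n) (bhom N (hd as) (last as))"
 shows "T \<in> mod_hom K (cochn n) (cochn n')"
proof -
 interpret V: module K "cochn n" by (rule cochain_module)
 interpret W: module K "cochn n'" by (rule cochain_module)
 show ?thesis
 proof (rule mod_homI)
  fix f g assume f: "f \<in> carrier (cochn n)" and g: "g \<in> carrier (cochn n)"
  show "T (f \<oplus>\<^bsub>cochn n\<^esub> g) = T f \<oplus>\<^bsub>cochn n'\<^esub> T g"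
  proof (rule cochain_ext)
   fix as cs assume as: "as \<in> obj_tuples A n'" and cs: "cs \<in> ltuples (hom_list A as)"
   show "hm_eval K A (T (f \<oplus>\<^bsub>cochn n\<^esub> g)) as cs = hm_eval K A (T f \<oplus>\<^bsub>cochn n'\<^esub> T g) as cs"
    using f g lin_add[OF eval_hom[OF as cs] cl[OF f] cl[OF g]] lin_add[OF lin[OF as cs] f g]
    by (simp add: ev[OF _ as cs])
  qed (use f g cl in auto)
 next
  fix a f assume a: "a \<in> carrier K" and f: "f \<in> carrier (cochn n)"
  show "T (a \<odot>\<^bsub>cochn n\<^esub> f) = a \<odot>\<^bsub>cochn n'\<^esub> T f"
  proof (rule cochain_ext)
   fix as cs assume as: "as \<in> obj_tuples A n'" and cs: "cs \<in> ltuples (hom_list A as)"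
   show "hm_eval K A (T (a \<odot>\<^bsub>cochn n\<^esub> f)) as cs = hm_eval K A (a \<odot>\<^bsub>cochn n'\<^esub> T f) as cs"
    using a f lin_smult[OF eval_hom[OF as cs] a cl[OF f]] lin_smult[OF lin[OF as cs] a f]
    by (simp add: ev[OF _ as cs])
  qed (use a f cl in auto)
 qed (rule cl)
qed

lemma bar_linear_post:
 assumes F: "bar_linear K A P y z N' F" and T: "T \<in> mod_hom K P P'"
 shows "bar_linear K A P' y z N' (\<lambda>os es. T (F os es))"
 by (rule bar_linearI) (rule lin_closed[OF T bar_closed[OF F]], assumption, rule lin_comp[OF T bar_slot[OF F]])

lemma outer_hom:
 assumes "y \<in> kobj A" "z \<in> kobj A" "y' \<in> kobj A" "z' \<in> kobj A" "u \<in> mor A y' y" "v \<in> mor A z z'"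
 shows "(\<lambda>m. blact N y' y z' u (bract N y z z' m v)) \<in> mod_hom K (bhom N y z) (bhom N y' z')"
 by (rule lin_comp[OF lact_hom_right ract_hom_left]) (use assms in auto)

definition
 "rco n f = cochain_of K A N n
   (\<lambda>as cs. bcuts (bhom N (hd as) (last as)) (Suc n) (eval_bar n f) (id_objs as) (id_mors A as cs))"

definition
 "hco n f = cochain_of K A N n
   (\<lambda>as cs. bhtpy (bhom N (hd as) (last as)) (Suc n) (eval_bar (Suc n) f) (id_objs as) (id_mors A as cs))"

lemma
 assumes f: "f \<in> carrier (cochn n)"
 shows rco_closed: "rco n f \<in> carrier (cochn n)"
  and rco_eval: "as \<in> obj_tuples A n \<Longrightarrow> cs \<in> ltuples (hom_list A as) \<Longrightarrow> hm_eval K A (rco n f) as cs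
   = bcuts (bhom N (hd as) (last as)) (Suc n) (eval_bar n f) (id_objs as) (id_mors A as cs)"
  and rco_bar: "(os, es) \<in> bar_tuples A y z (Suc (Suc n)) \<Longrightarrow> eval_bar n (rco n f) os es = bcuts (bhom N y z) (Suc n) (eval_bar n f) os es"
proof -
 let ?\<Phi> = "\<lambda>y z. bcuts (bhom N y z) (Suc n) (eval_bar n f)"
 have lin: "bar_linear K A (bhom N y z) y z (Suc (Suc n)) (?\<Phi> y z)" if "y \<in> kobj A" "z \<in> kobj A" for y z
  by (rule bcuts_linear[OF bhom_module[OF that(2,1)] eval_bar_linear[OF f that]]) simp
 show "rco n f \<in> carrier (cochn n)"
  unfolding rco_def by (rule cochain_of_closed[OF cochain_multilinear_of_bar[OF lin]])
 show ev: "as \<in> obj_tuples A n \<Longrightarrow> cs \<in> ltuples (hom_list A as) \<Longrightarrow> hm_eval K A (rco n f) as cs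
   = ?\<Phi> (hd as) (last as) (id_objs as) (id_mors A as cs)" for as cs
  unfolding rco_def by (rule eval_cochain_of[OF cochain_multilinear_of_bar[OF lin]])
 have outer: "?\<Phi> y' z' (outer_obj y' z' os) (outer_mor A y' z' u v os es) = blact N y' y z' u (bract N y z z' (?\<Phi> y z os es) v)"
  if yz: "y \<in> kobj A" "z \<in> kobj A" and y': "y' \<in> kobj A" "z' \<in> kobj A" and t: "(os, es) \<in> bar_tuples A y z (Suc (Suc n))"
   and uv: "u \<in> mor A y' y" "v \<in> mor A z z'" for y z y' z' u v os es
 proof -
  note P = bhom_module[OF yz(2,1)] and P' = bhom_module[OF y'(2,1)]
  note T = outer_hom[OF yz y' uv]
  have T': "bar_linear K A (bhom N y' z') y z (Suc (Suc n)) (\<lambda>os es. blact N y' y z' u (bract N y z z' (eval_bar n f os es) v))"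
   by (rule bar_linear_post[OF eval_bar_linear[OF f yz] T])
  have "?\<Phi> y' z' (outer_obj y' z' os) (outer_mor A y' z' u v os es)
    = bcuts (bhom N y' z') (Suc n) (\<lambda>os es. eval_bar n f (outer_obj y' z' os) (outer_mor A y' z' u v os es)) os es"
   by (rule bcuts_outer[OF P' eval_bar_linear[OF f y'] y' uv _ _ t]) auto
  also have "\<dots> = bcuts (bhom N y' z') (Suc n) (\<lambda>os es. blact N y' y z' u (bract N y z z' (eval_bar n f os es) v)) os es"
   by (rule bcuts_cong[OF P' T' _ cochain_bar_outer[OF _ y' uv eval_multilinear[OF f]] t]) auto
  also have "\<dots> = blact N y' y z' u (bract N y z z' (?\<Phi> y z os es) v)"
   by (rule bcuts_post[OF P P' T eval_bar_linear[OF f yz] _ t, symmetric]) simp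
  finally show ?thesis .
 qed
 show "(os, es) \<in> bar_tuples A y z (Suc (Suc n)) \<Longrightarrow> eval_bar n (rco n f) os es = ?\<Phi> y z os es"
  by (rule cochain_bar_of_bar[OF ev outer])
qed

lemma
 assumes f: "f \<in> carrier (cochn (Suc n))"
 shows hco_closed: "hco n f \<in> carrier (cochn n)"
  and hco_bar: "(os, es) \<in> bar_tuples A y z (Suc (Suc n)) \<Longrightarrow> eval_bar n (hco n f) os es = bhtpy (bhom N y z) (Suc n) (eval_bar (Suc n) f) os es"
proof -
 let ?\<Phi> = "\<lambda>y z. bhtpy (bhom N y z) (Suc n) (eval_bar (Suc n) f)"
 have lin: "bar_linear K A (bhom N y z) y z (Suc (Suc n)) (?\<Phi> y z)" if "y \<in> kobj A" "z \<in> kobj A" for y z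
  by (rule bhtpy_linear[OF bhom_module[OF that(2,1)] eval_bar_linear[OF f that]]) simp
 show "hco n f \<in> carrier (cochn n)"
  unfolding hco_def by (rule cochain_of_closed[OF cochain_multilinear_of_bar[OF lin]])
 have ev: "as \<in> obj_tuples A n \<Longrightarrow> cs \<in> ltuples (hom_list A as) \<Longrightarrow> hm_eval K A (hco n f) as cs
   = ?\<Phi> (hd as) (last as) (id_objs as) (id_mors A as cs)" for as cs
  unfolding hco_def by (rule eval_cochain_of[OF cochain_multilinear_of_bar[OF lin]])
 have outer: "?\<Phi> y' z' (outer_obj y' z' os) (outer_mor A y' z' u v os es) = blact N y' y z' u (bract N y z z' (?\<Phi> y z os es) v)"
  if yz: "y \<in> kobj A" "z \<in> kobj A" and y': "y' \<in> kobj A" "z' \<in> kobj A" and t: "(os, es) \<in> bar_tuples A y z (Suc (Suc n))"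
   and uv: "u \<in> mor A y' y" "v \<in> mor A z z'" for y z y' z' u v os es
 proof -
  note P = bhom_module[OF yz(2,1)] and P' = bhom_module[OF y'(2,1)]
  note T = outer_hom[OF yz y' uv]
  have T': "bar_linear K A (bhom N y' z') y z (Suc (Suc (Suc n))) (\<lambda>os es. blact N y' y z' u (bract N y z z' (eval_bar (Suc n) f os es) v))"
   by (rule bar_linear_post[OF eval_bar_linear[OF f yz] T])
  have "?\<Phi> y' z' (outer_obj y' z' os) (outer_mor A y' z' u v os es)
    = bhtpy (bhom N y' z') (Suc n) (\<lambda>os es. eval_bar (Suc n) f (outer_obj y' z' os) (outer_mor A y' z' u v os es)) os es"
   by (rule bhtpy_outer[OF P' eval_bar_linear[OF f y'] y' uv _ _ t]) auto
  also have "\<dots> = bhtpy (bhom N y' z') (Suc n) (\<lambda>os es. blact N y' y z' u (bract N y z z' (eval_bar (Suc n) f os es) v)) os es"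
   by (rule bhtpy_cong[OF P' T' _ cochain_bar_outer[OF _ y' uv eval_multilinear[OF f]] t]) auto
  also have "\<dots> = blact N y' y z' u (bract N y z z' (?\<Phi> y z os es) v)"
   by (rule bhtpy_post[OF P P' T eval_bar_linear[OF f yz] _ t, symmetric]) simp
  finally show ?thesis .
 qed
 show "(os, es) \<in> bar_tuples A y z (Suc (Suc n)) \<Longrightarrow> eval_bar n (hco n f) os es = ?\<Phi> y z os es"
  by (rule cochain_bar_of_bar[OF ev outer])
qed

lemma
 assumes f: "f \<in> carrier (cochn n)"
 shows coboundary_closed: "hm_coboundary K A N n f \<in> carrier (cochn (Suc n))"
  and coboundary_eval: "as \<in> obj_tuples A (Suc n) \<Longrightarrow> cs \<in> ltuples (hom_list A as) \<Longrightarrow> hm_eval K A (hm_coboundary K A N n f) as cs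
   = ksign K (Suc n) \<odot>\<^bsub>bhom N (hd as) (last as)\<^esub> bdiff (bhom N (hd as) (last as)) (Suc (Suc n)) (eval_bar n f) (id_objs as) (id_mors A as cs)"
  and coboundary_bar: "(os, es) \<in> bar_tuples A y z (Suc (Suc (Suc n))) \<Longrightarrow> eval_bar (Suc n) (hm_coboundary K A N n f) os es
   = ksign K (Suc n) \<odot>\<^bsub>bhom N y z\<^esub> bdiff (bhom N y z) (Suc (Suc n)) (eval_bar n f) os es"
proof -
 let ?\<Phi> = "\<lambda>y z os es. ksign K (Suc n) \<odot>\<^bsub>bhom N y z\<^esub> bdiff (bhom N y z) (Suc (Suc n)) (eval_bar n f) os es"
 let ?g = "\<lambda>xs cs. let N' = bhom N (hd xs) (last xs) in
     ksign K (n + 1) \<odot>\<^bsub>N'\<^esub>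
      blact N (xs ! 0) (xs ! 1) (last xs) (hd cs) (hm_eval K A f (tl xs) (tl cs))
     \<oplus>\<^bsub>N'\<^esub> (\<Oplus>\<^bsub>N'\<^esub> i \<in> {1..n}. ksign K i \<odot>\<^bsub>N'\<^esub>
         hm_eval K A f (drop_obj (n + 1 - i) xs) (merge_at A xs (n + 1 - i) cs))
     \<oplus>\<^bsub>N'\<^esub> bract N (hd xs) (xs ! n) (xs ! (n + 1)) (hm_eval K A f (butlast xs) (butlast cs)) (last cs)"
 have lin: "bar_linear K A (bhom N y z) y z (Suc (Suc (Suc n))) (?\<Phi> y z)" if yz: "y \<in> kobj A" "z \<in> kobj A" for y z
 proof -
  note P = bhom_module[OF yz(2,1)]
  interpret P: module K "bhom N y z" by (rule P)
  note B = bdiff_linear[OF P eval_bar_linear[OF f yz] order_refl]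
  show ?thesis
   by (rule bar_linearI) (auto intro: lin_smult_pointwise P bar_closed[OF B] bar_slot[OF B] P.smult_closed)
 qed
 have eq: "?g as cs = ?\<Phi> (hd as) (last as) (id_objs as) (id_mors A as cs)"
  if as: "as \<in> obj_tuples A (Suc n)" and cs: "cs \<in> ltuples (hom_list A as)" for as cs
 proof -
  note ob = obj_tuples_hd[OF as] obj_tuples_last[OF as]
  note face = cochain_bar_face[OF as cs eval_multilinear[OF f]]
  note P = bhom_module[OF ob(2,1)]
  interpret P: module K "bhom N (hd as) (last as)" by (rule P)
  let ?T = "\<lambda>q. bface A q (eval_bar n f) (id_objs as) (id_mors A as cs)"
  have cl: "?T q \<in> bim N (hd as) (last as)" if "q \<le> Suc n" for q
   using that by (intro bar_closed[OF bface_linear[OF eval_bar_linear[OF f ob]] id_tuple[OF as cs]]) auto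
  have "?\<Phi> (hd as) (last as) (id_objs as) (id_mors A as cs)
   = ksign K (n + 1) \<odot>\<^bsub>bhom N (hd as) (last as)\<^esub> ?T 0 \<oplus>\<^bsub>bhom N (hd as) (last as)\<^esub>
    (\<Oplus>\<^bsub>bhom N (hd as) (last as)\<^esub> i \<in> {1..n}. ksign K i \<odot>\<^bsub>bhom N (hd as) (last as)\<^esub> ?T (n + 1 - i))
    \<oplus>\<^bsub>bhom N (hd as) (last as)\<^esub> ?T (Suc n)"
   unfolding bdiff_def by (rule signed_sum_reverse[OF P cl])
  also have "(\<Oplus>\<^bsub>bhom N (hd as) (last as)\<^esub> i \<in> {1..n}. ksign K i \<odot>\<^bsub>bhom N (hd as) (last as)\<^esub> ?T (n + 1 - i))
   = (\<Oplus>\<^bsub>bhom N (hd as) (last as)\<^esub> i \<in> {1..n}. ksign K i \<odot>\<^bsub>bhom N (hd as) (last as)\<^esub>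
     hm_eval K A f (drop_obj (n + 1 - i) as) (merge_at A as (n + 1 - i) cs))"
  proof (rule P.finsum_cong')
   fix i assume i: "i \<in> {1..n}"
   then have "?T (n + 1 - i) = hm_eval K A f (drop_obj (n + 1 - i) as) (merge_at A as (n + 1 - i) cs)"
    by (subst face) auto
   then show "ksign K i \<odot>\<^bsub>bhom N (hd as) (last as)\<^esub> ?T (n + 1 - i) = ksign K i \<odot>\<^bsub>bhom N (hd as) (last as)\<^esub>
     hm_eval K A f (drop_obj (n + 1 - i) as) (merge_at A as (n + 1 - i) cs)" by simp
  next
   show "(\<lambda>i. ksign K i \<odot>\<^bsub>bhom N (hd as) (last as)\<^esub> hm_eval K A f (drop_obj (n + 1 - i) as) (merge_at A as (n + 1 - i) cs))
     \<in> {1..n} \<rightarrow> bim N (hd as) (last as)"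
   proof
    fix i assume i: "i \<in> {1..n}"
    then have "?T (n + 1 - i) = hm_eval K A f (drop_obj (n + 1 - i) as) (merge_at A as (n + 1 - i) cs)"
     by (subst face) auto
    with cl[of "n + 1 - i"] i show "ksign K i \<odot>\<^bsub>bhom N (hd as) (last as)\<^esub> hm_eval K A f (drop_obj (n + 1 - i) as) (merge_at A as (n + 1 - i) cs)
     \<in> bim N (hd as) (last as)" by auto
   qed
  qed simp
  finally show ?thesis using face[of 0] face[of "Suc n"] by (simp add: Let_def)
 qed
 have d: "hm_coboundary K A N n f = cochain_of K A N (Suc n) ?g"
  by (simp add: hm_coboundary_def cochain_of_def Let_def)
 have g: "cochain_multilinear K A N (Suc n) ?g"
  by (rule cochain_multilinear_cong[OF cochain_multilinear_of_bar[OF lin] eq])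
 show "hm_coboundary K A N n f \<in> carrier (cochn (Suc n))"
  unfolding d by (rule cochain_of_closed[OF g])
 show ev: "as \<in> obj_tuples A (Suc n) \<Longrightarrow> cs \<in> ltuples (hom_list A as) \<Longrightarrow> hm_eval K A (hm_coboundary K A N n f) as cs
   = ?\<Phi> (hd as) (last as) (id_objs as) (id_mors A as cs)" for as cs
  unfolding d by (subst eval_cochain_of[OF g]) (assumption+, rule eq)
 have outer: "?\<Phi> y' z' (outer_obj y' z' os) (outer_mor A y' z' u v os es) = blact N y' y z' u (bract N y z z' (?\<Phi> y z os es) v)"
  if yz: "y \<in> kobj A" "z \<in> kobj A" and y': "y' \<in> kobj A" "z' \<in> kobj A" and t: "(os, es) \<in> bar_tuples A y z (Suc (Suc (Suc n)))"
   and uv: "u \<in> mor A y' y" "v \<in> mor A z z'" for y z y' z' u v os es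
 proof -
  note P = bhom_module[OF yz(2,1)] and P' = bhom_module[OF y'(2,1)]
  interpret P': module K "bhom N y' z'" by (rule P')
  note T = outer_hom[OF yz y' uv] and D = bar_tuplesD[OF t]
  have L: "bar_linear K A (bhom N y z) y z (Suc (Suc n)) (eval_bar n f)" by (rule eval_bar_linear[OF f yz])
  have face: "bface A q (eval_bar n f) (outer_obj y' z' os) (outer_mor A y' z' u v os es)
    = bface A q (\<lambda>os es. blact N y' y z' u (bract N y z z' (eval_bar n f os es) v)) os es" if q: "q < Suc (Suc n)" for q
  proof -
   have "(drop_obj (Suc q) (outer_obj y' z' os), merge_at A (outer_obj y' z' os) (Suc q) (outer_mor A y' z' u v os es))
     = (outer_obj y' z' (drop_obj (Suc q) os), outer_mor A y' z' u v (drop_obj (Suc q) os) (merge_at A os (Suc q) es))"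
    using outer_merge[OF D(1) _ _ y', of q u v] uv D q by simp
   then show ?thesis
    unfolding bface_def using cochain_bar_outer[OF tuple_face[OF t q] y' uv eval_multilinear[OF f]] by simp
  qed
  have cl: "bface A q (\<lambda>os es. blact N y' y z' u (bract N y z z' (eval_bar n f os es) v)) os es \<in> bim N y' z'" if q: "q < Suc (Suc n)" for q
   unfolding bface_def by (rule lin_closed[OF T bar_closed[OF L tuple_face[OF t q]]])
  have "bdiff (bhom N y' z') (Suc (Suc n)) (eval_bar n f) (outer_obj y' z' os) (outer_mor A y' z' u v os es)
    = bdiff (bhom N y' z') (Suc (Suc n)) (\<lambda>os es. blact N y' y z' u (bract N y z z' (eval_bar n f os es) v)) os es"
   unfolding bdiff_def by (rule P'.finsum_cong') (use face cl in auto)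
  also have "\<dots> = blact N y' y z' u (bract N y z z' (bdiff (bhom N y z) (Suc (Suc n)) (eval_bar n f) os es) v)"
   by (rule bdiff_post[OF P P' T L order_refl t, symmetric])
  finally show ?thesis
   using lin_smult[OF T _ bar_closed[OF bdiff_linear[OF P L order_refl] t], of "ksign K (Suc n)"] by simp
 qed
 show "(os, es) \<in> bar_tuples A y z (Suc (Suc (Suc n))) \<Longrightarrow> eval_bar (Suc n) (hm_coboundary K A N n f) os es = ?\<Phi> y z os es"
  by (rule cochain_bar_of_bar[OF ev outer])
qed

lemma rco_hom: "rco n \<in> mod_hom K (cochn n) (cochn n)"
 by (rule cochain_op_hom[OF rco_closed rco_eval])
  (auto intro!: bcuts_param[OF cochain_module _ eval_bar_param] id_tuple bhom_module obj_tuples_hd obj_tuples_last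
   simp del: bcuts.simps)

lemma coboundary_hom: "hm_coboundary K A N n \<in> mod_hom K (cochn n) (cochn (Suc n))"
proof (rule cochain_op_hom[OF coboundary_closed coboundary_eval])
 fix as cs assume as: "as \<in> obj_tuples A (Suc n)" and cs: "cs \<in> ltuples (hom_list A as)"
 note P = bhom_module[OF obj_tuples_last[OF as] obj_tuples_hd[OF as]] and t = id_tuple[OF as cs]
 show "(\<lambda>f. ksign K (Suc n) \<odot>\<^bsub>bhom N (hd as) (last as)\<^esub> bdiff (bhom N (hd as) (last as)) (Suc (Suc n)) (eval_bar n f) (id_objs as) (id_mors A as cs))
   \<in> mod_hom K (cochn n) (bhom N (hd as) (last as))"
  unfolding bdiff_def bface_def
  by (intro lin_smult_pointwise[OF P] lin_finsum_pointwise[OF cochain_module P] eval_bar_param[OF tuple_face[OF t]]) auto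
qed

lemma eval_via_bar:
 assumes "f \<in> carrier (cochn n)" "as \<in> obj_tuples A n" "cs \<in> ltuples (hom_list A as)"
 shows "eval_bar n f (id_objs as) (id_mors A as cs) = hm_eval K A f as cs"
 by (rule cochain_bar_id[OF assms(2,3)]) (rule lin_closed[OF eval_hom[OF assms(2,3)] assms(1)])

lemma coboundary_rco:
 assumes f: "f \<in> carrier (cochn n)"
 shows "hm_coboundary K A N n (rco n f) = rco (Suc n) (hm_coboundary K A N n f)"
proof (rule cochain_ext[OF coboundary_closed[OF rco_closed[OF f]] rco_closed[OF coboundary_closed[OF f]]])
 fix as cs assume as: "as \<in> obj_tuples A (Suc n)" and cs: "cs \<in> ltuples (hom_list A as)"
 let ?P = "bhom N (hd as) (last as)"
 note ob = obj_tuples_hd[OF as] obj_tuples_last[OF as] and t = id_tuple[OF as cs]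
 note P = bhom_module[OF ob(2,1)] and L = eval_bar_linear[OF f ob]
 interpret P: module K ?P by (rule P)
 have sgn: "(\<lambda>m. ksign K (Suc n) \<odot>\<^bsub>?P\<^esub> m) \<in> mod_hom K ?P ?P"
  by (rule lin_smult_pointwise[OF P _ lin_id]) simp
 note B = bdiff_linear[OF P L order_refl]
 have "hm_eval K A (hm_coboundary K A N n (rco n f)) as cs
   = ksign K (Suc n) \<odot>\<^bsub>?P\<^esub> bdiff ?P (Suc (Suc n)) (eval_bar n (rco n f)) (id_objs as) (id_mors A as cs)"
  by (rule coboundary_eval[OF rco_closed[OF f] as cs])
 also have "bdiff ?P (Suc (Suc n)) (eval_bar n (rco n f)) (id_objs as) (id_mors A as cs)
   = bdiff ?P (Suc (Suc n)) (bcuts ?P (Suc n) (eval_bar n f)) (id_objs as) (id_mors A as cs)"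
  by (rule bdiff_cong[OF P bcuts_linear[OF P L] order_refl rco_bar[OF f] t]) auto
 also have "\<dots> = bcuts ?P (Suc (Suc n)) (bdiff ?P (Suc (Suc n)) (eval_bar n f)) (id_objs as) (id_mors A as cs)"
  by (rule bcuts_bdiff[OF P L t, symmetric])
 also have "ksign K (Suc n) \<odot>\<^bsub>?P\<^esub> \<dots> = bcuts ?P (Suc (Suc n)) (\<lambda>os es. ksign K (Suc n) \<odot>\<^bsub>?P\<^esub> bdiff ?P (Suc (Suc n)) (eval_bar n f) os es) (id_objs as) (id_mors A as cs)"
  by (rule bcuts_post[OF P P sgn B _ t]) simp
 also have "\<dots> = bcuts ?P (Suc (Suc n)) (eval_bar (Suc n) (hm_coboundary K A N n f)) (id_objs as) (id_mors A as cs)"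
  by (rule bcuts_cong[OF P eval_bar_linear[OF coboundary_closed[OF f] ob] _ coboundary_bar[OF f, symmetric] t]) auto
 also have "\<dots> = hm_eval K A (rco (Suc n) (hm_coboundary K A N n f)) as cs"
  by (rule rco_eval[OF coboundary_closed[OF f] as cs, symmetric])
 finally show "hm_eval K A (hm_coboundary K A N n (rco n f)) as cs = hm_eval K A (rco (Suc n) (hm_coboundary K A N n f)) as cs" .
qed

text \<open>For a cocycle the term of the homotopy formula that involves its faces vanishes. The sign is the one by which the
 coboundary differs from the alternating sum of faces.\<close>

theorem cochain_homotopy:
 assumes f: "f \<in> carrier (cochn n)" and df: "hm_coboundary K A N n f = \<zero>\<^bsub>cochn (Suc n)\<^esub>"
 shows "f \<ominus>\<^bsub>cochn n\<^esub> rco n f =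
  (if n = 0 then \<zero>\<^bsub>cochn n\<^esub> else ksign K n \<odot>\<^bsub>cochn n\<^esub> hm_coboundary K A N (n - 1) (hco (n - 1) f))"
proof -
 interpret C: module K "cochn n" by (rule cochain_module)
 have rf: "rco n f \<in> carrier (cochn n)" by (rule rco_closed[OF f])
 let ?d = "if n = 0 then \<zero>\<^bsub>cochn n\<^esub> else ksign K n \<odot>\<^bsub>cochn n\<^esub> hm_coboundary K A N (n - 1) (hco (n - 1) f)"
 have dc: "?d \<in> carrier (cochn n)"
 proof (cases n)
  case (Suc n')
  have "hm_coboundary K A N n' (hco n' f) \<in> carrier (cochn n)"
   unfolding Suc by (rule coboundary_closed[OF hco_closed[OF f[unfolded Suc]]])
  then show ?thesis using Suc C.smult_closed[OF ksign_in] by simp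
 next
  case 0
  then show ?thesis using C.zero_closed by simp
 qed
 show ?thesis
 proof (rule cochain_ext[OF C.minus_closed[OF f rf] dc])
  fix as cs assume as: "as \<in> obj_tuples A n" and cs: "cs \<in> ltuples (hom_list A as)"
  let ?P = "bhom N (hd as) (last as)"
  note ob = obj_tuples_hd[OF as] obj_tuples_last[OF as] and t = id_tuple[OF as cs]
  note P = bhom_module[OF ob(2,1)] and L = eval_bar_linear[OF f ob] and E = eval_hom[OF as cs]
  interpret P: module K ?P by (rule P)
  have zero: "(\<lambda>m. \<zero>\<^bsub>?P\<^esub>) \<in> mod_hom K ?P ?P" by (rule lin_const_zero[OF P])
  have bd: "bdiff ?P (Suc (Suc n)) (eval_bar n f) os es = \<zero>\<^bsub>?P\<^esub>" if u: "(os, es) \<in> bar_tuples A (hd as) (last as) (Suc (Suc (Suc n)))" for os es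
  proof -
   have cl: "bdiff ?P (Suc (Suc n)) (eval_bar n f) os es \<in> carrier ?P"
    by (rule bar_closed[OF bdiff_linear[OF P L order_refl] u])
   have "eval_bar (Suc n) (hm_coboundary K A N n f) os es = \<zero>\<^bsub>?P\<^esub>"
    unfolding df by (rule lin_zero[OF cochain_module P eval_bar_param[OF u]])
   then have "ksign K (Suc n) \<odot>\<^bsub>?P\<^esub> bdiff ?P (Suc (Suc n)) (eval_bar n f) os es = \<zero>\<^bsub>?P\<^esub>"
    using coboundary_bar[OF f u] by simp
   then show ?thesis using ksign_square[OF P cl, of "Suc n"] by simp
  qed
  have "bhtpy ?P (Suc n) (bdiff ?P (Suc (Suc n)) (eval_bar n f)) (id_objs as) (id_mors A as cs)
    = bhtpy ?P (Suc n) (\<lambda>os es. \<zero>\<^bsub>?P\<^esub>) (id_objs as) (id_mors A as cs)"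
   by (rule bhtpy_cong[OF P bdiff_linear[OF P L order_refl] _ bd[symmetric] t, symmetric]) auto
  also have "\<dots> = \<zero>\<^bsub>?P\<^esub>"
   by (rule bhtpy_post[OF P P zero bdiff_linear[OF P L order_refl] _ t, symmetric]) simp
  finally have first: "bhtpy ?P (Suc n) (bdiff ?P (Suc (Suc n)) (eval_bar n f)) (id_objs as) (id_mors A as cs) = \<zero>\<^bsub>?P\<^esub>" .
  have second: "bdiff ?P (Suc n) (bhtpy ?P n (eval_bar n f)) (id_objs as) (id_mors A as cs) = hm_eval K A ?d as cs"
  proof (cases n)
   case 0
   have "bdiff ?P (Suc n) (bhtpy ?P n (eval_bar n f)) (id_objs as) (id_mors A as cs) = \<zero>\<^bsub>?P\<^esub>"
    unfolding 0 by (simp add: bdiff_def bface_def bhtpy_def)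
   then show ?thesis using 0 lin_zero[OF cochain_module P E] by simp
  next
   case (Suc n')
   note f' = f[unfolded Suc] and hc = hco_closed[OF f[unfolded Suc]]
   have dh: "hm_coboundary K A N n' (hco n' f) \<in> carrier (cochn n)"
    unfolding Suc by (rule coboundary_closed[OF hc])
   have "bdiff ?P (Suc n) (bhtpy ?P n (eval_bar n f)) (id_objs as) (id_mors A as cs)
     = bdiff ?P (Suc n) (eval_bar n' (hco n' f)) (id_objs as) (id_mors A as cs)"
    unfolding Suc
    by (rule bdiff_cong[OF P eval_bar_linear[OF hc ob] order_refl hco_bar[OF f', symmetric]]) (use t Suc in auto)
   moreover have "hm_eval K A (hm_coboundary K A N n' (hco n' f)) as cs
     = ksign K n \<odot>\<^bsub>?P\<^esub> bdiff ?P (Suc n) (eval_bar n' (hco n' f)) (id_objs as) (id_mors A as cs)"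
    unfolding Suc by (rule coboundary_eval[OF hc]) (use as cs Suc in auto)
   moreover have "bdiff ?P (Suc n) (eval_bar n' (hco n' f)) (id_objs as) (id_mors A as cs) \<in> carrier ?P"
    unfolding Suc by (rule bar_closed[OF bdiff_linear[OF P eval_bar_linear[OF hc ob] order_refl]]) (use t Suc in auto)
   ultimately show ?thesis
    using Suc lin_smult[OF E _ dh, of "ksign K n"] ksign_square[OF P] by simp
  qed
  have "hm_eval K A (f \<ominus>\<^bsub>cochn n\<^esub> rco n f) as cs = hm_eval K A f as cs \<ominus>\<^bsub>?P\<^esub> hm_eval K A (rco n f) as cs"
   by (rule lin_minus[OF cochain_module P E f rf])
  also have "\<dots> = eval_bar n f (id_objs as) (id_mors A as cs) \<ominus>\<^bsub>?P\<^esub> bcuts ?P (Suc n) (eval_bar n f) (id_objs as) (id_mors A as cs)"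
   using eval_via_bar[OF f as cs] rco_eval[OF f as cs] by simp
  also have "\<dots> = bhtpy ?P (Suc n) (bdiff ?P (Suc (Suc n)) (eval_bar n f)) (id_objs as) (id_mors A as cs)
    \<oplus>\<^bsub>?P\<^esub> bdiff ?P (Suc n) (bhtpy ?P n (eval_bar n f)) (id_objs as) (id_mors A as cs)"
   using bar_homotopy[OF P L t] by simp
  also have "\<dots> = hm_eval K A ?d as cs"
   unfolding first second using lin_closed[OF E dc] by simp
  finally show "hm_eval K A (f \<ominus>\<^bsub>cochn n\<^esub> rco n f) as cs = hm_eval K A ?d as cs" .
 qed
qed

end

section \<open>Amalgamation of objects\<close>

context idempotent_category
begin

text \<open>The entries of a marked tuple begin and end, at the object \<open>os ! Suc k\<close>, with one of the
 idempotents of that object.\<close>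

definition
 "marked os es k x \<longleftrightarrow> x \<in> Idx (os ! Suc k)
   \<and> kcomp A (os ! k) (os ! Suc k) (os ! Suc k) (es ! k) (e x) = es ! k
   \<and> kcomp A (os ! Suc k) (os ! Suc k) (os ! Suc (Suc k)) (e x) (es ! Suc k) = es ! Suc k"

lemma marked_cut:
 assumes t: "(os, es) \<in> bar_tuples A y z N" and k: "Suc k < N" and x: "x \<in> Idx (os ! Suc k)"
 shows "marked os (cut_at A os k (e x) es) k x"
  and "marked os es (Suc k) w \<Longrightarrow> Suc (Suc k) < N \<Longrightarrow> marked os (cut_at A os k (e x) es) (Suc k) w"
  and "marked os es l w \<Longrightarrow> Suc k < l \<Longrightarrow> marked os (cut_at A os k (e x) es) l w"
proof -
 note D = bar_tuplesD[OF t] and ob = tuple_obj[OF t] and ho = tuple_hom[OF t]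
 have o: "os ! k \<in> kobj A" "os ! Suc k \<in> kobj A" "os ! Suc (Suc k) \<in> kobj A" using k by (auto intro!: ob)
 have h: "es ! k \<in> mor A (os ! k) (os ! Suc k)" "es ! Suc k \<in> mor A (os ! Suc k) (os ! Suc (Suc k))"
  using k by (auto intro!: ho)
 have ex: "e x \<in> mor A (os ! Suc k) (os ! Suc k)" by (rule idem_closed[OF o(2) x])
 have ex2: "kcomp A (os ! Suc k) (os ! Suc k) (os ! Suc k) (e x) (e x) = e x" by (rule idem[OF o(2) x])
 have "kcomp A (os ! k) (os ! Suc k) (os ! Suc k) (kcomp A (os ! k) (os ! Suc k) (os ! Suc k) (es ! k) (e x)) (e x)
   = kcomp A (os ! k) (os ! Suc k) (os ! Suc k) (es ! k) (e x)"
  using kcomp_assoc[OF o(2,2,2,1) h(1) ex ex] ex2 by simp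
 moreover have "kcomp A (os ! Suc k) (os ! Suc k) (os ! Suc (Suc k)) (e x) (kcomp A (os ! Suc k) (os ! Suc k) (os ! Suc (Suc k)) (e x) (es ! Suc k))
   = kcomp A (os ! Suc k) (os ! Suc k) (os ! Suc (Suc k)) (e x) (es ! Suc k)"
  using kcomp_assoc[OF o(3,2,2,2) ex ex h(2)] ex2 by simp
 ultimately show "marked os (cut_at A os k (e x) es) k x"
  using x k D by (simp add: marked_def nth_cut_at)
 show "marked os (cut_at A os k (e x) es) (Suc k) w" if m: "marked os es (Suc k) w" and k2: "Suc (Suc k) < N"
 proof -
  have ew: "e w \<in> mor A (os ! Suc (Suc k)) (os ! Suc (Suc k))"
   using m o by (intro idem_closed) (auto simp: marked_def)
  show ?thesis
   using m k D kcomp_assoc[OF o(3,3,2,2) ex h(2) ew] by (simp add: marked_def nth_cut_at)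
 qed
 show "marked os (cut_at A os k (e x) es) l w" if "marked os es l w" "Suc k < l"
  using that k D by (simp add: marked_def nth_cut_at)
qed

text \<open>A cut marks the object where it happens since idempotents absorb themselves, and the later cuts
 keep this mark.\<close>

lemma bcuts_into:
 assumes P: "module K P" and H: "submodule H K P"
  and F: "\<And>es. (os, es) \<in> bar_tuples A y z N \<Longrightarrow> (\<forall>k. Suc k < N \<longrightarrow> (\<exists>x. marked os es k x)) \<Longrightarrow> F os es \<in> H"
  and t: "(os, es) \<in> bar_tuples A y z N" and j: "j < N" and m: "\<forall>k. j \<le> k \<longrightarrow> Suc k < N \<longrightarrow> (\<exists>x. marked os es k x)"
 shows "bcuts P j F os es \<in> H"
 using t j m
proof (induction j arbitrary: es)
 case 0
 then show ?case using F by simp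
next
 case (Suc j)
 note t = Suc.prems(1)
 have "bcuts P j F os (cut_at A os j (e x) es) \<in> H" if x: "x \<in> Idx (os ! Suc j)" for x
 proof (rule Suc.IH)
  show "(os, cut_at A os j (e x) es) \<in> bar_tuples A y z N" by (rule tuple_cut_idem[OF t Suc.prems(2) x])
  show "\<forall>k. j \<le> k \<longrightarrow> Suc k < N \<longrightarrow> (\<exists>w. marked os (cut_at A os j (e x) es) k w)"
  proof (intro allI impI)
   fix k assume k: "j \<le> k" "Suc k < N"
   consider "k = j" | "k = Suc j" | "Suc j < k" using k by linarith
   then show "\<exists>w. marked os (cut_at A os j (e x) es) k w"
   proof cases
    case 1
    then show ?thesis using marked_cut(1)[OF t Suc.prems(2) x] by blast
   next
    case 2
    then obtain w where "marked os es (Suc j) w" using Suc.prems(3) k by blast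
    then show ?thesis using marked_cut(2)[OF t Suc.prems(2) x] 2 k by blast
   next
    case 3
    then obtain w where "marked os es k w" using Suc.prems(3) k by (metis less_imp_le)
    then show ?thesis using marked_cut(3)[OF t Suc.prems(2) x] 3 by blast
   qed
  qed
 qed (use Suc.prems in simp)
 then show ?case unfolding bcuts.simps bcut_def by (rule submodule_finsum[OF P H])
qed

text \<open>Cutting has no effect on a tuple that is marked by idempotents to which the others are
 orthogonal.\<close>

lemma bcuts_fixed:
 assumes P: "module K P" and F: "bar_linear K A P y z N F" and t: "(os, es) \<in> bar_tuples A y z N" and j: "j < N"
  and m: "\<And>k. Suc k < N \<Longrightarrow> marked os es k (x k)"
  and orth: "\<And>k w. \<lbrakk>Suc k < N; w \<in> Idx (os ! Suc k); w \<noteq> x k\<rbrakk>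
\<Longrightarrow> kcomp A (os ! k) (os ! Suc k) (os ! Suc k) (es ! k) (e w) = \<zero>\<^bsub>khom A (os ! k) (os ! Suc k)\<^esub>"
 shows "bcuts P j F os es = F os es"
 using j
proof (induction j)
 case 0
 then show ?case by simp
next
 case (Suc j)
 interpret P: module K P by (rule P)
 let ?G = "bcuts P j F"
 note D = bar_tuplesD[OF t]
 have G: "bar_linear K A P y z N ?G" using Suc.prems by (intro bcuts_linear[OF P F]) auto
 have ob: "os ! i \<in> kobj A" if "i \<le> N" for i by (rule tuple_obj[OF t that])
 have fin: "finite (Idx (os ! Suc j))" using Suc.prems by (intro idx_finite ob) auto
 have xj: "x j \<in> Idx (os ! Suc j)" using m[OF Suc.prems] by (simp add: marked_def)
 have cut: "?G os (cut_at A os j (e w) es) = (if x j = w then F os es else \<zero>\<^bsub>P\<^esub>)" if w: "w \<in> Idx (os ! Suc j)" for w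
 proof (cases "x j = w")
  case True
  have "cut_at A os j (e w) es = es"
   using m[OF Suc.prems] True by (simp add: marked_def cut_at_def)
  then show ?thesis using True Suc by simp
 next
  case False
  have t': "(os, cut_at A os j (e w) es) \<in> bar_tuples A y z N" by (rule tuple_cut_idem[OF t Suc.prems w])
  have "cut_at A os j (e w) es = (cut_at A os j (e w) es)[j := \<zero>\<^bsub>khom A (os ! j) (os ! Suc j)\<^esub>]"
   using orth[OF Suc.prems w] False D Suc.prems by (intro nth_equalityI) (auto simp: nth_cut_at nth_list_update)
  moreover have "?G os ((cut_at A os j (e w) es)[j := \<zero>\<^bsub>khom A (os ! j) (os ! Suc j)\<^esub>]) = \<zero>\<^bsub>P\<^esub>"
   using Suc.prems by (intro lin_zero[OF khom_module P bar_slot[OF G t']] ob) auto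
  ultimately show ?thesis using False by simp
 qed
 have "bcuts P (Suc j) F os es = (\<Oplus>\<^bsub>P\<^esub> w \<in> Idx (os ! Suc j). if x j = w then F os es else \<zero>\<^bsub>P\<^esub>)"
  unfolding bcuts.simps bcut_def
  by (rule P.finsum_cong') (use cut bar_closed[OF F t] in auto)
 also have "\<dots> = F os es"
  by (rule P.finsum_singleton[OF xj fin]) (use bar_closed[OF F t] in auto)
 finally show ?case .
qed

end

text \<open>The spaces of morphisms are a bimodule themselves, so the statements about morphisms below are
 instances of those about bimodules.\<close>

definition regular :: "('o, 'c, 'k) kcat \<Rightarrow> ('o, 'c, 'c, 'k) kbimod" where
 "regular C = \<lparr>bhom = khom C, blact = kcomp C, bract = kcomp C\<rparr>"

lemma regular_sel [simp]: "bhom (regular C) = khom C" "blact (regular C) = kcomp C" "bract (regular C) = kcomp C"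
 by (simp_all add: regular_def)

lemma (in k_category) regular_bimodule: "k_bimodule K C (regular C)"
 by (rule k_bimodule.intro[OF k_category_axioms k_bimodule_axioms.intro])
  (simp_all add: khom_module kcomp_bilin kcomp_assoc kid_left kid_right)

text \<open>
 The category \<open>A\<close> arises from \<open>B\<close> by amalgamating the objects in each fibre of \<open>p\<close>: a morphism of
 \<open>A\<close> is a matrix of morphisms of \<open>B\<close>. The map \<open>inc y x\<close> is the inclusion of the \<open>(y, x)\<close> entry,
 and \<open>prj y x\<close> is the projection to it. The bimodule \<open>N\<close> is related to \<open>M\<close> in the same way.
\<close>

locale amalgamation = A: k_bimodule K A N + B: k_bimodule K B M
 for K :: "('k, 'r) ring_scheme" (structure)
  and A :: "('a, 'c, 'k) kcat" and N :: "('a, 'c, 'n, 'k) kbimod"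
  and B :: "('b, 'd, 'k) kcat" and M :: "('b, 'd, 'm, 'k) kbimod" +
 fixes p :: "'b \<Rightarrow> 'a"
  and inc :: "'b \<Rightarrow> 'b \<Rightarrow> 'd \<Rightarrow> 'c" and prj :: "'b \<Rightarrow> 'b \<Rightarrow> 'c \<Rightarrow> 'd"
  and incM :: "'b \<Rightarrow> 'b \<Rightarrow> 'm \<Rightarrow> 'n" and prjM :: "'b \<Rightarrow> 'b \<Rightarrow> 'n \<Rightarrow> 'm"
 assumes p_obj: "x \<in> kobj B \<Longrightarrow> p x \<in> kobj A"
  and fibre_finite: "a \<in> kobj A \<Longrightarrow> finite {x \<in> kobj B. p x = a}"
  and inc_hom: "x \<in> kobj B \<Longrightarrow> y \<in> kobj B \<Longrightarrow> inc y x \<in> mod_hom K (khom B y x) (khom A (p y) (p x))"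
  and prj_hom: "x \<in> kobj B \<Longrightarrow> y \<in> kobj B \<Longrightarrow> prj y x \<in> mod_hom K (khom A (p y) (p x)) (khom B y x)"
  and prj_inc: "\<lbrakk>x \<in> kobj B; y \<in> kobj B; f \<in> mor B y x\<rbrakk> \<Longrightarrow> prj y x (inc y x f) = f"
  and inc_comp: "\<lbrakk>x \<in> kobj B; y \<in> kobj B; z \<in> kobj B; g \<in> mor B z y; f \<in> mor B y x\<rbrakk>
   \<Longrightarrow> inc z x (kcomp B z y x g f) = kcomp A (p z) (p y) (p x) (inc z y g) (inc y x f)"
  and unit_sum: "a \<in> kobj A \<Longrightarrow> (\<Oplus>\<^bsub>khom A a a\<^esub> x \<in> {x \<in> kobj B. p x = a}. inc x x (kid B x)) = kid A a"
  and unit_orth: "\<lbrakk>x \<in> kobj B; y \<in> kobj B; p x = p y; x \<noteq> y\<rbrakk>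
   \<Longrightarrow> kcomp A (p y) (p y) (p y) (inc x x (kid B x)) (inc y y (kid B y)) = \<zero>\<^bsub>khom A (p y) (p y)\<^esub>"
  and inc_prj: "\<lbrakk>x \<in> kobj B; y \<in> kobj B; c \<in> mor A (p y) (p x)\<rbrakk>
   \<Longrightarrow> inc y x (prj y x c) = kcomp A (p y) (p y) (p x) (inc y y (kid B y))
      (kcomp A (p y) (p x) (p x) c (inc x x (kid B x)))"
  and incM_hom: "x \<in> kobj B \<Longrightarrow> y \<in> kobj B \<Longrightarrow> incM y x \<in> mod_hom K (bhom M y x) (bhom N (p y) (p x))"
  and prjM_hom: "x \<in> kobj B \<Longrightarrow> y \<in> kobj B \<Longrightarrow> prjM y x \<in> mod_hom K (bhom N (p y) (p x)) (bhom M y x)"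
  and prjM_incM: "\<lbrakk>x \<in> kobj B; y \<in> kobj B; m \<in> bim M y x\<rbrakk> \<Longrightarrow> prjM y x (incM y x m) = m"
  and incM_lact: "\<lbrakk>x \<in> kobj B; y \<in> kobj B; z \<in> kobj B; g \<in> mor B z y; m \<in> bim M y x\<rbrakk>
   \<Longrightarrow> incM z x (blact M z y x g m) = blact N (p z) (p y) (p x) (inc z y g) (incM y x m)"
  and incM_ract: "\<lbrakk>x \<in> kobj B; y \<in> kobj B; z \<in> kobj B; m \<in> bim M z y; f \<in> mor B y x\<rbrakk>
   \<Longrightarrow> incM z x (bract M z y x m f) = bract N (p z) (p y) (p x) (incM z y m) (inc y x f)"
  and incM_prjM: "\<lbrakk>x \<in> kobj B; y \<in> kobj B; n \<in> bim N (p y) (p x)\<rbrakk>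
   \<Longrightarrow> incM y x (prjM y x n) = blact N (p y) (p y) (p x) (inc y y (kid B y))
      (bract N (p y) (p x) (p x) n (inc x x (kid B x)))"
begin

abbreviation unit :: "'b \<Rightarrow> 'c" where "unit x \<equiv> inc x x (kid B x)"

abbreviation fibre :: "'a \<Rightarrow> 'b set" where "fibre a \<equiv> {x \<in> kobj B. p x = a}"

lemma inc_closed: "\<lbrakk>x \<in> kobj B; y \<in> kobj B; f \<in> mor B y x\<rbrakk> \<Longrightarrow> inc y x f \<in> mor A (p y) (p x)"
 by (rule lin_closed[OF inc_hom])

lemma prj_closed: "\<lbrakk>x \<in> kobj B; y \<in> kobj B; c \<in> mor A (p y) (p x)\<rbrakk> \<Longrightarrow> prj y x c \<in> mor B y x"
 by (rule lin_closed[OF prj_hom])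

lemma incM_closed: "\<lbrakk>x \<in> kobj B; y \<in> kobj B; m \<in> bim M y x\<rbrakk> \<Longrightarrow> incM y x m \<in> bim N (p y) (p x)"
 by (rule lin_closed[OF incM_hom])

lemma prjM_closed: "\<lbrakk>x \<in> kobj B; y \<in> kobj B; n \<in> bim N (p y) (p x)\<rbrakk> \<Longrightarrow> prjM y x n \<in> bim M y x"
 by (rule lin_closed[OF prjM_hom])

lemma unit_closed: "x \<in> kobj B \<Longrightarrow> unit x \<in> mor A (p x) (p x)"
 by (intro inc_closed B.kid_closed)

lemma unit_incM: "\<lbrakk>x \<in> kobj B; y \<in> kobj B; m \<in> bim M y x\<rbrakk> \<Longrightarrow> blact N (p y) (p y) (p x) (unit y) (incM y x m) = incM y x m"
 using incM_lact[of x y y "kid B y" m] by (simp add: B.kid_closed B.blact_kid)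

lemma incM_unit: "\<lbrakk>x \<in> kobj B; y \<in> kobj B; m \<in> bim M y x\<rbrakk> \<Longrightarrow> bract N (p y) (p x) (p x) (incM y x m) (unit x) = incM y x m"
 using incM_ract[of x x y m "kid B x"] by (simp add: B.kid_closed B.bract_kid)

lemma unit_incM_other:
 assumes "x \<in> kobj B" "y \<in> kobj B" "w \<in> kobj B" "p w = p y" "w \<noteq> y" "m \<in> bim M y x"
 shows "blact N (p y) (p y) (p x) (unit w) (incM y x m) = \<zero>\<^bsub>bhom N (p y) (p x)\<^esub>"
proof -
 note o = p_obj[OF assms(1)] p_obj[OF assms(2)]
 have uw: "unit w \<in> mor A (p y) (p y)" using unit_closed[OF assms(3)] assms(4) by simp
 have "blact N (p y) (p y) (p x) (unit w) (incM y x m)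
   = blact N (p y) (p y) (p x) (unit w) (blact N (p y) (p y) (p x) (unit y) (incM y x m))"
  using assms by (simp add: unit_incM)
 also have "\<dots> = blact N (p y) (p y) (p x) (kcomp A (p y) (p y) (p y) (unit w) (unit y)) (incM y x m)"
  by (rule A.blact_assoc) (use o uw unit_closed incM_closed assms in auto)
 also have "\<dots> = blact N (p y) (p y) (p x) \<zero>\<^bsub>khom A (p y) (p y)\<^esub> (incM y x m)"
  using unit_orth[OF assms(3,2,4,5)] by simp
 also have "\<dots> = \<zero>\<^bsub>bhom N (p y) (p x)\<^esub>"
  by (rule lin_zero[OF A.khom_module A.bhom_module A.lact_hom_left]) (use o incM_closed assms in auto)
 finally show ?thesis .
qed

lemma incM_unit_other:
 assumes "x \<in> kobj B" "y \<in> kobj B" "w \<in> kobj B" "p w = p x" "w \<noteq> x" "m \<in> bim M y x"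
 shows "bract N (p y) (p x) (p x) (incM y x m) (unit w) = \<zero>\<^bsub>bhom N (p y) (p x)\<^esub>"
proof -
 note o = p_obj[OF assms(1)] p_obj[OF assms(2)]
 have uw: "unit w \<in> mor A (p x) (p x)" using unit_closed[OF assms(3)] assms(4) by simp
 have "bract N (p y) (p x) (p x) (incM y x m) (unit w)
   = bract N (p y) (p x) (p x) (bract N (p y) (p x) (p x) (incM y x m) (unit x)) (unit w)"
  using assms by (simp add: incM_unit)
 also have "\<dots> = bract N (p y) (p x) (p x) (incM y x m) (kcomp A (p x) (p x) (p x) (unit x) (unit w))"
  by (rule A.bract_assoc) (use o uw unit_closed incM_closed assms in auto)
 also have "\<dots> = bract N (p y) (p x) (p x) (incM y x m) \<zero>\<^bsub>khom A (p x) (p x)\<^esub>"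
  using unit_orth[of x w] assms by simp
 also have "\<dots> = \<zero>\<^bsub>bhom N (p y) (p x)\<^esub>"
  by (rule lin_zero[OF A.khom_module A.bhom_module A.ract_hom_right]) (use o incM_closed assms in auto)
 finally show ?thesis .
qed

lemma prjM_incM_other:
 assumes "x \<in> kobj B" "y \<in> kobj B" "x' \<in> kobj B" "y' \<in> kobj B" "p x' = p x" "p y' = p y" "x' \<noteq> x \<or> y' \<noteq> y"
  and "m \<in> bim M y' x'"
 shows "prjM y x (incM y' x' m) = \<zero>\<^bsub>bhom M y x\<^esub>"
proof -
 note o = p_obj[OF assms(1)] p_obj[OF assms(2)]
 have f: "incM y' x' m \<in> bim N (p y) (p x)" using incM_closed[of x' y' m] assms by simp
 have "blact N (p y) (p y) (p x) (unit y) (bract N (p y) (p x) (p x) (incM y' x' m) (unit x)) = \<zero>\<^bsub>bhom N (p y) (p x)\<^esub>"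
 proof (cases "x' = x")
  case False
  then have "bract N (p y) (p x) (p x) (incM y' x' m) (unit x) = \<zero>\<^bsub>bhom N (p y) (p x)\<^esub>"
   using incM_unit_other[of x' y' x m] assms by simp
  then show ?thesis
   using lin_zero[OF A.bhom_module A.bhom_module A.lact_hom_right[OF o(1) o(2) o(2) unit_closed[OF assms(2)]]] o by simp
 next
  case True
  then have "y' \<noteq> y" using assms(7) by simp
  then show ?thesis
   using unit_incM_other[of x' y' y m] incM_unit[of x' y' m] True assms by simp
 qed
 then have "incM y x (prjM y x (incM y' x' m)) = \<zero>\<^bsub>bhom N (p y) (p x)\<^esub>"
  using incM_prjM[OF assms(1,2) f] by simp
 then have "prjM y x (incM y x (prjM y x (incM y' x' m))) = \<zero>\<^bsub>bhom M y x\<^esub>"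
  using lin_zero[OF A.bhom_module B.bhom_module prjM_hom] o assms by simp
 then show ?thesis using prjM_incM[OF assms(1,2) prjM_closed[OF assms(1,2) f]] by simp
qed

lemma regular_amalgamation: "amalgamation K A (regular A) B (regular B) p inc prj inc prj"
 by (rule amalgamation.intro[OF A.regular_bimodule B.regular_bimodule amalgamation_axioms.intro])
  (simp_all add: p_obj fibre_finite inc_hom prj_hom prj_inc unit_sum unit_orth inc_prj inc_comp)

lemmas unit_inc = amalgamation.unit_incM[OF regular_amalgamation, unfolded regular_sel]
 and inc_unit = amalgamation.incM_unit[OF regular_amalgamation, unfolded regular_sel]
 and inc_unit_other = amalgamation.incM_unit_other[OF regular_amalgamation, unfolded regular_sel]
 and prj_inc_other = amalgamation.prjM_incM_other[OF regular_amalgamation, unfolded regular_sel]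

sublocale idempotent_bimodule K A fibre unit N
proof (rule idempotent_bimodule.intro)
 show "idempotent_category K A fibre unit"
 proof (rule idempotent_category.intro, rule A.k_category_axioms, rule idempotent_category_axioms.intro)
  show "kcomp A a a a (unit x) (unit x) = unit x" if "a \<in> kobj A" "x \<in> fibre a" for a x
   using that unit_inc[of x x "kid B x"] by (auto simp: B.kid_closed)
 qed (auto simp: fibre_finite unit_sum unit_closed)
 show "k_bimodule K A N" by (rule A.k_bimodule_axioms)
qed

definition
 "incs xs cs = map (\<lambda>i. inc (xs ! i) (xs ! Suc i) (cs ! i)) [0..<length cs]"

definition
 "prjs xs cs = map (\<lambda>i. prj (xs ! i) (xs ! Suc i) (cs ! i)) [0..<length cs]"

lemma length_incs [simp]: "length (incs xs cs) = length cs" "length (prjs xs cs') = length cs'"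
 by (simp_all add: incs_def prjs_def)

lemma nth_incs: "i < length cs \<Longrightarrow> incs xs cs ! i = inc (xs ! i) (xs ! Suc i) (cs ! i)"
 by (simp add: incs_def)

lemma nth_prjs: "i < length cs \<Longrightarrow> prjs xs cs ! i = prj (xs ! i) (xs ! Suc i) (cs ! i)"
 by (simp add: prjs_def)

lemma incs_update: "i < length cs \<Longrightarrow> incs xs (cs[i := c]) = (incs xs cs)[i := inc (xs ! i) (xs ! Suc i) c]"
 by (intro nth_equalityI) (auto simp: nth_incs nth_list_update)

lemma prjs_update: "i < length cs \<Longrightarrow> prjs xs (cs[i := c]) = (prjs xs cs)[i := prj (xs ! i) (xs ! Suc i) c]"
 by (intro nth_equalityI) (auto simp: nth_prjs nth_list_update)

context
 fixes n xs
 assumes xs: "xs \<in> obj_tuples B n"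
begin

lemma xs_obj: "i \<le> n \<Longrightarrow> xs ! i \<in> kobj B"
 using obj_tuples_nth[OF xs] by simp

lemma map_p_tuple: "map p xs \<in> obj_tuples A n"
 using xs p_obj by (auto simp: obj_tuples_def)

lemma map_p_ends: "hd (map p xs) = p (hd xs)" "last (map p xs) = p (last xs)"
 using obj_tuples_length[OF xs] by (auto simp: hd_map last_map simp flip: length_0_conv)

lemma B_tuple_iff: "cs \<in> ltuples (hom_list B xs) \<longleftrightarrow> length cs = n \<and> (\<forall>i<n. cs ! i \<in> mor B (xs ! i) (xs ! Suc i))"
 using obj_tuples_length[OF xs] by (auto simp: hom_list_tuples_iff)

lemma A_tuple_iff: "cs \<in> ltuples (hom_list A (map p xs)) \<longleftrightarrow> length cs = n \<and> (\<forall>i<n. cs ! i \<in> mor A (p (xs ! i)) (p (xs ! Suc i)))"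
 using obj_tuples_length[OF xs] by (auto simp: hom_list_tuples_iff)

lemma incs_tuple: "cs \<in> ltuples (hom_list B xs) \<Longrightarrow> incs xs cs \<in> ltuples (hom_list A (map p xs))"
 unfolding B_tuple_iff A_tuple_iff using xs_obj by (auto simp: nth_incs intro!: inc_closed)

lemma prjs_tuple: "cs \<in> ltuples (hom_list A (map p xs)) \<Longrightarrow> prjs xs cs \<in> ltuples (hom_list B xs)"
 unfolding B_tuple_iff A_tuple_iff using xs_obj by (auto simp: nth_prjs intro!: prj_closed)

lemma prjs_incs: "cs \<in> ltuples (hom_list B xs) \<Longrightarrow> prjs xs (incs xs cs) = cs"
 unfolding B_tuple_iff using xs_obj by (intro nth_equalityI) (auto simp: nth_prjs nth_incs prj_inc)

lemma inc_slot: "i < n \<Longrightarrow> inc (xs ! i) (xs ! Suc i) \<in> mod_hom K (hom_list B xs ! i) (hom_list A (map p xs) ! i)"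
 using inc_hom[of "xs ! Suc i" "xs ! i"] xs_obj obj_tuples_length[OF xs] by simp

lemma prj_slot: "i < n \<Longrightarrow> prj (xs ! i) (xs ! Suc i) \<in> mod_hom K (hom_list A (map p xs) ! i) (hom_list B xs ! i)"
 using prj_hom[of "xs ! Suc i" "xs ! i"] xs_obj obj_tuples_length[OF xs] by simp

end

definition
 "inct xs t = (incM (last xs) (hd xs) (fst t), incs xs (snd t))"

definition
 "prjt xs t = (prjM (last xs) (hd xs) (fst t), prjs xs (snd t))"

context
 fixes n xs
 assumes xs: "xs \<in> obj_tuples B n"
begin

lemma hd_obj: "hd xs \<in> kobj B" and last_obj: "last xs \<in> kobj B"
 by (rule obj_tuples_hd[OF xs], rule obj_tuples_last[OF xs])

lemma inct_tuple: "t \<in> chain_tuples B M xs \<Longrightarrow> inct xs t \<in> chain_tuples A N (map p xs)"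
 using incs_tuple[OF xs] incM_closed[OF hd_obj last_obj]
 by (auto simp: chain_tuples_def htuples_def inct_def map_p_ends[OF xs])

lemma prjt_tuple: "t \<in> chain_tuples A N (map p xs) \<Longrightarrow> prjt xs t \<in> chain_tuples B M xs"
 using prjs_tuple[OF xs] prjM_closed[OF hd_obj last_obj]
 by (auto simp: chain_tuples_def htuples_def prjt_def map_p_ends[OF xs])

lemma prjt_inct: "t \<in> chain_tuples B M xs \<Longrightarrow> prjt xs (inct xs t) = t"
 using prjs_incs[OF xs] prjM_incM[OF hd_obj last_obj]
 by (cases t) (auto simp: chain_tuples_def htuples_def inct_def prjt_def)

end

lemma incs_linear:
 assumes xs: "xs \<in> obj_tuples B n" and g: "multilinear K (hom_list A (map p xs)) P g"
 shows "multilinear K (hom_list B xs) P (\<lambda>cs. g (incs xs cs))"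
 unfolding multilinear_def
proof (intro conjI ballI allI impI)
 fix cs assume cs: "cs \<in> ltuples (hom_list B xs)"
 note cs' = incs_tuple[OF xs cs] and g' = g[unfolded multilinear_def]
 show "g (incs xs cs) \<in> carrier P" using g' cs' by blast
 fix i assume "i < length (hom_list B xs)"
 then have i: "i < n" using obj_tuples_length[OF xs] by simp
 have upd: "incs xs (cs[i := c]) = (incs xs cs)[i := inc (xs ! i) (xs ! Suc i) c]" for c
  by (rule incs_update) (use cs i B_tuple_iff[OF xs] in auto)
 have "(\<lambda>c. g ((incs xs cs)[i := c])) \<in> mod_hom K (hom_list A (map p xs) ! i) P"
  using g' cs' i obj_tuples_length[OF xs] by (auto simp del: nth_hom_list)
 from lin_comp[OF this inc_slot[OF xs i]]
 show "(\<lambda>c. g (incs xs (cs[i := c]))) \<in> mod_hom K (hom_list B xs ! i) P"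
  unfolding upd .
qed

lemma prjs_linear:
 assumes xs: "xs \<in> obj_tuples B n" and g: "multilinear K (hom_list B xs) P g"
 shows "multilinear K (hom_list A (map p xs)) P (\<lambda>cs. g (prjs xs cs))"
 unfolding multilinear_def
proof (intro conjI ballI allI impI)
 fix cs assume cs: "cs \<in> ltuples (hom_list A (map p xs))"
 note cs' = prjs_tuple[OF xs cs] and g' = g[unfolded multilinear_def]
 show "g (prjs xs cs) \<in> carrier P" using g' cs' by blast
 fix i assume "i < length (hom_list A (map p xs))"
 then have i: "i < n" using obj_tuples_length[OF xs] by simp
 have upd: "prjs xs (cs[i := c]) = (prjs xs cs)[i := prj (xs ! i) (xs ! Suc i) c]" for c
  by (rule prjs_update) (use cs i A_tuple_iff[OF xs] in auto)
 have "(\<lambda>c. g ((prjs xs cs)[i := c])) \<in> mod_hom K (hom_list B xs ! i) P"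
  using g' cs' i obj_tuples_length[OF xs] by (auto simp del: nth_hom_list)
 from lin_comp[OF this prj_slot[OF xs i]]
 show "(\<lambda>c. g (prjs xs (cs[i := c]))) \<in> mod_hom K (hom_list A (map p xs) ! i) P"
  unfolding upd .
qed

lemma inct_linear:
 assumes xs: "xs \<in> obj_tuples B n" and g: "hmultilinear K (bhom N (last (map p xs)) (hd (map p xs))) (hom_list A (map p xs)) P g"
 shows "hmultilinear K (bhom M (last xs) (hd xs)) (hom_list B xs) P (\<lambda>t. g (inct xs t))"
 unfolding hmultilinear_def inct_def fst_conv snd_conv
proof (intro conjI ballI)
 note ob = hd_obj[OF xs] last_obj[OF xs] and g' = g[unfolded hmultilinear_def map_p_ends[OF xs]]
 show "(\<lambda>m. g (incM (last xs) (hd xs) m, incs xs cs)) \<in> mod_hom K (bhom M (last xs) (hd xs)) P"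
  if "cs \<in> ltuples (hom_list B xs)" for cs
  by (rule lin_comp[OF _ incM_hom[OF ob], where g = "\<lambda>m. g (m, incs xs cs)"]) (use g' incs_tuple[OF xs that] in blast)
 show "multilinear K (hom_list B xs) P (\<lambda>cs. g (incM (last xs) (hd xs) m, incs xs cs))"
  if "m \<in> bim M (last xs) (hd xs)" for m
  by (rule incs_linear[OF xs, where g = "\<lambda>cs. g (incM (last xs) (hd xs) m, cs)"]) (use g' incM_closed[OF ob that] in blast)
qed

lemma prjt_linear:
 assumes xs: "xs \<in> obj_tuples B n" and g: "hmultilinear K (bhom M (last xs) (hd xs)) (hom_list B xs) P g"
 shows "hmultilinear K (bhom N (last (map p xs)) (hd (map p xs))) (hom_list A (map p xs)) P (\<lambda>t. g (prjt xs t))"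
 unfolding hmultilinear_def prjt_def fst_conv snd_conv map_p_ends[OF xs]
proof (intro conjI ballI)
 note ob = hd_obj[OF xs] last_obj[OF xs] and g' = g[unfolded hmultilinear_def]
 show "(\<lambda>m. g (prjM (last xs) (hd xs) m, prjs xs cs)) \<in> mod_hom K (bhom N (p (last xs)) (p (hd xs))) P"
  if "cs \<in> ltuples (hom_list A (map p xs))" for cs
  by (rule lin_comp[OF _ prjM_hom[OF ob], where g = "\<lambda>m. g (m, prjs xs cs)"]) (use g' prjs_tuple[OF xs that] in blast)
 show "multilinear K (hom_list A (map p xs)) P (\<lambda>cs. g (prjM (last xs) (hd xs) m, prjs xs cs))"
  if "m \<in> bim N (p (last xs)) (p (hd xs))" for m
  by (rule prjs_linear[OF xs, where g = "\<lambda>cs. g (prjM (last xs) (hd xs) m, cs)"]) (use g' prjM_closed[OF ob that] in blast)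
qed

text \<open>Composition with the inclusions carries bar tuples of \<open>B\<close> to bar tuples of \<open>A\<close>, and it
 commutes with the composition at inner objects, hence with all faces.\<close>

lemma map_p_drop: "map p (drop_obj q os) = drop_obj q (map p os)"
 by (simp add: drop_obj_def take_map drop_map)

lemma incs_bar:
 assumes "(os, es) \<in> bar_tuples B y z L"
 shows "(map p os, incs os es) \<in> bar_tuples A (p y) (p z) L"
proof -
 note D = bar_tuplesD[OF assms]
 have "path A (map p os) (incs os es)"
  using D path_obj[OF D(1)] path_hom[OF D(1)] by (intro pathI) (auto simp: nth_incs intro!: p_obj inc_closed)
 then show ?thesis using D by (auto simp: bar_tuples_def)
qed

lemma incs_merge:
 assumes t: "(os, es) \<in> bar_tuples B y z L" and q: "Suc q < L"
 shows "incs (drop_obj (Suc q) os) (merge_at B os (Suc q) es) = merge_at A (map p os) (Suc q) (incs os es)"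
proof -
 note D = bar_tuplesD[OF t]
 have o: "os ! q \<in> kobj B" "os ! Suc q \<in> kobj B" "os ! Suc (Suc q) \<in> kobj B" using q D by (auto intro!: path_obj[OF D(1)])
 have h: "es ! q \<in> mor B (os ! q) (os ! Suc q)" "es ! Suc q \<in> mor B (os ! Suc q) (os ! Suc (Suc q))"
  using q D by (auto intro!: path_hom[OF D(1)])
 show ?thesis
  using q D inc_comp[OF o(3,2,1) h] by (intro nth_equalityI) (auto simp: nth_incs nth_merge_at nth_drop_obj)
qed

text \<open>The objects of a tuple of \<open>B\<close> mark its image, since an included entry absorbs the identities of
 its two objects.\<close>

lemma incs_marked:
 assumes t: "(os, es) \<in> bar_tuples B y z L" and k: "Suc k < L"
 shows "marked (map p os) (incs os es) k (os ! Suc k)"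
  and "w \<in> fibre (map p os ! Suc k) \<Longrightarrow> w \<noteq> os ! Suc k
   \<Longrightarrow> kcomp A (map p os ! k) (map p os ! Suc k) (map p os ! Suc k) (incs os es ! k) (unit w)
    = \<zero>\<^bsub>khom A (map p os ! k) (map p os ! Suc k)\<^esub>"
proof -
 note D = bar_tuplesD[OF t]
 have o: "os ! k \<in> kobj B" "os ! Suc k \<in> kobj B" "os ! Suc (Suc k) \<in> kobj B" using k D by (auto intro!: path_obj[OF D(1)])
 have h: "es ! k \<in> mor B (os ! k) (os ! Suc k)" "es ! Suc k \<in> mor B (os ! Suc k) (os ! Suc (Suc k))"
  using k D by (auto intro!: path_hom[OF D(1)])
 show "marked (map p os) (incs os es) k (os ! Suc k)"
  using k D o inc_unit[OF o(2,1) h(1)] unit_inc[OF o(3,2) h(2)] by (simp add: marked_def nth_incs)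
 show "w \<in> fibre (map p os ! Suc k) \<Longrightarrow> w \<noteq> os ! Suc k
   \<Longrightarrow> kcomp A (map p os ! k) (map p os ! Suc k) (map p os ! Suc k) (incs os es ! k) (unit w)
    = \<zero>\<^bsub>khom A (map p os ! k) (map p os ! Suc k)\<^esub>"
  using k D inc_unit_other[OF o(2,1) _ _ _ h(1), of w] by (simp add: nth_incs)
qed

lemma trivial_bimodule: "idempotent_bimodule K B (\<lambda>b. {b}) (kid B) M"
 by (rule idempotent_bimodule.intro[OF B.trivial_idempotents B.k_bimodule_axioms])

abbreviation "chn_B n \<equiv> hm_chain K B M n"
abbreviation "cochn_B n \<equiv> hm_cochain K B M n"
abbreviation "bdiff_B \<equiv> idempotent_category.bdiff K B"
abbreviation "pure_bar_B n \<equiv> B.chain_bar n (hm_pure K B M n)"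
abbreviation "eval_bar_B n f \<equiv> B.cochain_bar n (hm_eval K B f)"

lemma bdiff_incs:
 assumes P: "module K P" and F: "\<And>os es. (os, es) \<in> bar_tuples A (p y) (p z) L \<Longrightarrow> F os es \<in> carrier P"
  and m: "m \<le> L" and t: "(os, es) \<in> bar_tuples B y z (Suc L)"
 shows "bdiff P m F (map p os) (incs os es) = bdiff_B P m (\<lambda>os es. F (map p os) (incs os es)) os es"
proof -
 interpret P: module K P by (rule P)
 interpret TB: idempotent_bimodule K B "\<lambda>b. {b}" "kid B" M by (rule trivial_bimodule)
 have face: "bface A q F (map p os) (incs os es) = bface B q (\<lambda>os es. F (map p os) (incs os es)) os es" if "q < m" for q
  using incs_merge[OF t, of q] that m by (simp add: bface_def map_p_drop)
 have "bface B q (\<lambda>os es. F (map p os) (incs os es)) os es \<in> carrier P" if "q < m" for q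
  unfolding bface_def by (rule F[OF incs_bar[OF TB.tuple_face[OF t]]]) (use that m in simp)
 then show ?thesis
  unfolding bdiff_def TB.bdiff_def by (intro P.finsum_cong') (auto simp: face)
qed

subsection \<open>Homology\<close>

definition
 "phi n = chain_lift K B M n (chn n) (\<lambda>xs t. hm_pure K A N n (map p xs) (inct xs t))"

lemma phi_multilinear: "chain_multilinear K B M n (chn n) (\<lambda>xs t. hm_pure K A N n (map p xs) (inct xs t))"
 unfolding chain_multilinear_def
proof
 fix xs assume xs: "xs \<in> obj_tuples B n"
 show "hmultilinear K (bhom M (last xs) (hd xs)) (hom_list B xs) (chn n) (\<lambda>t. hm_pure K A N n (map p xs) (inct xs t))"
  by (rule inct_linear[OF xs]) (use A.pure_multilinear map_p_tuple[OF xs] in \<open>simp add: chain_multilinear_def\<close>)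
qed

lemma phi_hom: "phi n \<in> mod_hom K (chn_B n) (chn n)"
 unfolding phi_def by (rule B.chain_lift_hom[OF A.chain_module phi_multilinear])

lemma phi_pure: "xs \<in> obj_tuples B n \<Longrightarrow> t \<in> chain_tuples B M xs
  \<Longrightarrow> phi n (hm_pure K B M n xs t) = hm_pure K A N n (map p xs) (inct xs t)"
 unfolding phi_def by (rule B.chain_lift_pure[OF A.chain_module phi_multilinear])

lemma phi_bar:
 assumes t: "(os, es) \<in> bar_tuples B y z (Suc (Suc n))" and m: "m \<in> bim M z y"
 shows "phi n (pure_bar_B n m os es) = pure_bar n (incM z y m) (map p os) (incs os es)"
proof -
 note D = bar_tuplesD[OF t] and core = B.core_tuple[OF t] and ob = B.tuple_objs[OF t] and ho = B.tuple_homs[OF t]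
 have o: "y \<in> kobj B" "z \<in> kobj B" "os ! 1 \<in> kobj B" "os ! Suc n \<in> kobj B"
  using ob[of 0] ob[of "Suc (Suc n)"] ob[of 1] ob[of "Suc n"] D by auto
 have h: "es ! 0 \<in> mor B y (os ! 1)" "es ! Suc n \<in> mor B (os ! Suc n) z"
  using ho[of 0] ho[of "Suc n"] D by auto
 have c: "map p (core os) = core (map p os)" "incs (core os) (core es) = core (incs os es)"
  using D by (auto intro!: nth_equalityI simp: nth_core nth_incs)
 have "incM (os ! Suc n) (os ! 1) (B.absorb n m os es) = A.absorb n (incM z y m) (map p os) (incs os es)"
  using D incM_lact[OF o(3,2,4) h(2) B.ract_closed[OF o(3,1,2) m h(1)]] incM_ract[OF o(3,1,2) m h(1)]
  by (simp add: A.absorb_def B.absorb_def nth_incs)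
 then show ?thesis
  unfolding B.chain_bar_def A.chain_bar_def phi_pure[OF core(1) B.chain_bar_tuple[OF t m]]
  by (simp add: inct_def c core(3,4))
qed

lemma phi_boundary:
 assumes "w \<in> carrier (chn_B (Suc n))"
 shows "hm_boundary K A N (Suc n) (phi (Suc n) w) = phi n (hm_boundary K B M (Suc n) w)"
proof (rule B.chain_hom_ext_bar[OF A.chain_module lin_comp[OF A.boundary_hom phi_hom] lin_comp[OF phi_hom B.boundary_hom] _ assms])
 interpret TB: idempotent_bimodule K B "\<lambda>b. {b}" "kid B" M by (rule trivial_bimodule)
 let ?P = "chn n" and ?N = "Suc (Suc n)"
 fix y z m os es assume y: "y \<in> kobj B" "z \<in> kobj B" and m: "m \<in> bim M z y" and t: "(os, es) \<in> bar_tuples B y z (Suc ?N)"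
 note m' = incM_closed[OF y m]
 have "hm_boundary K A N (Suc n) (phi (Suc n) (pure_bar_B (Suc n) m os es)) = bdiff ?P ?N (pure_bar n (incM z y m)) (map p os) (incs os es)"
  unfolding phi_bar[OF t m] by (rule boundary_bar[OF incs_bar[OF t] m'])
 also have "\<dots> = bdiff_B ?P ?N (\<lambda>os es. pure_bar n (incM z y m) (map p os) (incs os es)) os es"
  by (rule bdiff_incs[OF A.chain_module bar_closed[OF pure_bar_linear[OF m']] order_refl t])
 also have "\<dots> = bdiff_B ?P ?N (\<lambda>os es. phi n (pure_bar_B n m os es)) os es"
  by (rule TB.bdiff_cong[OF A.chain_module TB.bar_linear_post[OF TB.pure_bar_linear[OF m] phi_hom] order_refl phi_bar[OF _ m, symmetric] t])
 also have "\<dots> = phi n (bdiff_B (chn_B n) ?N (pure_bar_B n m) os es)"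
  by (rule TB.bdiff_post[OF B.chain_module A.chain_module phi_hom TB.pure_bar_linear[OF m] order_refl t, symmetric])
 also have "\<dots> = phi n (hm_boundary K B M (Suc n) (pure_bar_B (Suc n) m os es))"
  by (simp only: TB.boundary_bar[OF t m])
 finally show "hm_boundary K A N (Suc n) (phi (Suc n) (pure_bar_B (Suc n) m os es)) = phi n (hm_boundary K B M (Suc n) (pure_bar_B (Suc n) m os es))" .
qed

text \<open>Two tuples of objects with the same image under \<open>p\<close> differ at their first object or at an
 object on the right of some entry, and the projection then annihilates that entry.\<close>

lemma prjs_incs_other:
 assumes xs: "xs \<in> obj_tuples B n" and ys: "ys \<in> obj_tuples B n" and eq: "map p ys = map p xs" and ne: "ys \<noteq> xs"
  and cs: "cs \<in> ltuples (hom_list B ys)"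
 shows "hd ys \<noteq> hd xs \<or> (\<exists>j<n. prjs xs (incs ys cs) ! j = \<zero>\<^bsub>hom_list B xs ! j\<^esub>)"
proof -
 note len = obj_tuples_length[OF xs] obj_tuples_length[OF ys] and ob = xs_obj[OF xs] xs_obj[OF ys]
 have pq: "p (ys ! j) = p (xs ! j)" if "j \<le> n" for j
  using that arg_cong[OF eq, of "\<lambda>zs. zs ! j"] len by simp
 obtain i where i: "i \<le> n" "ys ! i \<noteq> xs ! i" using ne len by (metis less_Suc_eq_le nth_equalityI)
 show ?thesis
 proof (cases i)
  case 0
  then show ?thesis using i obj_tuples_hd_nth[OF xs] obj_tuples_hd_nth[OF ys] by simp
 next
  case (Suc j)
  then have j: "j < n" using i by simp
  have "prjs xs (incs ys cs) ! j = prj (xs ! j) (xs ! Suc j) (inc (ys ! j) (ys ! Suc j) (cs ! j))"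
   using j cs B_tuple_iff[OF ys] by (auto simp: nth_prjs nth_incs)
  also have "\<dots> = \<zero>\<^bsub>khom B (xs ! j) (xs ! Suc j)\<^esub>"
   by (rule prj_inc_other) (use i Suc j pq[of j] pq[of "Suc j"] ob cs B_tuple_iff[OF ys] in auto)
  finally show ?thesis using j len by auto
 qed
qed

lemma prjt_inct_other:
 assumes xs: "xs \<in> obj_tuples B n" and ys: "ys \<in> obj_tuples B n" and eq: "map p ys = map p xs" and ne: "ys \<noteq> xs"
  and t: "t \<in> chain_tuples B M ys"
 shows "hpure K (bhom M (last xs) (hd xs)) (hom_list B xs) (prjt xs (inct ys t)) = \<zero>\<^bsub>hm_summand K B M xs\<^esub>"
proof -
 let ?V = "bhom M (last xs) (hd xs)" and ?W = "hom_list B xs"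
 interpret htensor_factors K ?W ?V by (rule B.summand_factors[OF xs])
 note lin = hpure_multilinear[unfolded hmultilinear_def]
 obtain m cs where t': "t = (m, cs)" by (cases t)
 have m: "m \<in> bim M (last ys) (hd ys)" and cs: "cs \<in> ltuples (hom_list B ys)"
  using t t' by (auto simp: chain_tuples_def htuples_def)
 let ?m = "prjM (last xs) (hd xs) (incM (last ys) (hd ys) m)" and ?cs = "prjs xs (incs ys cs)"
 have "(?m, ?cs) \<in> chain_tuples B M xs"
  using prjt_tuple[OF xs, of "inct ys t"] inct_tuple[OF ys t] eq by (simp add: prjt_def inct_def t')
 then have c: "?m \<in> carrier ?V" "?cs \<in> ltuples ?W" by (auto simp: chain_tuples_def htuples_def)
 have "hpure K ?V ?W (?m, ?cs) = \<zero>\<^bsub>htensor K ?V ?W\<^esub>"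
  using prjs_incs_other[OF xs ys eq ne cs]
 proof (elim disjE exE conjE)
  assume "hd ys \<noteq> hd xs"
  then have "?m = \<zero>\<^bsub>?V\<^esub>"
   using map_p_ends[OF xs] map_p_ends[OF ys] eq m
   by (intro prjM_incM_other[OF hd_obj[OF xs] last_obj[OF xs] hd_obj[OF ys] last_obj[OF ys]]) auto
  then show ?thesis
   using lin_zero[OF head_module htensor_module, where h = "\<lambda>v. hpure K ?V ?W (v, ?cs)"] lin c by simp
 next
  fix j assume "j < n" "?cs ! j = \<zero>\<^bsub>?W ! j\<^esub>"
  then show ?thesis
   using lin c obj_tuples_length[OF xs] by (intro multilinear_zero[OF htensor_module, where g = "\<lambda>cs. hpure K ?V ?W (?m, cs)"]) auto
 qed
 then show ?thesis by (simp add: prjt_def inct_def t' hm_summand_def)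
qed

text \<open>On each summand, taking the entries indexed by \<open>xs\<close> is a left inverse.\<close>

lemma phi_injective:
 assumes w: "w \<in> carrier (chn_B n)" and w': "w' \<in> carrier (chn_B n)" and eq: "phi n w = phi n w'"
 shows "w = w'"
proof -
 define Pi where "Pi xs = pres_lift K (htuples (bhom N (last (map p xs)) (hd (map p xs))) (hom_list A (map p xs))) (hm_summand K B M xs)
  (\<lambda>t. hpure K (bhom M (last xs) (hd xs)) (hom_list B xs) (prjt xs t))" for xs
 have retract: "Pi xs (phi n v (map p xs)) = v xs" if xs: "xs \<in> obj_tuples B n" and v: "v \<in> carrier (chn_B n)" for xs v
 proof -
  interpret T: htensor_factors K "hom_list B xs" "bhom M (last xs) (hd xs)" by (rule B.summand_factors[OF xs])
  note as = map_p_tuple[OF xs]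
  interpret S: htensor_factors K "hom_list A (map p xs)" "bhom N (last (map p xs)) (hd (map p xs))" by (rule A.summand_factors[OF as])
  have mod: "module K (hm_summand K B M xs)" unfolding hm_summand_def by (rule T.htensor_module)
  have lin: "hmultilinear K (bhom N (last (map p xs)) (hd (map p xs))) (hom_list A (map p xs)) (hm_summand K B M xs)
    (\<lambda>t. hpure K (bhom M (last xs) (hd xs)) (hom_list B xs) (prjt xs t))"
   unfolding hm_summand_def by (rule prjt_linear[OF xs T.hpure_multilinear])
  have Pi: "Pi xs \<in> mod_hom K (hm_summand K A N (map p xs)) (hm_summand K B M xs)"
   unfolding Pi_def hm_summand_def[of K A N] by (rule S.htensor_lift_hom[OF mod lin])
  have evA: "(\<lambda>f. f (map p xs)) \<in> mod_hom K (chn n) (hm_summand K A N (map p xs))"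
   unfolding hm_chain_def by (rule module_family.dsum_eval_hom[OF A.chain_family as])
  have evB: "(\<lambda>f. f xs) \<in> mod_hom K (chn_B n) (hm_summand K B M xs)"
   unfolding hm_chain_def by (rule module_family.dsum_eval_hom[OF B.chain_family xs])
  show ?thesis
  proof (rule B.chain_hom_ext[OF mod lin_comp[OF Pi lin_comp[OF evA phi_hom]] evB _ v])
   fix ys t assume ys: "ys \<in> obj_tuples B n" and t: "t \<in> chain_tuples B M ys"
   show "Pi xs (phi n (hm_pure K B M n ys t) (map p xs)) = hm_pure K B M n ys t xs"
   proof (cases "map p ys = map p xs")
    case True
    have it: "inct ys t \<in> htuples (bhom N (last (map p xs)) (hd (map p xs))) (hom_list A (map p xs))"
     using inct_tuple[OF ys t] True by (simp add: chain_tuples_def)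
    have "phi n (hm_pure K B M n ys t) (map p xs) = hpure K (bhom N (last (map p xs)) (hd (map p xs))) (hom_list A (map p xs)) (inct ys t)"
     unfolding phi_pure[OF ys t] using as True by (simp add: hm_pure_def dsum_inj_def)
    then have "Pi xs (phi n (hm_pure K B M n ys t) (map p xs)) = hpure K (bhom M (last xs) (hd xs)) (hom_list B xs) (prjt xs (inct ys t))"
     unfolding Pi_def by (simp only: S.htensor_lift_pure[OF mod lin it])
    also have "\<dots> = hm_pure K B M n ys t xs"
    proof (cases "ys = xs")
     case True
     then show ?thesis using prjt_inct[OF ys t] xs by (simp add: hm_pure_def dsum_inj_def)
    next
     case False
     then show ?thesis using prjt_inct_other[OF xs ys True False t] xs by (simp add: hm_pure_def dsum_inj_def)
    qed
    finally show ?thesis .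
   next
    case False
    then have "phi n (hm_pure K B M n ys t) (map p xs) = \<zero>\<^bsub>hm_summand K A N (map p xs)\<^esub>"
     unfolding phi_pure[OF ys t] using as by (auto simp: hm_pure_def dsum_inj_def)
    moreover have "Pi xs \<zero>\<^bsub>hm_summand K A N (map p xs)\<^esub> = \<zero>\<^bsub>hm_summand K B M xs\<^esub>"
     by (rule lin_zero[OF _ mod Pi]) (simp add: hm_summand_def S.htensor_module)
    moreover have "hm_pure K B M n ys t xs = \<zero>\<^bsub>hm_summand K B M xs\<^esub>"
     using False xs by (auto simp: hm_pure_def dsum_inj_def)
    ultimately show ?thesis by simp
   qed
  qed
 qed
 show ?thesis
 proof (rule extensionalityI[of _ "obj_tuples B n"])
  show "w \<in> extensional (obj_tuples B n)" "w' \<in> extensional (obj_tuples B n)"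
   using w w' by (auto simp: hm_chain_def PiE_iff)
  show "w xs = w' xs" if "xs \<in> obj_tuples B n" for xs
   using retract[OF that w] retract[OF that w'] eq by simp
 qed
qed

text \<open>A marked tuple is the image of a tuple of \<open>B\<close>: its marks choose the objects of \<open>B\<close>.\<close>

lemma marked_lift:
 assumes t: "(os, es) \<in> bar_tuples A y z (Suc (Suc n))" and m: "\<forall>k. Suc k < Suc (Suc n) \<longrightarrow> (\<exists>x. marked os es k x)"
 obtains xs where "xs \<in> obj_tuples B n" "map p xs = core os" "core es = incs xs (prjs xs (core es))"
  "kcomp A (os ! 0) (os ! 1) (os ! 1) (es ! 0) (unit (hd xs)) = es ! 0"
  "kcomp A (os ! Suc n) (os ! Suc n) (os ! Suc (Suc n)) (unit (last xs)) (es ! Suc n) = es ! Suc n"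
proof -
 note D = bar_tuplesD[OF t] and core = A.core_tuple[OF t]
 have "\<forall>k. \<exists>x. k \<le> n \<longrightarrow> marked os es k x" using m by auto
 then obtain x where "\<forall>k. k \<le> n \<longrightarrow> marked os es k (x k)" by (rule choice[THEN exE])
 then have x: "\<And>k. k \<le> n \<Longrightarrow> marked os es k (x k)" by blast
 define xs where "xs = map x [0..<Suc n]"
 have nx: "xs ! k = x k" if "k \<le> n" for k
  using that nth_map[of k "[0..<Suc n]" x] by (simp add: xs_def del: upt_Suc)
 have ob: "x k \<in> kobj B" "p (x k) = os ! Suc k" if "k \<le> n" for k using x[OF that] by (auto simp: marked_def)
 have xs: "xs \<in> obj_tuples B n" using ob by (auto simp: obj_tuples_def xs_def)
 have mp: "map p xs = core os"
 proof (rule nth_equalityI)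
  show "length (map p xs) = length (core os)" using D by (simp add: xs_def)
  show "map p xs ! i = core os ! i" if "i < length (map p xs)" for i
  proof -
   have "i \<le> n" "i < length xs" using that by (simp_all add: xs_def)
   then show ?thesis using D nx[of i] ob[of i] by (simp add: nth_core)
  qed
 qed
 have ce: "core es = incs xs (prjs xs (core es))"
 proof (rule nth_equalityI)
  show "length (core es) = length (incs xs (prjs xs (core es)))" by simp
  fix i assume "i < length (core es)"
  then have i: "i < n" using D by simp
  have c: "es ! Suc i \<in> mor A (p (x i)) (p (x (Suc i)))"
   using i tuple_hom[OF t, of "Suc i"] ob[of i] ob[of "Suc i"] by simp
  have "inc (x i) (x (Suc i)) (prj (x i) (x (Suc i)) (es ! Suc i))
    = kcomp A (p (x i)) (p (x i)) (p (x (Suc i))) (unit (x i))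
      (kcomp A (p (x i)) (p (x (Suc i))) (p (x (Suc i))) (es ! Suc i) (unit (x (Suc i))))"
   using i ob by (intro inc_prj c) auto
  also have "\<dots> = es ! Suc i"
   using x[of i] x[of "Suc i"] ob[of i] ob[of "Suc i"] i by (simp add: marked_def)
  finally show "core es ! i = incs xs (prjs xs (core es)) ! i"
   using i D nx[of i] nx[of "Suc i"] by (simp add: nth_incs nth_prjs nth_core)
 qed
 have hl: "hd xs = x 0" "last xs = x n"
  using nx[of 0] nx[of n] obj_tuples_hd_nth[OF xs] obj_tuples_last_nth[OF xs] by auto
 show ?thesis
  by (rule that[OF xs mp ce]) (use x[of 0] x[of n] hl in \<open>auto simp: marked_def\<close>)
qed

text \<open>After the cuts every inner object carries an idempotent that belongs to an object of \<open>B\<close>, and the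
 two at the ends are absorbed by the coefficient.\<close>

lemma rmap_in_phi:
 assumes "w \<in> carrier (chn n)"
 shows "rmap n w \<in> phi n ` carrier (chn_B n)"
proof -
 let ?H = "phi n ` carrier (chn_B n)"
 have H: "submodule ?H K (chn n)" by (rule submodule_image[OF B.chain_module A.chain_module phi_hom])
 show ?thesis
 proof (rule A.chain_hom_into[OF A.chain_module rmap_hom H _ assms])
  fix as t assume as: "as \<in> obj_tuples A n" and t: "t \<in> chain_tuples A N as"
  obtain m cs where mcs: "t = (m, cs)" by (cases t)
  have m: "m \<in> bim N (last as) (hd as)" and cs: "cs \<in> ltuples (hom_list A as)"
   using t mcs by (auto simp: chain_tuples_def htuples_def)
  note id = A.id_tuple[OF as cs]
  have "bcuts (chn n) (Suc n) (pure_bar n m) (id_objs as) (id_mors A as cs) \<in> ?H"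
  proof (rule bcuts_into[OF A.chain_module H _ id])
   fix es assume u: "(id_objs as, es) \<in> bar_tuples A (hd as) (last as) (Suc (Suc n))"
    and mk: "\<forall>k. Suc k < Suc (Suc n) \<longrightarrow> (\<exists>x. marked (id_objs as) es k x)"
   let ?os = "id_objs as"
   note D = bar_tuplesD[OF u]
   obtain xs where xs: "xs \<in> obj_tuples B n" "map p xs = core ?os" "core es = incs xs (prjs xs (core es))"
    "kcomp A (?os ! 0) (?os ! 1) (?os ! 1) (es ! 0) (unit (hd xs)) = es ! 0"
    "kcomp A (?os ! Suc n) (?os ! Suc n) (?os ! Suc (Suc n)) (unit (last xs)) (es ! Suc n) = es ! Suc n"
    by (rule marked_lift[OF u mk])
   note ob = A.tuple_objs[OF u] and ho = A.tuple_homs[OF u] and core = A.core_tuple[OF u]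
   note xe = obj_tuples_hd[OF xs(1)] obj_tuples_last[OF xs(1)] and pe = map_p_ends[OF xs(1)]
   have pxs: "p (hd xs) = ?os ! 1" "p (last xs) = ?os ! Suc n" using pe xs(2) core(3,4) by simp_all
   have o: "?os ! 0 \<in> kobj A" "?os ! 1 \<in> kobj A" "?os ! Suc n \<in> kobj A" "?os ! Suc (Suc n) \<in> kobj A" by (auto intro!: ob)
   have h: "es ! 0 \<in> mor A (?os ! 0) (?os ! 1)" "es ! Suc n \<in> mor A (?os ! Suc n) (?os ! Suc (Suc n))"
    using ho[of 0] ho[of "Suc n"] by auto
   have uh: "unit (hd xs) \<in> mor A (?os ! 1) (?os ! 1)" "unit (last xs) \<in> mor A (?os ! Suc n) (?os ! Suc n)"
    using unit_closed[OF xe(1)] unit_closed[OF xe(2)] pxs by simp_all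
   have m': "m \<in> bim N (?os ! Suc (Suc n)) (?os ! 0)" using m D(4,5) by simp
   have mu: "bract N (?os ! Suc (Suc n)) (?os ! 0) (?os ! 1) m (es ! 0) \<in> bim N (?os ! Suc (Suc n)) (?os ! 1)"
    using m' h o by (intro A.ract_closed)
   let ?a = "A.absorb n m ?os es"
   have ac: "?a \<in> bim N (?os ! Suc n) (?os ! 1)" using A.absorb_closed[OF u m] core(3,4) by simp
   have "bract N (?os ! Suc (Suc n)) (?os ! 1) (?os ! 1) (bract N (?os ! Suc (Suc n)) (?os ! 0) (?os ! 1) m (es ! 0)) (unit (hd xs))
     = bract N (?os ! Suc (Suc n)) (?os ! 0) (?os ! 1) m (es ! 0)"
    using A.bract_assoc[OF o(2,2,1,4) m' h(1) uh(1)] xs(4) by simp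
   then have "bract N (?os ! Suc n) (?os ! 1) (?os ! 1) ?a (unit (hd xs)) = ?a"
    using A.blact_bract[OF o(2,2,4,3) h(2) mu uh(1)] by (simp add: A.absorb_def)
   moreover have "blact N (?os ! Suc n) (?os ! Suc n) (?os ! 1) (unit (last xs)) ?a = ?a"
    using A.blact_assoc[OF o(2,4,3,3) uh(2) h(2) mu] xs(5) by (simp add: A.absorb_def)
   ultimately have a: "incM (last xs) (hd xs) (prjM (last xs) (hd xs) ?a) = ?a"
    using incM_prjM[OF xe, of ?a] ac pxs by simp
   have tup: "prjt xs (?a, core es) \<in> chain_tuples B M xs"
    using prjt_tuple[OF xs(1)] A.chain_bar_tuple[OF u m] xs(2) by simp
   have "pure_bar n m ?os es = hm_pure K A N n (map p xs) (inct xs (prjt xs (?a, core es)))"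
    unfolding A.chain_bar_def using xs(2,3) a by (simp add: inct_def prjt_def)
   also have "\<dots> = phi n (hm_pure K B M n xs (prjt xs (?a, core es)))"
    by (rule phi_pure[OF xs(1) tup, symmetric])
   finally show "pure_bar n m ?os es \<in> ?H" using B.pure_closed[OF xs(1) tup] by blast
  qed auto
  then have r: "rmap n (pure_bar n m (id_objs as) (id_mors A as cs)) \<in> ?H"
   unfolding rmap_bar[OF id m] .
  have "pure_bar n m (id_objs as) (id_mors A as cs) = hm_pure K A N n as t"
   unfolding mcs by (rule A.chain_bar_id[OF as]) (use t mcs in simp)
  with r show "rmap n (hm_pure K A N n as t) \<in> ?H" by (simp only:)
 qed
qed

text \<open>Of all the idempotents inserted by the cuts, only those of the objects of the tuple itself act
 by a nonzero map.\<close>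

lemma rmap_phi:
 assumes "w \<in> carrier (chn_B n)"
 shows "rmap n (phi n w) = phi n w"
proof (rule B.chain_hom_ext_bar[OF A.chain_module lin_comp[OF rmap_hom phi_hom] phi_hom _ assms])
 fix y z m os es assume y: "y \<in> kobj B" "z \<in> kobj B" and m: "m \<in> bim M z y" and t: "(os, es) \<in> bar_tuples B y z (Suc (Suc n))"
 note m' = incM_closed[OF y m]
 have "rmap n (pure_bar n (incM z y m) (map p os) (incs os es))
   = bcuts (chn n) (Suc n) (pure_bar n (incM z y m)) (map p os) (incs os es)"
  by (rule rmap_bar[OF incs_bar[OF t] m'])
 also have "\<dots> = pure_bar n (incM z y m) (map p os) (incs os es)"
  by (rule bcuts_fixed[OF A.chain_module pure_bar_linear[OF m'] incs_bar[OF t] _ incs_marked[OF t]]) auto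
 finally show "rmap n (phi n (pure_bar_B n m os es)) = phi n (pure_bar_B n m os es)" unfolding phi_bar[OF t m] .
qed

lemma hm_cycles_eq:
 assumes "module K (hm_chain K C' M' n)"
 shows "hm_cycles K C' M' n = (hm_chain K C' M' n)\<lparr>carrier := carrier (hm_cycles K C' M' n)\<rparr>"
 by (simp add: hm_cycles_def mod_kernel_def)

lemma cycles_submodule:
 assumes "k_bimodule K C' M'"
 shows "submodule (carrier (hm_cycles K C' M' n)) K (hm_chain K C' M' n)"
proof -
 interpret k_bimodule K C' M' by fact
 interpret C: module K "hm_chain K C' M' n" by (rule chain_module)
 show ?thesis
 proof (cases n)
  case 0
  then show ?thesis using C.carrier_is_submodule by (simp add: hm_cycles_def)
 next
  case (Suc n')
  have "submodule {v \<in> carrier (hm_chain K C' M' n). hm_boundary K C' M' n v = \<zero>\<^bsub>hm_chain K C' M' n'\<^esub>} K (hm_chain K C' M' n)"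
   unfolding Suc by (rule submodule_equalizer[OF chain_module chain_module boundary_hom lin_const_zero[OF chain_module]])
  then show ?thesis using Suc by (simp add: hm_cycles_def mod_kernel_def)
 qed
qed

text \<open>The map \<open>phi\<close> identifies the chains of \<open>B\<close> with the image of the projection \<open>rmap\<close>, which is
 homotopic to the identity.\<close>

theorem homology_iso:
 shows "mod_isomorphic K (hm_homology K B M n) (hm_homology K A N n)"
  and "mod_isomorphic K (hm_homology K A N n) (hm_homology K B M n)"
proof -
 let ?Z = "carrier (hm_cycles K B M n)" and ?Z' = "carrier (hm_cycles K A N n)"
 let ?H = "hm_boundary K B M (Suc n) ` carrier (chn_B (Suc n))"
 let ?H' = "hm_boundary K A N (Suc n) ` carrier (chn (Suc n))"
 let ?V = "chn_B n" and ?V' = "chn n"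
 interpret V': module K ?V' by (rule A.chain_module)
 have Z: "submodule ?Z K ?V" and Z': "submodule ?Z' K ?V'"
  by (rule cycles_submodule[OF B.k_bimodule_axioms], rule cycles_submodule[OF A.k_bimodule_axioms])
 have Zc: "z \<in> carrier ?V" if "z \<in> ?Z" for z using that submodule_subset[OF B.chain_module Z] by blast
 have Zc': "z \<in> carrier ?V'" if "z \<in> ?Z'" for z using that submodule_subset[OF A.chain_module Z'] by blast
 have H: "submodule ?H K ?V" by (rule submodule_image[OF B.chain_module B.chain_module B.boundary_hom])
 have H': "submodule ?H' K ?V'" by (rule submodule_image[OF A.chain_module A.chain_module A.boundary_hom])
 have HH: "phi n ` ?H \<subseteq> ?H'"
 proof
  fix v assume "v \<in> phi n ` ?H"
  then obtain w where w: "w \<in> carrier (chn_B (Suc n))" and v: "v = phi n (hm_boundary K B M (Suc n) w)" by blast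
  show "v \<in> ?H'"
   unfolding v phi_boundary[OF w, symmetric] by (intro imageI lin_closed[OF phi_hom w])
 qed
 have ZZ: "phi n ` ?Z \<subseteq> ?Z'"
 proof
  fix z' assume "z' \<in> phi n ` ?Z"
  then obtain z where z: "z \<in> ?Z" "z' = phi n z" by blast
  show "z' \<in> ?Z'"
  proof (cases n)
   case 0
   then show ?thesis using z lin_closed[OF phi_hom] by (simp add: hm_cycles_def)
  next
   case (Suc n')
   have "hm_boundary K A N n z' = phi n' (hm_boundary K B M n z)"
    using phi_boundary[of z n'] Zc[OF z(1)] z(2) Suc by simp
   also have "hm_boundary K B M n z = \<zero>\<^bsub>chn_B n'\<^esub>"
    using z(1) Suc by (simp add: hm_cycles_def mod_kernel_def)
   also have "phi n' \<zero>\<^bsub>chn_B n'\<^esub> = \<zero>\<^bsub>chn n'\<^esub>"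
    by (rule lin_zero[OF B.chain_module A.chain_module phi_hom])
   finally show ?thesis
    using Suc z(2) lin_closed[OF phi_hom Zc[OF z(1)]] by (simp add: hm_cycles_def mod_kernel_def)
  qed
 qed
 have inj: "z \<in> ?H" if z: "z \<in> ?Z" and b: "phi n z \<in> ?H'" for z
 proof -
  obtain w where w: "w \<in> carrier (chn (Suc n))" "phi n z = hm_boundary K A N (Suc n) w" using b by blast
  obtain v where v: "v \<in> carrier (chn_B (Suc n))" "rmap (Suc n) w = phi (Suc n) v"
   using rmap_in_phi[OF w(1)] by blast
  have "phi n z = rmap n (phi n z)" using rmap_phi[OF Zc[OF z]] by simp
  also have "\<dots> = hm_boundary K A N (Suc n) (rmap (Suc n) w)" using w boundary_rmap by simp
  also have "\<dots> = phi n (hm_boundary K B M (Suc n) v)" using v phi_boundary by simp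
  finally have "z = hm_boundary K B M (Suc n) v"
   by (intro phi_injective[OF Zc[OF z] lin_closed[OF B.boundary_hom v(1)]])
  then show ?thesis using v by blast
 qed
 have surj: "\<exists>z\<in>?Z. z' \<ominus>\<^bsub>?V'\<^esub> phi n z \<in> ?H'" if z': "z' \<in> ?Z'" for z'
 proof -
  obtain z where z: "z \<in> carrier ?V" "rmap n z' = phi n z" using rmap_in_phi[OF Zc'[OF z']] by blast
  have "z \<in> ?Z"
  proof (cases n)
   case 0
   then show ?thesis using z by (simp add: hm_cycles_def)
  next
   case (Suc n')
   have "phi n' (hm_boundary K B M n z) = rmap n' (hm_boundary K A N n z')"
    using phi_boundary[of z n'] boundary_rmap[of z' n'] z Zc'[OF z'] Suc by simp
   also have "hm_boundary K A N n z' = \<zero>\<^bsub>chn n'\<^esub>"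
    using z' Suc by (simp add: hm_cycles_def mod_kernel_def)
   also have "rmap n' \<zero>\<^bsub>chn n'\<^esub> = phi n' \<zero>\<^bsub>chn_B n'\<^esub>"
    using lin_zero[OF A.chain_module A.chain_module rmap_hom] lin_zero[OF B.chain_module A.chain_module phi_hom] by simp
   finally have "hm_boundary K B M n z = \<zero>\<^bsub>chn_B n'\<^esub>"
    using z lin_closed[OF B.boundary_hom] Suc
    by (intro phi_injective) (auto simp: abelian_monoid.zero_closed abelian_group.axioms module.axioms[OF B.chain_module])
   then show ?thesis using Suc z by (simp add: hm_cycles_def mod_kernel_def)
  qed
  moreover have "z' \<ominus>\<^bsub>?V'\<^esub> phi n z = hm_boundary K A N (Suc n) (hmap n z')"
  proof -
   have b: "hm_boundary K A N (Suc n) (hmap n z') \<in> carrier ?V'"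
    by (rule lin_closed[OF A.boundary_hom lin_closed[OF hmap_hom Zc'[OF z']]])
   have "(if n = 0 then \<zero>\<^bsub>?V'\<^esub> else hmap (n - 1) (hm_boundary K A N n z')) = \<zero>\<^bsub>?V'\<^esub>"
   proof (cases n)
    case (Suc n')
    then have "hm_boundary K A N n z' = \<zero>\<^bsub>chn n'\<^esub>"
     using z' by (simp add: hm_cycles_def mod_kernel_def)
    then show ?thesis using Suc lin_zero[OF A.chain_module A.chain_module hmap_hom] by simp
   qed simp
   then show ?thesis using chain_homotopy[OF Zc'[OF z']] b z(2) by simp
  qed
  ultimately show ?thesis using lin_closed[OF hmap_hom Zc'[OF z']] by blast
 qed
 have "mod_isomorphic K (quot_mod (?V\<lparr>carrier := ?Z\<rparr>) ?H) (quot_mod (?V'\<lparr>carrier := ?Z'\<rparr>) ?H')"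
  "mod_isomorphic K (quot_mod (?V'\<lparr>carrier := ?Z'\<rparr>) ?H') (quot_mod (?V\<lparr>carrier := ?Z\<rparr>) ?H)"
  by (rule quot_mod_isoI[OF B.chain_module A.chain_module H H' Z Z' phi_hom HH ZZ inj surj], assumption+)+
 then show "mod_isomorphic K (hm_homology K B M n) (hm_homology K A N n)"
  "mod_isomorphic K (hm_homology K A N n) (hm_homology K B M n)"
  using hm_cycles_eq[OF B.chain_module, of n] hm_cycles_eq[OF A.chain_module, of n] by (simp_all add: hm_homology_def)
qed

subsection \<open>Cohomology\<close>

text \<open>The inclusion \<open>incM\<close> is injective, and it carries both sides to the same corner of the
 bimodule \<open>N\<close>.\<close>

lemma prjM_lact:
 assumes x: "x \<in> kobj B" and y: "y \<in> kobj B" and z: "z \<in> kobj B" and g: "g \<in> mor B z y"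
  and n: "n \<in> bim N (p y) (p x)"
 shows "prjM z x (blact N (p z) (p y) (p x) (inc z y g) n) = blact M z y x g (prjM y x n)"
proof -
 note o = p_obj[OF x] p_obj[OF y] p_obj[OF z] and ig = inc_closed[OF y z g]
 note u = unit_closed[OF x] unit_closed[OF y] unit_closed[OF z]
 let ?nu = "bract N (p y) (p x) (p x) n (unit x)"
 have nu: "?nu \<in> bim N (p y) (p x)" using n u o by (intro A.ract_closed)
 have gn: "blact N (p z) (p y) (p x) (inc z y g) n \<in> bim N (p z) (p x)" using n ig o by (intro A.lact_closed)
 have pn: "prjM y x n \<in> bim M y x" by (rule prjM_closed[OF x y n])
 have "incM z x (prjM z x (blact N (p z) (p y) (p x) (inc z y g) n))
   = blact N (p z) (p z) (p x) (unit z) (blact N (p z) (p y) (p x) (inc z y g) ?nu)"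
  using incM_prjM[OF x z gn] A.blact_bract[OF o(1,1,2,3) ig n u(1)] by simp
 also have "\<dots> = blact N (p z) (p y) (p x) (inc z y g) ?nu"
  using A.blact_assoc[OF o(1,2,3,3) u(3) ig nu] unit_inc[OF y z g] by simp
 also have "\<dots> = blact N (p z) (p y) (p x) (inc z y g) (blact N (p y) (p y) (p x) (unit y) ?nu)"
  using A.blact_assoc[OF o(1,2,2,3) ig u(2) nu] inc_unit[OF y z g] by simp
 also have "\<dots> = blact N (p z) (p y) (p x) (inc z y g) (incM y x (prjM y x n))"
  using incM_prjM[OF x y n] by simp
 also have "\<dots> = incM z x (blact M z y x g (prjM y x n))"
  by (rule incM_lact[OF x y z g pn, symmetric])
 finally have "prjM z x (incM z x (prjM z x (blact N (p z) (p y) (p x) (inc z y g) n)))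
   = prjM z x (incM z x (blact M z y x g (prjM y x n)))" by simp
 then show ?thesis
  using prjM_incM[OF x z prjM_closed[OF x z gn]] prjM_incM[OF x z B.lact_closed[OF x y z g pn]] by simp
qed

lemma prjM_ract:
 assumes x: "x \<in> kobj B" and y: "y \<in> kobj B" and z: "z \<in> kobj B" and n: "n \<in> bim N (p z) (p y)"
  and f: "f \<in> mor B y x"
 shows "prjM z x (bract N (p z) (p y) (p x) n (inc y x f)) = bract M z y x (prjM z y n) f"
proof -
 note o = p_obj[OF x] p_obj[OF y] p_obj[OF z] and ig = inc_closed[OF x y f]
 note u = unit_closed[OF x] unit_closed[OF y] unit_closed[OF z]
 let ?nf = "bract N (p z) (p y) (p x) n (inc y x f)" and ?un = "bract N (p z) (p y) (p y) n (unit y)"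
 have nf: "?nf \<in> bim N (p z) (p x)" using n ig o by (intro A.ract_closed)
 have un: "?un \<in> bim N (p z) (p y)" using n u o by (intro A.ract_closed)
 have pn: "prjM z y n \<in> bim M z y" by (rule prjM_closed[OF y z n])
 have "incM z x (prjM z x ?nf) = blact N (p z) (p z) (p x) (unit z) (bract N (p z) (p x) (p x) ?nf (unit x))"
  by (rule incM_prjM[OF x z nf])
 also have "bract N (p z) (p x) (p x) ?nf (unit x) = ?nf"
  using A.bract_assoc[OF o(1,1,2,3) n ig u(1)] inc_unit[OF x y f] by simp
 also have "blact N (p z) (p z) (p x) (unit z) ?nf = blact N (p z) (p z) (p x) (unit z) (bract N (p z) (p y) (p x) ?un (inc y x f))"
  using A.bract_assoc[OF o(1,2,2,3) n u(2) ig] unit_inc[OF x y f] by simp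
 also have "\<dots> = bract N (p z) (p y) (p x) (blact N (p z) (p z) (p y) (unit z) ?un) (inc y x f)"
  by (rule A.blact_bract[OF o(1,2,3,3) u(3) un ig])
 also have "\<dots> = bract N (p z) (p y) (p x) (incM z y (prjM z y n)) (inc y x f)"
  using incM_prjM[OF y z n] by simp
 also have "\<dots> = incM z x (bract M z y x (prjM z y n) f)"
  by (rule incM_ract[OF x y z pn f, symmetric])
 finally have "prjM z x (incM z x (prjM z x ?nf)) = prjM z x (incM z x (bract M z y x (prjM z y n) f))" by simp
 then show ?thesis
  using prjM_incM[OF x z prjM_closed[OF x z nf]] prjM_incM[OF x z B.ract_closed[OF x y z pn f]] by simp
qed

definition
 "psi n f = cochain_of K B M n (\<lambda>xs cs. prjM (hd xs) (last xs) (hm_eval K A f (map p xs) (incs xs cs)))"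

lemma psi_multilinear:
 assumes "f \<in> carrier (cochn n)"
 shows "cochain_multilinear K B M n (\<lambda>xs cs. prjM (hd xs) (last xs) (hm_eval K A f (map p xs) (incs xs cs)))"
 unfolding cochain_multilinear_def
proof
 fix xs assume xs: "xs \<in> obj_tuples B n"
 have "multilinear K (hom_list A (map p xs)) (bhom N (p (hd xs)) (p (last xs))) (hm_eval K A f (map p xs))"
  using A.eval_multilinear[OF assms] map_p_tuple[OF xs] map_p_ends[OF xs] by (auto simp: cochain_multilinear_def)
 from multilinear_comp[OF incs_linear[OF xs this] prjM_hom[OF last_obj[OF xs] hd_obj[OF xs]]]
 show "multilinear K (hom_list B xs) (bhom M (hd xs) (last xs)) (\<lambda>cs. prjM (hd xs) (last xs) (hm_eval K A f (map p xs) (incs xs cs)))" .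
qed

lemma psi_closed: "f \<in> carrier (cochn n) \<Longrightarrow> psi n f \<in> carrier (cochn_B n)"
 unfolding psi_def by (rule B.cochain_of_closed[OF psi_multilinear])

lemma psi_eval: "\<lbrakk>f \<in> carrier (cochn n); xs \<in> obj_tuples B n; cs \<in> ltuples (hom_list B xs)\<rbrakk>
\<Longrightarrow> hm_eval K B (psi n f) xs cs = prjM (hd xs) (last xs) (hm_eval K A f (map p xs) (incs xs cs))"
 unfolding psi_def by (rule B.eval_cochain_of[OF psi_multilinear])

lemma eval_inc_hom:
 assumes xs: "xs \<in> obj_tuples B n" and cs: "cs \<in> ltuples (hom_list B xs)"
 shows "(\<lambda>f. hm_eval K A f (map p xs) (incs xs cs)) \<in> mod_hom K (cochn n) (bhom N (p (hd xs)) (p (last xs)))"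
 using eval_hom[OF map_p_tuple[OF xs] incs_tuple[OF xs cs]] by (simp only: map_p_ends[OF xs])

lemma psi_hom: "psi n \<in> mod_hom K (cochn n) (cochn_B n)"
proof -
 interpret V: module K "cochn n" by (rule A.cochain_module)
 interpret W: module K "cochn_B n" by (rule B.cochain_module)
 have lin: "(\<lambda>f. prjM (hd xs) (last xs) (hm_eval K A f (map p xs) (incs xs cs))) \<in> mod_hom K (cochn n) (bhom M (hd xs) (last xs))"
  if "xs \<in> obj_tuples B n" "cs \<in> ltuples (hom_list B xs)" for xs cs
  by (rule lin_comp[OF prjM_hom[OF last_obj[OF that(1)] hd_obj[OF that(1)]] eval_inc_hom[OF that]])
 note evB = idempotent_bimodule.eval_hom[OF trivial_bimodule]
 show ?thesis
 proof (rule mod_homI)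
  fix f g assume f: "f \<in> carrier (cochn n)" and g: "g \<in> carrier (cochn n)"
  show "psi n (f \<oplus>\<^bsub>cochn n\<^esub> g) = psi n f \<oplus>\<^bsub>cochn_B n\<^esub> psi n g"
  proof (rule B.cochain_ext)
   fix xs cs assume xs: "xs \<in> obj_tuples B n" and cs: "cs \<in> ltuples (hom_list B xs)"
   show "hm_eval K B (psi n (f \<oplus>\<^bsub>cochn n\<^esub> g)) xs cs = hm_eval K B (psi n f \<oplus>\<^bsub>cochn_B n\<^esub> psi n g) xs cs"
    using f g lin_add[OF evB[OF xs cs] psi_closed[OF f] psi_closed[OF g]] lin_add[OF lin[OF xs cs] f g]
    by (simp add: psi_eval[OF _ xs cs])
  qed (use f g psi_closed in auto)
 next
  fix a f assume a: "a \<in> carrier K" and f: "f \<in> carrier (cochn n)"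
  show "psi n (a \<odot>\<^bsub>cochn n\<^esub> f) = a \<odot>\<^bsub>cochn_B n\<^esub> psi n f"
  proof (rule B.cochain_ext)
   fix xs cs assume xs: "xs \<in> obj_tuples B n" and cs: "cs \<in> ltuples (hom_list B xs)"
   show "hm_eval K B (psi n (a \<odot>\<^bsub>cochn n\<^esub> f)) xs cs = hm_eval K B (a \<odot>\<^bsub>cochn_B n\<^esub> psi n f) xs cs"
    using a f lin_smult[OF evB[OF xs cs] a psi_closed[OF f]] lin_smult[OF lin[OF xs cs] a f]
    by (simp add: psi_eval[OF _ xs cs])
  qed (use a f psi_closed in auto)
 qed (rule psi_closed)
qed

lemma incs_bar_linear:
 assumes F: "bar_linear K A P (p y) (p z) L F"
 shows "bar_linear K B P y z L (\<lambda>os es. F (map p os) (incs os es))"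
proof (rule idempotent_category.bar_linearI[OF B.trivial_idempotents])
 fix os es assume t: "(os, es) \<in> bar_tuples B y z L"
 note D = bar_tuplesD[OF t]
 show "F (map p os) (incs os es) \<in> carrier P" by (rule bar_closed[OF F incs_bar[OF t]])
 fix i assume i: "i < L"
 have "inc (os ! i) (os ! Suc i) \<in> mod_hom K (khom B (os ! i) (os ! Suc i)) (khom A (map p os ! i) (map p os ! Suc i))"
  using i D path_obj[OF D(1)] by (auto intro!: inc_hom)
 from lin_comp[OF bar_slot[OF F incs_bar[OF t] i] this]
 show "(\<lambda>c. F (map p os) (incs os (es[i := c]))) \<in> mod_hom K (khom B (os ! i) (os ! Suc i)) P"
  using i D by (simp add: incs_update)
qed

lemma psi_bar:
 assumes f: "f \<in> carrier (cochn n)" and t: "(os, es) \<in> bar_tuples B y z (Suc (Suc n))"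
 shows "eval_bar_B n (psi n f) os es = prjM y z (eval_bar n f (map p os) (incs os es))"
proof -
 note D = bar_tuplesD[OF t] and core = B.core_tuple[OF t] and ob = B.tuple_objs[OF t] and ho = B.tuple_homs[OF t]
 have o: "y \<in> kobj B" "z \<in> kobj B" "os ! 1 \<in> kobj B" "os ! Suc n \<in> kobj B"
  using ob[of 0] ob[of "Suc (Suc n)"] ob[of 1] ob[of "Suc n"] D by auto
 have h: "es ! 0 \<in> mor B y (os ! 1)" "es ! Suc n \<in> mor B (os ! Suc n) z"
  using ho[of 0] ho[of "Suc n"] D by auto
 have c: "map p (core os) = core (map p os)" "incs (core os) (core es) = core (incs os es)"
  using D by (auto intro!: nth_equalityI simp: nth_core nth_incs)
 have v: "hm_eval K A f (core (map p os)) (core (incs os es)) \<in> bim N (p (os ! 1)) (p (os ! Suc n))"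
  using lin_closed[OF eval_inc_hom[OF core(1,2)] f] by (simp add: c core(3,4))
 have iv: "bract N (p (os ! 1)) (p (os ! Suc n)) (p z) (hm_eval K A f (core (map p os)) (core (incs os es))) (inc (os ! Suc n) z (es ! Suc n))
   \<in> bim N (p (os ! 1)) (p z)"
  using v h o by (intro A.ract_closed p_obj inc_closed)
 show ?thesis
  using D prjM_ract[OF o(2,4,3) v h(2)] prjM_lact[OF o(2,3,1) h(1) iv] psi_eval[OF f core(1,2)]
  by (simp add: A.cochain_bar_def B.cochain_bar_def A.wrap_def B.wrap_def nth_incs c core(3,4))
qed

lemma psi_coboundary:
 assumes f: "f \<in> carrier (cochn n)"
 shows "hm_coboundary K B M n (psi n f) = psi (Suc n) (hm_coboundary K A N n f)"
proof -
 interpret TB: idempotent_bimodule K B "\<lambda>b. {b}" "kid B" M by (rule trivial_bimodule)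
 note pf = psi_closed[OF f] and df = coboundary_closed[OF f]
 show ?thesis
 proof (rule B.cochain_ext[OF TB.coboundary_closed[OF pf] psi_closed[OF df]])
  fix xs cs assume xs: "xs \<in> obj_tuples B (Suc n)" and cs: "cs \<in> ltuples (hom_list B xs)"
  let ?P = "bhom M (hd xs) (last xs)" and ?Q = "bhom N (p (hd xs)) (p (last xs))"
  let ?os = "id_objs xs" and ?es = "id_mors B xs cs" and ?N = "Suc (Suc n)"
  note ob = last_obj[OF xs] hd_obj[OF xs] and t = B.id_tuple[OF xs cs]
  note P = B.bhom_module[OF ob] and Q = A.bhom_module[OF p_obj[OF ob(1)] p_obj[OF ob(2)]]
  note L = eval_bar_linear[OF f p_obj[OF ob(2)] p_obj[OF ob(1)]] and T = prjM_hom[OF ob]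
  have "eval_bar_B (Suc n) (psi (Suc n) (hm_coboundary K A N n f)) ?os ?es
    = prjM (hd xs) (last xs) (ksign K (Suc n) \<odot>\<^bsub>?Q\<^esub> bdiff ?Q ?N (eval_bar n f) (map p ?os) (incs ?os ?es))"
   unfolding psi_bar[OF df t] by (simp only: coboundary_bar[OF f incs_bar[OF t]])
  also have "\<dots> = ksign K (Suc n) \<odot>\<^bsub>?P\<^esub> prjM (hd xs) (last xs) (bdiff ?Q ?N (eval_bar n f) (map p ?os) (incs ?os ?es))"
   by (rule lin_smult[OF T A.ksign_in bar_closed[OF bdiff_linear[OF Q L order_refl] incs_bar[OF t]]])
  also have "bdiff ?Q ?N (eval_bar n f) (map p ?os) (incs ?os ?es) = bdiff_B ?Q ?N (\<lambda>os es. eval_bar n f (map p os) (incs os es)) ?os ?es"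
   by (rule bdiff_incs[OF Q bar_closed[OF L] order_refl t])
  also have "prjM (hd xs) (last xs) \<dots> = bdiff_B ?P ?N (\<lambda>os es. prjM (hd xs) (last xs) (eval_bar n f (map p os) (incs os es))) ?os ?es"
   by (rule TB.bdiff_post[OF Q P T incs_bar_linear[OF L] order_refl t])
  also have "\<dots> = bdiff_B ?P ?N (eval_bar_B n (psi n f)) ?os ?es"
   by (rule TB.bdiff_cong[OF P TB.eval_bar_linear[OF pf ob(2,1)] order_refl psi_bar[OF f, symmetric] t])
  also have "ksign K (Suc n) \<odot>\<^bsub>?P\<^esub> \<dots> = eval_bar_B (Suc n) (hm_coboundary K B M n (psi n f)) ?os ?es"
   by (rule TB.coboundary_bar[OF pf t, symmetric])
  finally show "hm_eval K B (hm_coboundary K B M n (psi n f)) xs cs = hm_eval K B (psi (Suc n) (hm_coboundary K A N n f)) xs cs"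
   using TB.eval_via_bar[OF psi_closed[OF df] xs cs] TB.eval_via_bar[OF TB.coboundary_closed[OF pf] xs cs] by simp
 qed
qed

abbreviation lifts :: "nat \<Rightarrow> 'a list \<Rightarrow> 'b list set" where
 "lifts n as \<equiv> {xs \<in> obj_tuples B n. map p xs = as}"

lemma lifts_finite:
 assumes as: "as \<in> obj_tuples A n" shows "finite (lifts n as)"
proof -
 have "finite {xs. set xs \<subseteq> (\<Union>a\<in>set as. fibre a) \<and> length xs = Suc n}"
  by (rule finite_lists_length_eq) (use as fibre_finite in \<open>auto simp: obj_tuples_def\<close>)
 moreover have "lifts n as \<subseteq> {xs. set xs \<subseteq> (\<Union>a\<in>set as. fibre a) \<and> length xs = Suc n}"
  by (auto simp: obj_tuples_def)
 ultimately show ?thesis by (rule finite_subset[rotated])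
qed

text \<open>A cochain of \<open>B\<close> extends to \<open>A\<close> by summing over all lifts of a tuple of objects. At a tuple of
 \<open>B\<close> the other lifts contribute zero.\<close>

lemma psi_surjective:
 assumes g: "g \<in> carrier (cochn_B n)"
 shows "g \<in> psi n ` carrier (cochn n)"
proof -
 let ?G = "\<lambda>xs cs. incM (hd xs) (last xs) (hm_eval K B g xs (prjs xs cs))"
 let ?h = "\<lambda>as cs. \<Oplus>\<^bsub>bhom N (hd as) (last as)\<^esub> xs \<in> lifts n as. ?G xs cs"
 have G: "multilinear K (hom_list A (map p xs)) (bhom N (p (hd xs)) (p (last xs))) (?G xs)" if xs: "xs \<in> obj_tuples B n" for xs
 proof -
  have "multilinear K (hom_list B xs) (bhom M (hd xs) (last xs)) (hm_eval K B g xs)"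
   using B.eval_multilinear[OF g] xs by (simp add: cochain_multilinear_def)
  from multilinear_comp[OF prjs_linear[OF xs this] incM_hom[OF last_obj[OF xs] hd_obj[OF xs]]] show ?thesis .
 qed
 have h: "cochain_multilinear K A N n ?h"
  unfolding cochain_multilinear_def
 proof
  fix as assume as: "as \<in> obj_tuples A n"
  let ?Q = "bhom N (hd as) (last as)"
  have Q: "module K ?Q" by (rule A.coefficient_module[OF as])
  interpret Q: module K ?Q by (rule Q)
  interpret T: tensor_factors K "hom_list A as" by (rule A.hom_list_factors[OF as])
  have Gas: "multilinear K (hom_list A as) ?Q (?G xs)" if "xs \<in> lifts n as" for xs
  proof -
   have xs: "xs \<in> obj_tuples B n" "map p xs = as" using that by simp_all
   show ?thesis using G[OF xs(1)] map_p_ends[OF xs(1)] unfolding xs(2) by (simp only:)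
  qed
  show "multilinear K (hom_list A as) ?Q (?h as)"
   unfolding multilinear_def
  proof (intro conjI ballI allI impI)
   fix cs assume cs: "cs \<in> ltuples (hom_list A as)"
   show "?h as cs \<in> carrier ?Q"
    by (rule Q.finsum_closed, rule Pi_I, drule Gas) (simp add: multilinear_def cs)
   fix i assume i: "i < length (hom_list A as)"
   show "(\<lambda>w. ?h as (cs[i := w])) \<in> mod_hom K (hom_list A as ! i) ?Q"
    by (rule lin_finsum_pointwise[OF T.factor_module[OF i] Q])
     (drule Gas, use cs i in \<open>unfold multilinear_def, blast\<close>)
  qed
 qed
 let ?f = "cochain_of K A N n ?h"
 have f: "?f \<in> carrier (cochn n)" by (rule A.cochain_of_closed[OF h])
 have "psi n ?f = g"
 proof (rule B.cochain_ext[OF psi_closed[OF f] g])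
  fix xs cs assume xs: "xs \<in> obj_tuples B n" and cs: "cs \<in> ltuples (hom_list B xs)"
  note as = map_p_tuple[OF xs] and ds = incs_tuple[OF xs cs]
  let ?P = "bhom M (hd xs) (last xs)" and ?Q = "bhom N (p (hd xs)) (p (last xs))"
  note ob = last_obj[OF xs] hd_obj[OF xs]
  note P = B.bhom_module[OF ob] and Q = A.bhom_module[OF p_obj[OF ob(1)] p_obj[OF ob(2)]]
  interpret P: module K ?P by (rule P)
  have gB: "hm_eval K B g ys es \<in> bim M (hd ys) (last ys)" if "ys \<in> obj_tuples B n" "es \<in> ltuples (hom_list B ys)" for ys es
   using B.eval_multilinear[OF g] that by (simp add: cochain_multilinear_def multilinear_def)
  have gx: "hm_eval K B g xs cs \<in> carrier ?P" by (rule gB[OF xs cs])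
  have each: "prjM (hd xs) (last xs) (?G ys (incs xs cs)) = (if xs = ys then hm_eval K B g xs cs else \<zero>\<^bsub>?P\<^esub>)"
   if ys: "ys \<in> lifts n (map p xs)" for ys
  proof (cases "ys = xs")
   case True
   then show ?thesis using prjs_incs[OF xs cs] prjM_incM[OF ob gx] by simp
  next
   case False
   have ys': "ys \<in> obj_tuples B n" and eq: "map p ys = map p xs" using ys by auto
   interpret T: tensor_factors K "hom_list B ys" by (rule B.hom_list_factors[OF ys'])
   have es: "prjs ys (incs xs cs) \<in> ltuples (hom_list B ys)" by (rule prjs_tuple[OF ys']) (use ds eq in simp)
   have e: "p (hd ys) = p (hd xs)" "p (last ys) = p (last xs)"
    using map_p_ends[OF xs] map_p_ends[OF ys'] eq by simp_all
   have "prjM (hd xs) (last xs) (?G ys (incs xs cs)) = \<zero>\<^bsub>?P\<^esub>"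
    using prjs_incs_other[OF ys' xs eq[symmetric] False[symmetric] cs]
   proof (elim disjE exE conjE)
    assume "hd xs \<noteq> hd ys"
    then show ?thesis using gB[OF ys' es] e
     by (intro prjM_incM_other[OF ob last_obj[OF ys'] hd_obj[OF ys']]) auto
   next
    fix j assume j: "j < n" "prjs ys (incs xs cs) ! j = \<zero>\<^bsub>hom_list B ys ! j\<^esub>"
    have z: "hm_eval K B g ys (prjs ys (incs xs cs)) = \<zero>\<^bsub>bhom M (hd ys) (last ys)\<^esub>"
     by (rule T.multilinear_zero[OF B.coefficient_module[OF ys'] _ es _ j(2)])
      (use B.eval_multilinear[OF g] ys' j obj_tuples_length[OF ys'] in \<open>auto simp: cochain_multilinear_def\<close>)
    have "?G ys (incs xs cs) = \<zero>\<^bsub>bhom N (p (hd ys)) (p (last ys))\<^esub>"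
     unfolding z
     by (rule lin_zero[OF B.coefficient_module[OF ys'] _ incM_hom[OF last_obj[OF ys'] hd_obj[OF ys']]]) (use Q e in simp)
    then show ?thesis using lin_zero[OF Q P prjM_hom[OF ob]] e by simp
   qed
   then show ?thesis using False by simp
  qed
  have G': "?G ys (incs xs cs) \<in> carrier ?Q" if ys: "ys \<in> lifts n (map p xs)" for ys
  proof -
   have ys': "ys \<in> obj_tuples B n" and eq: "map p ys = map p xs" using ys by auto
   have "?G ys (incs xs cs) \<in> bim N (p (hd ys)) (p (last ys))"
    using G[OF ys'] ds unfolding eq by (simp add: multilinear_def)
   then show ?thesis using map_p_ends[OF xs] map_p_ends[OF ys'] eq by simp
  qed
  have "hm_eval K B (psi n ?f) xs cs = prjM (hd xs) (last xs) (\<Oplus>\<^bsub>?Q\<^esub> ys \<in> lifts n (map p xs). ?G ys (incs xs cs))"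
   unfolding psi_eval[OF f xs cs] A.eval_cochain_of[OF h as ds] map_p_ends[OF xs] ..
  also have "\<dots> = (\<Oplus>\<^bsub>?P\<^esub> ys \<in> lifts n (map p xs). prjM (hd xs) (last xs) (?G ys (incs xs cs)))"
   by (rule lin_finsum[OF Q P prjM_hom[OF ob]], rule Pi_I, rule G')
  also have "\<dots> = (\<Oplus>\<^bsub>?P\<^esub> ys \<in> lifts n (map p xs). if xs = ys then hm_eval K B g xs cs else \<zero>\<^bsub>?P\<^esub>)"
   by (rule P.finsum_cong'[OF refl _ each]) (simp_all add: gx Pi_iff)
  also have "\<dots> = hm_eval K B g xs cs"
   by (rule P.finsum_singleton[OF _ lifts_finite[OF as]]) (use xs gx in auto)
  finally show "hm_eval K B (psi n ?f) xs cs = hm_eval K B g xs cs" .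
 qed
 from image_eqI[of g "psi n", OF this[symmetric] f] show ?thesis .
qed

lemma psi_rco:
 assumes f: "f \<in> carrier (cochn n)"
 shows "psi n (rco n f) = psi n f"
proof -
 interpret TB: idempotent_bimodule K B "\<lambda>b. {b}" "kid B" M by (rule trivial_bimodule)
 note rf = rco_closed[OF f]
 show ?thesis
 proof (rule B.cochain_ext[OF psi_closed[OF rf] psi_closed[OF f]])
  fix xs cs assume xs: "xs \<in> obj_tuples B n" and cs: "cs \<in> ltuples (hom_list B xs)"
  let ?os = "id_objs xs" and ?es = "id_mors B xs cs" and ?Q = "bhom N (p (hd xs)) (p (last xs))"
  note t = B.id_tuple[OF xs cs] and ob = p_obj[OF last_obj[OF xs]] p_obj[OF hd_obj[OF xs]]
  have "eval_bar n (rco n f) (map p ?os) (incs ?os ?es) = bcuts ?Q (Suc n) (eval_bar n f) (map p ?os) (incs ?os ?es)"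
   by (rule rco_bar[OF f incs_bar[OF t]])
  also have "\<dots> = eval_bar n f (map p ?os) (incs ?os ?es)"
   by (rule bcuts_fixed[OF A.bhom_module[OF ob] eval_bar_linear[OF f ob(2,1)] incs_bar[OF t] _ incs_marked[OF t]]) auto
  finally show "hm_eval K B (psi n (rco n f)) xs cs = hm_eval K B (psi n f) xs cs"
   using psi_bar[OF rf t] psi_bar[OF f t] TB.eval_via_bar[OF psi_closed[OF rf] xs cs] TB.eval_via_bar[OF psi_closed[OF f] xs cs] by simp
 qed
qed

text \<open>The cuts turn a value of \<open>f\<close> into a sum of values at marked tuples. Such a tuple comes from \<open>B\<close>,
 and there \<open>psi n f\<close> is the value of \<open>f\<close> up to the idempotents at its ends.\<close>

lemma rco_kernel:
 assumes f: "f \<in> carrier (cochn n)" and zero: "psi n f = \<zero>\<^bsub>cochn_B n\<^esub>"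
 shows "rco n f = \<zero>\<^bsub>cochn n\<^esub>"
proof -
 interpret V: module K "cochn n" by (rule A.cochain_module)
 show ?thesis
 proof (rule A.cochain_ext[OF rco_closed[OF f] V.zero_closed])
  fix as cs assume as: "as \<in> obj_tuples A n" and cs: "cs \<in> ltuples (hom_list A as)"
  let ?P = "bhom N (hd as) (last as)" and ?os = "id_objs as"
  have P: "module K ?P" by (rule A.coefficient_module[OF as])
  interpret P: module K ?P by (rule P)
  have H: "submodule {\<zero>\<^bsub>?P\<^esub>} K ?P" by (rule P.submoduleI_linear) auto
  have "bcuts ?P (Suc n) (eval_bar n f) ?os (id_mors A as cs) \<in> {\<zero>\<^bsub>?P\<^esub>}"
  proof (rule bcuts_into[OF P H _ A.id_tuple[OF as cs]])
   fix es assume u: "(?os, es) \<in> bar_tuples A (hd as) (last as) (Suc (Suc n))"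
    and mk: "\<forall>k. Suc k < Suc (Suc n) \<longrightarrow> (\<exists>x. marked ?os es k x)"
   note D = bar_tuplesD[OF u]
   obtain xs where xs: "xs \<in> obj_tuples B n" "map p xs = core ?os" "core es = incs xs (prjs xs (core es))"
    "kcomp A (?os ! 0) (?os ! 1) (?os ! 1) (es ! 0) (unit (hd xs)) = es ! 0"
    "kcomp A (?os ! Suc n) (?os ! Suc n) (?os ! Suc (Suc n)) (unit (last xs)) (es ! Suc n) = es ! Suc n"
    by (rule marked_lift[OF u mk])
   note tob = A.tuple_objs[OF u] and ho = A.tuple_homs[OF u] and core = A.core_tuple[OF u]
   note xe = last_obj[OF xs(1)] hd_obj[OF xs(1)] and pe = map_p_ends[OF xs(1)]
   have pxs: "p (hd xs) = ?os ! 1" "p (last xs) = ?os ! Suc n" using pe xs(2) core(3,4) by simp_all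
   have o: "?os ! 0 \<in> kobj A" "?os ! 1 \<in> kobj A" "?os ! Suc n \<in> kobj A" "?os ! Suc (Suc n) \<in> kobj A" by (auto intro!: tob)
   have h: "es ! 0 \<in> mor A (?os ! 0) (?os ! 1)" "es ! Suc n \<in> mor A (?os ! Suc n) (?os ! Suc (Suc n))"
    using ho[of 0] ho[of "Suc n"] by auto
   have uh: "unit (hd xs) \<in> mor A (?os ! 1) (?os ! 1)" "unit (last xs) \<in> mor A (?os ! Suc n) (?os ! Suc n)"
    using unit_closed[OF xe(2)] unit_closed[OF xe(1)] pxs by simp_all
   have ds: "prjs xs (core es) \<in> ltuples (hom_list B xs)" by (rule prjs_tuple[OF xs(1)]) (use core(2) xs(2) in simp)
   let ?v = "hm_eval K A f (core ?os) (core es)"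
   let ?Q = "bhom N (?os ! 1) (?os ! Suc n)"
   have v: "?v \<in> carrier ?Q" using lin_closed[OF eval_hom[OF core(1,2)] f] core(3,4) by simp
   have vu: "bract N (?os ! 1) (?os ! Suc n) (?os ! Suc n) ?v (unit (last xs)) \<in> carrier ?Q" using v uh o by (intro A.ract_closed)
   have "prjM (hd xs) (last xs) ?v = hm_eval K B (psi n f) xs (prjs xs (core es))"
    unfolding psi_eval[OF f xs(1) ds] using xs(2,3) by simp
   also have "\<dots> = \<zero>\<^bsub>bhom M (hd xs) (last xs)\<^esub>"
    unfolding zero by (rule lin_zero[OF B.cochain_module B.bhom_module[OF xe] idempotent_bimodule.eval_hom[OF trivial_bimodule xs(1) ds]])
   finally have "incM (hd xs) (last xs) (prjM (hd xs) (last xs) ?v) = \<zero>\<^bsub>?Q\<^esub>"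
    using lin_zero[OF B.bhom_module[OF xe] A.bhom_module[OF p_obj[OF xe(1)] p_obj[OF xe(2)]] incM_hom[OF xe]] pxs by simp
   then have uvu: "blact N (?os ! 1) (?os ! 1) (?os ! Suc n) (unit (hd xs)) (bract N (?os ! 1) (?os ! Suc n) (?os ! Suc n) ?v (unit (last xs))) = \<zero>\<^bsub>?Q\<^esub>"
    using incM_prjM[OF xe, of ?v] v pxs by simp
   have vu0: "blact N (?os ! 0) (?os ! 1) (?os ! Suc n) (es ! 0) (bract N (?os ! 1) (?os ! Suc n) (?os ! Suc n) ?v (unit (last xs)))
     = \<zero>\<^bsub>bhom N (?os ! 0) (?os ! Suc n)\<^esub>"
   proof -
    have "blact N (?os ! 0) (?os ! 1) (?os ! Suc n) (es ! 0) (bract N (?os ! 1) (?os ! Suc n) (?os ! Suc n) ?v (unit (last xs)))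
      = blact N (?os ! 0) (?os ! 1) (?os ! Suc n) (es ! 0) (blact N (?os ! 1) (?os ! 1) (?os ! Suc n) (unit (hd xs)) (bract N (?os ! 1) (?os ! Suc n) (?os ! Suc n) ?v (unit (last xs))))"
     using A.blact_assoc[OF o(3,2,2,1) h(1) uh(1) vu] xs(4) by simp
    also have "\<dots> = \<zero>\<^bsub>bhom N (?os ! 0) (?os ! Suc n)\<^esub>"
     unfolding uvu by (rule lin_zero[OF A.bhom_module A.bhom_module A.lact_hom_right]) (use o h in auto)
    finally show ?thesis .
   qed
   have "eval_bar n f ?os es = blact N (?os ! 0) (?os ! 1) (?os ! Suc (Suc n)) (es ! 0)
     (bract N (?os ! 1) (?os ! Suc n) (?os ! Suc (Suc n)) ?v (es ! Suc n))"
    by (simp add: A.cochain_bar_def A.wrap_def)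
   also have "bract N (?os ! 1) (?os ! Suc n) (?os ! Suc (Suc n)) ?v (es ! Suc n)
     = bract N (?os ! 1) (?os ! Suc n) (?os ! Suc (Suc n)) (bract N (?os ! 1) (?os ! Suc n) (?os ! Suc n) ?v (unit (last xs))) (es ! Suc n)"
    using A.bract_assoc[OF o(4,3,3,2) v uh(2) h(2)] xs(5) by simp
   also have "blact N (?os ! 0) (?os ! 1) (?os ! Suc (Suc n)) (es ! 0) \<dots>
     = bract N (?os ! 0) (?os ! Suc n) (?os ! Suc (Suc n)) (blact N (?os ! 0) (?os ! 1) (?os ! Suc n) (es ! 0) (bract N (?os ! 1) (?os ! Suc n) (?os ! Suc n) ?v (unit (last xs)))) (es ! Suc n)"
    by (rule A.blact_bract[OF o(4,3,2,1) h(1) vu h(2)])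
   also have "\<dots> = \<zero>\<^bsub>bhom N (?os ! 0) (?os ! Suc (Suc n))\<^esub>"
    unfolding vu0 by (rule lin_zero[OF A.bhom_module A.bhom_module A.ract_hom_left]) (use o h in auto)
   finally show "eval_bar n f ?os es \<in> {\<zero>\<^bsub>?P\<^esub>}" using D by simp
  qed auto
  then have "hm_eval K A (rco n f) as cs = \<zero>\<^bsub>?P\<^esub>" using rco_eval[OF f as cs] by simp
  also have "\<dots> = hm_eval K A \<zero>\<^bsub>cochn n\<^esub> as cs"
   by (rule lin_zero[OF A.cochain_module P eval_hom[OF as cs], symmetric])
  finally show "hm_eval K A (rco n f) as cs = hm_eval K A \<zero>\<^bsub>cochn n\<^esub> as cs" .
 qed
qed

end

lemma (in k_bimodule) cocycles_submodule:
 "submodule {f \<in> carrier (hm_cochain K C M n). hm_coboundary K C M n f = \<zero>\<^bsub>hm_cochain K C M (Suc n)\<^esub>} K (hm_cochain K C M n)"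
 by (rule submodule_equalizer[OF cochain_module cochain_module _ lin_const_zero[OF cochain_module]])
  (rule idempotent_bimodule.coboundary_hom[OF idempotent_bimodule.intro[OF trivial_idempotents k_bimodule_axioms]])

lemma (in k_bimodule) coboundaries_submodule: "submodule (hm_coboundaries K C M n) K (hm_cochain K C M n)"
proof (cases n)
 case 0
 interpret V: module K "hm_cochain K C M n" by (rule cochain_module)
 have "submodule {\<zero>\<^bsub>hm_cochain K C M n\<^esub>} K (hm_cochain K C M n)" by (rule V.submoduleI_linear) auto
 then show ?thesis using 0 by (simp add: hm_coboundaries_def)
next
 case (Suc m)
 have "submodule (hm_coboundary K C M m ` carrier (hm_cochain K C M m)) K (hm_cochain K C M (Suc m))"
  by (rule submodule_image[OF cochain_module cochain_module])
   (rule idempotent_bimodule.coboundary_hom[OF idempotent_bimodule.intro[OF trivial_idempotents k_bimodule_axioms]])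
 then show ?thesis using Suc by (simp add: hm_coboundaries_def)
qed

context amalgamation
begin

lemma psi_zero: "psi n \<zero>\<^bsub>cochn n\<^esub> = \<zero>\<^bsub>cochn_B n\<^esub>"
 by (rule lin_zero[OF A.cochain_module B.cochain_module psi_hom])

text \<open>Dually to the case of homology, \<open>psi\<close> is surjective and the projection \<open>rco\<close>, which is homotopic
 to the identity, annihilates its kernel.\<close>

theorem cohomology_iso:
 shows "mod_isomorphic K (hm_cohomology K A N n) (hm_cohomology K B M n)"
  and "mod_isomorphic K (hm_cohomology K B M n) (hm_cohomology K A N n)"
proof -
 let ?V = "cochn n" and ?V' = "cochn_B n"
 let ?Z = "{f \<in> carrier ?V. hm_coboundary K A N n f = \<zero>\<^bsub>cochn (Suc n)\<^esub>}"
 let ?Z' = "{f \<in> carrier ?V'. hm_coboundary K B M n f = \<zero>\<^bsub>cochn_B (Suc n)\<^esub>}"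
 let ?H = "hm_coboundaries K A N n" and ?H' = "hm_coboundaries K B M n"
 interpret V: module K ?V by (rule A.cochain_module)
 interpret V': module K ?V' by (rule B.cochain_module)
 note H = A.coboundaries_submodule[of n] and H' = B.coboundaries_submodule[of n]
 note Z = A.cocycles_submodule[of n] and Z' = B.cocycles_submodule[of n]
 have HH: "psi n ` ?H \<subseteq> ?H'"
 proof (rule image_subsetI)
  fix v assume v: "v \<in> ?H"
  show "psi n v \<in> ?H'"
  proof (cases n)
   case 0
   then show ?thesis using v psi_zero[of n] by (simp add: hm_coboundaries_def)
  next
   case (Suc m)
   then obtain w where w: "w \<in> carrier (cochn m)" "v = hm_coboundary K A N m w"
    using v by (auto simp: hm_coboundaries_def)
   have "psi n v = hm_coboundary K B M m (psi m w)" using psi_coboundary[OF w(1)] w(2) Suc by simp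
   then show ?thesis using psi_closed[OF w(1)] Suc by (simp add: hm_coboundaries_def)
  qed
 qed
 have ZZ: "psi n ` ?Z \<subseteq> ?Z'"
 proof (rule image_subsetI)
  fix z assume z: "z \<in> ?Z"
  then have "hm_coboundary K B M n (psi n z) = \<zero>\<^bsub>cochn_B (Suc n)\<^esub>"
   using psi_coboundary[of z n] psi_zero[of "Suc n"] by simp
  then show "psi n z \<in> ?Z'" using z psi_closed[of z n] by simp
 qed
 have rest: "v \<in> ?H" if z: "z \<in> ?Z" and v: "v = z \<ominus>\<^bsub>?V\<^esub> rco n z" for z v
 proof (cases n)
  case 0
  then show ?thesis using cochain_homotopy[of z n] z v by (simp add: hm_coboundaries_def)
 next
  case (Suc m)
  have hz: "hco m z \<in> carrier (cochn m)" using hco_closed[of z m] z Suc by simp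
  have "hm_coboundary K A N m (hco m z) \<in> ?H" using hz Suc by (simp add: hm_coboundaries_def)
  then have "ksign K n \<odot>\<^bsub>?V\<^esub> hm_coboundary K A N m (hco m z) \<in> ?H"
   by (rule submodule.smult_closed[OF H, OF A.ksign_in])
  then show ?thesis using cochain_homotopy[of z n] z v Suc by simp
 qed
 have inj: "z \<in> ?H" if z: "z \<in> ?Z" and b: "psi n z \<in> ?H'" for z
 proof -
  have zc: "z \<in> carrier ?V" using z by simp
  have "rco n z \<in> ?H"
  proof (cases n)
   case 0
   then have "rco n z = \<zero>\<^bsub>?V\<^esub>" using b by (intro rco_kernel[OF zc]) (simp add: hm_coboundaries_def)
   then show ?thesis using submodule_zero[OF A.cochain_module H] by simp
  next
   case (Suc m)
   then obtain u where u: "u \<in> carrier (cochn_B m)" "psi n z = hm_coboundary K B M m u"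
    using b by (auto simp: hm_coboundaries_def)
   obtain w where w: "w \<in> carrier (cochn m)" "u = psi m w" using psi_surjective[OF u(1)] by blast
   let ?dw = "hm_coboundary K A N m w"
   have dw: "?dw \<in> carrier ?V" using coboundary_closed[OF w(1)] Suc by simp
   have "psi n z = psi n ?dw" using u w psi_coboundary[OF w(1)] Suc by simp
   then have "psi n (z \<ominus>\<^bsub>?V\<^esub> ?dw) = \<zero>\<^bsub>?V'\<^esub>"
    using lin_minus[OF A.cochain_module B.cochain_module psi_hom zc dw] psi_closed[OF dw]
    by (simp add: V'.minus_eq V'.r_neg)
   then have "rco n (z \<ominus>\<^bsub>?V\<^esub> ?dw) = \<zero>\<^bsub>?V\<^esub>" by (intro rco_kernel V.minus_closed zc dw)
   then have "rco n z \<ominus>\<^bsub>?V\<^esub> rco n ?dw = \<zero>\<^bsub>?V\<^esub>"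
    using lin_minus[OF A.cochain_module A.cochain_module rco_hom zc dw] by simp
   moreover have "(rco n z \<ominus>\<^bsub>?V\<^esub> rco n ?dw) \<oplus>\<^bsub>?V\<^esub> rco n ?dw = rco n z"
    using rco_closed[OF zc] rco_closed[OF dw] by (simp add: V.minus_eq V.a_assoc V.l_neg)
   ultimately have "rco n z = rco n ?dw" using rco_closed[OF dw] by simp
   also have "\<dots> = hm_coboundary K A N m (rco m w)" using coboundary_rco[OF w(1)] Suc by simp
   finally show ?thesis using rco_closed[OF w(1)] Suc by (simp add: hm_coboundaries_def)
  qed
  then have "(z \<ominus>\<^bsub>?V\<^esub> rco n z) \<oplus>\<^bsub>?V\<^esub> rco n z \<in> ?H"
   by (intro submodule_add[OF A.cochain_module H] rest[OF z refl])
  moreover have "(z \<ominus>\<^bsub>?V\<^esub> rco n z) \<oplus>\<^bsub>?V\<^esub> rco n z = z"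
   using zc rco_closed[OF zc] by (simp add: V.minus_eq V.a_assoc V.l_neg)
  ultimately show ?thesis by simp
 qed
 have surj: "\<exists>z\<in>?Z. z' \<ominus>\<^bsub>?V'\<^esub> psi n z \<in> ?H'" if z': "z' \<in> ?Z'" for z'
 proof -
  have zc: "z' \<in> carrier ?V'" using z' by simp
  obtain w where w: "w \<in> carrier ?V" "z' = psi n w" using psi_surjective[OF zc] by blast
  have dw: "hm_coboundary K A N n w \<in> carrier (cochn (Suc n))" by (rule coboundary_closed[OF w(1)])
  have "psi (Suc n) (hm_coboundary K A N n w) = \<zero>\<^bsub>cochn_B (Suc n)\<^esub>"
   using psi_coboundary[OF w(1)] z' w(2) by simp
  then have "rco (Suc n) (hm_coboundary K A N n w) = \<zero>\<^bsub>cochn (Suc n)\<^esub>" by (rule rco_kernel[OF dw])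
  then have "rco n w \<in> ?Z" using coboundary_rco[OF w(1)] rco_closed[OF w(1)] by simp
  moreover have "z' \<ominus>\<^bsub>?V'\<^esub> psi n (rco n w) = \<zero>\<^bsub>?V'\<^esub>"
   using psi_rco[OF w(1)] w(2) zc by (simp add: V'.minus_eq V'.r_neg)
  ultimately show ?thesis using submodule_zero[OF B.cochain_module H'] by (intro bexI[of _ "rco n w"]) simp_all
 qed
 have k: "mod_kernel ?V (cochn (Suc n)) (hm_coboundary K A N n) = ?V\<lparr>carrier := ?Z\<rparr>"
  "mod_kernel ?V' (cochn_B (Suc n)) (hm_coboundary K B M n) = ?V'\<lparr>carrier := ?Z'\<rparr>"
  by (simp_all add: mod_kernel_def)
 show "mod_isomorphic K (hm_cohomology K A N n) (hm_cohomology K B M n)"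
  unfolding hm_cohomology_def k
  by (rule quot_mod_isoI(1)[OF A.cochain_module B.cochain_module H H' Z Z' psi_hom HH ZZ inj surj])
 show "mod_isomorphic K (hm_cohomology K B M n) (hm_cohomology K A N n)"
  unfolding hm_cohomology_def k
  by (rule quot_mod_isoI(2)[OF A.cochain_module B.cochain_module H H' Z Z' psi_hom HH ZZ inj surj])
qed

end

section \<open>Expansion\<close>

text \<open>The projection to the subspace cut out by the idempotents of two objects of the expansion.\<close>

definition corner :: "('o, 'c, 'k) kcat \<Rightarrow> ('o, 'c, 'm, 'k) kbimod \<Rightarrow> 'o \<Rightarrow> 'o + 'c \<Rightarrow> 'o + 'c \<Rightarrow> 'm \<Rightarrow> 'm" where
 "corner C M x b a m = blact M (base_obj x b) (base_obj x b) (base_obj x a) (base_idem C b)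
   (bract M (base_obj x b) (base_obj x a) (base_obj x a) m (base_idem C a))"

locale idempotent_system = k_bimodule K C M
 for K :: "('k, 'r) ring_scheme" (structure)
  and C :: "('o, 'c, 'k) kcat" and M :: "('o, 'c, 'm, 'k) kbimod" +
 fixes x :: 'o and E :: "'c set"
 assumes x: "x \<in> kobj C" and E: "complete_orth_idempotents C x E"
begin

abbreviation "ob \<equiv> base_obj x"
abbreviation "id' \<equiv> base_idem C"
abbreviation "CE \<equiv> expansion C x E"
abbreviation "ME \<equiv> expansion_bimod C M x"

lemma ob_obj: "b \<in> kobj CE \<Longrightarrow> ob b \<in> kobj C"
 using x by (auto simp: expansion_def)

lemma idem_mor: "b \<in> kobj CE \<Longrightarrow> id' b \<in> mor C (ob b) (ob b)"
 using E by (auto simp: expansion_def complete_orth_idempotents_def intro: kid_closed)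

lemma idem_idem: "b \<in> kobj CE \<Longrightarrow> kcomp C (ob b) (ob b) (ob b) (id' b) (id' b) = id' b"
 using E by (auto simp: expansion_def complete_orth_idempotents_def simp: kid_left kid_closed)

lemma regular_system: "idempotent_system K C (regular C) x E"
 by (rule idempotent_system.intro[OF regular_bimodule idempotent_system_axioms.intro[OF x E]])

lemma expansion_sel [simp]: "kcomp CE c b a = kcomp C (ob c) (ob b) (ob a)" "kid CE = id'"
 "blact ME c b a = blact M (ob c) (ob b) (ob a)" "bract ME c b a = bract M (ob c) (ob b) (ob a)"
 "bhom (expansion_bimod C (regular C) x) = khom CE"
 by (simp_all add: expansion_def expansion_bimod_def fun_eq_iff)

lemma bhom_expansion: "bhom ME b a = (bhom M (ob b) (ob a))\<lparr>carrier := corner C M x b a ` bim M (ob b) (ob a)\<rparr>"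
 by (simp add: expansion_bimod_def Let_def corner_def)

context
 fixes b a
 assumes b: "b \<in> kobj CE" and a: "a \<in> kobj CE"
begin

lemma corner_hom: "corner C M x b a \<in> mod_hom K (bhom M (ob b) (ob a)) (bhom M (ob b) (ob a))"
 unfolding corner_def
 by (rule lin_comp[OF lact_hom_right ract_hom_left]) (intro ob_obj idem_mor a b)+

lemma corner_fixed:
 assumes m: "m \<in> bim M (ob b) (ob a)"
 shows "blact M (ob b) (ob b) (ob a) (id' b) (corner C M x b a m) = corner C M x b a m"
  and "bract M (ob b) (ob a) (ob a) (corner C M x b a m) (id' a) = corner C M x b a m"
proof -
 let ?m = "bract M (ob b) (ob a) (ob a) m (id' a)"
 note o = ob_obj[OF a] ob_obj[OF b] and e = idem_mor[OF a] idem_mor[OF b]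
 note m' = ract_closed[OF o(1,1,2) m e(1)]
 show "blact M (ob b) (ob b) (ob a) (id' b) (corner C M x b a m) = corner C M x b a m"
  using blact_assoc[OF o(1,2,2,2) e(2,2) m'] idem_idem[OF b] by (simp add: corner_def)
 have "bract M (ob b) (ob a) (ob a) ?m (id' a) = ?m"
  using bract_assoc[OF o(1,1,1,2) m e(1,1)] idem_idem[OF a] by simp
 then show "bract M (ob b) (ob a) (ob a) (corner C M x b a m) (id' a) = corner C M x b a m"
  using blact_bract[OF o(1,1,2,2) e(2) m' e(1)] by (simp add: corner_def)
qed

lemma bhom_expansion_iff: "m \<in> bim ME b a \<longleftrightarrow> m \<in> bim M (ob b) (ob a)
  \<and> blact M (ob b) (ob b) (ob a) (id' b) m = m \<and> bract M (ob b) (ob a) (ob a) m (id' a) = m"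
proof
 show "m \<in> bim ME b a" if "m \<in> bim M (ob b) (ob a)
  \<and> blact M (ob b) (ob b) (ob a) (id' b) m = m \<and> bract M (ob b) (ob a) (ob a) m (id' a) = m"
  using that by (auto simp: bhom_expansion corner_def intro!: image_eqI[of m _ m])
qed (auto simp: bhom_expansion corner_fixed lin_closed[OF corner_hom])

lemma bhom_expansion_module: "module K (bhom ME b a)"
proof -
 note m = bhom_module[OF ob_obj[OF a] ob_obj[OF b]]
 show ?thesis
  unfolding bhom_expansion by (rule submodule.submodule_is_module[OF submodule_image[OF m m corner_hom] m])
qed

lemma bhom_expansion_sub: "m \<in> bim ME b a \<Longrightarrow> m \<in> bim M (ob b) (ob a)"
 by (simp add: bhom_expansion_iff)

lemma inclusion_hom: "(\<lambda>m. m) \<in> mod_hom K (bhom ME b a) (bhom M (ob b) (ob a))"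
 using bhom_expansion_sub by (auto simp: bhom_expansion intro!: mod_homI)

lemma corner_projection: "corner C M x b a \<in> mod_hom K (bhom M (ob b) (ob a)) (bhom ME b a)"
 using corner_hom by (auto simp: mod_hom_def bhom_expansion)

lemma into_bhom: "h \<in> mod_hom K V (bhom M (ob b) (ob a)) \<Longrightarrow> (\<And>v. v \<in> carrier V \<Longrightarrow> h v \<in> bim ME b a)
  \<Longrightarrow> h \<in> mod_hom K V (bhom ME b a)"
 by (auto simp: mod_hom_def bhom_expansion)

end

lemmas khom_expansion_iff = idempotent_system.bhom_expansion_iff[OF regular_system, unfolded regular_sel expansion_sel]
 and khom_expansion_module = idempotent_system.bhom_expansion_module[OF regular_system, unfolded expansion_sel]
 and khom_expansion_sub = idempotent_system.bhom_expansion_sub[OF regular_system, unfolded regular_sel expansion_sel]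
 and khom_inclusion_hom = idempotent_system.inclusion_hom[OF regular_system, unfolded regular_sel expansion_sel]
 and khom_corner_projection = idempotent_system.corner_projection[OF regular_system, unfolded regular_sel expansion_sel]

context
 fixes c b a
 assumes o: "a \<in> kobj CE" "b \<in> kobj CE" "c \<in> kobj CE"
begin

lemma lact_corner:
 assumes g: "g \<in> mor CE c b" and m: "m \<in> bim ME b a"
 shows "blact M (ob c) (ob b) (ob a) g m \<in> bim ME c a"
 using g m blact_assoc[OF ob_obj[OF o(1)] ob_obj[OF o(2)] ob_obj[OF o(3)] ob_obj[OF o(3)] idem_mor[OF o(3)], of g m]
  blact_bract[OF ob_obj[OF o(1)] ob_obj[OF o(1)] ob_obj[OF o(2)] ob_obj[OF o(3)] _ _ idem_mor[OF o(1)], of g m]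
  lact_closed[OF ob_obj[OF o(1)] ob_obj[OF o(2)] ob_obj[OF o(3)], of g m]
 by (simp add: khom_expansion_iff bhom_expansion_iff o)

lemma ract_corner:
 assumes m: "m \<in> bim ME c b" and f: "f \<in> mor CE b a"
 shows "bract M (ob c) (ob b) (ob a) m f \<in> bim ME c a"
 using m f blact_bract[OF ob_obj[OF o(1)] ob_obj[OF o(2)] ob_obj[OF o(3)] ob_obj[OF o(3)] idem_mor[OF o(3)], of m f]
  bract_assoc[OF ob_obj[OF o(1)] ob_obj[OF o(1)] ob_obj[OF o(2)] ob_obj[OF o(3)] _ _ idem_mor[OF o(1)], of m f]
  ract_closed[OF ob_obj[OF o(1)] ob_obj[OF o(2)] ob_obj[OF o(3)], of m f]
 by (simp add: khom_expansion_iff bhom_expansion_iff o)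

lemma lact_expansion_bilin: "bilin K (khom CE c b) (bhom ME b a) (bhom ME c a) (blact M (ob c) (ob b) (ob a))"
 unfolding bilin_def
proof (intro conjI ballI)
 note ob = ob_obj[OF o(1)] ob_obj[OF o(2)] ob_obj[OF o(3)]
 show "blact M (ob c) (ob b) (ob a) g \<in> mod_hom K (bhom ME b a) (bhom ME c a)" if g: "g \<in> mor CE c b" for g
  by (rule into_bhom[OF o(3,1) lin_comp[OF lact_hom_right[OF ob khom_expansion_sub[OF o(3,2) g]] inclusion_hom[OF o(2,1)]]])
   (rule lact_corner[OF g])
 show "(\<lambda>g. blact M (ob c) (ob b) (ob a) g m) \<in> mod_hom K (khom CE c b) (bhom ME c a)" if m: "m \<in> bim ME b a" for m
  by (rule into_bhom[OF o(3,1) lin_comp[OF lact_hom_left[OF ob bhom_expansion_sub[OF o(2,1) m]] khom_inclusion_hom[OF o(3,2)]]])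
   (rule lact_corner[OF _ m])
qed

lemma ract_expansion_bilin: "bilin K (bhom ME c b) (khom CE b a) (bhom ME c a) (bract M (ob c) (ob b) (ob a))"
 unfolding bilin_def
proof (intro conjI ballI)
 note ob = ob_obj[OF o(1)] ob_obj[OF o(2)] ob_obj[OF o(3)]
 show "bract M (ob c) (ob b) (ob a) m \<in> mod_hom K (khom CE b a) (bhom ME c a)" if m: "m \<in> bim ME c b" for m
  by (rule into_bhom[OF o(3,1) lin_comp[OF ract_hom_right[OF ob bhom_expansion_sub[OF o(3,2) m]] khom_inclusion_hom[OF o(2,1)]]])
   (rule ract_corner[OF m])
 show "(\<lambda>m. bract M (ob c) (ob b) (ob a) m f) \<in> mod_hom K (bhom ME c b) (bhom ME c a)" if f: "f \<in> mor CE b a" for f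
  by (rule into_bhom[OF o(3,1) lin_comp[OF ract_hom_left[OF ob khom_expansion_sub[OF o(2,1) f]] inclusion_hom[OF o(3,2)]]])
   (rule ract_corner[OF _ f])
qed

end

lemma expansion_category: "k_category K CE"
 by (rule k_category.intro[OF field_axioms k_category_axioms.intro])
  (simp_all add: khom_expansion_module khom_expansion_iff idem_mor idem_idem ob_obj kcomp_assoc
   idempotent_system.lact_expansion_bilin[OF regular_system, unfolded regular_sel expansion_sel])

lemma expansion_bimodule: "k_bimodule K CE ME"
 by (rule k_bimodule.intro[OF expansion_category k_bimodule_axioms.intro])
  (simp_all add: bhom_expansion_module khom_expansion_iff bhom_expansion_iff ob_obj blact_assoc bract_assoc blact_bract
   lact_expansion_bilin ract_expansion_bilin)

lemma fibre_expansion: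
 "a \<in> kobj C \<Longrightarrow> {b \<in> kobj CE. ob b = a} = (if a = x then Inr ` E else {Inl a})"
 by (auto simp: expansion_def)

text \<open>The category \<open>C\<close> amalgamates the objects \<open>e \<in> E\<close> of the expansion into \<open>x\<close>. As the morphisms of
 the expansion are morphisms of \<open>C\<close>, the inclusions of the entries are identity maps.\<close>

lemma expansion_amalgamation: "amalgamation K C M CE ME ob (\<lambda>b a c. c) (corner C (regular C) x) (\<lambda>b a m. m) (corner C M x)"
proof (rule amalgamation.intro[OF k_bimodule_axioms expansion_bimodule amalgamation_axioms.intro])
 have fin: "finite E" using E by (simp add: complete_orth_idempotents_def)
 show "ob b \<in> kobj C" if "b \<in> kobj CE" for b by (rule ob_obj[OF that])
 show "finite {b \<in> kobj CE. ob b = a}" if "a \<in> kobj C" for a using that fin by (simp add: fibre_expansion)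
 show "(\<Oplus>\<^bsub>khom C a a\<^esub> b \<in> {b \<in> kobj CE. ob b = a}. kid CE b) = kid C a" if a: "a \<in> kobj C" for a
 proof (cases "a = x")
  case True
  interpret module K "khom C x x" by (rule khom_module[OF x x])
  have "(\<Oplus>\<^bsub>khom C x x\<^esub> b \<in> Inr ` E. id' b) = (\<Oplus>\<^bsub>khom C x x\<^esub> e \<in> E. id' (Inr e))"
   by (rule finsum_reindex) (use E in \<open>auto simp: complete_orth_idempotents_def\<close>)
  then show ?thesis using E True a by (simp add: fibre_expansion complete_orth_idempotents_def)
 next
  case False
  interpret module K "khom C a a" by (rule khom_module[OF a a])
  show ?thesis using a False kid_closed[OF a] by (simp add: fibre_expansion)
 qed
 show "kcomp C (ob b) (ob b) (ob b) (kid CE a) (kid CE b) = \<zero>\<^bsub>khom C (ob b) (ob b)\<^esub>"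
  if "a \<in> kobj CE" "b \<in> kobj CE" "ob a = ob b" "a \<noteq> b" for a b
  using that E by (auto simp: expansion_def complete_orth_idempotents_def; blast)
 show "corner C (regular C) x b a c = c" if "a \<in> kobj CE" "b \<in> kobj CE" "c \<in> mor CE b a" for a b c
  using that by (simp add: khom_expansion_iff corner_def)
 show "corner C M x b a m = m" if "a \<in> kobj CE" "b \<in> kobj CE" "m \<in> bim ME b a" for a b m
  using that by (simp add: bhom_expansion_iff corner_def)
qed (simp_all add: inclusion_hom khom_inclusion_hom corner_projection khom_corner_projection corner_def)

end

section \<open>Contraction\<close>

definition single :: "'o set \<Rightarrow> ('o \<Rightarrow> 'o \<Rightarrow> ('k, 'v) module) \<Rightarrow> 'o option \<Rightarrow> 'o option \<Rightarrow> 'o \<Rightarrow> 'o \<Rightarrow> 'v \<Rightarrow> 'o \<times> 'o \<Rightarrow> 'v" where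
 "single F H b a y x = dsum_inj (block F b \<times> block F a) (\<lambda>(y, x). H y x) (y, x)"

locale matrix_space =
 fixes K :: "('k, 'r) ring_scheme" and F :: "'o set" and H :: "'o \<Rightarrow> 'o \<Rightarrow> ('k, 'v) module"
  and b a :: "'o option"
 assumes cring: "cring K" and finite_rows: "finite (block F b)" and finite_columns: "finite (block F a)"
  and entry_module: "y \<in> block F b \<Longrightarrow> x \<in> block F a \<Longrightarrow> module K (H y x)"
begin

lemma family: "module_family K (block F b \<times> block F a) (\<lambda>(y, x). H y x)"
 by (rule module_family.intro[OF cring]) (auto intro: entry_module)

lemma mat_module: "module K (mat_space F H b a)"
 unfolding mat_space_def by (rule module_family.dsum_mod_module[OF family])

lemma mat_carrier_iff: "f \<in> carrier (mat_space F H b a) \<longleftrightarrow> f \<in> extensional (block F b \<times> block F a)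
  \<and> (\<forall>y\<in>block F b. \<forall>x\<in>block F a. f (y, x) \<in> carrier (H y x))"
 using finite_rows finite_columns by (auto simp: mat_space_def dsum_supp_def PiE_iff)

lemma entry_hom: "y \<in> block F b \<Longrightarrow> x \<in> block F a \<Longrightarrow> (\<lambda>f. f (y, x)) \<in> mod_hom K (mat_space F H b a) (H y x)"
 using module_family.dsum_eval_hom[OF family, of "(y, x)"] by (simp add: mat_space_def)

lemma mat_ext:
 assumes "f \<in> carrier (mat_space F H b a)" "g \<in> carrier (mat_space F H b a)"
  and "\<And>y x. y \<in> block F b \<Longrightarrow> x \<in> block F a \<Longrightarrow> f (y, x) = g (y, x)"
 shows "f = g"
 by (rule extensionalityI[of _ "block F b \<times> block F a"]) (use assms in \<open>auto simp: mat_carrier_iff\<close>)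

lemma hom_into_mat:
 assumes "module K V" and h: "\<And>y x. y \<in> block F b \<Longrightarrow> x \<in> block F a \<Longrightarrow> (\<lambda>v. h v (y, x)) \<in> mod_hom K V (H y x)"
  and ext: "\<And>v. h v \<in> extensional (block F b \<times> block F a)"
 shows "h \<in> mod_hom K V (mat_space F H b a)"
proof -
 interpret V: module K V by fact
 interpret W: module K "mat_space F H b a" by (rule mat_module)
 have cl: "h v \<in> carrier (mat_space F H b a)" if "v \<in> carrier V" for v
  using lin_closed[OF h that] ext by (simp add: mat_carrier_iff)
 show ?thesis
 proof (rule mod_homI[OF cl])
  show "h (u \<oplus>\<^bsub>V\<^esub> v) = h u \<oplus>\<^bsub>mat_space F H b a\<^esub> h v" if "u \<in> carrier V" "v \<in> carrier V" for u v
  proof (rule mat_ext)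
   fix y x assume yx: "y \<in> block F b" "x \<in> block F a"
   show "h (u \<oplus>\<^bsub>V\<^esub> v) (y, x) = (h u \<oplus>\<^bsub>mat_space F H b a\<^esub> h v) (y, x)"
    using lin_add[OF h[OF yx] that] lin_add[OF entry_hom[OF yx] cl[OF that(1)] cl[OF that(2)]] by simp
  qed (use that cl in auto)
  show "h (k \<odot>\<^bsub>V\<^esub> v) = k \<odot>\<^bsub>mat_space F H b a\<^esub> h v" if "k \<in> carrier K" "v \<in> carrier V" for k v
  proof (rule mat_ext)
   fix y x assume yx: "y \<in> block F b" "x \<in> block F a"
   show "h (k \<odot>\<^bsub>V\<^esub> v) (y, x) = (k \<odot>\<^bsub>mat_space F H b a\<^esub> h v) (y, x)"
    using lin_smult[OF h[OF yx] that] lin_smult[OF entry_hom[OF yx] that(1) cl[OF that(2)]] by simp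
  qed (use that cl in auto)
 qed
qed

lemma zero_entry: "y \<in> block F b \<Longrightarrow> x \<in> block F a \<Longrightarrow> \<zero>\<^bsub>mat_space F H b a\<^esub> (y, x) = \<zero>\<^bsub>H y x\<^esub>"
 by (simp add: mat_space_def)

lemma finsum_entry:
 assumes "y \<in> block F b" "x \<in> block F a" "f \<in> I \<rightarrow> carrier (mat_space F H b a)"
 shows "(\<Oplus>\<^bsub>mat_space F H b a\<^esub> i \<in> I. f i) (y, x) = (\<Oplus>\<^bsub>H y x\<^esub> i \<in> I. f i (y, x))"
 by (rule lin_finsum[OF mat_module entry_module[OF assms(1,2)] entry_hom[OF assms(1,2)] assms(3)])

lemma single_hom: "y \<in> block F b \<Longrightarrow> x \<in> block F a \<Longrightarrow> single F H b a y x \<in> mod_hom K (H y x) (mat_space F H b a)"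
 using module_family.dsum_inj_hom[OF family, of "(y, x)"] by (simp add: mat_space_def single_def)

lemma single_entry: "y' \<in> block F b \<Longrightarrow> x' \<in> block F a
  \<Longrightarrow> single F H b a y x v (y', x') = (if y' = y \<and> x' = x then v else \<zero>\<^bsub>H y' x'\<^esub>)"
 by (auto simp: single_def dsum_inj_def)

end

locale matrix_product = left: matrix_space K F G c b + right: matrix_space K F G' b a + result: matrix_space K F H c a
 for K :: "('k, 'r) ring_scheme" and F :: "'o set" and G :: "'o \<Rightarrow> 'o \<Rightarrow> ('k, 'u) module"
  and G' :: "'o \<Rightarrow> 'o \<Rightarrow> ('k, 'v) module" and H :: "'o \<Rightarrow> 'o \<Rightarrow> ('k, 'w) module"
  and c b a :: "'o option" +
 fixes op :: "'o \<Rightarrow> 'o \<Rightarrow> 'o \<Rightarrow> 'u \<Rightarrow> 'v \<Rightarrow> 'w"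
 assumes op_bilin: "\<lbrakk>z \<in> block F c; y \<in> block F b; x \<in> block F a\<rbrakk> \<Longrightarrow> bilin K (G z y) (G' y x) (H z x) (op z y x)"
begin

abbreviation "matmul \<equiv> mat_prod F H op c b a"

lemma op_left: "\<lbrakk>z \<in> block F c; y \<in> block F b; x \<in> block F a; f \<in> carrier (G' y x)\<rbrakk> \<Longrightarrow> (\<lambda>g. op z y x g f) \<in> mod_hom K (G z y) (H z x)"
 using op_bilin by (simp add: bilin_def)

lemma op_right: "\<lbrakk>z \<in> block F c; y \<in> block F b; x \<in> block F a; g \<in> carrier (G z y)\<rbrakk> \<Longrightarrow> (\<lambda>f. op z y x g f) \<in> mod_hom K (G' y x) (H z x)"
 using op_bilin by (simp add: bilin_def)

lemma op_closed: "\<lbrakk>z \<in> block F c; y \<in> block F b; x \<in> block F a; g \<in> carrier (G z y); f \<in> carrier (G' y x)\<rbrakk> \<Longrightarrow> op z y x g f \<in> carrier (H z x)"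
 by (rule lin_closed[OF op_right])

lemma matmul_entry: "z \<in> block F c \<Longrightarrow> x \<in> block F a \<Longrightarrow> matmul g f (z, x) = (\<Oplus>\<^bsub>H z x\<^esub> y \<in> block F b. op z y x (g (z, y)) (f (y, x)))"
 by (simp add: mat_prod_def)

lemma matmul_extensional: "matmul g f \<in> extensional (block F c \<times> block F a)"
 by (simp add: mat_prod_def)

lemma entry_left: "\<lbrakk>g \<in> carrier (mat_space F G c b); z \<in> block F c; y \<in> block F b\<rbrakk> \<Longrightarrow> g (z, y) \<in> carrier (G z y)"
 by (simp add: left.mat_carrier_iff)

lemma entry_right: "\<lbrakk>f \<in> carrier (mat_space F G' b a); y \<in> block F b; x \<in> block F a\<rbrakk> \<Longrightarrow> f (y, x) \<in> carrier (G' y x)"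
 by (simp add: right.mat_carrier_iff)

lemma matmul_bilin: "bilin K (mat_space F G c b) (mat_space F G' b a) (mat_space F H c a) matmul"
 unfolding bilin_def
proof (intro conjI ballI)
 fix g assume g: "g \<in> carrier (mat_space F G c b)"
 show "matmul g \<in> mod_hom K (mat_space F G' b a) (mat_space F H c a)"
 proof (rule result.hom_into_mat[OF right.mat_module _ matmul_extensional])
  fix z x assume z: "z \<in> block F c" and x: "x \<in> block F a"
  show "(\<lambda>f. matmul g f (z, x)) \<in> mod_hom K (mat_space F G' b a) (H z x)"
   unfolding matmul_entry[OF z x]
   by (rule lin_finsum_pointwise[OF right.mat_module result.entry_module[OF z x]])
    (rule lin_comp[OF op_right right.entry_hom], use z x g entry_left in auto)
 qed
next
 fix f assume f: "f \<in> carrier (mat_space F G' b a)"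
 show "(\<lambda>g. matmul g f) \<in> mod_hom K (mat_space F G c b) (mat_space F H c a)"
 proof (rule result.hom_into_mat[OF left.mat_module _ matmul_extensional])
  fix z x assume z: "z \<in> block F c" and x: "x \<in> block F a"
  show "(\<lambda>g. matmul g f (z, x)) \<in> mod_hom K (mat_space F G c b) (H z x)"
   unfolding matmul_entry[OF z x]
   by (rule lin_finsum_pointwise[OF left.mat_module result.entry_module[OF z x]])
    (rule lin_comp[OF op_left left.entry_hom], use z x f entry_right in auto)
 qed
qed

lemma matmul_closed: "g \<in> carrier (mat_space F G c b) \<Longrightarrow> f \<in> carrier (mat_space F G' b a) \<Longrightarrow> matmul g f \<in> carrier (mat_space F H c a)"
 by (rule lin_closed[OF matmul_bilin[unfolded bilin_def, THEN conjunct1, rule_format]])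

lemma matmul_single_right:
 assumes g: "g \<in> carrier (mat_space F G c b)" and y: "y \<in> block F b" and v: "v \<in> carrier (G' y x)"
  and z: "z \<in> block F c" and x': "x' \<in> block F a"
 shows "matmul g (single F G' b a y x v) (z, x') = (if x' = x then op z y x (g (z, y)) v else \<zero>\<^bsub>H z x'\<^esub>)"
proof -
 interpret Hm: module K "H z x'" by (rule result.entry_module[OF z x'])
 have zero: "op z y' x' (g (z, y')) \<zero>\<^bsub>G' y' x'\<^esub> = \<zero>\<^bsub>H z x'\<^esub>" if "y' \<in> block F b" for y'
  by (rule lin_zero[OF right.entry_module[OF that x'] Hm.module_axioms op_right[OF z that x' entry_left[OF g z that]]])
 show ?thesis
 proof (cases "x' = x")
  case True
  have cl: "op z y x (g (z, y)) v \<in> carrier (H z x)"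
   by (rule op_closed[OF z y _ entry_left[OF g z y] v]) (use x' True in simp)
  have "matmul g (single F G' b a y x v) (z, x') = (\<Oplus>\<^bsub>H z x'\<^esub> y' \<in> block F b. if y = y' then op z y x (g (z, y)) v else \<zero>\<^bsub>H z x'\<^esub>)"
   unfolding matmul_entry[OF z x']
   by (rule Hm.finsum_cong') (use zero True x' cl Hm.zero_closed in \<open>auto simp: right.single_entry\<close>)
  also have "\<dots> = op z y x (g (z, y)) v"
   by (rule Hm.finsum_singleton[OF y left.finite_columns]) (use cl True in auto)
  finally show ?thesis using True by simp
 next
  case False
  have "matmul g (single F G' b a y x v) (z, x') = (\<Oplus>\<^bsub>H z x'\<^esub> y' \<in> block F b. \<zero>\<^bsub>H z x'\<^esub>)"
   unfolding matmul_entry[OF z x']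
   by (rule Hm.finsum_cong') (use zero False x' in \<open>auto simp: right.single_entry\<close>)
  then show ?thesis using False by simp
 qed
qed

lemma matmul_single_left:
 assumes f: "f \<in> carrier (mat_space F G' b a)" and y: "y \<in> block F b" and v: "v \<in> carrier (G z y)"
  and z': "z' \<in> block F c" and x: "x \<in> block F a"
 shows "matmul (single F G c b z y v) f (z', x) = (if z' = z then op z y x v (f (y, x)) else \<zero>\<^bsub>H z' x\<^esub>)"
proof -
 interpret Hm: module K "H z' x" by (rule result.entry_module[OF z' x])
 have zero: "op z' y' x \<zero>\<^bsub>G z' y'\<^esub> (f (y', x)) = \<zero>\<^bsub>H z' x\<^esub>" if "y' \<in> block F b" for y'
  by (rule lin_zero[OF left.entry_module[OF z' that] Hm.module_axioms op_left[OF z' that x entry_right[OF f that x]]])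
 show ?thesis
 proof (cases "z' = z")
  case True
  have cl: "op z y x v (f (y, x)) \<in> carrier (H z x)"
   by (rule op_closed[OF _ y x v entry_right[OF f y x]]) (use z' True in simp)
  have "matmul (single F G c b z y v) f (z', x) = (\<Oplus>\<^bsub>H z' x\<^esub> y' \<in> block F b. if y = y' then op z y x v (f (y, x)) else \<zero>\<^bsub>H z' x\<^esub>)"
   unfolding matmul_entry[OF z' x]
   by (rule Hm.finsum_cong') (use zero True z' cl Hm.zero_closed in \<open>auto simp: left.single_entry\<close>)
  also have "\<dots> = op z y x v (f (y, x))"
   by (rule Hm.finsum_singleton[OF y left.finite_columns]) (use cl True in auto)
  finally show ?thesis using True by simp
 next
  case False
  have "matmul (single F G c b z y v) f (z', x) = (\<Oplus>\<^bsub>H z' x\<^esub> y' \<in> block F b. \<zero>\<^bsub>H z' x\<^esub>)"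
   unfolding matmul_entry[OF z' x]
   by (rule Hm.finsum_cong') (use zero False z' in \<open>auto simp: left.single_entry\<close>)
  then show ?thesis using False by simp
 qed
qed

end

lemma mat_prod_unit_left:
 assumes P: "matrix_product K F G H H b b a op" and f: "f \<in> carrier (mat_space F H b a)"
  and e: "\<And>y. y \<in> block F b \<Longrightarrow> e y \<in> carrier (G y y)"
  and unit: "\<And>y x v. \<lbrakk>y \<in> block F b; x \<in> block F a; v \<in> carrier (H y x)\<rbrakk> \<Longrightarrow> op y y x (e y) v = v"
 shows "mat_prod F H op b b a (\<lambda>(y, x) \<in> block F b \<times> block F b. if y = x then e x else \<zero>\<^bsub>G y x\<^esub>) f = f"
proof -
 interpret matrix_product K F G H H b b a op by (rule P)
 let ?e = "\<lambda>(y, x) \<in> block F b \<times> block F b. if y = x then e x else \<zero>\<^bsub>G y x\<^esub>"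
 have ze: "\<zero>\<^bsub>G y x\<^esub> \<in> carrier (G y x)" if "y \<in> block F b" "x \<in> block F b" for y x
  using module_family.summand_zero[OF left.family, of "(y, x)"] that by simp
 have ec: "?e \<in> carrier (mat_space F G b b)" using e ze by (auto simp: left.mat_carrier_iff)
 show ?thesis
 proof (rule right.mat_ext[OF matmul_closed[OF ec f] f])
  fix z x assume z: "z \<in> block F b" and x: "x \<in> block F a"
  interpret Hm: module K "H z x" by (rule right.entry_module[OF z x])
  have zero: "op z y x \<zero>\<^bsub>G z y\<^esub> (f (y, x)) = \<zero>\<^bsub>H z x\<^esub>" if "y \<in> block F b" for y
   by (rule lin_zero[OF left.entry_module[OF z that] Hm.module_axioms op_left[OF z that x entry_right[OF f that x]]])
  have "matmul ?e f (z, x) = (\<Oplus>\<^bsub>H z x\<^esub> y \<in> block F b. if z = y then f (z, x) else \<zero>\<^bsub>H z x\<^esub>)"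
   unfolding matmul_entry[OF z x]
   by (rule Hm.finsum_cong') (use zero z x unit entry_right[OF f] in auto)
  also have "\<dots> = f (z, x)" by (rule Hm.finsum_singleton[OF z left.finite_columns]) (use entry_right[OF f] z x in auto)
  finally show "matmul ?e f (z, x) = f (z, x)" .
 qed
qed

lemma mat_prod_unit_right:
 assumes P: "matrix_product K F H G H b a a op" and f: "f \<in> carrier (mat_space F H b a)"
  and e: "\<And>y. y \<in> block F a \<Longrightarrow> e y \<in> carrier (G y y)"
  and unit: "\<And>y x v. \<lbrakk>y \<in> block F b; x \<in> block F a; v \<in> carrier (H y x)\<rbrakk> \<Longrightarrow> op y x x v (e x) = v"
 shows "mat_prod F H op b a a f (\<lambda>(y, x) \<in> block F a \<times> block F a. if y = x then e x else \<zero>\<^bsub>G y x\<^esub>) = f"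
proof -
 interpret matrix_product K F H G H b a a op by (rule P)
 let ?e = "\<lambda>(y, x) \<in> block F a \<times> block F a. if y = x then e x else \<zero>\<^bsub>G y x\<^esub>"
 have ze: "\<zero>\<^bsub>G y x\<^esub> \<in> carrier (G y x)" if "y \<in> block F a" "x \<in> block F a" for y x
  using module_family.summand_zero[OF right.family, of "(y, x)"] that by simp
 have ec: "?e \<in> carrier (mat_space F G a a)" using e ze by (auto simp: right.mat_carrier_iff)
 show ?thesis
 proof (rule left.mat_ext[OF matmul_closed[OF f ec] f])
  fix z x assume z: "z \<in> block F b" and x: "x \<in> block F a"
  interpret Hm: module K "H z x" by (rule left.entry_module[OF z x])
  have zero: "op z y x (f (z, y)) \<zero>\<^bsub>G y x\<^esub> = \<zero>\<^bsub>H z x\<^esub>" if "y \<in> block F a" for y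
   by (rule lin_zero[OF right.entry_module[OF that x] Hm.module_axioms op_right[OF z that x entry_left[OF f z that]]])
  have "matmul f ?e (z, x) = (\<Oplus>\<^bsub>H z x\<^esub> y \<in> block F a. if x = y then f (z, x) else \<zero>\<^bsub>H z x\<^esub>)"
   unfolding matmul_entry[OF z x]
   by (rule Hm.finsum_cong') (use zero z x unit entry_left[OF f] in auto)
  also have "\<dots> = f (z, x)" by (rule Hm.finsum_singleton[OF x left.finite_columns]) (use entry_left[OF f] z x in auto)
  finally show "matmul f ?e (z, x) = f (z, x)" .
 qed
qed

text \<open>The four operations are kept apart so that the lemma covers the associativity of the composition
 as well as the three compatibilities of the actions.\<close>

lemma mat_prod_assoc:
 assumes P1: "matrix_product K F G1 G23 H d c a op1" and P2: "matrix_product K F G2 G3 G23 c b a op2"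
  and P3: "matrix_product K F G12 G3 H d b a op3" and P4: "matrix_product K F G1 G2 G12 d c b op4"
  and assoc: "\<And>w z y x h g f. \<lbrakk>w \<in> block F d; z \<in> block F c; y \<in> block F b; x \<in> block F a;
    h \<in> carrier (G1 w z); g \<in> carrier (G2 z y); f \<in> carrier (G3 y x)\<rbrakk>
   \<Longrightarrow> op1 w z x h (op2 z y x g f) = op3 w y x (op4 w z y h g) f"
  and h: "h \<in> carrier (mat_space F G1 d c)" and g: "g \<in> carrier (mat_space F G2 c b)" and f: "f \<in> carrier (mat_space F G3 b a)"
 shows "mat_prod F H op1 d c a h (mat_prod F G23 op2 c b a g f) = mat_prod F H op3 d b a (mat_prod F G12 op4 d c b h g) f"
proof -
 interpret P1: matrix_product K F G1 G23 H d c a op1 by (rule P1)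
 interpret P2: matrix_product K F G2 G3 G23 c b a op2 by (rule P2)
 interpret P3: matrix_product K F G12 G3 H d b a op3 by (rule P3)
 interpret P4: matrix_product K F G1 G2 G12 d c b op4 by (rule P4)
 note gf = P2.matmul_closed[OF g f] and hg = P4.matmul_closed[OF h g]
 show ?thesis
 proof (rule P1.result.mat_ext[OF P1.matmul_closed[OF h gf] P3.matmul_closed[OF hg f]])
  fix w x assume w: "w \<in> block F d" and x: "x \<in> block F a"
  interpret Hm: module K "H w x" by (rule P1.result.entry_module[OF w x])
  have hc: "h (w, z) \<in> carrier (G1 w z)" if "z \<in> block F c" for z by (rule P1.entry_left[OF h w that])
  have gc: "g (z, y) \<in> carrier (G2 z y)" if "z \<in> block F c" "y \<in> block F b" for z y by (rule P2.entry_left[OF g that])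
  have fc: "f (y, x) \<in> carrier (G3 y x)" if "y \<in> block F b" for y by (rule P2.entry_right[OF f that x])
  have opc: "op1 w z x (h (w, z)) (op2 z y x (g (z, y)) (f (y, x))) \<in> carrier (H w x)" if "z \<in> block F c" "y \<in> block F b" for z y
   using that by (intro P1.op_closed P2.op_closed w x hc gc fc)
  have "P1.matmul h (P2.matmul g f) (w, x)
    = (\<Oplus>\<^bsub>H w x\<^esub> z \<in> block F c. \<Oplus>\<^bsub>H w x\<^esub> y \<in> block F b. op1 w z x (h (w, z)) (op2 z y x (g (z, y)) (f (y, x))))"
   unfolding P1.matmul_entry[OF w x]
  proof (rule Hm.finsum_cong'[OF refl])
   fix z assume z: "z \<in> block F c"
   show "op1 w z x (h (w, z)) (P2.matmul g f (z, x)) = (\<Oplus>\<^bsub>H w x\<^esub> y \<in> block F b. op1 w z x (h (w, z)) (op2 z y x (g (z, y)) (f (y, x))))"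
    unfolding P2.matmul_entry[OF z x]
    by (rule lin_finsum[OF P1.right.entry_module[OF z x] Hm.module_axioms P1.op_right[OF w z x hc[OF z]]])
     (use z x gc fc P2.op_closed in auto)
  qed (use opc in \<open>auto intro!: Hm.finsum_closed\<close>)
  also have "\<dots> = (\<Oplus>\<^bsub>H w x\<^esub> y \<in> block F b. \<Oplus>\<^bsub>H w x\<^esub> z \<in> block F c. op1 w z x (h (w, z)) (op2 z y x (g (z, y)) (f (y, x))))"
   by (rule Hm.finsum_swap[OF P2.left.finite_rows P2.left.finite_columns opc])
  also have "\<dots> = (\<Oplus>\<^bsub>H w x\<^esub> y \<in> block F b. op3 w y x (P4.matmul h g (w, y)) (f (y, x)))"
  proof (rule Hm.finsum_cong'[OF refl])
   fix y assume y: "y \<in> block F b"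
   have "op3 w y x (P4.matmul h g (w, y)) (f (y, x)) = (\<Oplus>\<^bsub>H w x\<^esub> z \<in> block F c. op3 w y x (op4 w z y (h (w, z)) (g (z, y))) (f (y, x)))"
    unfolding P4.matmul_entry[OF w y]
    by (rule lin_finsum[OF P3.left.entry_module[OF w y] Hm.module_axioms P3.op_left[OF w y x fc[OF y]]])
     (use w y gc hc P4.op_closed in auto)
   also have "\<dots> = (\<Oplus>\<^bsub>H w x\<^esub> z \<in> block F c. op1 w z x (h (w, z)) (op2 z y x (g (z, y)) (f (y, x))))"
    by (rule Hm.finsum_cong'[OF refl]) (use opc y assoc[OF w _ y x hc gc fc, symmetric] in auto)
   finally show "(\<Oplus>\<^bsub>H w x\<^esub> z \<in> block F c. op1 w z x (h (w, z)) (op2 z y x (g (z, y)) (f (y, x))))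
     = op3 w y x (P4.matmul h g (w, y)) (f (y, x))" ..
  next
   show "(\<lambda>y. op3 w y x (P4.matmul h g (w, y)) (f (y, x))) \<in> block F b \<rightarrow> carrier (H w x)"
    using w x fc hg P3.op_closed P3.entry_left by auto
  qed
  also have "\<dots> = P3.matmul (P4.matmul h g) f (w, x)" by (rule P3.matmul_entry[OF w x, symmetric])
  finally show "P1.matmul h (P2.matmul g f) (w, x) = P3.matmul (P4.matmul h g) f (w, x)" .
 qed
qed

locale finite_subcategory = k_bimodule K C M
 for K :: "('k, 'r) ring_scheme" (structure)
  and C :: "('o, 'c, 'k) kcat" and M :: "('o, 'c, 'm, 'k) kbimod" +
 fixes F :: "'o set"
 assumes objects: "F \<subseteq> kobj C" and finite: "finite F"
begin

abbreviation "CF \<equiv> contraction C F"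
abbreviation "MF \<equiv> contraction_bimod M F"

lemma block_object: "a \<in> kobj CF \<Longrightarrow> x \<in> block F a \<Longrightarrow> x \<in> kobj C"
 using objects by (cases a) (auto simp: contraction_def)

lemma block_finite: "finite (block F a)"
 using finite by (cases a) auto

lemma CF_sel [simp]: "khom CF = mat_space F (khom C)" "kcomp CF = mat_prod F (khom C) (kcomp C)"
 "bhom MF = mat_space F (bhom M)" "blact MF = mat_prod F (bhom M) (blact M)" "bract MF = mat_prod F (bhom M) (bract M)"
 "kid CF a = (\<lambda>(y, x) \<in> block F a \<times> block F a. if y = x then kid C x else \<zero>\<^bsub>khom C y x\<^esub>)"
 by (simp_all add: contraction_def contraction_bimod_def)

lemma hom_matrices: "a \<in> kobj CF \<Longrightarrow> b \<in> kobj CF \<Longrightarrow> matrix_space K F (khom C) b a"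
 by (rule matrix_space.intro) (auto simp: is_cring block_finite intro: khom_module block_object)

lemma bhom_matrices: "a \<in> kobj CF \<Longrightarrow> b \<in> kobj CF \<Longrightarrow> matrix_space K F (bhom M) b a"
 by (rule matrix_space.intro) (auto simp: is_cring block_finite intro: bhom_module block_object)

context
 fixes c b a
 assumes c: "c \<in> kobj CF" and b: "b \<in> kobj CF" and a: "a \<in> kobj CF"
begin

lemma comp_matrices: "matrix_product K F (khom C) (khom C) (khom C) c b a (kcomp C)"
 by (rule matrix_product.intro[OF hom_matrices[OF b c] hom_matrices[OF a b] hom_matrices[OF a c] matrix_product_axioms.intro])
  (rule kcomp_bilin[OF block_object[OF a] block_object[OF b] block_object[OF c]])

lemma lact_matrices: "matrix_product K F (khom C) (bhom M) (bhom M) c b a (blact M)"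
 by (rule matrix_product.intro[OF hom_matrices[OF b c] bhom_matrices[OF a b] bhom_matrices[OF a c] matrix_product_axioms.intro])
  (rule blact_bilin[OF block_object[OF a] block_object[OF b] block_object[OF c]])

lemma ract_matrices: "matrix_product K F (bhom M) (khom C) (bhom M) c b a (bract M)"
 by (rule matrix_product.intro[OF bhom_matrices[OF b c] hom_matrices[OF a b] bhom_matrices[OF a c] matrix_product_axioms.intro])
  (rule bract_bilin[OF block_object[OF a] block_object[OF b] block_object[OF c]])

end

lemma kid_matrix: "a \<in> kobj CF \<Longrightarrow> kid CF a \<in> mor CF a a"
proof -
 assume a: "a \<in> kobj CF"
 interpret matrix_space K F "khom C" a a by (rule hom_matrices[OF a a])
 have "\<zero>\<^bsub>khom C y x\<^esub> \<in> mor C y x" if "y \<in> block F a" "x \<in> block F a" for y x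
  using module_family.summand_zero[OF family, of "(y, x)"] that by simp
 then show ?thesis
  using block_object[OF a] by (auto simp: mat_carrier_iff intro!: kid_closed)
qed

lemma contraction_category: "k_category K CF"
proof (rule k_category.intro[OF field_axioms k_category_axioms.intro])
 show "module K (khom CF b a)" if "a \<in> kobj CF" "b \<in> kobj CF" for a b
  using matrix_space.mat_module[OF hom_matrices[OF that]] by simp
 show "bilin K (khom CF c b) (khom CF b a) (khom CF c a) (kcomp CF c b a)"
  if "a \<in> kobj CF" "b \<in> kobj CF" "c \<in> kobj CF" for a b c
  using matrix_product.matmul_bilin[OF comp_matrices[OF that(3,2,1)]] by simp
 show "kcomp CF d c a h (kcomp CF c b a g f) = kcomp CF d b a (kcomp CF d c b h g) f"
  if o: "a \<in> kobj CF" "b \<in> kobj CF" "c \<in> kobj CF" "d \<in> kobj CF"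
   and h: "h \<in> mor CF d c" "g \<in> mor CF c b" "f \<in> mor CF b a" for a b c d h g f
  unfolding CF_sel
  by (rule mat_prod_assoc[OF comp_matrices[OF o(4,3,1)] comp_matrices[OF o(3,2,1)] comp_matrices[OF o(4,2,1)] comp_matrices[OF o(4,3,2)] _ h[unfolded CF_sel]])
   (rule kcomp_assoc[OF block_object[OF o(1)] block_object[OF o(2)] block_object[OF o(3)] block_object[OF o(4)]])
 show "kid CF a \<in> mor CF a a" if "a \<in> kobj CF" for a by (rule kid_matrix[OF that])
 show "kcomp CF b b a (kid CF b) f = f" if o: "a \<in> kobj CF" "b \<in> kobj CF" and f: "f \<in> mor CF b a" for a b f
  unfolding CF_sel
  by (rule mat_prod_unit_left[OF comp_matrices[OF o(2,2,1)] f[unfolded CF_sel]])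
   (use kid_closed kid_left block_object o in blast)+
 show "kcomp CF b a a f (kid CF a) = f" if o: "a \<in> kobj CF" "b \<in> kobj CF" and f: "f \<in> mor CF b a" for a b f
  unfolding CF_sel
  by (rule mat_prod_unit_right[OF comp_matrices[OF o(2,1,1)] f[unfolded CF_sel]])
   (use kid_closed kid_right block_object o in blast)+
qed

lemma contraction_bimodule: "k_bimodule K CF MF"
proof (rule k_bimodule.intro[OF contraction_category k_bimodule_axioms.intro])
 show "module K (bhom MF b a)" if "a \<in> kobj CF" "b \<in> kobj CF" for a b
  using matrix_space.mat_module[OF bhom_matrices[OF that]] by simp
 show "bilin K (khom CF c b) (bhom MF b a) (bhom MF c a) (blact MF c b a)"
  if "a \<in> kobj CF" "b \<in> kobj CF" "c \<in> kobj CF" for a b c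
  using matrix_product.matmul_bilin[OF lact_matrices[OF that(3,2,1)]] by simp
 show "bilin K (bhom MF c b) (khom CF b a) (bhom MF c a) (bract MF c b a)"
  if "a \<in> kobj CF" "b \<in> kobj CF" "c \<in> kobj CF" for a b c
  using matrix_product.matmul_bilin[OF ract_matrices[OF that(3,2,1)]] by simp
 show "blact MF d c a h (blact MF c b a g m) = blact MF d b a (kcomp CF d c b h g) m"
  if o: "a \<in> kobj CF" "b \<in> kobj CF" "c \<in> kobj CF" "d \<in> kobj CF"
   and h: "h \<in> mor CF d c" "g \<in> mor CF c b" "m \<in> bim MF b a" for a b c d h g m
  unfolding CF_sel
  by (rule mat_prod_assoc[OF lact_matrices[OF o(4,3,1)] lact_matrices[OF o(3,2,1)] lact_matrices[OF o(4,2,1)] comp_matrices[OF o(4,3,2)] _ h[unfolded CF_sel]])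
   (rule blact_assoc[OF block_object[OF o(1)] block_object[OF o(2)] block_object[OF o(3)] block_object[OF o(4)]])
 show "bract MF d b a (bract MF d c b m g) f = bract MF d c a m (kcomp CF c b a g f)"
  if o: "a \<in> kobj CF" "b \<in> kobj CF" "c \<in> kobj CF" "d \<in> kobj CF"
   and h: "m \<in> bim MF d c" "g \<in> mor CF c b" "f \<in> mor CF b a" for a b c d m g f
  unfolding CF_sel
  by (rule mat_prod_assoc[OF ract_matrices[OF o(4,3,1)] comp_matrices[OF o(3,2,1)] ract_matrices[OF o(4,2,1)] ract_matrices[OF o(4,3,2)] _ h[unfolded CF_sel], symmetric])
   (rule bract_assoc[OF block_object[OF o(1)] block_object[OF o(2)] block_object[OF o(3)] block_object[OF o(4)], symmetric])
 show "blact MF d c a h (bract MF c b a m f) = bract MF d b a (blact MF d c b h m) f"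
  if o: "a \<in> kobj CF" "b \<in> kobj CF" "c \<in> kobj CF" "d \<in> kobj CF"
   and h: "h \<in> mor CF d c" "m \<in> bim MF c b" "f \<in> mor CF b a" for a b c d h m f
  unfolding CF_sel
  by (rule mat_prod_assoc[OF lact_matrices[OF o(4,3,1)] ract_matrices[OF o(3,2,1)] ract_matrices[OF o(4,2,1)] lact_matrices[OF o(4,3,2)] _ h[unfolded CF_sel]])
   (rule blact_bract[OF block_object[OF o(1)] block_object[OF o(2)] block_object[OF o(3)] block_object[OF o(4)]])
 show "blact MF b b a (kid CF b) m = m" if o: "a \<in> kobj CF" "b \<in> kobj CF" and f: "m \<in> bim MF b a" for a b m
  unfolding CF_sel
  by (rule mat_prod_unit_left[OF lact_matrices[OF o(2,2,1)] f[unfolded CF_sel]])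
   (use kid_closed blact_kid block_object o in blast)+
 show "bract MF b a a m (kid CF a) = m" if o: "a \<in> kobj CF" "b \<in> kobj CF" and f: "m \<in> bim MF b a" for a b m
  unfolding CF_sel
  by (rule mat_prod_unit_right[OF ract_matrices[OF o(2,1,1)] f[unfolded CF_sel]])
   (use kid_closed bract_kid block_object o in blast)+
qed

definition
 "blk x = (if x \<in> F then None else Some x)"

lemma blk_object: "x \<in> kobj C \<Longrightarrow> blk x \<in> kobj CF"
 by (simp add: blk_def contraction_def)

lemma in_blk: "x \<in> block F (blk x)"
 by (simp add: blk_def)

lemma fibre_blk: "a \<in> kobj CF \<Longrightarrow> {x \<in> kobj C. blk x = a} = block F a"
 using objects by (cases a) (auto simp: blk_def contraction_def split: if_splits)

abbreviation (input) "inc y x \<equiv> single F (khom C) (blk y) (blk x) y x"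
abbreviation (input) "incM y x \<equiv> single F (bhom M) (blk y) (blk x) y x"

lemma single_product:
 assumes P: "matrix_product K F G G' H (blk z) (blk y) (blk x) op"
  and g: "g \<in> carrier (G z y)" and f: "f \<in> carrier (G' y x)"
 shows "single F H (blk z) (blk x) z x (op z y x g f)
  = mat_prod F H op (blk z) (blk y) (blk x) (single F G (blk z) (blk y) z y g) (single F G' (blk y) (blk x) y x f)"
proof -
 interpret matrix_product K F G G' H "blk z" "blk y" "blk x" op by (rule P)
 note i = in_blk
 have sg: "single F G (blk z) (blk y) z y g \<in> carrier (mat_space F G (blk z) (blk y))"
  by (rule lin_closed[OF left.single_hom[OF i i] g])
 have sf: "single F G' (blk y) (blk x) y x f \<in> carrier (mat_space F G' (blk y) (blk x))"
  by (rule lin_closed[OF right.single_hom[OF i i] f])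
 note gf = op_closed[OF i i i g f]
 show ?thesis
 proof (rule result.mat_ext[OF lin_closed[OF result.single_hom[OF i i] gf] matmul_closed[OF sg sf]])
  fix z' x' assume z': "z' \<in> block F (blk z)" and x': "x' \<in> block F (blk x)"
  show "single F H (blk z) (blk x) z x (op z y x g f) (z', x')
   = matmul (single F G (blk z) (blk y) z y g) (single F G' (blk y) (blk x) y x f) (z', x')"
   unfolding matmul_single_left[OF sf i g z' x'] result.single_entry[OF z' x'] right.single_entry[OF i x']
   using lin_zero[OF right.entry_module result.entry_module op_right] i z' x' g by simp
 qed
qed

lemma unit_matrix: "x \<in> kobj C \<Longrightarrow> inc x x (kid C x) \<in> carrier (mat_space F (khom C) (blk x) (blk x))"
 by (rule lin_closed[OF matrix_space.single_hom[OF hom_matrices[OF blk_object blk_object] in_blk in_blk] kid_closed])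

text \<open>Multiplication by the identities of \<open>y\<close> and \<open>x\<close>, seen as matrices, singles out one entry.\<close>

lemma single_cut:
 assumes P: "matrix_product K F (khom C) H H (blk y) (blk y) (blk x) l" and Q: "matrix_product K F H (khom C) H (blk y) (blk x) (blk x) r"
  and x: "x \<in> kobj C" and y: "y \<in> kobj C" and c: "c \<in> carrier (mat_space F H (blk y) (blk x))"
  and l: "\<And>w v. w \<in> kobj C \<Longrightarrow> v \<in> carrier (H y w) \<Longrightarrow> l y y w (kid C y) v = v"
  and r: "\<And>v. v \<in> carrier (H y x) \<Longrightarrow> r y x x v (kid C x) = v"
 shows "single F H (blk y) (blk x) y x (c (y, x)) = mat_prod F H l (blk y) (blk y) (blk x) (inc y y (kid C y))
  (mat_prod F H r (blk y) (blk x) (blk x) c (inc x x (kid C x)))"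
proof -
 interpret P: matrix_product K F "khom C" H H "blk y" "blk y" "blk x" l by (rule P)
 interpret Q: matrix_product K F H "khom C" H "blk y" "blk x" "blk x" r by (rule Q)
 note i = in_blk
 have cyx: "c (y, x) \<in> carrier (H y x)" using c i by (simp add: P.right.mat_carrier_iff)
 note cu = Q.matmul_closed[OF c unit_matrix[OF x]]
 show ?thesis
 proof (rule P.right.mat_ext[OF lin_closed[OF P.right.single_hom[OF i i] cyx] P.matmul_closed[OF unit_matrix[OF y] cu]])
  fix z w assume z: "z \<in> block F (blk y)" and w: "w \<in> block F (blk x)"
  interpret h: module K "H y w" by (rule P.right.entry_module[OF i w])
  have q: "Q.matmul c (inc x x (kid C x)) (y, w) = (if w = x then c (y, x) else \<zero>\<^bsub>H y w\<^esub>)"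
   using Q.matmul_single_right[OF c i kid_closed[OF x] i w] r[OF cyx] by simp
  have "P.matmul (inc y y (kid C y)) (Q.matmul c (inc x x (kid C x))) (z, w)
   = (if z = y then l y y w (kid C y) (Q.matmul c (inc x x (kid C x)) (y, w)) else \<zero>\<^bsub>H z w\<^esub>)"
   by (rule P.matmul_single_left[OF cu i kid_closed[OF y] z w])
  also have "l y y w (kid C y) (Q.matmul c (inc x x (kid C x)) (y, w)) = (if w = x then c (y, x) else \<zero>\<^bsub>H y w\<^esub>)"
   unfolding q by (rule l[OF block_object[OF blk_object[OF x] w]]) (use cyx in auto)
  finally show "single F H (blk y) (blk x) y x (c (y, x)) (z, w) = P.matmul (inc y y (kid C y)) (Q.matmul c (inc x x (kid C x))) (z, w)"
   using P.right.single_entry[OF z w, of y x "c (y, x)"] by auto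
 qed
qed

text \<open>The contraction amalgamates the objects of \<open>F\<close> into \<^const>\<open>None\<close>.\<close>

lemma contraction_amalgamation:
 "amalgamation K CF MF C M blk inc (\<lambda>y x m. m (y, x)) incM (\<lambda>y x m. m (y, x))"
proof (rule amalgamation.intro[OF contraction_bimodule k_bimodule_axioms amalgamation_axioms.intro])
 note i = in_blk
 note ho = hom_matrices[OF blk_object blk_object] and bo = bhom_matrices[OF blk_object blk_object]
 note mp = comp_matrices[OF blk_object blk_object blk_object]
 show "blk x \<in> kobj CF" if "x \<in> kobj C" for x by (rule blk_object[OF that])
 show "finite {x \<in> kobj C. blk x = a}" if "a \<in> kobj CF" for a using block_finite by (simp add: fibre_blk[OF that])
 show "inc y x \<in> mod_hom K (khom C y x) (khom CF (blk y) (blk x))" if "x \<in> kobj C" "y \<in> kobj C" for x y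
  using matrix_space.single_hom[OF ho[OF that] i i] by simp
 show "incM y x \<in> mod_hom K (bhom M y x) (bhom MF (blk y) (blk x))" if "x \<in> kobj C" "y \<in> kobj C" for x y
  using matrix_space.single_hom[OF bo[OF that] i i] by simp
 show "(\<lambda>m. m (y, x)) \<in> mod_hom K (khom CF (blk y) (blk x)) (khom C y x)" if "x \<in> kobj C" "y \<in> kobj C" for x y
  using matrix_space.entry_hom[OF ho[OF that] i i] by simp
 show "(\<lambda>m. m (y, x)) \<in> mod_hom K (bhom MF (blk y) (blk x)) (bhom M y x)" if "x \<in> kobj C" "y \<in> kobj C" for x y
  using matrix_space.entry_hom[OF bo[OF that] i i] by simp
 show "inc y x f (y, x) = f" if "x \<in> kobj C" "y \<in> kobj C" for x y f
  by (simp add: matrix_space.single_entry[OF ho[OF that] i i])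
 show "incM y x f (y, x) = f" if "x \<in> kobj C" "y \<in> kobj C" for x y f
  by (simp add: matrix_space.single_entry[OF bo[OF that] i i])
 show "inc z x (kcomp C z y x g f) = kcomp CF (blk z) (blk y) (blk x) (inc z y g) (inc y x f)"
  if "x \<in> kobj C" "y \<in> kobj C" "z \<in> kobj C" and gf: "g \<in> mor C z y" "f \<in> mor C y x" for x y z g f
  unfolding CF_sel by (rule single_product[OF comp_matrices gf]) (intro blk_object that)+
 show "incM z x (blact M z y x g m) = blact MF (blk z) (blk y) (blk x) (inc z y g) (incM y x m)"
  if "x \<in> kobj C" "y \<in> kobj C" "z \<in> kobj C" and gf: "g \<in> mor C z y" "m \<in> bim M y x" for x y z g m
  unfolding CF_sel by (rule single_product[OF lact_matrices gf]) (intro blk_object that)+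
 show "incM z x (bract M z y x m f) = bract MF (blk z) (blk y) (blk x) (incM z y m) (inc y x f)"
  if "x \<in> kobj C" "y \<in> kobj C" "z \<in> kobj C" and gf: "m \<in> bim M z y" "f \<in> mor C y x" for x y z m f
  unfolding CF_sel by (rule single_product[OF ract_matrices gf]) (intro blk_object that)+
 note unit = unit_matrix
 show "(\<Oplus>\<^bsub>khom CF a a\<^esub> x \<in> {x \<in> kobj C. blk x = a}. inc x x (kid C x)) = kid CF a" if a: "a \<in> kobj CF" for a
 proof -
  interpret S: matrix_space K F "khom C" a a by (rule hom_matrices[OF a a])
  interpret m: module K "mat_space F (khom C) a a" by (rule S.mat_module)
  have ob: "x \<in> kobj C" "blk x = a" if "x \<in> block F a" for x using that fibre_blk[OF a] by auto
  have u: "inc x x (kid C x) \<in> carrier (mat_space F (khom C) a a)" if "x \<in> block F a" for x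
   using unit[OF ob(1)[OF that]] ob(2)[OF that] by simp
  have "(\<Oplus>\<^bsub>mat_space F (khom C) a a\<^esub> x \<in> block F a. inc x x (kid C x)) = kid CF a"
  proof (rule S.mat_ext)
   show "(\<Oplus>\<^bsub>mat_space F (khom C) a a\<^esub> x \<in> block F a. inc x x (kid C x)) \<in> carrier (mat_space F (khom C) a a)"
    by (rule m.finsum_closed) (use u in auto)
   show "kid CF a \<in> carrier (mat_space F (khom C) a a)" using kid_matrix[OF a] by (simp only: CF_sel)
   fix y w assume y: "y \<in> block F a" and w: "w \<in> block F a"
   interpret h: module K "khom C y w" by (rule S.entry_module[OF y w])
   have if_in: "(if P then u else \<zero>\<^bsub>khom C y w\<^esub>) \<in> mor C y w" if "P \<Longrightarrow> u \<in> mor C y w" for P u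
    using that by simp
   have v: "(if y = w then kid C y else \<zero>\<^bsub>khom C y w\<^esub>) \<in> mor C y w"
    by (rule if_in) (use kid_closed ob(1)[OF y] in simp)
   have "(\<Oplus>\<^bsub>mat_space F (khom C) a a\<^esub> x \<in> block F a. inc x x (kid C x)) (y, w) = (\<Oplus>\<^bsub>khom C y w\<^esub> x \<in> block F a. inc x x (kid C x) (y, w))"
    by (rule S.finsum_entry[OF y w]) (use u in auto)
   also have "\<dots> = (\<Oplus>\<^bsub>khom C y w\<^esub> x \<in> block F a. if y = x then (if y = w then kid C y else \<zero>\<^bsub>khom C y w\<^esub>) else \<zero>\<^bsub>khom C y w\<^esub>)"
   proof (rule h.finsum_cong'[OF refl])
    show "inc x x (kid C x) (y, w) = (if y = x then (if y = w then kid C y else \<zero>\<^bsub>khom C y w\<^esub>) else \<zero>\<^bsub>khom C y w\<^esub>)"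
     if x: "x \<in> block F a" for x
     using S.single_entry[OF y w, of x x "kid C x"] ob(2)[OF x] by auto
   qed (intro Pi_I if_in v)
   also have "\<dots> = (if y = w then kid C y else \<zero>\<^bsub>khom C y w\<^esub>)"
    by (rule h.finsum_singleton[OF y block_finite]) (intro Pi_I v)
   also have "\<dots> = kid CF a (y, w)" using y w by simp
   finally show "(\<Oplus>\<^bsub>mat_space F (khom C) a a\<^esub> x \<in> block F a. inc x x (kid C x)) (y, w) = kid CF a (y, w)" .
  qed
  then show ?thesis by (simp only: CF_sel(1) fibre_blk[OF a])
 qed
 show "kcomp CF (blk y) (blk y) (blk y) (inc x x (kid C x)) (inc y y (kid C y)) = \<zero>\<^bsub>khom CF (blk y) (blk y)\<^esub>"
  if x: "x \<in> kobj C" and y: "y \<in> kobj C" and eq: "blk x = blk y" and ne: "x \<noteq> y" for x y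
 proof -
  interpret matrix_product K F "khom C" "khom C" "khom C" "blk y" "blk y" "blk y" "kcomp C"
   by (rule mp[OF y y y])
  interpret m: module K "mat_space F (khom C) (blk y) (blk y)" by (rule left.mat_module)
  have ix: "x \<in> block F (blk y)" using in_blk[of x] eq by simp
  have ux: "inc x x (kid C x) \<in> carrier (mat_space F (khom C) (blk y) (blk y))" using unit[OF x] eq by simp
  have "matmul (inc x x (kid C x)) (inc y y (kid C y)) = \<zero>\<^bsub>mat_space F (khom C) (blk y) (blk y)\<^esub>"
  proof (rule left.mat_ext[OF matmul_closed[OF ux unit[OF y]] m.zero_closed])
   fix z w assume z: "z \<in> block F (blk y)" and w: "w \<in> block F (blk y)"
   have "matmul (inc x x (kid C x)) (inc y y (kid C y)) (z, w) = (if z = x then kcomp C x x w (kid C x) (inc y y (kid C y) (x, w)) else \<zero>\<^bsub>khom C z w\<^esub>)"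
    unfolding eq by (rule matmul_single_left[OF unit[OF y] ix kid_closed[OF x] z w])
   also have "\<dots> = \<zero>\<^bsub>khom C z w\<^esub>"
    using left.single_entry[OF ix w, of y y "kid C y"] ne lin_zero[OF left.entry_module[OF ix w] left.entry_module[OF ix w] op_right[OF ix ix w kid_closed[OF x]]]
    by auto
   finally show "matmul (inc x x (kid C x)) (inc y y (kid C y)) (z, w) = \<zero>\<^bsub>mat_space F (khom C) (blk y) (blk y)\<^esub> (z, w)"
    using left.zero_entry[OF z w] by simp
  qed
  then show ?thesis by (simp only: CF_sel)
 qed
 show "inc y x (c (y, x)) = kcomp CF (blk y) (blk y) (blk x) (inc y y (kid C y)) (kcomp CF (blk y) (blk x) (blk x) c (inc x x (kid C x)))"
  if x: "x \<in> kobj C" and y: "y \<in> kobj C" and c: "c \<in> mor CF (blk y) (blk x)" for x y c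
  unfolding CF_sel
  by (rule single_cut[OF mp[OF y y x] mp[OF y x x] x y c[unfolded CF_sel]]) (use kid_left kid_right x y in blast)+
 show "incM y x (c (y, x)) = blact MF (blk y) (blk y) (blk x) (inc y y (kid C y)) (bract MF (blk y) (blk x) (blk x) c (inc x x (kid C x)))"
  if x: "x \<in> kobj C" and y: "y \<in> kobj C" and c: "c \<in> bim MF (blk y) (blk x)" for x y c
  unfolding CF_sel
  by (rule single_cut[OF lact_matrices[OF blk_object blk_object blk_object, OF y y x] ract_matrices[OF blk_object blk_object blk_object, OF y x x] x y c[unfolded CF_sel]])
   (use blact_kid bract_kid x y in blast)+
qed

end

theorem proposition2p8:
  fixes K :: "('k, 'r) ring_scheme"
    and C :: "('o, 'c, 'k) kcat"
    and M :: "('o, 'c, 'm, 'k) kbimod"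
  assumes "field K" and "k_category K C" and "k_bimodule K C M"
  shows "(\<forall>F. F \<subseteq> kobj C \<and> finite F \<longrightarrow>
           (\<forall>n. mod_isomorphic K (hm_homology K C M n)
                  (hm_homology K (contraction C F) (contraction_bimod M F) n)
              \<and> mod_isomorphic K (hm_cohomology K C M n)
                  (hm_cohomology K (contraction C F) (contraction_bimod M F) n)))
       \<and> (\<forall>x E. x \<in> kobj C \<and> complete_orth_idempotents C x E \<longrightarrow>
           (\<forall>n. mod_isomorphic K (hm_homology K C M n)
                  (hm_homology K (expansion C x E) (expansion_bimod C M x) n)
              \<and> mod_isomorphic K (hm_cohomology K C M n)
                  (hm_cohomology K (expansion C x E) (expansion_bimod C M x) n)))"
proof (intro conjI allI impI)
  fix F n assume F: "F \<subseteq> kobj C \<and> finite F"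
  note am = finite_subcategory.contraction_amalgamation[OF finite_subcategory.intro[OF assms(3) finite_subcategory_axioms.intro], of F]
  show "mod_isomorphic K (hm_homology K C M n) (hm_homology K (contraction C F) (contraction_bimod M F) n)"
    by (rule amalgamation.homology_iso(1)[OF am]) (use F in simp_all)
  show "mod_isomorphic K (hm_cohomology K C M n) (hm_cohomology K (contraction C F) (contraction_bimod M F) n)"
    by (rule amalgamation.cohomology_iso(2)[OF am]) (use F in simp_all)
next
  fix x E n assume E: "x \<in> kobj C \<and> complete_orth_idempotents C x E"
  note am = idempotent_system.expansion_amalgamation[OF idempotent_system.intro[OF assms(3) idempotent_system_axioms.intro], of x E]
  show "mod_isomorphic K (hm_homology K C M n) (hm_homology K (expansion C x E) (expansion_bimod C M x) n)"
    by (rule amalgamation.homology_iso(2)[OF am]) (use E in simp_all)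
  show "mod_isomorphic K (hm_cohomology K C M n) (hm_cohomology K (expansion C x E) (expansion_bimod C M x) n)"
    by (rule amalgamation.cohomology_iso(1)[OF am]) (use E in simp_all)
qed

end
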